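(* Let $(\mathcal C,\circ,I,\bullet,J)$ be a $\bullet$-braided duoidal category with a reversion. Assume that $\mathcal C$ has, and $\bullet$ preserves, binary intersections. Let $H$ and $H'$ be Hopf monoids. Let $\pi:A\to H$ and $\sigma:H\to A$ be morphisms in $\mathrm{Bimon}(\mathcal C,\circ,\bullet)$ with $\pi\sigma=\mathrm{Id}_H$, where $u_H:I\to H$ is a monomorphism in $\mathcal C$ and $A$ is cocommutative. Then, for every morphism $f:H'\to H$ in the category $\mathrm{Bimon}_{\mathrm{coc}}(\mathcal C,\circ,\bullet)$ of cocommutative bimonoids, the pullback of $\pi$ along $f$ exists in $\mathrm{Bimon}_{\mathrm{coc}}(\mathcal C,\circ,\bullet)$.
   Context: Conventions: composition is juxtaposition (right to left), an object also denotes its identity morphism, associativity constraints are suppressed. Duoidal category $(\mathcal C,\circ,I,\bullet,J)$: a category with monoidal structures $(\mathcal C,\circ,I)$, $(\mathcal C,\bullet,J)$ (left/right unit constraints $l^\circ,r^\circ$, resp. $l^\bullet,r^\bullet$), a natural transformation $\zeta_{A,B,C,D}:(A\bullet B)\circ(C\bullet D)\to(A\circ C)\bullet(B\circ D)$ and morphisms $\Delta_I:I\to I\bullet I$, $m_J:J\circ J\to J$, $\varepsilon_I=u_J:I\to J$ such that $(J,m_J,u_J)$ is a monoid in $(\mathcal C,\circ,I)$, $(I,\Delta_I,\varepsilon_I)$ is a comonoid in $(\mathcal C,\bullet,J)$, and $\zeta_{A,B,C\circ E,D\circ F}((A\bullet B)\circ\zeta_{C,D,E,F})=\zeta_{A\circ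 C,B\circ D,E,F}(\zeta_{A,B,C,D}\circ(E\bullet F))$, $((A\circ D)\bullet\zeta_{B,C,E,F})\zeta_{A,B\bullet C,D,E\bullet F}=(\zeta_{A,B,D,E}\bullet(C\circ F))\zeta_{A\bullet B,C,D\bullet E,F}$, $(l^\circ_A\bullet l^\circ_B)\zeta_{I,I,A,B}(\Delta_I\circ(A\bullet B))=l^\circ_{A\bullet B}$, $(r^\circ_A\bullet r^\circ_B)\zeta_{A,B,I,I}((A\bullet B)\circ\Delta_I)=r^\circ_{A\bullet B}$, $l^\bullet_{A\circ B}(m_J\bullet(A\circ B))\zeta_{J,A,J,B}=l^\bullet_A\circ l^\bullet_B$, $r^\bullet_{A\circ B}((A\circ B)\bullet m_J)\zeta_{A,J,B,J}=r^\bullet_A\circ r^\bullet_B$. It is $\bullet$-braided if $(\mathcal C,\bullet,J)$ has a braiding, here denoted $\sigma_{X,Y}:X\bullet Y\to Y\bullet X$, with $\sigma_{A\circ C,B\circ D}\zeta_{A,B,C,D}=\zeta_{B,A,D,C}(\sigma_{A,B}\circ\sigma_{C,D})$ and $\sigma_{I,I}\Delta_I=\Delta_I$. A binary intersection is a pullback of two monomorphisms with common codomain; "$\bullet$ preserves binary intersections" means all functors $X\bullet(-)$ and $(-)\bullet X$ do. Bimonoid: $(H,m_H,u_H,\Delta_H,\varepsilon_H)$ with $(H,m_H,u_H)$ a monoid in $(\mathcal C,\circ,I)$, $(H,\Delta_H,\varepsilon_H)$ a comonoid in $(\mathcal C,\bullet,J)$ and $\Delta_Hm_H=(m_H\bullet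 m_H)\zeta_{H,H,H,H}(\Delta_H\circ\Delta_H)$, $\varepsilon_Hm_H=m_J(\varepsilon_H\circ\varepsilon_H)$, $\Delta_Hu_H=(u_H\bullet u_H)\Delta_I$, $\varepsilon_Hu_H=\varepsilon_I$; morphisms are morphisms of monoids and comonoids. $H$ is cocommutative if $\sigma_{H,H}\Delta_H=\Delta_H$; $\mathrm{Bimon}_{\mathrm{coc}}(\mathcal C,\circ,\bullet)$ is the full subcategory of cocommutative bimonoids. Reversion: a functor $(-)^-:\mathcal C\to\mathcal C$ with lax monoidal structures $(\phi^\circ_{X,Y}:X^-\circ Y^-\to(Y\circ X)^-,\ \phi^\circ_0:I\to I^-)$ from $(\mathcal C,\circ^{\mathrm{rev}})$ to $(\mathcal C,\circ)$ and $(\phi^\bullet_{X,Y}:X^-\bullet Y^-\to(Y\bullet X)^-,\ \phi^\bullet_0:J\to J^-)$ from $(\mathcal C,\bullet^{\mathrm{rev}})$ to $(\mathcal C,\bullet)$ ($\mathrm{rev}$ = reversed tensor product), forming a double lax monoidal functor $(\mathcal C,\circ^{\mathrm{rev}},\bullet^{\mathrm{rev}})\to(\mathcal C,\circ,\bullet)$, i.e. $\phi^\bullet_{C\circ A,D\circ B}(\phi^\circ_{A,C}\bullet\phi^\circ_{B,D})\zeta_{A^-,B^-,C^-,D^-}=(\zeta_{D,C,B,A})^-\phi^\circ_{B\bullet A,D\bullet C}(\phi^\bullet_{A,B}\circ\phi^\bullet_{C,D})$, $\phi^\bullet_{I,I}(\phi^\circ_0\bullet\phi^\circ_0)\Delta_I=(\Delta_I)^-\phi^\circ_0$,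 $(m_J)^-\phi^\circ_{J,J}(\phi^\bullet_0\circ\phi^\bullet_0)=\phi^\bullet_0m_J$, $\phi^\bullet_0\varepsilon_I=(\varepsilon_I)^-\phi^\circ_0$; together with natural transformations $\gamma_{X,Y,Z,T}:((X\bullet Y^-)\circ Z)\bullet T\to X\circ(Z\bullet(Y\circ T))$, $\delta_{X,Y,Z,T}:X\bullet(Y\circ(Z^-\bullet T))\to((X\circ Z)\bullet Y)\circ T$, $\widetilde\gamma_{X,Y,Z,T}:X^-\bullet((Y\bullet Z)\circ T)\to Z\circ((X\circ Y)^-\bullet T)$, $\widetilde\delta_{X,Y,Z,T}:(X\circ(Y\bullet Z))\bullet T^-\to(X\bullet(Z\circ T)^-)\circ Y$. Put $\psi_{X,Y}=\gamma_{J,X,I,Y}(((l^\bullet_{X^-})^{-1}\circ I)\bullet Y)((r^\circ_{X^-})^{-1}\bullet Y):X^-\bullet Y\to J\circ(I\bullet(X\circ Y))$, $\varphi_{X,Y}=\delta_{X,I,Y,J}(X\bullet(I\circ(r^\bullet_{Y^-})^{-1}))(X\bullet(l^\circ_{Y^-})^{-1}):X\bullet Y^-\to((X\circ Y)\bullet I)\circ J$, $\widetilde\psi_{X,Y}=l^\circ_{(X\circ Y)^-}(I\circ r^\bullet_{(X\circ Y)^-})\widetilde\gamma_{X,Y,I,J}:X^-\bullet((Y\bullet I)\circ J)\to(X\circ Y)^-$, $\widetilde\varphi_{X,Y}=r^\circ_{(X\circ Y)^-}(l^\bullet_{(X\circ Y)^-}\circ I)\widetilde\delta_{J,I,X,Y}:(J\circ(I\bullet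 X))\bullet Y^-\to(X\circ Y)^-$. Axioms, for all objects ($\Delta_J:J\to J\bullet J$ is the inverse unit constraint): (R1) $\gamma_{X,Y,Z\circ U,T\circ V}\zeta_{(X\bullet Y^-)\circ Z,T,U,V}=(X\circ\zeta_{Z,Y\circ T,U,V})(\gamma_{X,Y,Z,T}\circ(U\bullet V))$. (R2) $((X\circ T)\bullet\gamma_{Y,Z,U,V})(\zeta_{X,Y\bullet Z^-,T,U}\bullet V)=\zeta_{X,Y,T,U\bullet(Z\circ V)}\gamma_{X\bullet Y,Z,T\bullet U,V}$. (R3) $\delta_{X\circ Z,Y\circ T,U,V}\zeta_{X,Y,Z,T\circ(U^-\bullet V)}=(\zeta_{X,Y,Z\circ U,T}\circ V)((X\bullet Y)\circ\delta_{Z,T,U,V})$. (R4) $(\delta_{X,Y,T,U}\bullet(Z\circ V))(X\bullet\zeta_{Y,Z,T^-\bullet U,V})=\zeta_{(X\circ T)\bullet Y,Z,U,V}\delta_{X,Y\bullet Z,T,U\bullet V}$. (R5) $\delta_{X,Y,T,U\bullet(Z\circ V)}(X\bullet\gamma_{Y,Z,T^-\bullet U,V})=\gamma_{(X\circ T)\bullet Y,Z,U,V}(\delta_{X,Y\bullet Z^-,T,U}\bullet V)$. (R6) $l^\circ_{I\bullet I}(I\circ(I\bullet l^\circ_I))\gamma_{I,I,I,I}(((I\bullet\phi^\circ_0)\Delta_I\circ I)\bullet I)=l^\circ_I\bullet I$. (R7) $r^\circ_{I\bullet I}((r^\circ_I\bullet I)\circ I)\delta_{I,I,I,I}(I\bullet(I\circ(\phi^\circ_0\bullet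 I)\Delta_I))=I\bullet r^\circ_I$. (R8) $\gamma_{X\circ Z,Y,J\circ J,U}((\delta_{X,Y^-,Z,J}\circ J)\bullet U)(((X\bullet(Y^-\circ(r^\bullet_{Z^-})^{-1}))\circ J)\bullet U)=(X\circ Z\circ\zeta_{J,Y,J,U})(X\circ Z\circ(l^\bullet_Y)^{-1}\circ(l^\bullet_U)^{-1})(X\circ l^\bullet_{Z\circ Y\circ U})\gamma_{X,Z\circ Y,J,U}(((X\bullet\phi^\circ_{Y,Z})\circ J)\bullet U)$. (R9) $\delta_{X,J\circ J,Z,Y\circ U}(X\bullet(J\circ\gamma_{J,Y,Z^-,U}))(X\bullet(J\circ(((l^\bullet_{Y^-})^{-1}\circ Z^-)\bullet U)))=(\zeta_{X,J,Z,J}\circ Y\circ U)((r^\bullet_X)^{-1}\circ(r^\bullet_Z)^{-1}\circ Y\circ U)(r^\bullet_{X\circ Z\circ Y}\circ U)\delta_{X,J,Z\circ Y,U}(X\bullet(J\circ(\phi^\circ_{Y,Z}\bullet U)))$. (R10) $\widetilde\varphi_{X\circ Y,Z}(\psi_{X,Y}\bullet Z^-)=\widetilde\psi_{X,Y\circ Z}(X^-\bullet\varphi_{Y,Z})$. (R11) $(r^\circ_X)^-l^\circ_{(X\circ I)^-}(I\circ r^\bullet_{(X\circ I)^-})\widetilde\gamma_{X,I,I,J}(X^-\bullet(\Delta_I\circ J))=r^\bullet_{X^-}(X^-\bullet l^\circ_J)$. (R12) $(l^\circ_X)^-r^\circ_{(I\circ X)^-}(l^\bullet_{(I\circ X)^-}\circ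 I)\widetilde\delta_{J,I,I,X}((J\circ\Delta_I)\bullet X^-)=l^\bullet_{X^-}(r^\circ_J\bullet X^-)$. (R13) $\gamma_{X,Y,T\bullet(Z\circ U),V}(\gamma_{X\bullet Y^-,Z,T,U}\bullet V)=(X\circ(T\bullet\zeta_{Z,Y,U,V}))\gamma_{X,Z\bullet Y,T,U\bullet V}(((X\bullet\phi^\bullet_{Y,Z})\circ T)\bullet U\bullet V)$. (R14) $\delta_{X,(Y\circ T)\bullet Z,U,V}(X\bullet\delta_{Y,Z,T,U^-\bullet V})=((\zeta_{X,Y,U,T}\bullet Z)\circ V)\delta_{X\bullet Y,Z,U\bullet T,V}(X\bullet Y\bullet(Z\circ(\phi^\bullet_{T,U}\bullet V)))$. (R15) $(X\circ\gamma_{Z,T,U,Y\circ V})\gamma_{X,Y,(Z\bullet T^-)\circ U,V}=\gamma_{X\circ Z,T\circ Y,U,V}((((X\circ Z)\bullet\phi^\circ_{Y,T})\circ U)\bullet V)((\zeta_{X,Y^-,Z,T^-}\circ U)\bullet V)$. (R16) $(\delta_{X\circ U,Y,Z,T}\circ V)\delta_{X,Y\circ(Z^-\bullet T),U,V}=\delta_{X,Y,U\circ Z,T\circ V}(X\bullet(Y\circ(\phi^\circ_{Z,U}\bullet(T\circ V))))(X\bullet(Y\circ\zeta_{Z^-,T,U^-,V}))$. (R17) $r^\circ_J(J\circ r^\bullet_I)(J\circ(I\bullet m_J))\gamma_{J,J,I,J}(((J\bullet\phi^\bullet_0)\Delta_J\circ I)\bullet J)=r^\bullet_J(r^\circ_J\bullet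 J)$. (R18) $l^\circ_J(l^\bullet_I\circ J)((m_J\bullet I)\circ J)\delta_{J,I,J,J}(J\bullet(I\circ(\phi^\bullet_0\bullet J)\Delta_J))=l^\bullet_J(J\bullet l^\circ_J)$. Hopf monoid: a bimonoid $H$ with an antipode, i.e. a morphism $\Sigma_H:H\to H^-$ in $\mathcal C$ such that $((m_H\bullet I)\circ J)\varphi_{H,H}(H\bullet\Sigma_H)\Delta_H=((u_H\bullet I)\circ J)(\Delta_I\circ J)(l^\circ_J)^{-1}\varepsilon_H$ and $(J\circ(I\bullet m_H))\psi_{H,H}(\Sigma_H\bullet H)\Delta_H=(J\circ(I\bullet u_H))(J\circ\Delta_I)(r^\circ_J)^{-1}\varepsilon_H$. *)

theory Defs
  imports Main
begin

text \<open>
  Categories are single-sorted: an object is identified with its identity morphism. This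
  realises literally the convention that an object also denotes its identity morphism, so that a
  single operation gives the action of a functor on objects and on morphisms, and whiskerings such
  as \<open>A \<bullet> f\<close> need no extra notation. Components of a natural transformation are indexed by objects.
  The operations are total; they are only meaningful, and only constrained, on (composable)
  morphisms and on objects.
\<close>

section \<open>Categories\<close>

record 'm cat =
  Arr  :: "'m set"
  Dom  :: "'m \<Rightarrow> 'm"
  Cod  :: "'m \<Rightarrow> 'm"
  Comp :: "'m \<Rightarrow> 'm \<Rightarrow> 'm"

definition Ob :: "'m cat \<Rightarrow> 'm set" where
  "Ob C = {X \<in> Arr C. Dom C X = X \<and> Cod C X = X}"

definition hom :: "'m cat \<Rightarrow> 'm \<Rightarrow> 'm \<Rightarrow> 'm set" where
  "hom C A B = {f \<in> Arr C. Dom C f = A \<and> Cod C f = B}"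

locale category =
  fixes C :: "'m cat"
  assumes dom_ob: "f \<in> Arr C \<Longrightarrow> Dom C f \<in> Ob C"
    and cod_ob: "f \<in> Arr C \<Longrightarrow> Cod C f \<in> Ob C"
    and comp_in_hom: "\<lbrakk>f \<in> hom C X Y; g \<in> hom C Y Z\<rbrakk> \<Longrightarrow> Comp C g f \<in> hom C X Z"
    and comp_assoc: "\<lbrakk>f \<in> hom C W X; g \<in> hom C X Y; h \<in> hom C Y Z\<rbrakk>
      \<Longrightarrow> Comp C h (Comp C g f) = Comp C (Comp C h g) f"
    and comp_dom: "f \<in> Arr C \<Longrightarrow> Comp C f (Dom C f) = f"
    and comp_cod: "f \<in> Arr C \<Longrightarrow> Comp C (Cod C f) f = f"

definition inverse_arrows :: "'m cat \<Rightarrow> 'm \<Rightarrow> 'm \<Rightarrow> bool" where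
  "inverse_arrows C f g \<longleftrightarrow> f \<in> Arr C \<and> g \<in> hom C (Cod C f) (Dom C f) \<and>
     Comp C g f = Dom C f \<and> Comp C f g = Cod C f"

definition iso_arr :: "'m cat \<Rightarrow> 'm \<Rightarrow> bool" where
  "iso_arr C f \<longleftrightarrow> (\<exists>g. inverse_arrows C f g)"

definition inv_arr :: "'m cat \<Rightarrow> 'm \<Rightarrow> 'm" where
  "inv_arr C f = (THE g. inverse_arrows C f g)"

definition mono_arr :: "'m cat \<Rightarrow> 'm \<Rightarrow> bool" where
  "mono_arr C f \<longleftrightarrow> f \<in> Arr C \<and>
     (\<forall>g h X. g \<in> hom C X (Dom C f) \<and> h \<in> hom C X (Dom C f) \<and> Comp C f g = Comp C f h
        \<longrightarrow> g = h)"

definition is_pullback :: "'m cat \<Rightarrow> 'm \<Rightarrow> 'm \<Rightarrow> 'm \<Rightarrow> 'm \<Rightarrow> bool" where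
  "is_pullback C f g p q \<longleftrightarrow>
     f \<in> Arr C \<and> g \<in> Arr C \<and> Cod C f = Cod C g \<and>
     (\<exists>P. p \<in> hom C P (Dom C f) \<and> q \<in> hom C P (Dom C g) \<and> Comp C f p = Comp C g q \<and>
       (\<forall>Q x y. x \<in> hom C Q (Dom C f) \<and> y \<in> hom C Q (Dom C g) \<and> Comp C f x = Comp C g y
          \<longrightarrow> (\<exists>!h. h \<in> hom C Q P \<and> Comp C p h = x \<and> Comp C q h = y)))"

definition has_pullback :: "'m cat \<Rightarrow> 'm \<Rightarrow> 'm \<Rightarrow> bool" where
  "has_pullback C f g \<longleftrightarrow> (\<exists>p q. is_pullback C f g p q)"

definition has_binary_intersections :: "'m cat \<Rightarrow> bool" where
  "has_binary_intersections C \<longleftrightarrow>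
     (\<forall>f g. mono_arr C f \<and> mono_arr C g \<and> Cod C f = Cod C g \<longrightarrow> has_pullback C f g)"

definition preserves_binary_intersections :: "'m cat \<Rightarrow> ('m \<Rightarrow> 'm) \<Rightarrow> bool" where
  "preserves_binary_intersections C F \<longleftrightarrow>
     (\<forall>f g p q. mono_arr C f \<and> mono_arr C g \<and> is_pullback C f g p q
        \<longrightarrow> is_pullback C (F f) (F g) (F p) (F q))"

locale endofunctor = category C for C :: "'m cat" +
  fixes F :: "'m \<Rightarrow> 'm"
  assumes preserves_hom: "f \<in> hom C X Y \<Longrightarrow> F f \<in> hom C (F X) (F Y)"
    and preserves_ob: "X \<in> Ob C \<Longrightarrow> F X \<in> Ob C"
    and preserves_comp: "\<lbrakk>f \<in> hom C X Y; g \<in> hom C Y Z\<rbrakk>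
      \<Longrightarrow> F (Comp C g f) = Comp C (F g) (F f)"


section \<open>Monoidal categories\<close>

record 'm monoidal =
  tensor     :: "'m \<Rightarrow> 'm \<Rightarrow> 'm"
  unit_ob    :: "'m"
  associator :: "'m \<Rightarrow> 'm \<Rightarrow> 'm \<Rightarrow> 'm"
  lunitor    :: "'m \<Rightarrow> 'm"
  runitor    :: "'m \<Rightarrow> 'm"

locale monoidal_syntax =
  fixes C :: "'m cat" and M :: "'m monoidal"
begin

abbreviation ob where "ob X \<equiv> X \<in> Ob C"
abbreviation in_hom ("\<guillemotleft>_ : _ \<rightarrow> _\<guillemotright>") where "\<guillemotleft>f : X \<rightarrow> Y\<guillemotright> \<equiv> f \<in> hom C X Y"
abbreviation comp (infixr "\<cdot>" 55) where "g \<cdot> f \<equiv> Comp C g f"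
abbreviation Inv where "Inv f \<equiv> inv_arr C f"
abbreviation ten (infix "\<otimes>" 60) where "f \<otimes> g \<equiv> tensor M f g"
abbreviation I where "I \<equiv> unit_ob M"
abbreviation a where "a X Y Z \<equiv> associator M X Y Z"
abbreviation l where "l X \<equiv> lunitor M X"
abbreviation r where "r X \<equiv> runitor M X"

end

locale monoidal_category = category C + monoidal_syntax C M
  for C :: "'m cat" and M :: "'m monoidal" +
  assumes tensor_ob: "\<lbrakk>ob X; ob Y\<rbrakk> \<Longrightarrow> ob (X \<otimes> Y)"
    and tensor_in_hom: "\<lbrakk>\<guillemotleft>f : X \<rightarrow> X'\<guillemotright>; \<guillemotleft>g : Y \<rightarrow> Y'\<guillemotright>\<rbrakk> \<Longrightarrow> \<guillemotleft>f \<otimes> g : X \<otimes> Y \<rightarrow> X' \<otimes> Y'\<guillemotright>"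
    and interchange: "\<lbrakk>\<guillemotleft>f : X \<rightarrow> X'\<guillemotright>; \<guillemotleft>f' : X' \<rightarrow> X''\<guillemotright>; \<guillemotleft>g : Y \<rightarrow> Y'\<guillemotright>; \<guillemotleft>g' : Y' \<rightarrow> Y''\<guillemotright>\<rbrakk>
      \<Longrightarrow> (f' \<cdot> f) \<otimes> (g' \<cdot> g) = (f' \<otimes> g') \<cdot> (f \<otimes> g)"
    and unit_ob: "ob I"
    and assoc_in_hom: "\<lbrakk>ob X; ob Y; ob Z\<rbrakk>
      \<Longrightarrow> \<guillemotleft>a X Y Z : (X \<otimes> Y) \<otimes> Z \<rightarrow> X \<otimes> (Y \<otimes> Z)\<guillemotright>"
    and assoc_iso: "\<lbrakk>ob X; ob Y; ob Z\<rbrakk> \<Longrightarrow> iso_arr C (a X Y Z)"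
    and assoc_natural: "\<lbrakk>\<guillemotleft>f : X \<rightarrow> X'\<guillemotright>; \<guillemotleft>g : Y \<rightarrow> Y'\<guillemotright>; \<guillemotleft>h : Z \<rightarrow> Z'\<guillemotright>\<rbrakk>
      \<Longrightarrow> a X' Y' Z' \<cdot> ((f \<otimes> g) \<otimes> h) = (f \<otimes> (g \<otimes> h)) \<cdot> a X Y Z"
    and lunit_in_hom: "ob X \<Longrightarrow> \<guillemotleft>l X : I \<otimes> X \<rightarrow> X\<guillemotright>"
    and lunit_iso: "ob X \<Longrightarrow> iso_arr C (l X)"
    and lunit_natural: "\<guillemotleft>f : X \<rightarrow> Y\<guillemotright> \<Longrightarrow> l Y \<cdot> (I \<otimes> f) = f \<cdot> l X"
    and runit_in_hom: "ob X \<Longrightarrow> \<guillemotleft>r X : X \<otimes> I \<rightarrow> X\<guillemotright>"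
    and runit_iso: "ob X \<Longrightarrow> iso_arr C (r X)"
    and runit_natural: "\<guillemotleft>f : X \<rightarrow> Y\<guillemotright> \<Longrightarrow> r Y \<cdot> (f \<otimes> I) = f \<cdot> r X"
    and pentagon: "\<lbrakk>ob W; ob X; ob Y; ob Z\<rbrakk>
      \<Longrightarrow> (W \<otimes> a X Y Z) \<cdot> a W (X \<otimes> Y) Z \<cdot> (a W X Y \<otimes> Z)
        = a W X (Y \<otimes> Z) \<cdot> a (W \<otimes> X) Y Z"
    and triangle: "\<lbrakk>ob X; ob Y\<rbrakk> \<Longrightarrow> (X \<otimes> l Y) \<cdot> a X I Y = r X \<otimes> Y"

locale braided_monoidal_category = monoidal_category C M
  for C :: "'m cat" and M :: "'m monoidal" +
  fixes c :: "'m \<Rightarrow> 'm \<Rightarrow> 'm"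
  assumes braiding_in_hom: "\<lbrakk>ob X; ob Y\<rbrakk> \<Longrightarrow> \<guillemotleft>c X Y : X \<otimes> Y \<rightarrow> Y \<otimes> X\<guillemotright>"
    and braiding_iso: "\<lbrakk>ob X; ob Y\<rbrakk> \<Longrightarrow> iso_arr C (c X Y)"
    and braiding_natural: "\<lbrakk>\<guillemotleft>f : X \<rightarrow> X'\<guillemotright>; \<guillemotleft>g : Y \<rightarrow> Y'\<guillemotright>\<rbrakk>
      \<Longrightarrow> c X' Y' \<cdot> (f \<otimes> g) = (g \<otimes> f) \<cdot> c X Y"
    and hexagon1: "\<lbrakk>ob X; ob Y; ob Z\<rbrakk>
      \<Longrightarrow> a Y Z X \<cdot> c X (Y \<otimes> Z) \<cdot> a X Y Z = (Y \<otimes> c X Z) \<cdot> a Y X Z \<cdot> (c X Y \<otimes> Z)"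
    and hexagon2: "\<lbrakk>ob X; ob Y; ob Z\<rbrakk>
      \<Longrightarrow> Inv (a Z X Y) \<cdot> c (X \<otimes> Y) Z \<cdot> Inv (a X Y Z)
        = (c X Z \<otimes> Y) \<cdot> Inv (a X Z Y) \<cdot> (X \<otimes> c Y Z)"

locale monoid_object = monoidal_syntax C M
  for C :: "'m cat" and M :: "'m monoidal" +
  fixes X :: 'm and m :: 'm and u :: 'm
  assumes ob_carrier: "ob X"
    and mult_in_hom: "\<guillemotleft>m : X \<otimes> X \<rightarrow> X\<guillemotright>"
    and unit_in_hom: "\<guillemotleft>u : I \<rightarrow> X\<guillemotright>"
    and mult_assoc: "m \<cdot> (m \<otimes> X) = m \<cdot> (X \<otimes> m) \<cdot> a X X X"
    and mult_unit_left: "m \<cdot> (u \<otimes> X) = l X"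
    and mult_unit_right: "m \<cdot> (X \<otimes> u) = r X"

locale comonoid_object = monoidal_syntax C M
  for C :: "'m cat" and M :: "'m monoidal" +
  fixes X :: 'm and d :: 'm and e :: 'm
  assumes ob_carrier: "ob X"
    and comult_in_hom: "\<guillemotleft>d : X \<rightarrow> X \<otimes> X\<guillemotright>"
    and counit_in_hom: "\<guillemotleft>e : X \<rightarrow> I\<guillemotright>"
    and comult_assoc: "a X X X \<cdot> (d \<otimes> X) \<cdot> d = (X \<otimes> d) \<cdot> d"
    and comult_counit_left: "l X \<cdot> (e \<otimes> X) \<cdot> d = X"
    and comult_counit_right: "r X \<cdot> (X \<otimes> e) \<cdot> d = X"

definition reversed_monoidal :: "'m cat \<Rightarrow> 'm monoidal \<Rightarrow> 'm monoidal" where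
  "reversed_monoidal C M =
     \<lparr>tensor = (\<lambda>f g. tensor M g f), unit_ob = unit_ob M,
      associator = (\<lambda>X Y Z. inv_arr C (associator M Z Y X)),
      lunitor = runitor M, runitor = lunitor M\<rparr>"

locale lax_monoidal_endofunctor = endofunctor C F
  for C :: "'m cat" and M :: "'m monoidal" and N :: "'m monoidal" and F :: "'m \<Rightarrow> 'm" +
  fixes \<phi> :: "'m \<Rightarrow> 'm \<Rightarrow> 'm" and \<phi>\<^sub>0 :: 'm
  assumes phi_in_hom: "\<lbrakk>X \<in> Ob C; Y \<in> Ob C\<rbrakk>
      \<Longrightarrow> \<phi> X Y \<in> hom C (tensor N (F X) (F Y)) (F (tensor M X Y))"
    and phi_natural: "\<lbrakk>f \<in> hom C X X'; g \<in> hom C Y Y'\<rbrakk>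
      \<Longrightarrow> Comp C (\<phi> X' Y') (tensor N (F f) (F g)) = Comp C (F (tensor M f g)) (\<phi> X Y)"
    and phi0_in_hom: "\<phi>\<^sub>0 \<in> hom C (unit_ob N) (F (unit_ob M))"
    and phi_assoc: "\<lbrakk>X \<in> Ob C; Y \<in> Ob C; Z \<in> Ob C\<rbrakk>
      \<Longrightarrow> Comp C (F (associator M X Y Z)) (Comp C (\<phi> (tensor M X Y) Z) (tensor N (\<phi> X Y) (F Z)))
        = Comp C (\<phi> X (tensor M Y Z))
            (Comp C (tensor N (F X) (\<phi> Y Z)) (associator N (F X) (F Y) (F Z)))"
    and phi_unit_left: "X \<in> Ob C
      \<Longrightarrow> Comp C (F (lunitor M X)) (Comp C (\<phi> (unit_ob M) X) (tensor N \<phi>\<^sub>0 (F X)))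
        = lunitor N (F X)"
    and phi_unit_right: "X \<in> Ob C
      \<Longrightarrow> Comp C (F (runitor M X)) (Comp C (\<phi> X (unit_ob M)) (tensor N (F X) \<phi>\<^sub>0))
        = runitor N (F X)"


section \<open>Duoidal categories\<close>

record 'm duoidal =
  base  :: "'m cat"
  circ  :: "'m monoidal"
  bull  :: "'m monoidal"
  zeta  :: "'m \<Rightarrow> 'm \<Rightarrow> 'm \<Rightarrow> 'm \<Rightarrow> 'm"
  DelI  :: "'m"
  mulJ  :: "'m"
  epsI  :: "'m"

text \<open>
  The first product, usually written as a small circle, is denoted by \<open>\<odot>\<close>; subscripts \<open>o\<close> and \<open>b\<close>
  refer to the structures \<open>\<odot>\<close> and \<open>\<bullet>\<close>. The name \<open>\<epsilon>\<^sub>I\<close> also stands for the unit of the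
  monoid \<open>J\<close>.
\<close>

locale duoidal_syntax =
  fixes D :: "'m duoidal"
begin

abbreviation ob where "ob X \<equiv> X \<in> Ob (base D)"
abbreviation in_hom ("\<guillemotleft>_ : _ \<rightarrow> _\<guillemotright>") where "\<guillemotleft>f : X \<rightarrow> Y\<guillemotright> \<equiv> f \<in> hom (base D) X Y"
abbreviation comp (infixr "\<cdot>" 55) where "g \<cdot> f \<equiv> Comp (base D) g f"
abbreviation Inv where "Inv f \<equiv> inv_arr (base D) f"
abbreviation ten_o (infix "\<odot>" 60) where "f \<odot> g \<equiv> tensor (circ D) f g"
abbreviation ten_b (infix "\<bullet>" 60) where "f \<bullet> g \<equiv> tensor (bull D) f g"
abbreviation I where "I \<equiv> unit_ob (circ D)"
abbreviation J where "J \<equiv> unit_ob (bull D)"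
abbreviation a\<^sub>o where "a\<^sub>o X Y Z \<equiv> associator (circ D) X Y Z"
abbreviation a\<^sub>b where "a\<^sub>b X Y Z \<equiv> associator (bull D) X Y Z"
abbreviation l\<^sub>o where "l\<^sub>o X \<equiv> lunitor (circ D) X"
abbreviation r\<^sub>o where "r\<^sub>o X \<equiv> runitor (circ D) X"
abbreviation l\<^sub>b where "l\<^sub>b X \<equiv> lunitor (bull D) X"
abbreviation r\<^sub>b where "r\<^sub>b X \<equiv> runitor (bull D) X"
abbreviation \<zeta> where "\<zeta> A B X Y \<equiv> zeta D A B X Y"
abbreviation \<Delta>\<^sub>I where "\<Delta>\<^sub>I \<equiv> DelI D"
abbreviation m\<^sub>J where "m\<^sub>J \<equiv> mulJ D"
abbreviation \<epsilon>\<^sub>I where "\<epsilon>\<^sub>I \<equiv> epsI D"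

end

locale duoidal_category = duoidal_syntax D for D :: "'m duoidal" +
  assumes circ_monoidal: "monoidal_category (base D) (circ D)"
    and bull_monoidal: "monoidal_category (base D) (bull D)"
    and zeta_in_hom: "\<lbrakk>ob A; ob B; ob X; ob Y\<rbrakk>
      \<Longrightarrow> \<guillemotleft>\<zeta> A B X Y : (A \<bullet> B) \<odot> (X \<bullet> Y) \<rightarrow> (A \<odot> X) \<bullet> (B \<odot> Y)\<guillemotright>"
    and zeta_natural: "\<lbrakk>\<guillemotleft>f : A \<rightarrow> A'\<guillemotright>; \<guillemotleft>g : B \<rightarrow> B'\<guillemotright>; \<guillemotleft>h : X \<rightarrow> X'\<guillemotright>; \<guillemotleft>k : Y \<rightarrow> Y'\<guillemotright>\<rbrakk>
      \<Longrightarrow> \<zeta> A' B' X' Y' \<cdot> ((f \<bullet> g) \<odot> (h \<bullet> k)) = ((f \<odot> h) \<bullet> (g \<odot> k)) \<cdot> \<zeta> A B X Y"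
    and J_monoid: "monoid_object (base D) (circ D) J m\<^sub>J \<epsilon>\<^sub>I"
    and I_comonoid: "comonoid_object (base D) (bull D) I \<Delta>\<^sub>I \<epsilon>\<^sub>I"
    and zeta_assoc_o: "\<lbrakk>ob A; ob B; ob X; ob Y; ob E; ob F\<rbrakk>
      \<Longrightarrow> \<zeta> A B (X \<odot> E) (Y \<odot> F) \<cdot> ((A \<bullet> B) \<odot> \<zeta> X Y E F) \<cdot> a\<^sub>o (A \<bullet> B) (X \<bullet> Y) (E \<bullet> F)
        = (a\<^sub>o A X E \<bullet> a\<^sub>o B Y F) \<cdot> \<zeta> (A \<odot> X) (B \<odot> Y) E F \<cdot> (\<zeta> A B X Y \<odot> (E \<bullet> F))"
    and zeta_assoc_b: "\<lbrakk>ob A; ob B; ob X; ob Y; ob E; ob F\<rbrakk>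
      \<Longrightarrow> ((A \<odot> Y) \<bullet> \<zeta> B X E F) \<cdot> \<zeta> A (B \<bullet> X) Y (E \<bullet> F) \<cdot> (a\<^sub>b A B X \<odot> a\<^sub>b Y E F)
        = a\<^sub>b (A \<odot> Y) (B \<odot> E) (X \<odot> F) \<cdot> (\<zeta> A B Y E \<bullet> (X \<odot> F)) \<cdot> \<zeta> (A \<bullet> B) X (Y \<bullet> E) F"
    and zeta_lunit_o: "\<lbrakk>ob A; ob B\<rbrakk>
      \<Longrightarrow> (l\<^sub>o A \<bullet> l\<^sub>o B) \<cdot> \<zeta> I I A B \<cdot> (\<Delta>\<^sub>I \<odot> (A \<bullet> B)) = l\<^sub>o (A \<bullet> B)"
    and zeta_runit_o: "\<lbrakk>ob A; ob B\<rbrakk>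
      \<Longrightarrow> (r\<^sub>o A \<bullet> r\<^sub>o B) \<cdot> \<zeta> A B I I \<cdot> ((A \<bullet> B) \<odot> \<Delta>\<^sub>I) = r\<^sub>o (A \<bullet> B)"
    and zeta_lunit_b: "\<lbrakk>ob A; ob B\<rbrakk>
      \<Longrightarrow> l\<^sub>b (A \<odot> B) \<cdot> (m\<^sub>J \<bullet> (A \<odot> B)) \<cdot> \<zeta> J A J B = l\<^sub>b A \<odot> l\<^sub>b B"
    and zeta_runit_b: "\<lbrakk>ob A; ob B\<rbrakk>
      \<Longrightarrow> r\<^sub>b (A \<odot> B) \<cdot> ((A \<odot> B) \<bullet> m\<^sub>J) \<cdot> \<zeta> A J B J = r\<^sub>b A \<odot> r\<^sub>b B"

locale bullet_braided_duoidal_category = duoidal_category D for D :: "'m duoidal" +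
  fixes c :: "'m \<Rightarrow> 'm \<Rightarrow> 'm"
  assumes bull_braided: "braided_monoidal_category (base D) (bull D) c"
    and braiding_zeta: "\<lbrakk>ob A; ob B; ob X; ob Y\<rbrakk>
      \<Longrightarrow> c (A \<odot> X) (B \<odot> Y) \<cdot> \<zeta> A B X Y = \<zeta> B A Y X \<cdot> (c A B \<odot> c X Y)"
    and braiding_DelI: "c I I \<cdot> \<Delta>\<^sub>I = \<Delta>\<^sub>I"

definition bullet_preserves_binary_intersections :: "'m duoidal \<Rightarrow> bool" where
  "bullet_preserves_binary_intersections D \<longleftrightarrow>
     (\<forall>X \<in> Ob (base D).
        preserves_binary_intersections (base D) (\<lambda>f. tensor (bull D) X f) \<and>
        preserves_binary_intersections (base D) (\<lambda>f. tensor (bull D) f X))"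


section \<open>Bimonoids\<close>

record 'm bimon =
  obj    :: "'m"
  mult   :: "'m"
  unt    :: "'m"
  comult :: "'m"
  counit :: "'m"

locale bimonoid = duoidal_syntax D for D :: "'m duoidal" +
  fixes H :: "'m bimon"
  assumes monoid: "monoid_object (base D) (circ D) (obj H) (mult H) (unt H)"
    and comonoid: "comonoid_object (base D) (bull D) (obj H) (comult H) (counit H)"
    and comult_mult: "comult H \<cdot> mult H =
      (mult H \<bullet> mult H) \<cdot> \<zeta> (obj H) (obj H) (obj H) (obj H) \<cdot> (comult H \<odot> comult H)"
    and counit_mult: "counit H \<cdot> mult H = m\<^sub>J \<cdot> (counit H \<odot> counit H)"
    and comult_unit: "comult H \<cdot> unt H = (unt H \<bullet> unt H) \<cdot> \<Delta>\<^sub>I"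
    and counit_unit: "counit H \<cdot> unt H = \<epsilon>\<^sub>I"

locale bimonoid_morphism = duoidal_syntax D + source: bimonoid D A + target: bimonoid D B
  for D :: "'m duoidal" and A :: "'m bimon" and f :: "'m" and B :: "'m bimon" +
  assumes in_hom: "\<guillemotleft>f : obj A \<rightarrow> obj B\<guillemotright>"
    and mult: "f \<cdot> mult A = mult B \<cdot> (f \<odot> f)"
    and unit: "f \<cdot> unt A = unt B"
    and comult: "comult B \<cdot> f = (f \<bullet> f) \<cdot> comult A"
    and counit: "counit B \<cdot> f = counit A"

definition cocommutative :: "'m duoidal \<Rightarrow> ('m \<Rightarrow> 'm \<Rightarrow> 'm) \<Rightarrow> 'm bimon \<Rightarrow> bool" where
  "cocommutative D c H \<longleftrightarrow> Comp (base D) (c (obj H) (obj H)) (comult H) = comult H"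

type_synonym 'm bimon_arrow = "'m bimon \<times> 'm \<times> 'm bimon"

text \<open>
  A morphism \<open>A \<rightarrow> B\<close> of bimonoids is the triple \<open>(A, f, B)\<close>, where \<open>f\<close> is the underlying morphism;
  so the object \<open>A\<close>, in the form of its identity morphism, is \<open>(A, obj A, A)\<close>.
\<close>

definition bimon_id :: "'m bimon \<Rightarrow> 'm bimon_arrow" where
  "bimon_id A = (A, obj A, A)"

definition Bimon :: "'m duoidal \<Rightarrow> 'm bimon_arrow cat" where
  "Bimon D =
     \<lparr>Arr = {(A, f, B). bimonoid_morphism D A f B},
      Dom = (\<lambda>(A, f, B). bimon_id A),
      Cod = (\<lambda>(A, f, B). bimon_id B),
      Comp = (\<lambda>(B, g, E) (A, f, B'). (A, Comp (base D) g f, E))\<rparr>"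

definition Bimon_coc :: "'m duoidal \<Rightarrow> ('m \<Rightarrow> 'm \<Rightarrow> 'm) \<Rightarrow> 'm bimon_arrow cat" where
  "Bimon_coc D c = (Bimon D)
     \<lparr>Arr := {(A, f, B) \<in> Arr (Bimon D). cocommutative D c A \<and> cocommutative D c B}\<rparr>"


section \<open>Reversions and Hopf monoids\<close>

record 'm reversion_data =
  rev_fun  :: "'m \<Rightarrow> 'm"
  phi_o    :: "'m \<Rightarrow> 'm \<Rightarrow> 'm"
  phi_o0   :: "'m"
  phi_b    :: "'m \<Rightarrow> 'm \<Rightarrow> 'm"
  phi_b0   :: "'m"
  gam      :: "'m \<Rightarrow> 'm \<Rightarrow> 'm \<Rightarrow> 'm \<Rightarrow> 'm"
  del      :: "'m \<Rightarrow> 'm \<Rightarrow> 'm \<Rightarrow> 'm \<Rightarrow> 'm"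
  gam_t    :: "'m \<Rightarrow> 'm \<Rightarrow> 'm \<Rightarrow> 'm \<Rightarrow> 'm"
  del_t    :: "'m \<Rightarrow> 'm \<Rightarrow> 'm \<Rightarrow> 'm \<Rightarrow> 'm"

locale reversion_syntax = duoidal_syntax D for D :: "'m duoidal" +
  fixes R :: "'m reversion_data"
begin

abbreviation minus ("_\<^sup>-" [1000] 1000) where "f\<^sup>- \<equiv> rev_fun R f"
abbreviation \<phi>\<^sub>o where "\<phi>\<^sub>o X Y \<equiv> phi_o R X Y"
abbreviation \<phi>\<^sub>o\<^sub>0 where "\<phi>\<^sub>o\<^sub>0 \<equiv> phi_o0 R"
abbreviation \<phi>\<^sub>b where "\<phi>\<^sub>b X Y \<equiv> phi_b R X Y"
abbreviation \<phi>\<^sub>b\<^sub>0 where "\<phi>\<^sub>b\<^sub>0 \<equiv> phi_b0 R"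
abbreviation \<gamma> where "\<gamma> X Y Z T \<equiv> gam R X Y Z T"
abbreviation \<delta> where "\<delta> X Y Z T \<equiv> del R X Y Z T"
abbreviation \<gamma>\<^sub>t where "\<gamma>\<^sub>t X Y Z T \<equiv> gam_t R X Y Z T"
abbreviation \<delta>\<^sub>t where "\<delta>\<^sub>t X Y Z T \<equiv> del_t R X Y Z T"

abbreviation \<Delta>\<^sub>J where "\<Delta>\<^sub>J \<equiv> Inv (l\<^sub>b J)"

definition psi :: "'m \<Rightarrow> 'm \<Rightarrow> 'm" where
  "psi X Y = \<gamma> J X I Y \<cdot> ((Inv (l\<^sub>b (X\<^sup>-)) \<odot> I) \<bullet> Y) \<cdot> (Inv (r\<^sub>o (X\<^sup>-)) \<bullet> Y)"

definition phi :: "'m \<Rightarrow> 'm \<Rightarrow> 'm" where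
  "phi X Y = \<delta> X I Y J \<cdot> (X \<bullet> (I \<odot> Inv (r\<^sub>b (Y\<^sup>-)))) \<cdot> (X \<bullet> Inv (l\<^sub>o (Y\<^sup>-)))"

definition psi_t :: "'m \<Rightarrow> 'm \<Rightarrow> 'm" where
  "psi_t X Y = l\<^sub>o ((X \<odot> Y)\<^sup>-) \<cdot> (I \<odot> r\<^sub>b ((X \<odot> Y)\<^sup>-)) \<cdot> \<gamma>\<^sub>t X Y I J"

definition phi_t :: "'m \<Rightarrow> 'm \<Rightarrow> 'm" where
  "phi_t X Y = r\<^sub>o ((X \<odot> Y)\<^sup>-) \<cdot> (l\<^sub>b ((X \<odot> Y)\<^sup>-) \<odot> I) \<cdot> \<delta>\<^sub>t J I X Y"

end

text \<open>
  The associators that are customarily suppressed are inserted explicitly in the axioms below; by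
  coherence it is immaterial how this is done.
\<close>

locale reversion = reversion_syntax D R + duoidal_category D
  for D :: "'m duoidal" and R :: "'m reversion_data" +
  assumes lax_o: "lax_monoidal_endofunctor (base D)
      (reversed_monoidal (base D) (circ D)) (circ D) (rev_fun R) (phi_o R) (phi_o0 R)"
    and lax_b: "lax_monoidal_endofunctor (base D)
      (reversed_monoidal (base D) (bull D)) (bull D) (rev_fun R) (phi_b R) (phi_b0 R)"
    and double_lax_zeta: "\<lbrakk>ob A; ob B; ob X; ob Y\<rbrakk>
      \<Longrightarrow> \<phi>\<^sub>b (X \<odot> A) (Y \<odot> B) \<cdot> (\<phi>\<^sub>o A X \<bullet> \<phi>\<^sub>o B Y) \<cdot> \<zeta> (A\<^sup>-) (B\<^sup>-) (X\<^sup>-) (Y\<^sup>-)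
        = (\<zeta> Y X B A)\<^sup>- \<cdot> \<phi>\<^sub>o (B \<bullet> A) (Y \<bullet> X) \<cdot> (\<phi>\<^sub>b A B \<odot> \<phi>\<^sub>b X Y)"
    and double_lax_DelI: "\<phi>\<^sub>b I I \<cdot> (\<phi>\<^sub>o\<^sub>0 \<bullet> \<phi>\<^sub>o\<^sub>0) \<cdot> \<Delta>\<^sub>I = \<Delta>\<^sub>I\<^sup>- \<cdot> \<phi>\<^sub>o\<^sub>0"
    and double_lax_mJ: "m\<^sub>J\<^sup>- \<cdot> \<phi>\<^sub>o J J \<cdot> (\<phi>\<^sub>b\<^sub>0 \<odot> \<phi>\<^sub>b\<^sub>0) = \<phi>\<^sub>b\<^sub>0 \<cdot> m\<^sub>J"
    and double_lax_epsI: "\<phi>\<^sub>b\<^sub>0 \<cdot> \<epsilon>\<^sub>I = \<epsilon>\<^sub>I\<^sup>- \<cdot> \<phi>\<^sub>o\<^sub>0"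
    and gamma_in_hom: "\<lbrakk>ob X; ob Y; ob Z; ob T\<rbrakk>
      \<Longrightarrow> \<guillemotleft>\<gamma> X Y Z T : ((X \<bullet> Y\<^sup>-) \<odot> Z) \<bullet> T \<rightarrow> X \<odot> (Z \<bullet> (Y \<odot> T))\<guillemotright>"
    and gamma_natural: "\<lbrakk>\<guillemotleft>x : X \<rightarrow> X'\<guillemotright>; \<guillemotleft>y : Y \<rightarrow> Y'\<guillemotright>; \<guillemotleft>z : Z \<rightarrow> Z'\<guillemotright>; \<guillemotleft>t : T \<rightarrow> T'\<guillemotright>\<rbrakk>
      \<Longrightarrow> \<gamma> X' Y' Z' T' \<cdot> (((x \<bullet> y\<^sup>-) \<odot> z) \<bullet> t) = (x \<odot> (z \<bullet> (y \<odot> t))) \<cdot> \<gamma> X Y Z T"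
    and delta_in_hom: "\<lbrakk>ob X; ob Y; ob Z; ob T\<rbrakk>
      \<Longrightarrow> \<guillemotleft>\<delta> X Y Z T : X \<bullet> (Y \<odot> (Z\<^sup>- \<bullet> T)) \<rightarrow> ((X \<odot> Z) \<bullet> Y) \<odot> T\<guillemotright>"
    and delta_natural: "\<lbrakk>\<guillemotleft>x : X \<rightarrow> X'\<guillemotright>; \<guillemotleft>y : Y \<rightarrow> Y'\<guillemotright>; \<guillemotleft>z : Z \<rightarrow> Z'\<guillemotright>; \<guillemotleft>t : T \<rightarrow> T'\<guillemotright>\<rbrakk>
      \<Longrightarrow> \<delta> X' Y' Z' T' \<cdot> (x \<bullet> (y \<odot> (z\<^sup>- \<bullet> t))) = (((x \<odot> z) \<bullet> y) \<odot> t) \<cdot> \<delta> X Y Z T"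
    and gamma_t_in_hom: "\<lbrakk>ob X; ob Y; ob Z; ob T\<rbrakk>
      \<Longrightarrow> \<guillemotleft>\<gamma>\<^sub>t X Y Z T : X\<^sup>- \<bullet> ((Y \<bullet> Z) \<odot> T) \<rightarrow> Z \<odot> ((X \<odot> Y)\<^sup>- \<bullet> T)\<guillemotright>"
    and gamma_t_natural: "\<lbrakk>\<guillemotleft>x : X \<rightarrow> X'\<guillemotright>; \<guillemotleft>y : Y \<rightarrow> Y'\<guillemotright>; \<guillemotleft>z : Z \<rightarrow> Z'\<guillemotright>; \<guillemotleft>t : T \<rightarrow> T'\<guillemotright>\<rbrakk>
      \<Longrightarrow> \<gamma>\<^sub>t X' Y' Z' T' \<cdot> (x\<^sup>- \<bullet> ((y \<bullet> z) \<odot> t)) = (z \<odot> ((x \<odot> y)\<^sup>- \<bullet> t)) \<cdot> \<gamma>\<^sub>t X Y Z T"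
    and delta_t_in_hom: "\<lbrakk>ob X; ob Y; ob Z; ob T\<rbrakk>
      \<Longrightarrow> \<guillemotleft>\<delta>\<^sub>t X Y Z T : (X \<odot> (Y \<bullet> Z)) \<bullet> T\<^sup>- \<rightarrow> (X \<bullet> (Z \<odot> T)\<^sup>-) \<odot> Y\<guillemotright>"
    and delta_t_natural: "\<lbrakk>\<guillemotleft>x : X \<rightarrow> X'\<guillemotright>; \<guillemotleft>y : Y \<rightarrow> Y'\<guillemotright>; \<guillemotleft>z : Z \<rightarrow> Z'\<guillemotright>; \<guillemotleft>t : T \<rightarrow> T'\<guillemotright>\<rbrakk>
      \<Longrightarrow> \<delta>\<^sub>t X' Y' Z' T' \<cdot> ((x \<odot> (y \<bullet> z)) \<bullet> t\<^sup>-) = ((x \<bullet> (z \<odot> t)\<^sup>-) \<odot> y) \<cdot> \<delta>\<^sub>t X Y Z T"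
    and R1: "\<lbrakk>ob X; ob Y; ob Z; ob T; ob U; ob V\<rbrakk>
      \<Longrightarrow> \<gamma> X Y (Z \<odot> U) (T \<odot> V) \<cdot> (a\<^sub>o (X \<bullet> Y\<^sup>-) Z U \<bullet> (T \<odot> V)) \<cdot> \<zeta> ((X \<bullet> Y\<^sup>-) \<odot> Z) T U V
        = (X \<odot> ((Z \<odot> U) \<bullet> a\<^sub>o Y T V)) \<cdot> (X \<odot> \<zeta> Z (Y \<odot> T) U V)
          \<cdot> a\<^sub>o X (Z \<bullet> (Y \<odot> T)) (U \<bullet> V) \<cdot> (\<gamma> X Y Z T \<odot> (U \<bullet> V))"
    and R2: "\<lbrakk>ob X; ob Y; ob Z; ob T; ob U; ob V\<rbrakk>
      \<Longrightarrow> ((X \<odot> T) \<bullet> \<gamma> Y Z U V) \<cdot> a\<^sub>b (X \<odot> T) ((Y \<bullet> Z\<^sup>-) \<odot> U) V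
          \<cdot> (\<zeta> X (Y \<bullet> Z\<^sup>-) T U \<bullet> V) \<cdot> ((a\<^sub>b X Y (Z\<^sup>-) \<odot> (T \<bullet> U)) \<bullet> V)
        = \<zeta> X Y T (U \<bullet> (Z \<odot> V)) \<cdot> ((X \<bullet> Y) \<odot> a\<^sub>b T U (Z \<odot> V)) \<cdot> \<gamma> (X \<bullet> Y) Z (T \<bullet> U) V"
    and R3: "\<lbrakk>ob X; ob Y; ob Z; ob T; ob U; ob V\<rbrakk>
      \<Longrightarrow> ((a\<^sub>o X Z U \<bullet> (Y \<odot> T)) \<odot> V) \<cdot> \<delta> (X \<odot> Z) (Y \<odot> T) U V
          \<cdot> ((X \<odot> Z) \<bullet> Inv (a\<^sub>o Y T (U\<^sup>- \<bullet> V))) \<cdot> \<zeta> X Y Z (T \<odot> (U\<^sup>- \<bullet> V))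
        = (\<zeta> X Y (Z \<odot> U) T \<odot> V) \<cdot> Inv (a\<^sub>o (X \<bullet> Y) ((Z \<odot> U) \<bullet> T) V) \<cdot> ((X \<bullet> Y) \<odot> \<delta> Z T U V)"
    and R4: "\<lbrakk>ob X; ob Y; ob Z; ob T; ob U; ob V\<rbrakk>
      \<Longrightarrow> (\<delta> X Y T U \<bullet> (Z \<odot> V)) \<cdot> Inv (a\<^sub>b X (Y \<odot> (T\<^sup>- \<bullet> U)) (Z \<odot> V))
          \<cdot> (X \<bullet> \<zeta> Y Z (T\<^sup>- \<bullet> U) V)
        = \<zeta> ((X \<odot> T) \<bullet> Y) Z U V \<cdot> (Inv (a\<^sub>b (X \<odot> T) Y Z) \<odot> (U \<bullet> V))
          \<cdot> \<delta> X (Y \<bullet> Z) T (U \<bullet> V) \<cdot> (X \<bullet> ((Y \<bullet> Z) \<odot> a\<^sub>b (T\<^sup>-) U V))"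
    and R5: "\<lbrakk>ob X; ob Y; ob Z; ob T; ob U; ob V\<rbrakk>
      \<Longrightarrow> \<delta> X Y T (U \<bullet> (Z \<odot> V)) \<cdot> (X \<bullet> (Y \<odot> a\<^sub>b (T\<^sup>-) U (Z \<odot> V)))
          \<cdot> (X \<bullet> \<gamma> Y Z (T\<^sup>- \<bullet> U) V) \<cdot> a\<^sub>b X ((Y \<bullet> Z\<^sup>-) \<odot> (T\<^sup>- \<bullet> U)) V
        = \<gamma> ((X \<odot> T) \<bullet> Y) Z U V \<cdot> ((Inv (a\<^sub>b (X \<odot> T) Y (Z\<^sup>-)) \<odot> U) \<bullet> V)
          \<cdot> (\<delta> X (Y \<bullet> Z\<^sup>-) T U \<bullet> V)"
    and R6: "l\<^sub>o (I \<bullet> I) \<cdot> (I \<odot> (I \<bullet> l\<^sub>o I)) \<cdot> \<gamma> I I I I \<cdot> ((((I \<bullet> \<phi>\<^sub>o\<^sub>0) \<cdot> \<Delta>\<^sub>I) \<odot> I) \<bullet> I)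
        = l\<^sub>o I \<bullet> I"
    and R7: "r\<^sub>o (I \<bullet> I) \<cdot> ((r\<^sub>o I \<bullet> I) \<odot> I) \<cdot> \<delta> I I I I \<cdot> (I \<bullet> (I \<odot> ((\<phi>\<^sub>o\<^sub>0 \<bullet> I) \<cdot> \<Delta>\<^sub>I)))
        = I \<bullet> r\<^sub>o I"
    and R8: "\<lbrakk>ob X; ob Y; ob Z; ob U\<rbrakk>
      \<Longrightarrow> \<gamma> (X \<odot> Z) Y (J \<odot> J) U \<cdot> (a\<^sub>o ((X \<odot> Z) \<bullet> Y\<^sup>-) J J \<bullet> U)
          \<cdot> ((\<delta> X (Y\<^sup>-) Z J \<odot> J) \<bullet> U) \<cdot> (((X \<bullet> (Y\<^sup>- \<odot> Inv (r\<^sub>b (Z\<^sup>-)))) \<odot> J) \<bullet> U)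
        = ((X \<odot> Z) \<odot> \<zeta> J Y J U) \<cdot> ((X \<odot> Z) \<odot> (Inv (l\<^sub>b Y) \<odot> Inv (l\<^sub>b U)))
          \<cdot> Inv (a\<^sub>o X Z (Y \<odot> U)) \<cdot> (X \<odot> a\<^sub>o Z Y U)
          \<cdot> (X \<odot> l\<^sub>b ((Z \<odot> Y) \<odot> U)) \<cdot> \<gamma> X (Z \<odot> Y) J U \<cdot> (((X \<bullet> \<phi>\<^sub>o Y Z) \<odot> J) \<bullet> U)"
    and R9: "\<lbrakk>ob X; ob Y; ob Z; ob U\<rbrakk>
      \<Longrightarrow> \<delta> X (J \<odot> J) Z (Y \<odot> U) \<cdot> (X \<bullet> Inv (a\<^sub>o J J (Z\<^sup>- \<bullet> (Y \<odot> U))))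
          \<cdot> (X \<bullet> (J \<odot> \<gamma> J Y (Z\<^sup>-) U)) \<cdot> (X \<bullet> (J \<odot> ((Inv (l\<^sub>b (Y\<^sup>-)) \<odot> Z\<^sup>-) \<bullet> U)))
        = (\<zeta> X J Z J \<odot> (Y \<odot> U)) \<cdot> ((Inv (r\<^sub>b X) \<odot> Inv (r\<^sub>b Z)) \<odot> (Y \<odot> U))
          \<cdot> a\<^sub>o (X \<odot> Z) Y U \<cdot> (Inv (a\<^sub>o X Z Y) \<odot> U)
          \<cdot> (r\<^sub>b (X \<odot> (Z \<odot> Y)) \<odot> U) \<cdot> \<delta> X J (Z \<odot> Y) U \<cdot> (X \<bullet> (J \<odot> (\<phi>\<^sub>o Y Z \<bullet> U)))"
    and R10: "\<lbrakk>ob X; ob Y; ob Z\<rbrakk>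
      \<Longrightarrow> (a\<^sub>o X Y Z)\<^sup>- \<cdot> phi_t (X \<odot> Y) Z \<cdot> (psi X Y \<bullet> Z\<^sup>-)
        = psi_t X (Y \<odot> Z) \<cdot> (X\<^sup>- \<bullet> phi Y Z) \<cdot> a\<^sub>b (X\<^sup>-) Y (Z\<^sup>-)"
    and R11: "ob X
      \<Longrightarrow> (r\<^sub>o X)\<^sup>- \<cdot> l\<^sub>o ((X \<odot> I)\<^sup>-) \<cdot> (I \<odot> r\<^sub>b ((X \<odot> I)\<^sup>-)) \<cdot> \<gamma>\<^sub>t X I I J \<cdot> (X\<^sup>- \<bullet> (\<Delta>\<^sub>I \<odot> J))
        = r\<^sub>b (X\<^sup>-) \<cdot> (X\<^sup>- \<bullet> l\<^sub>o J)"
    and R12: "ob X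
      \<Longrightarrow> (l\<^sub>o X)\<^sup>- \<cdot> r\<^sub>o ((I \<odot> X)\<^sup>-) \<cdot> (l\<^sub>b ((I \<odot> X)\<^sup>-) \<odot> I) \<cdot> \<delta>\<^sub>t J I I X \<cdot> ((J \<odot> \<Delta>\<^sub>I) \<bullet> X\<^sup>-)
        = l\<^sub>b (X\<^sup>-) \<cdot> (r\<^sub>o J \<bullet> X\<^sup>-)"
    and R13: "\<lbrakk>ob X; ob Y; ob Z; ob T; ob U; ob V\<rbrakk>
      \<Longrightarrow> (X \<odot> a\<^sub>b T (Z \<odot> U) (Y \<odot> V)) \<cdot> \<gamma> X Y (T \<bullet> (Z \<odot> U)) V \<cdot> (\<gamma> (X \<bullet> Y\<^sup>-) Z T U \<bullet> V)
        = (X \<odot> (T \<bullet> \<zeta> Z Y U V)) \<cdot> \<gamma> X (Z \<bullet> Y) T (U \<bullet> V) \<cdot> (((X \<bullet> \<phi>\<^sub>b Y Z) \<odot> T) \<bullet> (U \<bullet> V))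
          \<cdot> a\<^sub>b ((X \<bullet> (Y\<^sup>- \<bullet> Z\<^sup>-)) \<odot> T) U V \<cdot> (((a\<^sub>b X (Y\<^sup>-) (Z\<^sup>-) \<odot> T) \<bullet> U) \<bullet> V)"
    and R14: "\<lbrakk>ob X; ob Y; ob Z; ob T; ob U; ob V\<rbrakk>
      \<Longrightarrow> \<delta> X ((Y \<odot> T) \<bullet> Z) U V \<cdot> (X \<bullet> \<delta> Y Z T (U\<^sup>- \<bullet> V))
        = (a\<^sub>b (X \<odot> U) (Y \<odot> T) Z \<odot> V) \<cdot> ((\<zeta> X Y U T \<bullet> Z) \<odot> V) \<cdot> \<delta> (X \<bullet> Y) Z (U \<bullet> T) V
          \<cdot> ((X \<bullet> Y) \<bullet> (Z \<odot> (\<phi>\<^sub>b T U \<bullet> V))) \<cdot> ((X \<bullet> Y) \<bullet> (Z \<odot> Inv (a\<^sub>b (T\<^sup>-) (U\<^sup>-) V)))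
          \<cdot> Inv (a\<^sub>b X Y (Z \<odot> (T\<^sup>- \<bullet> (U\<^sup>- \<bullet> V))))"
    and R15: "\<lbrakk>ob X; ob Y; ob Z; ob T; ob U; ob V\<rbrakk>
      \<Longrightarrow> (X \<odot> \<gamma> Z T U (Y \<odot> V)) \<cdot> \<gamma> X Y ((Z \<bullet> T\<^sup>-) \<odot> U) V \<cdot> (a\<^sub>o (X \<bullet> Y\<^sup>-) (Z \<bullet> T\<^sup>-) U \<bullet> V)
        = a\<^sub>o X Z (U \<bullet> (T \<odot> (Y \<odot> V))) \<cdot> ((X \<odot> Z) \<odot> (U \<bullet> a\<^sub>o T Y V)) \<cdot> \<gamma> (X \<odot> Z) (T \<odot> Y) U V
          \<cdot> ((((X \<odot> Z) \<bullet> \<phi>\<^sub>o Y T) \<odot> U) \<bullet> V) \<cdot> ((\<zeta> X (Y\<^sup>-) Z (T\<^sup>-) \<odot> U) \<bullet> V)"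
    and R16: "\<lbrakk>ob X; ob Y; ob Z; ob T; ob U; ob V\<rbrakk>
      \<Longrightarrow> ((a\<^sub>o X U Z \<bullet> Y) \<odot> (T \<odot> V)) \<cdot> a\<^sub>o (((X \<odot> U) \<odot> Z) \<bullet> Y) T V
          \<cdot> (\<delta> (X \<odot> U) Y Z T \<odot> V) \<cdot> \<delta> X (Y \<odot> (Z\<^sup>- \<bullet> T)) U V
        = \<delta> X Y (U \<odot> Z) (T \<odot> V) \<cdot> (X \<bullet> (Y \<odot> (\<phi>\<^sub>o Z U \<bullet> (T \<odot> V))))
          \<cdot> (X \<bullet> (Y \<odot> \<zeta> (Z\<^sup>-) T (U\<^sup>-) V)) \<cdot> (X \<bullet> a\<^sub>o Y (Z\<^sup>- \<bullet> T) (U\<^sup>- \<bullet> V))"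
    and R17: "r\<^sub>o J \<cdot> (J \<odot> r\<^sub>b I) \<cdot> (J \<odot> (I \<bullet> m\<^sub>J)) \<cdot> \<gamma> J J I J \<cdot> ((((J \<bullet> \<phi>\<^sub>b\<^sub>0) \<cdot> \<Delta>\<^sub>J) \<odot> I) \<bullet> J)
        = r\<^sub>b J \<cdot> (r\<^sub>o J \<bullet> J)"
    and R18: "l\<^sub>o J \<cdot> (l\<^sub>b I \<odot> J) \<cdot> ((m\<^sub>J \<bullet> I) \<odot> J) \<cdot> \<delta> J I J J \<cdot> (J \<bullet> (I \<odot> ((\<phi>\<^sub>b\<^sub>0 \<bullet> J) \<cdot> \<Delta>\<^sub>J)))
        = l\<^sub>b J \<cdot> (J \<bullet> l\<^sub>o J)"

locale antipode = reversion_syntax D R for D :: "'m duoidal" and R :: "'m reversion_data" +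
  fixes H :: "'m bimon" and \<Sigma> :: "'m"
  assumes antipode_in_hom: "\<guillemotleft>\<Sigma> : obj H \<rightarrow> (obj H)\<^sup>-\<guillemotright>"
    and antipode_right: "((mult H \<bullet> I) \<odot> J) \<cdot> phi (obj H) (obj H) \<cdot> (obj H \<bullet> \<Sigma>) \<cdot> comult H
      = ((unt H \<bullet> I) \<odot> J) \<cdot> (\<Delta>\<^sub>I \<odot> J) \<cdot> Inv (l\<^sub>o J) \<cdot> counit H"
    and antipode_left: "(J \<odot> (I \<bullet> mult H)) \<cdot> psi (obj H) (obj H) \<cdot> (\<Sigma> \<bullet> obj H) \<cdot> comult H
      = (J \<odot> (I \<bullet> unt H)) \<cdot> (J \<odot> \<Delta>\<^sub>I) \<cdot> Inv (r\<^sub>o J) \<cdot> counit H"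

definition hopf_monoid :: "'m duoidal \<Rightarrow> 'm reversion_data \<Rightarrow> 'm bimon \<Rightarrow> bool" where
  "hopf_monoid D R H \<longleftrightarrow> bimonoid D H \<and> (\<exists>\<Sigma>. antipode D R H \<Sigma>)"

end

theory Submission
  imports Defs
begin

text \<open>
  Write \<open>B\<close> for \<open>H'\<close>, \<open>\<nu> = (A \<bullet> \<pi>) \<Delta>\<^sub>A\<close> and \<open>\<rho> = (f \<bullet> B) \<Delta>\<^sub>B\<close>. The pullback is carried by the
  equalizer \<open>e : E \<rightarrow> A \<bullet> B\<close> of the two arrows \<open>\<nu> \<bullet> B\<close> and \<open>A \<bullet> \<rho>\<close>. This pair is coreflexive, so
  its equalizer is an intersection, which \<open>\<bullet>\<close> preserves; hence the monoid and the comonoid structure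
  of \<open>A \<bullet> B\<close> restrict to \<open>E\<close>, and \<open>E\<close> has the required universal property as soon as it is
  cocommutative. Since the braiding is not a symmetry, cocommutativity is the nontrivial point: it
  amounts to the double braiding \<open>t\<close> of \<open>A\<close> and \<open>B\<close> fixing \<open>e\<close>.

  For a right \<open>H\<close>-module \<open>(V, \<mu>)\<close> and a left \<open>H\<close>-comodule \<open>(T, \<rho>)\<close> the antipode makes
  \<open>(V \<bullet> I) \<circ> T \<rightarrow> V \<bullet> T\<close>, \<open>(\<mu> \<bullet> T) \<zeta> ((V \<bullet> I) \<circ> \<rho>)\<close>, invertible. For \<open>V = A\<close>, \<open>T = B\<close> it carries
  \<open>t\<^bsub>A,I\<^esub> \<circ> B\<close> to \<open>t\<^bsub>A,B\<^esub>\<close>. Under it \<open>e\<close> corresponds to an arrow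
  fixed by \<open>\<varpi> \<circ> B\<close>, where \<open>\<varpi>\<close> is an endomorphism of \<open>A \<bullet> I\<close> equalizing \<open>\<nu> \<bullet> I\<close> with the insertion of
  the unit of \<open>H\<close>. Cocommutativity of \<open>A\<close> makes the double braiding trivial on the image of \<open>\<nu>\<close>, hence on that of
  \<open>\<varpi>\<close>, because \<open>A \<bullet> u\<^sub>H\<close> is a monomorphism.
\<close>

section \<open>Categories and monoidal categories\<close>

text \<open>For groups, \<open>e\<close> consists of pairs \<open>(a, b)\<close> with
  \<open>\<pi> a = f b\<close>. The Hopf isomorphism is
  \<open>(v, t) \<mapsto> (v \<sigma>(f t), t)\<close>, and its inverse turns \<open>(a, b)\<close>
  into \<open>(a \<sigma>(\<pi> a)^{-1}, b)\<close>, whose first entry lies in the kernel of \<pi>;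
  \<open>\<varpi>\<close> is the projection \<open>a \<mapsto> a \<sigma>(\<pi> a)^{-1}\<close> onto
  that kernel. The obstacle is that the functors \<open>(-) \<circ> T\<close> are not assumed to
  preserve equalizers, so "the first entry lies in the kernel" cannot be expressed by factoring
  through an equalizer formed inside \<open>A \<bullet> I\<close>. An idempotent replaces the
  equalizer: being fixed by \<open>\<varpi> \<circ> B\<close> is an equation, and every functor
  respects equations. \<open>\<varpi>\<close> is \<open>\<nu> \<bullet> I\<close> followed by a
  retraction of the insertion of the unit of \<open>H\<close>. That retraction comes from the same
  Hopf isomorphism, taken for the cofree comodule \<open>H \<bullet> I\<close>. The factor
  \<open>I\<close> is the unit of \<open>\<circ>\<close> and not of \<open>\<bullet>\<close>, so it
  has to be carried along; the counit \<open>I \<rightarrow> J\<close> removes it in the comparison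
  with \<open>\<nu>\<close>.\<close>

context category
begin

lemma homI: "\<lbrakk>f \<in> Arr C; Dom C f = X; Cod C f = Y\<rbrakk> \<Longrightarrow> f \<in> hom C X Y"
  by (simp add: hom_def)

lemma homD:
  assumes "f \<in> hom C X Y"
  shows "f \<in> Arr C" "Dom C f = X" "Cod C f = Y"
  using assms by (simp_all add: hom_def)

lemma ob_arr [simp]: "X \<in> Ob C \<Longrightarrow> X \<in> Arr C"
  and ob_Dom [simp]: "X \<in> Ob C \<Longrightarrow> Dom C X = X"
  and ob_Cod [simp]: "X \<in> Ob C \<Longrightarrow> Cod C X = X"
  by (simp_all add: Ob_def)

lemma ob_Dom_Cod [simp]:
  assumes "f \<in> Arr C"
  shows "Dom C f \<in> Ob C" "Cod C f \<in> Ob C"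
  using assms dom_ob cod_ob by auto

lemma comp_arr [simp]:
  assumes "f \<in> Arr C" "g \<in> Arr C" "Dom C g = Cod C f"
  shows "Comp C g f \<in> Arr C" "Dom C (Comp C g f) = Dom C f" "Cod C (Comp C g f) = Cod C g"
proof -
  have "Comp C g f \<in> hom C (Dom C f) (Cod C g)"
    by (rule comp_in_hom[of _ _ "Cod C f"]) (use assms in \<open>auto intro!: homI\<close>)
  then show "Comp C g f \<in> Arr C" "Dom C (Comp C g f) = Dom C f" "Cod C (Comp C g f) = Cod C g"
    by (auto dest: homD)
qed

lemma assoc [simp]:
  assumes "f \<in> Arr C" "g \<in> Arr C" "h \<in> Arr C" "Dom C g = Cod C f" "Dom C h = Cod C g"
  shows "Comp C (Comp C h g) f = Comp C h (Comp C g f)"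
  using assms by (intro comp_assoc[symmetric]) (auto intro!: homI)

lemma comp_ob_left [simp]: "\<lbrakk>X \<in> Ob C; f \<in> Arr C; Cod C f = X\<rbrakk> \<Longrightarrow> Comp C X f = f"
  using comp_cod by auto

lemma comp_ob_right [simp]: "\<lbrakk>X \<in> Ob C; f \<in> Arr C; Dom C f = X\<rbrakk> \<Longrightarrow> Comp C f X = f"
  using comp_dom by auto

text \<open>Simplification nests composites to the right, which hides the subterm
  \<open>Comp C g f\<close>. This form applies an equation between composites in front of a further
  arrow \<open>h\<close>; most later calculations use it, in duoidal categories under the name
  \<open>red\<close>.\<close>

lemma comp_reduce:
  assumes "Comp C g f = k" "f \<in> Arr C" "g \<in> Arr C" "Dom C g = Cod C f"
    "h \<in> Arr C" "Dom C f = Cod C h"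
  shows "Comp C g (Comp C f h) = Comp C k h"
  using assoc[of h f g] assms(2-) unfolding assms(1)[symmetric] by simp

lemma inverse_arrows_unique:
  assumes "inverse_arrows C f g" "inverse_arrows C f g'"
  shows "g = g'"
proof -
  note [simp] = assms[unfolded inverse_arrows_def hom_def, simplified]
  have "g = Comp C (Comp C g' f) g"
    using assms unfolding inverse_arrows_def hom_def by simp
  also have "\<dots> = Comp C g' (Comp C f g)"
    using assms unfolding inverse_arrows_def hom_def by (intro assoc) auto
  also have "\<dots> = g'"
    using assms unfolding inverse_arrows_def hom_def by simp
  finally show ?thesis .
qed

lemma inv_arrI:
  assumes "inverse_arrows C f g"
  shows "inv_arr C f = g"
  unfolding inv_arr_def using assms inverse_arrows_unique by blast

lemma inverse_arrows_inv:
  assumes "iso_arr C f"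
  shows "inverse_arrows C f (inv_arr C f)"
  using assms inv_arrI unfolding iso_arr_def by auto

lemma iso_is_arr: "iso_arr C f \<Longrightarrow> f \<in> Arr C"
  unfolding iso_arr_def inverse_arrows_def by auto

lemma inv_simps [simp]:
  assumes "iso_arr C f"
  shows "inv_arr C f \<in> Arr C" "Dom C (inv_arr C f) = Cod C f" "Cod C (inv_arr C f) = Dom C f"
    "Comp C (inv_arr C f) f = Dom C f" "Comp C f (inv_arr C f) = Cod C f"
  using inverse_arrows_inv[OF assms] unfolding inverse_arrows_def hom_def by auto

lemma inv_cancel [simp]:
  assumes "iso_arr C f" "h \<in> Arr C"
  shows "Cod C h = Dom C f \<Longrightarrow> Comp C (inv_arr C f) (Comp C f h) = h"
    "Cod C h = Cod C f \<Longrightarrow> Comp C f (Comp C (inv_arr C f) h) = h"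
proof -
  note [simp] = assms iso_is_arr
  show "Comp C (inv_arr C f) (Comp C f h) = h" if "Cod C h = Dom C f"
    using that by (subst comp_reduce[where k="Dom C f"]) auto
  show "Comp C f (Comp C (inv_arr C f) h) = h" if "Cod C h = Cod C f"
    using that by (subst comp_reduce[where k="Cod C f"]) auto
qed

lemma iso_arrI:
  assumes "f \<in> Arr C" "g \<in> Arr C" "Dom C g = Cod C f" "Cod C g = Dom C f"
    "Comp C g f = Dom C f" "Comp C f g = Cod C f"
  shows "iso_arr C f" "inv_arr C f = g"
proof -
  have "inverse_arrows C f g"
    using assms unfolding inverse_arrows_def hom_def by auto
  then show "iso_arr C f" "inv_arr C f = g"
    using inv_arrI by (auto simp: iso_arr_def)
qed

lemma iso_inv [simp]: "iso_arr C f \<Longrightarrow> iso_arr C (inv_arr C f)"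
  by (rule iso_arrI(1)[where g=f]) (auto simp: iso_is_arr)

lemma iso_cancel_left:
  assumes "iso_arr C f" "g \<in> Arr C" "h \<in> Arr C" "Cod C g = Dom C f" "Cod C h = Dom C f"
    "Comp C f g = Comp C f h"
  shows "g = h"
proof -
  have "g = Comp C (inv_arr C f) (Comp C f g)"
    using assms(1-5) by simp
  also have "\<dots> = h"
    unfolding assms(6) using assms(1-5) by simp
  finally show ?thesis .
qed

lemma iso_cancel_right:
  assumes "iso_arr C f" "g \<in> Arr C" "h \<in> Arr C" "Dom C g = Cod C f" "Dom C h = Cod C f"
    "Comp C g f = Comp C h f"
  shows "g = h"
proof -
  note [simp] = assms(1-5) iso_is_arr[OF assms(1)]
  have "Comp C (Comp C g f) (inv_arr C f) = Comp C (Comp C h f) (inv_arr C f)"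
    using assms(6) by simp
  then show ?thesis by simp
qed

lemma iso_ob [simp]: "X \<in> Ob C \<Longrightarrow> iso_arr C X"
  by (rule iso_arrI(1)[where g=X]) auto

lemma inv_ob [simp]: "X \<in> Ob C \<Longrightarrow> inv_arr C X = X"
  by (rule iso_arrI(2)[where g=X]) auto

lemma mono_is_arr: "mono_arr C f \<Longrightarrow> f \<in> Arr C"
  by (simp add: mono_arr_def)

lemma mono_cancel:
  assumes "mono_arr C f" "g \<in> Arr C" "h \<in> Arr C" "Cod C g = Dom C f" "Cod C h = Dom C f"
    "Dom C g = Dom C h" "Comp C f g = Comp C f h"
  shows "g = h"
proof -
  have "g \<in> hom C (Dom C h) (Dom C f)" "h \<in> hom C (Dom C h) (Dom C f)"
    using assms by (simp_all add: hom_def)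
  then show ?thesis
    using assms(1,7) unfolding mono_arr_def by blast
qed

lemma monoI:
  assumes "f \<in> Arr C"
    "\<And>g h. \<lbrakk>g \<in> Arr C; h \<in> Arr C; Cod C g = Dom C f; Cod C h = Dom C f; Dom C g = Dom C h;
       Comp C f g = Comp C f h\<rbrakk> \<Longrightarrow> g = h"
  shows "mono_arr C f"
  unfolding mono_arr_def
proof (intro conjI allI impI)
  fix g h X
  assume "g \<in> hom C X (Dom C f) \<and> h \<in> hom C X (Dom C f) \<and> Comp C f g = Comp C f h"
  then show "g = h"
    by (auto simp: hom_def intro: assms(2)[of g h])
qed (rule assms(1))

lemma split_mono:
  assumes "f \<in> Arr C" "k \<in> Arr C" "Dom C k = Cod C f" "Comp C k f = Dom C f"
  shows "mono_arr C f"
proof (rule monoI)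
  fix g h
  assume [simp]: "g \<in> Arr C" "h \<in> Arr C" "Cod C g = Dom C f" "Cod C h = Dom C f"
    and eq: "Comp C f g = Comp C f h"
  have "Comp C (Comp C k f) g = Comp C (Comp C k f) h"
    using eq assms(1-3) by simp
  then show "g = h"
    using assms by simp
qed (use assms in auto)

lemma mono_comp:
  assumes "mono_arr C f" "mono_arr C g" "Dom C g = Cod C f"
  shows "mono_arr C (Comp C g f)"
proof -
  note [simp] = assms(3) mono_is_arr[OF assms(1)] mono_is_arr[OF assms(2)]
  show ?thesis
  proof (rule monoI)
    fix x y
    assume [simp]: "x \<in> Arr C" "y \<in> Arr C" and
      dc: "Cod C x = Dom C (Comp C g f)" "Cod C y = Dom C (Comp C g f)" "Dom C x = Dom C y"
      and eq: "Comp C (Comp C g f) x = Comp C (Comp C g f) y"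
    have [simp]: "Cod C x = Dom C f" "Cod C y = Dom C f"
      using dc by simp_all
    have "Comp C g (Comp C f x) = Comp C g (Comp C f y)"
      using eq by simp
    from mono_cancel[OF assms(2) _ _ _ _ _ this] have "Comp C f x = Comp C f y"
      by (simp add: dc(3))
    from mono_cancel[OF assms(1) _ _ _ _ _ this] show "x = y"
      by (simp add: dc(3))
  qed simp
qed

lemma iso_mono: "iso_arr C f \<Longrightarrow> mono_arr C f"
  by (rule split_mono[where k="inv_arr C f"]) (auto simp: iso_is_arr)

end

section \<open>Naturality and coherence of the constraints of a monoidal category\<close>

context monoidal_category
begin

declare tensor_ob [simp] unit_ob [simp] assoc_iso [simp] lunit_iso [simp] runit_iso [simp]

lemma tensor_arr [simp]:
  assumes "f \<in> Arr C" "g \<in> Arr C"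
  shows "f \<otimes> g \<in> Arr C" "Dom C (f \<otimes> g) = Dom C f \<otimes> Dom C g" "Cod C (f \<otimes> g) = Cod C f \<otimes> Cod C g"
proof -
  have "\<guillemotleft>f \<otimes> g : Dom C f \<otimes> Dom C g \<rightarrow> Cod C f \<otimes> Cod C g\<guillemotright>"
    using assms by (intro tensor_in_hom) (auto intro!: homI)
  then show "f \<otimes> g \<in> Arr C" "Dom C (f \<otimes> g) = Dom C f \<otimes> Dom C g" "Cod C (f \<otimes> g) = Cod C f \<otimes> Cod C g"
    by (auto dest: homD)
qed

lemma assoc_arr [simp]:
  assumes "ob X" "ob Y" "ob Z"
  shows "a X Y Z \<in> Arr C" "Dom C (a X Y Z) = (X \<otimes> Y) \<otimes> Z" "Cod C (a X Y Z) = X \<otimes> (Y \<otimes> Z)"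
  using assoc_in_hom[OF assms] by (auto dest: homD)

lemma lunit_arr [simp]:
  assumes "ob X"
  shows "l X \<in> Arr C" "Dom C (l X) = I \<otimes> X" "Cod C (l X) = X"
  using lunit_in_hom[OF assms] by (auto dest: homD)

lemma runit_arr [simp]:
  assumes "ob X"
  shows "r X \<in> Arr C" "Dom C (r X) = X \<otimes> I" "Cod C (r X) = X"
  using runit_in_hom[OF assms] by (auto dest: homD)

lemma tensor_comp:
  assumes "f \<in> Arr C" "f' \<in> Arr C" "g \<in> Arr C" "g' \<in> Arr C"
    "Dom C f' = Cod C f" "Dom C g' = Cod C g"
  shows "(f' \<otimes> g') \<cdot> (f \<otimes> g) = (f' \<cdot> f) \<otimes> (g' \<cdot> g)"
  using assms by (intro interchange[symmetric]) (auto intro!: homI)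

lemma tensor_comp_reduce:
  assumes "f \<in> Arr C" "f' \<in> Arr C" "g \<in> Arr C" "g' \<in> Arr C"
    "Dom C f' = Cod C f" "Dom C g' = Cod C g" "h \<in> Arr C" "Cod C h = Dom C f \<otimes> Dom C g"
  shows "(f' \<otimes> g') \<cdot> ((f \<otimes> g) \<cdot> h) = ((f' \<cdot> f) \<otimes> (g' \<cdot> g)) \<cdot> h"
  using assms by (subst comp_reduce[OF tensor_comp]) auto

lemma whisker_left:
  assumes "ob X" "f \<in> Arr C" "g \<in> Arr C" "Dom C g = Cod C f"
  shows "X \<otimes> (g \<cdot> f) = (X \<otimes> g) \<cdot> (X \<otimes> f)"
  using assms by (simp add: tensor_comp)

lemma whisker_right:
  assumes "ob X" "f \<in> Arr C" "g \<in> Arr C" "Dom C g = Cod C f"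
  shows "(g \<cdot> f) \<otimes> X = (g \<otimes> X) \<cdot> (f \<otimes> X)"
  using assms by (simp add: tensor_comp)

lemma iso_tensor [simp]:
  assumes "iso_arr C f" "iso_arr C g"
  shows "iso_arr C (f \<otimes> g)"
    and inv_tensor: "Inv (f \<otimes> g) = Inv f \<otimes> Inv g"
proof -
  note [simp] = assms iso_is_arr
  show "iso_arr C (f \<otimes> g)" "Inv (f \<otimes> g) = Inv f \<otimes> Inv g"
    by (rule iso_arrI[of "f \<otimes> g" "Inv f \<otimes> Inv g"]; simp add: tensor_comp)+
qed

lemma assoc_nat:
  assumes "f \<in> Arr C" "g \<in> Arr C" "h \<in> Arr C"
  shows "a (Cod C f) (Cod C g) (Cod C h) \<cdot> ((f \<otimes> g) \<otimes> h) = (f \<otimes> (g \<otimes> h)) \<cdot> a (Dom C f) (Dom C g) (Dom C h)"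
  using assms by (intro assoc_natural) (auto intro!: homI)

lemma assoc_inv_nat:
  assumes "f \<in> Arr C" "g \<in> Arr C" "h \<in> Arr C"
  shows "Inv (a (Cod C f) (Cod C g) (Cod C h)) \<cdot> (f \<otimes> (g \<otimes> h))
    = ((f \<otimes> g) \<otimes> h) \<cdot> Inv (a (Dom C f) (Dom C g) (Dom C h))"
proof (rule iso_cancel_left[of "a (Cod C f) (Cod C g) (Cod C h)"])
  note [simp] = assms
  show "a (Cod C f) (Cod C g) (Cod C h) \<cdot> Inv (a (Cod C f) (Cod C g) (Cod C h)) \<cdot> (f \<otimes> (g \<otimes> h))
    = a (Cod C f) (Cod C g) (Cod C h) \<cdot> ((f \<otimes> g) \<otimes> h) \<cdot> Inv (a (Dom C f) (Dom C g) (Dom C h))"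
    by (simp add: comp_reduce[OF assoc_nat])
qed (use assms in simp_all)

lemma lunit_nat: "f \<in> Arr C \<Longrightarrow> l (Cod C f) \<cdot> (I \<otimes> f) = f \<cdot> l (Dom C f)"
  by (intro lunit_natural homI) auto

lemma runit_nat: "f \<in> Arr C \<Longrightarrow> r (Cod C f) \<cdot> (f \<otimes> I) = f \<cdot> r (Dom C f)"
  by (intro runit_natural homI) auto

lemma lunit_inv_nat:
  assumes [simp]: "f \<in> Arr C"
  shows "Inv (l (Cod C f)) \<cdot> f = (I \<otimes> f) \<cdot> Inv (l (Dom C f))"
  by (rule iso_cancel_left[of "l (Cod C f)"]) (simp_all add: comp_reduce[OF lunit_nat])

lemma runit_inv_nat:
  assumes [simp]: "f \<in> Arr C"
  shows "Inv (r (Cod C f)) \<cdot> f = (f \<otimes> I) \<cdot> Inv (r (Dom C f))"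
  by (rule iso_cancel_left[of "r (Cod C f)"]) (simp_all add: comp_reduce[OF runit_nat])

lemma lunit_faithful:
  assumes "f \<in> Arr C" "g \<in> Arr C" "Dom C f = Dom C g" "Cod C f = Cod C g" "I \<otimes> f = I \<otimes> g"
  shows "f = g"
proof (rule iso_cancel_right[of "l (Dom C f)"])
  show "f \<cdot> l (Dom C f) = g \<cdot> l (Dom C f)"
    using lunit_nat[of f] lunit_nat[of g] assms by simp
qed (use assms in simp_all)

lemma runit_faithful:
  assumes "f \<in> Arr C" "g \<in> Arr C" "Dom C f = Dom C g" "Cod C f = Cod C g" "f \<otimes> I = g \<otimes> I"
  shows "f = g"
proof (rule iso_cancel_right[of "r (Dom C f)"])
  show "f \<cdot> r (Dom C f) = g \<cdot> r (Dom C f)"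
    using runit_nat[of f] runit_nat[of g] assms by simp
qed (use assms in simp_all)

text \<open>Kelly's argument: tensoring with \<open>I\<close> loses no information
  (\<open>lunit_faithful\<close>), and after it the pentagon and two instances of the triangle
  connect both sides. The associators left over are invertible and cancel.\<close>

lemma lunit_tensor:
  assumes [simp]: "ob X" "ob Y"
  shows "l (X \<otimes> Y) \<cdot> a I X Y = l X \<otimes> Y"
proof (rule lunit_faithful)
  show "I \<otimes> (l (X \<otimes> Y) \<cdot> a I X Y) = I \<otimes> (l X \<otimes> Y)"
  proof (rule iso_cancel_right[of "a I (I \<otimes> X) Y \<cdot> (a I I X \<otimes> Y)"])
    show "iso_arr C (a I (I \<otimes> X) Y \<cdot> (a I I X \<otimes> Y))"
      by (rule iso_arrI(1)[where g="(Inv (a I I X) \<otimes> Y) \<cdot> Inv (a I (I \<otimes> X) Y)"])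
        (simp_all add: tensor_comp tensor_comp_reduce)
    have "(I \<otimes> (l (X \<otimes> Y) \<cdot> a I X Y)) \<cdot> a I (I \<otimes> X) Y \<cdot> (a I I X \<otimes> Y)
      = (I \<otimes> l (X \<otimes> Y)) \<cdot> a I I (X \<otimes> Y) \<cdot> a (I \<otimes> I) X Y"
      by (simp add: whisker_left pentagon)
    also have "\<dots> = (r I \<otimes> (X \<otimes> Y)) \<cdot> a (I \<otimes> I) X Y"
      by (simp add: comp_reduce[OF triangle])
    also have "\<dots> = a I X Y \<cdot> ((r I \<otimes> X) \<otimes> Y)"
      using assoc_nat[of "r I" X Y] by simp
    also have "\<dots> = a I X Y \<cdot> ((I \<otimes> l X) \<otimes> Y) \<cdot> (a I I X \<otimes> Y)"
      by (simp add: tensor_comp triangle)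
    also have "\<dots> = (I \<otimes> (l X \<otimes> Y)) \<cdot> a I (I \<otimes> X) Y \<cdot> (a I I X \<otimes> Y)"
      using comp_reduce[OF assoc_nat[of I "l X" Y]] by simp
    finally show "(I \<otimes> (l (X \<otimes> Y) \<cdot> a I X Y)) \<cdot> a I (I \<otimes> X) Y \<cdot> (a I I X \<otimes> Y)
      = (I \<otimes> (l X \<otimes> Y)) \<cdot> a I (I \<otimes> X) Y \<cdot> (a I I X \<otimes> Y)" .
  qed simp_all
qed simp_all

lemma runit_tensor:
  assumes [simp]: "ob X" "ob Y"
  shows "(X \<otimes> r Y) \<cdot> a X Y I = r (X \<otimes> Y)"
proof (rule runit_faithful)
  show "((X \<otimes> r Y) \<cdot> a X Y I) \<otimes> I = r (X \<otimes> Y) \<otimes> I"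
  proof (rule iso_cancel_left[of "a X Y I"])
    have "a X Y I \<cdot> (((X \<otimes> r Y) \<cdot> a X Y I) \<otimes> I) = a X Y I \<cdot> ((X \<otimes> r Y) \<otimes> I) \<cdot> (a X Y I \<otimes> I)"
      by (simp add: whisker_right)
    also have "\<dots> = (X \<otimes> (r Y \<otimes> I)) \<cdot> a X (Y \<otimes> I) I \<cdot> (a X Y I \<otimes> I)"
      using comp_reduce[OF assoc_nat[of X "r Y" I]] by simp
    also have "\<dots> = (X \<otimes> (Y \<otimes> l I)) \<cdot> (X \<otimes> a Y I I) \<cdot> a X (Y \<otimes> I) I \<cdot> (a X Y I \<otimes> I)"
      by (simp add: triangle[symmetric] whisker_left)
    also have "\<dots> = (X \<otimes> (Y \<otimes> l I)) \<cdot> a X Y (I \<otimes> I) \<cdot> a (X \<otimes> Y) I I"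
      by (simp add: pentagon)
    also have "\<dots> = a X Y I \<cdot> ((X \<otimes> Y) \<otimes> l I) \<cdot> a (X \<otimes> Y) I I"
      using comp_reduce[OF assoc_nat[of X Y "l I"]] by simp
    also have "\<dots> = a X Y I \<cdot> (r (X \<otimes> Y) \<otimes> I)"
      by (simp add: triangle)
    finally show "a X Y I \<cdot> (((X \<otimes> r Y) \<cdot> a X Y I) \<otimes> I) = a X Y I \<cdot> (r (X \<otimes> Y) \<otimes> I)" .
  qed simp_all
qed simp_all

lemma lunit_of_lunit:
  assumes [simp]: "ob X"
  shows "l (I \<otimes> X) = I \<otimes> l X"
  using lunit_nat[of "l X"] iso_cancel_left[of "l X" "l (I \<otimes> X)" "I \<otimes> l X"] by simp

lemma runit_of_runit:
  assumes [simp]: "ob X"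
  shows "r (X \<otimes> I) = r X \<otimes> I"
  using runit_nat[of "r X"] iso_cancel_left[of "r X" "r (X \<otimes> I)" "r X \<otimes> I"] by simp

text \<open>\<open>l (I \<otimes> I) \<cdot> a I I I\<close> is \<open>l I \<otimes> I\<close> by
  \<open>lunit_tensor\<close>, and \<open>r I \<otimes> I\<close> by \<open>lunit_of_lunit\<close>
  and the triangle; the factor \<open>I\<close> is then stripped.\<close>

lemma lunit_eq_runit: "l I = r I"
proof (rule lunit_faithful)
  have "l (I \<otimes> I) \<cdot> a I I I = l I \<otimes> I" by (rule lunit_tensor) auto
  moreover have "l (I \<otimes> I) \<cdot> a I I I = r I \<otimes> I" by (simp add: lunit_of_lunit triangle)
  ultimately have "l I \<otimes> I = r I \<otimes> I" by simp
  then have "l I = r I" by (rule runit_faithful[rotated -1]) simp_all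
  then show "I \<otimes> l I = I \<otimes> r I" by simp
qed simp_all

lemma triangle_inv:
  assumes [simp]: "ob X" "ob Y"
  shows "a X I Y \<cdot> (Inv (r X) \<otimes> Y) = X \<otimes> Inv (l Y)"
  by (rule iso_cancel_left[of "X \<otimes> l Y"])
    (simp_all add: comp_reduce[OF triangle] tensor_comp)

lemma triangle_inv':
  assumes [simp]: "ob X" "ob Y"
  shows "Inv (a X I Y) \<cdot> (X \<otimes> Inv (l Y)) = Inv (r X) \<otimes> Y"
  by (simp add: triangle_inv[symmetric])

lemma lunit_inv_tensor:
  assumes [simp]: "ob X" "ob Y"
  shows "a I X Y \<cdot> (Inv (l X) \<otimes> Y) = Inv (l (X \<otimes> Y))"
  by (rule iso_cancel_left[of "l (X \<otimes> Y)"])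
    (simp_all add: comp_reduce[OF lunit_tensor] tensor_comp)

lemma runit_inv_tensor:
  assumes [simp]: "ob X" "ob Y"
  shows "Inv (a X Y I) \<cdot> (X \<otimes> Inv (r Y)) = Inv (r (X \<otimes> Y))"
proof (rule iso_cancel_left[of "a X Y I"])
  show "a X Y I \<cdot> Inv (a X Y I) \<cdot> (X \<otimes> Inv (r Y)) = a X Y I \<cdot> Inv (r (X \<otimes> Y))"
    by (rule iso_cancel_left[of "X \<otimes> r Y"])
      (simp_all add: comp_reduce[OF runit_tensor] tensor_comp)
qed simp_all

end

section \<open>Products of monoids in a duoidal category\<close>

text \<open>Monoids are bundled so that products can be iterated, as in
  \<open>prodmon M (prodmon N K)\<close>. Multiplicativity then becomes a matter of composing
  morphisms, which keeps \<zeta> out of the later calculations.\<close>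

record 'm mon =
  car :: 'm
  mul :: 'm
  un  :: 'm

sublocale duoidal_category \<subseteq> circ: monoidal_category "base D" "circ D"
  by (rule circ_monoidal)

sublocale duoidal_category \<subseteq> bull: monoidal_category "base D" "bull D"
  by (rule bull_monoidal)

sublocale bullet_braided_duoidal_category \<subseteq> bull: braided_monoidal_category "base D" "bull D" c
  by (rule bull_braided)

context duoidal_category
begin

abbreviation Ar where "Ar f \<equiv> f \<in> Arr (base D)"
abbreviation dom where "dom f \<equiv> Dom (base D) f"
abbreviation cod where "cod f \<equiv> Cod (base D) f"
abbreviation iso where "iso f \<equiv> iso_arr (base D) f"
abbreviation mono where "mono f \<equiv> mono_arr (base D) f"

lemmas homI = circ.homI and homD = circ.homD
lemmas red = circ.comp_reduce
lemmas merge = circ.tensor_comp circ.tensor_comp_reduce bull.tensor_comp bull.tensor_comp_reduce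

lemma zeta_arr [simp]:
  assumes "ob A" "ob B" "ob X" "ob Y"
  shows "Ar (\<zeta> A B X Y)" "dom (\<zeta> A B X Y) = (A \<bullet> B) \<odot> (X \<bullet> Y)"
    "cod (\<zeta> A B X Y) = (A \<odot> X) \<bullet> (B \<odot> Y)"
  using zeta_in_hom[OF assms] by (auto dest: homD)

lemma zeta_nat:
  assumes "Ar f" "Ar g" "Ar h" "Ar k"
  shows "\<zeta> (cod f) (cod g) (cod h) (cod k) \<cdot> ((f \<bullet> g) \<odot> (h \<bullet> k))
    = ((f \<odot> h) \<bullet> (g \<odot> k)) \<cdot> \<zeta> (dom f) (dom g) (dom h) (dom k)"
  using assms by (intro zeta_natural) (auto intro!: homI)

lemma DelI_arr [simp]: "Ar \<Delta>\<^sub>I" "dom \<Delta>\<^sub>I = I" "cod \<Delta>\<^sub>I = I \<bullet> I"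
  using comonoid_object.comult_in_hom[OF I_comonoid] by (auto dest: homD)

lemma mJ_arr [simp]: "Ar m\<^sub>J" "dom m\<^sub>J = J \<odot> J" "cod m\<^sub>J = J"
  using monoid_object.mult_in_hom[OF J_monoid] by (auto dest: homD)

lemma epsI_arr [simp]: "Ar \<epsilon>\<^sub>I" "dom \<epsilon>\<^sub>I = I" "cod \<epsilon>\<^sub>I = J"
  using monoid_object.unit_in_hom[OF J_monoid] by (auto dest: homD)

lemmas DelI_assoc = comonoid_object.comult_assoc[OF I_comonoid]
  and DelI_counit_left = comonoid_object.comult_counit_left[OF I_comonoid]
  and DelI_counit_right = comonoid_object.comult_counit_right[OF I_comonoid]

definition ismon :: "'m mon \<Rightarrow> bool" where
  "ismon M \<longleftrightarrow> monoid_object (base D) (circ D) (car M) (mul M) (un M)"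

lemma ismon_arr [simp]:
  assumes "ismon M"
  shows "ob (car M)" "Ar (mul M)" "dom (mul M) = car M \<odot> car M" "cod (mul M) = car M"
    "Ar (un M)" "dom (un M) = I" "cod (un M) = car M"
  using assms unfolding ismon_def monoid_object_def by (auto dest: homD)

lemma ismon_laws:
  assumes "ismon M"
  shows ismon_assoc: "mul M \<cdot> (mul M \<odot> car M) = mul M \<cdot> (car M \<odot> mul M) \<cdot> a\<^sub>o (car M) (car M) (car M)"
    and ismon_unit_left: "mul M \<cdot> (un M \<odot> car M) = l\<^sub>o (car M)"
    and ismon_unit_right: "mul M \<cdot> (car M \<odot> un M) = r\<^sub>o (car M)"
  using assms unfolding ismon_def monoid_object_def by auto

text \<open>The functor \<bullet> is lax monoidal with respect to \<odot>, with structure arrows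
  \<zeta> and \<open>\<Delta>\<^sub>I\<close>; this is the monoid that it induces.\<close>

definition prodmon :: "'m mon \<Rightarrow> 'm mon \<Rightarrow> 'm mon" where
  "prodmon M N = \<lparr>car = car M \<bullet> car N, mul = (mul M \<bullet> mul N) \<cdot> \<zeta> (car M) (car N) (car M) (car N),
    un = (un M \<bullet> un N) \<cdot> \<Delta>\<^sub>I\<rparr>"

definition Jmon :: "'m mon" where
  "Jmon = \<lparr>car = J, mul = m\<^sub>J, un = \<epsilon>\<^sub>I\<rparr>"

lemma prodmon_sel [simp]:
  "car (prodmon M N) = car M \<bullet> car N"
  "mul (prodmon M N) = (mul M \<bullet> mul N) \<cdot> \<zeta> (car M) (car N) (car M) (car N)"
  "un (prodmon M N) = (un M \<bullet> un N) \<cdot> \<Delta>\<^sub>I"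
  by (simp_all add: prodmon_def)

lemma Jmon_sel [simp]: "car Jmon = J" "mul Jmon = m\<^sub>J" "un Jmon = \<epsilon>\<^sub>I"
  by (simp_all add: Jmon_def)

lemma ismon_J [simp]: "ismon Jmon"
  by (simp add: ismon_def J_monoid)

lemma ismon_prod [simp]:
  assumes [simp]: "ismon M" "ismon N"
  shows "ismon (prodmon M N)"
  unfolding ismon_def
proof (unfold_locales)
  let ?X = "car M" and ?Y = "car N"
  let ?P = "car (prodmon M N)" and ?m = "mul (prodmon M N)" and ?u = "un (prodmon M N)"
  show "ob ?P" "\<guillemotleft>?m : ?P \<odot> ?P \<rightarrow> ?P\<guillemotright>" "\<guillemotleft>?u : I \<rightarrow> ?P\<guillemotright>"
    by (auto intro!: homI)
  have "?m \<cdot> (?m \<odot> ?P) = (mul M \<bullet> mul N) \<cdot> \<zeta> ?X ?Y ?X ?Y \<cdot> ((mul M \<bullet> mul N) \<odot> (?X \<bullet> ?Y))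
      \<cdot> (\<zeta> ?X ?Y ?X ?Y \<odot> (?X \<bullet> ?Y))"
    by (simp add: circ.whisker_right)
  also have "\<dots> = ((mul M \<cdot> (mul M \<odot> ?X)) \<bullet> (mul N \<cdot> (mul N \<odot> ?Y))) \<cdot> \<zeta> (?X \<odot> ?X) (?Y \<odot> ?Y) ?X ?Y
      \<cdot> (\<zeta> ?X ?Y ?X ?Y \<odot> (?X \<bullet> ?Y))"
    using red[OF zeta_nat[of "mul M" "mul N" ?X ?Y]] by (simp add: bull.tensor_comp_reduce)
  also have "\<dots> = ((mul M \<cdot> (?X \<odot> mul M)) \<bullet> (mul N \<cdot> (?Y \<odot> mul N)))
      \<cdot> (a\<^sub>o ?X ?X ?X \<bullet> a\<^sub>o ?Y ?Y ?Y) \<cdot> \<zeta> (?X \<odot> ?X) (?Y \<odot> ?Y) ?X ?Y \<cdot> (\<zeta> ?X ?Y ?X ?Y \<odot> (?X \<bullet> ?Y))"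
    by (simp add: ismon_assoc bull.tensor_comp_reduce)
  also have "\<dots> = ((mul M \<cdot> (?X \<odot> mul M)) \<bullet> (mul N \<cdot> (?Y \<odot> mul N)))
      \<cdot> \<zeta> ?X ?Y (?X \<odot> ?X) (?Y \<odot> ?Y) \<cdot> ((?X \<bullet> ?Y) \<odot> \<zeta> ?X ?Y ?X ?Y) \<cdot> a\<^sub>o (?X \<bullet> ?Y) (?X \<bullet> ?Y) (?X \<bullet> ?Y)"
    by (simp add: zeta_assoc_o)
  also have "\<dots> = (mul M \<bullet> mul N) \<cdot> \<zeta> ?X ?Y ?X ?Y \<cdot> ((?X \<bullet> ?Y) \<odot> (mul M \<bullet> mul N))
      \<cdot> ((?X \<bullet> ?Y) \<odot> \<zeta> ?X ?Y ?X ?Y) \<cdot> a\<^sub>o (?X \<bullet> ?Y) (?X \<bullet> ?Y) (?X \<bullet> ?Y)"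
    using red[OF zeta_nat[of ?X ?Y "mul M" "mul N"]] by (simp add: bull.tensor_comp_reduce)
  also have "\<dots> = ?m \<cdot> (?P \<odot> ?m) \<cdot> a\<^sub>o ?P ?P ?P"
    by (simp add: circ.whisker_left)
  finally show "?m \<cdot> (?m \<odot> ?P) = ?m \<cdot> (?P \<odot> ?m) \<cdot> a\<^sub>o ?P ?P ?P" .
  have "?m \<cdot> (?u \<odot> ?P) = (mul M \<bullet> mul N) \<cdot> \<zeta> ?X ?Y ?X ?Y \<cdot> ((un M \<bullet> un N) \<odot> (?X \<bullet> ?Y))
      \<cdot> (\<Delta>\<^sub>I \<odot> (?X \<bullet> ?Y))"
    by (simp add: circ.whisker_right)
  also have "\<dots> = ((mul M \<cdot> (un M \<odot> ?X)) \<bullet> (mul N \<cdot> (un N \<odot> ?Y))) \<cdot> \<zeta> I I ?X ?Y \<cdot> (\<Delta>\<^sub>I \<odot> (?X \<bullet> ?Y))"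
    using red[OF zeta_nat[of "un M" "un N" ?X ?Y]] by (simp add: bull.tensor_comp_reduce)
  also have "\<dots> = l\<^sub>o (?X \<bullet> ?Y)"
    by (simp add: ismon_unit_left zeta_lunit_o)
  finally show "?m \<cdot> (?u \<odot> ?P) = l\<^sub>o ?P" by simp
  have "?m \<cdot> (?P \<odot> ?u) = (mul M \<bullet> mul N) \<cdot> \<zeta> ?X ?Y ?X ?Y \<cdot> ((?X \<bullet> ?Y) \<odot> (un M \<bullet> un N))
      \<cdot> ((?X \<bullet> ?Y) \<odot> \<Delta>\<^sub>I)"
    by (simp add: circ.whisker_left)
  also have "\<dots> = ((mul M \<cdot> (?X \<odot> un M)) \<bullet> (mul N \<cdot> (?Y \<odot> un N))) \<cdot> \<zeta> ?X ?Y I I \<cdot> ((?X \<bullet> ?Y) \<odot> \<Delta>\<^sub>I)"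
    using red[OF zeta_nat[of ?X ?Y "un M" "un N"]] by (simp add: bull.tensor_comp_reduce)
  also have "\<dots> = r\<^sub>o (?X \<bullet> ?Y)"
    by (simp add: ismon_unit_right zeta_runit_o)
  finally show "?m \<cdot> (?P \<odot> ?u) = r\<^sub>o ?P" by simp
qed

definition mhom :: "'m mon \<Rightarrow> 'm \<Rightarrow> 'm mon \<Rightarrow> bool" where
  "mhom M f N \<longleftrightarrow> ismon M \<and> ismon N \<and> \<guillemotleft>f : car M \<rightarrow> car N\<guillemotright> \<and>
    f \<cdot> mul M = mul N \<cdot> (f \<odot> f) \<and> f \<cdot> un M = un N"

lemma mhomI:
  assumes "ismon M" "ismon N" "Ar f" "dom f = car M" "cod f = car N"
    "f \<cdot> mul M = mul N \<cdot> (f \<odot> f)" "f \<cdot> un M = un N"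
  shows "mhom M f N"
  using assms by (auto simp: mhom_def intro!: homI)

lemma mhomD:
  assumes "mhom M f N"
  shows "ismon M" "ismon N" "Ar f" "dom f = car M" "cod f = car N"
    "f \<cdot> mul M = mul N \<cdot> (f \<odot> f)" "f \<cdot> un M = un N"
  using assms unfolding mhom_def by (auto dest: homD)

lemma mhom_id: "ismon M \<Longrightarrow> mhom M (car M) M"
  by (rule mhomI) auto

lemma mhom_comp:
  assumes "mhom L f M" "mhom M g N"
  shows "mhom L (g \<cdot> f) N"
proof -
  note [simp] = mhomD(1-5)[OF assms(1)] mhomD(1-5)[OF assms(2)]
  show ?thesis
  proof (rule mhomI)
    have "(g \<cdot> f) \<cdot> mul L = (g \<cdot> mul M) \<cdot> (f \<odot> f)"
      by (simp add: mhomD(6)[OF assms(1)])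
    also have "\<dots> = mul N \<cdot> ((g \<cdot> f) \<odot> (g \<cdot> f))"
      unfolding mhomD(6)[OF assms(2)] by (simp add: merge)
    finally show "(g \<cdot> f) \<cdot> mul L = mul N \<cdot> ((g \<cdot> f) \<odot> (g \<cdot> f))" .
    show "(g \<cdot> f) \<cdot> un L = un N"
      using mhomD(7)[OF assms(1)] mhomD(7)[OF assms(2)] by simp
  qed simp_all
qed

lemma mhom_tensor:
  assumes "mhom M f M'" "mhom N g N'"
  shows "mhom (prodmon M N) (f \<bullet> g) (prodmon M' N')"
proof -
  note [simp] = mhomD(1-5)[OF assms(1)] mhomD(1-5)[OF assms(2)]
  show ?thesis
  proof (rule mhomI)
    show "(f \<bullet> g) \<cdot> mul (prodmon M N) = mul (prodmon M' N') \<cdot> ((f \<bullet> g) \<odot> (f \<bullet> g))"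
      using zeta_nat[of f g f g]
      by (simp add: merge mhomD(6)[OF assms(1)] mhomD(6)[OF assms(2)])
    show "(f \<bullet> g) \<cdot> un (prodmon M N) = un (prodmon M' N')"
      by (simp add: merge mhomD(7)[OF assms(1)] mhomD(7)[OF assms(2)])
  qed simp_all
qed

lemma mhom_inv:
  assumes "mhom M f N" and [simp]: "iso f"
  shows "mhom N (Inv f) M"
proof -
  note [simp] = mhomD(1-5)[OF assms(1)]
  show ?thesis
  proof (rule mhomI)
    have "f \<cdot> Inv f \<cdot> mul N = f \<cdot> mul M \<cdot> (Inv f \<odot> Inv f)"
      by (subst red[OF mhomD(6)[OF assms(1)]]) (simp_all add: merge)
    then show "Inv f \<cdot> mul N = mul M \<cdot> (Inv f \<odot> Inv f)"
      by (rule circ.iso_cancel_left[of f, rotated -1]) simp_all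
    show "Inv f \<cdot> un N = un M"
      by (simp add: mhomD(7)[OF assms(1), symmetric])
  qed simp_all
qed

text \<open>Both sides of each law agree after composing with the monomorphism \<open>f\<close>,
  because \<open>f\<close> and \<open>f \<cdot> h = g\<close> are multiplicative. In this way arrows
  factored through an equalizer become morphisms of monoids.\<close>

lemma mhom_mono:
  assumes "mhom L g N" "mhom M f N" "mono f" "Ar h" "dom h = car L" "cod h = car M" "f \<cdot> h = g"
  shows "mhom L h M"
proof -
  note [simp] = mhomD(1-5)[OF assms(1)] mhomD(1-5)[OF assms(2)] assms(4-6)
  show ?thesis
  proof (rule mhomI)
    have "f \<cdot> h \<cdot> mul L = (f \<cdot> h) \<cdot> mul L" by simp
    also have "\<dots> = mul N \<cdot> ((f \<cdot> h) \<odot> (f \<cdot> h))"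
      unfolding assms(7) by (rule mhomD(6)[OF assms(1)])
    also have "\<dots> = (f \<cdot> mul M) \<cdot> (h \<odot> h)"
      unfolding mhomD(6)[OF assms(2)] by (simp add: merge)
    also have "\<dots> = f \<cdot> mul M \<cdot> (h \<odot> h)" by simp
    finally show "h \<cdot> mul L = mul M \<cdot> (h \<odot> h)"
      by (rule circ.mono_cancel[OF assms(3), rotated -1]) simp_all
    have "f \<cdot> h \<cdot> un L = (f \<cdot> h) \<cdot> un L" by simp
    also have "\<dots> = f \<cdot> un M"
      unfolding assms(7) using mhomD(7)[OF assms(1)] mhomD(7)[OF assms(2)] by simp
    finally show "h \<cdot> un L = un M"
      by (rule circ.mono_cancel[OF assms(3), rotated -1]) simp_all
  qed simp_all
qed

text \<open>\<open>zeta_assoc_b\<close> gives the law for the multiplications, coassociativity of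
  \<open>\<Delta>\<^sub>I\<close> the one for the units. With the unit constraints and the braiding
  treated likewise below, composites of structure arrows of \<bullet> and morphisms of monoids are
  multiplicative without further calculation.\<close>

lemma mhom_assoc:
  assumes [simp]: "ismon L" "ismon M" "ismon N"
  shows "mhom (prodmon (prodmon L M) N) (a\<^sub>b (car L) (car M) (car N)) (prodmon L (prodmon M N))"
proof (rule mhomI)
  let ?X = "car L" and ?Y = "car M" and ?Z = "car N"
  let ?a = "a\<^sub>b ?X ?Y ?Z"
  have "?a \<cdot> mul (prodmon (prodmon L M) N) = ?a \<cdot> ((mul L \<bullet> mul M) \<bullet> mul N)
      \<cdot> (\<zeta> ?X ?Y ?X ?Y \<bullet> (?Z \<odot> ?Z)) \<cdot> \<zeta> (?X \<bullet> ?Y) ?Z (?X \<bullet> ?Y) ?Z"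
    by (simp add: merge)
  also have "\<dots> = (mul L \<bullet> (mul M \<bullet> mul N)) \<cdot> a\<^sub>b (?X \<odot> ?X) (?Y \<odot> ?Y) (?Z \<odot> ?Z)
      \<cdot> (\<zeta> ?X ?Y ?X ?Y \<bullet> (?Z \<odot> ?Z)) \<cdot> \<zeta> (?X \<bullet> ?Y) ?Z (?X \<bullet> ?Y) ?Z"
    using red[OF bull.assoc_nat[of "mul L" "mul M" "mul N"]] by simp
  also have "\<dots> = (mul L \<bullet> (mul M \<bullet> mul N)) \<cdot> ((?X \<odot> ?X) \<bullet> \<zeta> ?Y ?Z ?Y ?Z)
      \<cdot> \<zeta> ?X (?Y \<bullet> ?Z) ?X (?Y \<bullet> ?Z) \<cdot> (?a \<odot> ?a)"
    by (simp add: zeta_assoc_b)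
  also have "\<dots> = mul (prodmon L (prodmon M N)) \<cdot> (?a \<odot> ?a)"
    by (simp add: merge)
  finally show "?a \<cdot> mul (prodmon (prodmon L M) N) = mul (prodmon L (prodmon M N)) \<cdot> (?a \<odot> ?a)" .
  have "?a \<cdot> un (prodmon (prodmon L M) N) = ?a \<cdot> ((un L \<bullet> un M) \<bullet> un N) \<cdot> (\<Delta>\<^sub>I \<bullet> I) \<cdot> \<Delta>\<^sub>I"
    by (simp add: merge)
  also have "\<dots> = (un L \<bullet> (un M \<bullet> un N)) \<cdot> a\<^sub>b I I I \<cdot> (\<Delta>\<^sub>I \<bullet> I) \<cdot> \<Delta>\<^sub>I"
    using red[OF bull.assoc_nat[of "un L" "un M" "un N"]] by simp
  also have "\<dots> = un (prodmon L (prodmon M N))"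
    by (simp add: merge DelI_assoc)
  finally show "?a \<cdot> un (prodmon (prodmon L M) N) = un (prodmon L (prodmon M N))" .
qed simp_all

lemma mhom_lunit:
  assumes [simp]: "ismon M"
  shows "mhom (prodmon Jmon M) (l\<^sub>b (car M)) M"
proof (rule mhomI)
  let ?X = "car M"
  have "l\<^sub>b ?X \<cdot> mul (prodmon Jmon M) = l\<^sub>b ?X \<cdot> (J \<bullet> mul M) \<cdot> (m\<^sub>J \<bullet> (?X \<odot> ?X)) \<cdot> \<zeta> J ?X J ?X"
    by (simp add: merge)
  also have "\<dots> = mul M \<cdot> l\<^sub>b (?X \<odot> ?X) \<cdot> (m\<^sub>J \<bullet> (?X \<odot> ?X)) \<cdot> \<zeta> J ?X J ?X"
    using red[OF bull.lunit_nat[of "mul M"]] by simp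
  also have "\<dots> = mul M \<cdot> (l\<^sub>b ?X \<odot> l\<^sub>b ?X)"
    by (simp add: zeta_lunit_b)
  finally show "l\<^sub>b ?X \<cdot> mul (prodmon Jmon M) = mul M \<cdot> (l\<^sub>b ?X \<odot> l\<^sub>b ?X)" .
  have "l\<^sub>b ?X \<cdot> un (prodmon Jmon M) = l\<^sub>b ?X \<cdot> (J \<bullet> un M) \<cdot> (\<epsilon>\<^sub>I \<bullet> I) \<cdot> \<Delta>\<^sub>I"
    by (simp add: merge)
  also have "\<dots> = un M \<cdot> l\<^sub>b I \<cdot> (\<epsilon>\<^sub>I \<bullet> I) \<cdot> \<Delta>\<^sub>I"
    using red[OF bull.lunit_nat[of "un M"]] by simp
  also have "\<dots> = un M"
    by (simp add: DelI_counit_left)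
  finally show "l\<^sub>b ?X \<cdot> un (prodmon Jmon M) = un M" .
qed simp_all

lemma mhom_runit:
  assumes [simp]: "ismon M"
  shows "mhom (prodmon M Jmon) (r\<^sub>b (car M)) M"
proof (rule mhomI)
  let ?X = "car M"
  have "r\<^sub>b ?X \<cdot> mul (prodmon M Jmon) = r\<^sub>b ?X \<cdot> (mul M \<bullet> J) \<cdot> ((?X \<odot> ?X) \<bullet> m\<^sub>J) \<cdot> \<zeta> ?X J ?X J"
    by (simp add: merge)
  also have "\<dots> = mul M \<cdot> r\<^sub>b (?X \<odot> ?X) \<cdot> ((?X \<odot> ?X) \<bullet> m\<^sub>J) \<cdot> \<zeta> ?X J ?X J"
    using red[OF bull.runit_nat[of "mul M"]] by simp
  also have "\<dots> = mul M \<cdot> (r\<^sub>b ?X \<odot> r\<^sub>b ?X)"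
    by (simp add: zeta_runit_b)
  finally show "r\<^sub>b ?X \<cdot> mul (prodmon M Jmon) = mul M \<cdot> (r\<^sub>b ?X \<odot> r\<^sub>b ?X)" .
  have "r\<^sub>b ?X \<cdot> un (prodmon M Jmon) = r\<^sub>b ?X \<cdot> (un M \<bullet> J) \<cdot> (I \<bullet> \<epsilon>\<^sub>I) \<cdot> \<Delta>\<^sub>I"
    by (simp add: merge)
  also have "\<dots> = un M \<cdot> r\<^sub>b I \<cdot> (I \<bullet> \<epsilon>\<^sub>I) \<cdot> \<Delta>\<^sub>I"
    using red[OF bull.runit_nat[of "un M"]] by simp
  also have "\<dots> = un M"
    by (simp add: DelI_counit_right)
  finally show "r\<^sub>b ?X \<cdot> un (prodmon M Jmon) = un M" .
qed simp_all

end

context bullet_braided_duoidal_category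
begin

lemma braid_arr [simp]:
  assumes "ob X" "ob Y"
  shows "Ar (c X Y)" "dom (c X Y) = X \<bullet> Y" "cod (c X Y) = Y \<bullet> X" "iso (c X Y)"
  using bull.braiding_in_hom[OF assms] bull.braiding_iso[OF assms] by (auto dest: homD)

lemma braid_nat:
  assumes "Ar f" "Ar g"
  shows "c (cod f) (cod g) \<cdot> (f \<bullet> g) = (g \<bullet> f) \<cdot> c (dom f) (dom g)"
  using assms by (intro bull.braiding_natural) (auto intro!: homI)

lemma mhom_braid:
  assumes [simp]: "ismon M" "ismon N"
  shows "mhom (prodmon M N) (c (car M) (car N)) (prodmon N M)"
proof (rule mhomI)
  let ?c = "c (car M) (car N)"
  show "?c \<cdot> mul (prodmon M N) = mul (prodmon N M) \<cdot> (?c \<odot> ?c)"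
    using red[OF braid_nat[of "mul M" "mul N"]] by (simp add: braiding_zeta)
  show "?c \<cdot> un (prodmon M N) = un (prodmon N M)"
    using red[OF braid_nat[of "un M" "un N"]] by (simp add: braiding_DelI)
qed simp_all

end

section \<open>Consequences of the axioms of a reversion\<close>

context reversion
begin

lemma rev_ob [simp]: "ob X \<Longrightarrow> ob (X\<^sup>-)"
  using lax_o by (simp add: lax_monoidal_endofunctor_def endofunctor_def endofunctor_axioms_def)

lemma rev_arr [simp]:
  assumes "Ar f"
  shows "Ar (f\<^sup>-)" "dom (f\<^sup>-) = (dom f)\<^sup>-" "cod (f\<^sup>-) = (cod f)\<^sup>-"
proof -
  have "\<guillemotleft>f : dom f \<rightarrow> cod f\<guillemotright>"
    using assms by (intro homI) auto
  then have "\<guillemotleft>f\<^sup>- : (dom f)\<^sup>- \<rightarrow> (cod f)\<^sup>-\<guillemotright>"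
    using lax_o by (simp add: lax_monoidal_endofunctor_def endofunctor_def endofunctor_axioms_def)
  then show "Ar (f\<^sup>-)" "dom (f\<^sup>-) = (dom f)\<^sup>-" "cod (f\<^sup>-) = (cod f)\<^sup>-"
    by (auto dest: homD)
qed

lemma rev_comp:
  assumes "Ar f" "Ar g" "dom g = cod f"
  shows "(g \<cdot> f)\<^sup>- = g\<^sup>- \<cdot> f\<^sup>-"
proof -
  have "\<guillemotleft>f : dom f \<rightarrow> cod f\<guillemotright>" "\<guillemotleft>g : cod f \<rightarrow> cod g\<guillemotright>"
    using assms by (auto intro!: homI)
  then show ?thesis
    using lax_o unfolding lax_monoidal_endofunctor_def endofunctor_def endofunctor_axioms_def by blast
qed

lemma phi_o_arr [simp]:
  assumes "ob X" "ob Y"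
  shows "Ar (\<phi>\<^sub>o X Y)" "dom (\<phi>\<^sub>o X Y) = X\<^sup>- \<odot> Y\<^sup>-" "cod (\<phi>\<^sub>o X Y) = (Y \<odot> X)\<^sup>-"
  using assms lax_monoidal_endofunctor.phi_in_hom[OF lax_o, of X Y]
  by (auto dest: homD simp: reversed_monoidal_def)

lemma phi_o0_arr [simp]: "Ar \<phi>\<^sub>o\<^sub>0" "dom \<phi>\<^sub>o\<^sub>0 = I" "cod \<phi>\<^sub>o\<^sub>0 = I\<^sup>-"
  using lax_monoidal_endofunctor.phi0_in_hom[OF lax_o]
  by (auto dest: homD simp: reversed_monoidal_def)

text \<open>The right unit constraint of the reversed product is \<open>l\<^sub>o\<close>; hence the
  unit law of the lax functor relates a reversed \<open>l\<^sub>o\<close> to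
  \<open>r\<^sub>o\<close>.\<close>

lemma phi_o_unit:
  assumes "ob X"
  shows "(l\<^sub>o X)\<^sup>- \<cdot> \<phi>\<^sub>o X I \<cdot> (X\<^sup>- \<odot> \<phi>\<^sub>o\<^sub>0) = r\<^sub>o (X\<^sup>-)"
  using lax_monoidal_endofunctor.phi_unit_right[OF lax_o, of X] assms
  by (simp add: reversed_monoidal_def)

lemma gamma_arr [simp]:
  assumes "ob X" "ob Y" "ob Z" "ob T"
  shows "Ar (\<gamma> X Y Z T)" "dom (\<gamma> X Y Z T) = ((X \<bullet> Y\<^sup>-) \<odot> Z) \<bullet> T"
    "cod (\<gamma> X Y Z T) = X \<odot> (Z \<bullet> (Y \<odot> T))"
  using gamma_in_hom[OF assms] by (auto dest: homD)

lemma delta_arr [simp]: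
  assumes "ob X" "ob Y" "ob Z" "ob T"
  shows "Ar (\<delta> X Y Z T)" "dom (\<delta> X Y Z T) = X \<bullet> (Y \<odot> (Z\<^sup>- \<bullet> T))"
    "cod (\<delta> X Y Z T) = ((X \<odot> Z) \<bullet> Y) \<odot> T"
  using delta_in_hom[OF assms] by (auto dest: homD)

lemma gamma_nat:
  assumes "Ar x" "Ar y" "Ar z" "Ar t"
  shows "\<gamma> (cod x) (cod y) (cod z) (cod t) \<cdot> (((x \<bullet> y\<^sup>-) \<odot> z) \<bullet> t)
    = (x \<odot> (z \<bullet> (y \<odot> t))) \<cdot> \<gamma> (dom x) (dom y) (dom z) (dom t)"
  using assms by (intro gamma_natural homI) auto

lemma delta_nat:
  assumes "Ar x" "Ar y" "Ar z" "Ar t"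
  shows "\<delta> (cod x) (cod y) (cod z) (cod t) \<cdot> (x \<bullet> (y \<odot> (z\<^sup>- \<bullet> t)))
    = (((x \<odot> z) \<bullet> y) \<odot> t) \<cdot> \<delta> (dom x) (dom y) (dom z) (dom t)"
  using assms by (intro delta_natural homI) auto

text \<open>Extends R7 from \<open>X = Y = I\<close> to all objects. The arrow \<open>?z\<close> is
  invertible by \<open>zeta_runit_o\<close>; inserting it lets R3 split off
  \<open>X \<bullet> Y\<close> and leaves \<open>\<delta> I I I I\<close>, to which R7
  applies.\<close>

lemma delta_unit:
  assumes [simp]: "ob X" "ob Y"
  shows "\<delta> X Y I I \<cdot> (X \<bullet> ((Y \<odot> ((\<phi>\<^sub>o\<^sub>0 \<bullet> I) \<cdot> \<Delta>\<^sub>I)) \<cdot> Inv (r\<^sub>o Y)))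
    = ((Inv (r\<^sub>o X) \<bullet> Y) \<odot> I) \<cdot> Inv (r\<^sub>o (X \<bullet> Y))"
proof -
  define w where "w = (\<phi>\<^sub>o\<^sub>0 \<bullet> I) \<cdot> \<Delta>\<^sub>I"
  have w [simp]: "Ar w" "dom w = I" "cod w = I\<^sup>- \<bullet> I"
    by (simp_all add: w_def)
  let ?p = "((a\<^sub>o X I I \<bullet> (Y \<odot> I)) \<odot> I) \<cdot> (((Inv (r\<^sub>o X) \<odot> I) \<bullet> Inv (r\<^sub>o Y)) \<odot> I)"
  let ?lhs = "\<delta> X Y I I \<cdot> (X \<bullet> ((Y \<odot> w) \<cdot> Inv (r\<^sub>o Y)))"
  let ?z = "\<zeta> X Y I I \<cdot> ((X \<bullet> Y) \<odot> \<Delta>\<^sub>I)"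
  have z: "?z = (Inv (r\<^sub>o X) \<bullet> Inv (r\<^sub>o Y)) \<cdot> r\<^sub>o (X \<bullet> Y)"
    by (rule circ.iso_cancel_left[of "r\<^sub>o X \<bullet> r\<^sub>o Y"]) (simp_all add: zeta_runit_o bull.tensor_comp_reduce)
  have tri: "Inv (a\<^sub>o Y I I) \<cdot> (Y \<odot> Inv (l\<^sub>o I)) = Inv (r\<^sub>o Y) \<odot> I"
    by (rule circ.triangle_inv') simp_all
  have R7': "\<delta> I I I I \<cdot> (I \<bullet> ((I \<odot> w) \<cdot> Inv (l\<^sub>o I))) = ((Inv (r\<^sub>o I) \<bullet> I) \<odot> I) \<cdot> Inv (r\<^sub>o (I \<bullet> I))"
  proof (rule circ.iso_cancel_left[of "r\<^sub>o (I \<bullet> I) \<cdot> ((r\<^sub>o I \<bullet> I) \<odot> I)"])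
    show "iso (r\<^sub>o (I \<bullet> I) \<cdot> ((r\<^sub>o I \<bullet> I) \<odot> I))"
      by (rule circ.iso_arrI(1)[where g="((Inv (r\<^sub>o I) \<bullet> I) \<odot> I) \<cdot> Inv (r\<^sub>o (I \<bullet> I))"]) (simp_all add: merge)
    have "(r\<^sub>o (I \<bullet> I) \<cdot> ((r\<^sub>o I \<bullet> I) \<odot> I)) \<cdot> \<delta> I I I I \<cdot> (I \<bullet> ((I \<odot> w) \<cdot> Inv (l\<^sub>o I)))
      = (r\<^sub>o (I \<bullet> I) \<cdot> ((r\<^sub>o I \<bullet> I) \<odot> I) \<cdot> \<delta> I I I I \<cdot> (I \<bullet> (I \<odot> w))) \<cdot> (I \<bullet> Inv (l\<^sub>o I))"
      by (simp add: bull.tensor_comp)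
    also have "\<dots> = I \<bullet> I"
      unfolding w_def R7 by (simp add: bull.tensor_comp circ.lunit_eq_runit)
    finally show "(r\<^sub>o (I \<bullet> I) \<cdot> ((r\<^sub>o I \<bullet> I) \<odot> I)) \<cdot> \<delta> I I I I \<cdot> (I \<bullet> ((I \<odot> w) \<cdot> Inv (l\<^sub>o I)))
      = (r\<^sub>o (I \<bullet> I) \<cdot> ((r\<^sub>o I \<bullet> I) \<odot> I)) \<cdot> ((Inv (r\<^sub>o I) \<bullet> I) \<odot> I) \<cdot> Inv (r\<^sub>o (I \<bullet> I))"
      by (simp add: merge)
  qed simp_all
  have "?p \<cdot> ?lhs \<cdot> r\<^sub>o (X \<bullet> Y) = ((a\<^sub>o X I I \<bullet> (Y \<odot> I)) \<odot> I) \<cdot> \<delta> (X \<odot> I) (Y \<odot> I) I I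
      \<cdot> (Inv (r\<^sub>o X) \<bullet> ((Inv (r\<^sub>o Y) \<odot> (I\<^sup>- \<bullet> I)) \<cdot> (Y \<odot> w) \<cdot> Inv (r\<^sub>o Y))) \<cdot> r\<^sub>o (X \<bullet> Y)"
    using red[OF delta_nat[of "Inv (r\<^sub>o X)" "Inv (r\<^sub>o Y)" I I, symmetric]]
    by (simp add: bull.tensor_comp bull.tensor_comp_reduce)
  also have "(Inv (r\<^sub>o Y) \<odot> (I\<^sup>- \<bullet> I)) \<cdot> (Y \<odot> w) \<cdot> Inv (r\<^sub>o Y) = ((Y \<odot> I) \<odot> w) \<cdot> (Inv (r\<^sub>o Y) \<odot> I) \<cdot> Inv (r\<^sub>o Y)"
    by (simp add: merge)
  also have "\<dots> = Inv (a\<^sub>o Y I (I\<^sup>- \<bullet> I)) \<cdot> (Y \<odot> (I \<odot> w)) \<cdot> (Y \<odot> Inv (l\<^sub>o I)) \<cdot> Inv (r\<^sub>o Y)"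
    using red[OF circ.assoc_inv_nat[of Y I w]] by (simp add: tri[symmetric])
  finally have "?p \<cdot> ?lhs \<cdot> r\<^sub>o (X \<bullet> Y) = ((a\<^sub>o X I I \<bullet> (Y \<odot> I)) \<odot> I) \<cdot> \<delta> (X \<odot> I) (Y \<odot> I) I I
      \<cdot> ((X \<odot> I) \<bullet> Inv (a\<^sub>o Y I (I\<^sup>- \<bullet> I))) \<cdot> ((X \<odot> I) \<bullet> (Y \<odot> ((I \<odot> w) \<cdot> Inv (l\<^sub>o I)))) \<cdot> ?z"
    unfolding z by (simp add: bull.tensor_comp bull.tensor_comp_reduce circ.whisker_left)
  also have "\<dots> = ((a\<^sub>o X I I \<bullet> (Y \<odot> I)) \<odot> I) \<cdot> \<delta> (X \<odot> I) (Y \<odot> I) I I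
      \<cdot> ((X \<odot> I) \<bullet> Inv (a\<^sub>o Y I (I\<^sup>- \<bullet> I))) \<cdot> \<zeta> X Y I (I \<odot> (I\<^sup>- \<bullet> I))
      \<cdot> ((X \<bullet> Y) \<odot> ((I \<bullet> ((I \<odot> w) \<cdot> Inv (l\<^sub>o I))) \<cdot> \<Delta>\<^sub>I))"
    using red[OF zeta_nat[of X Y I "(I \<odot> w) \<cdot> Inv (l\<^sub>o I)"]] by (simp add: circ.whisker_left[of "X \<bullet> Y"])
  also have "\<dots> = (((a\<^sub>o X I I \<bullet> (Y \<odot> I)) \<odot> I) \<cdot> \<delta> (X \<odot> I) (Y \<odot> I) I I
      \<cdot> ((X \<odot> I) \<bullet> Inv (a\<^sub>o Y I (I\<^sup>- \<bullet> I))) \<cdot> \<zeta> X Y I (I \<odot> (I\<^sup>- \<bullet> I)))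
      \<cdot> ((X \<bullet> Y) \<odot> ((I \<bullet> ((I \<odot> w) \<cdot> Inv (l\<^sub>o I))) \<cdot> \<Delta>\<^sub>I))"
    by simp
  \<comment> \<open>R3 replaces \<delta> on products by \<delta> on the second factor, where all
    objects are \<open>I\<close>.\<close>
  also have "\<dots> = (\<zeta> X Y (I \<odot> I) I \<odot> I) \<cdot> Inv (a\<^sub>o (X \<bullet> Y) ((I \<odot> I) \<bullet> I) I)
      \<cdot> ((X \<bullet> Y) \<odot> ((\<delta> I I I I \<cdot> (I \<bullet> ((I \<odot> w) \<cdot> Inv (l\<^sub>o I)))) \<cdot> \<Delta>\<^sub>I))"
    by (subst R3) (simp_all add: circ.tensor_comp)
  also have "\<dots> = (\<zeta> X Y (I \<odot> I) I \<odot> I) \<cdot> Inv (a\<^sub>o (X \<bullet> Y) ((I \<odot> I) \<bullet> I) I)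
      \<cdot> ((X \<bullet> Y) \<odot> ((Inv (r\<^sub>o I) \<bullet> I) \<odot> I)) \<cdot> ((X \<bullet> Y) \<odot> Inv (r\<^sub>o (I \<bullet> I))) \<cdot> ((X \<bullet> Y) \<odot> \<Delta>\<^sub>I)"
    unfolding R7' by (simp add: circ.whisker_left)
  also have "\<dots> = (\<zeta> X Y (I \<odot> I) I \<odot> I) \<cdot> (((X \<bullet> Y) \<odot> (Inv (r\<^sub>o I) \<bullet> I)) \<odot> I)
      \<cdot> Inv (r\<^sub>o ((X \<bullet> Y) \<odot> (I \<bullet> I))) \<cdot> ((X \<bullet> Y) \<odot> \<Delta>\<^sub>I)"
    using red[OF circ.assoc_inv_nat[of "X \<bullet> Y" "Inv (r\<^sub>o I) \<bullet> I" I]]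
      red[OF circ.runit_inv_tensor[of "X \<bullet> Y" "I \<bullet> I"]] by simp
  also have "\<dots> = ((\<zeta> X Y (I \<odot> I) I \<cdot> ((X \<bullet> Y) \<odot> (Inv (r\<^sub>o I) \<bullet> I)) \<cdot> ((X \<bullet> Y) \<odot> \<Delta>\<^sub>I)) \<odot> I)
      \<cdot> Inv (r\<^sub>o ((X \<bullet> Y) \<odot> I))"
    using circ.runit_inv_nat[of "(X \<bullet> Y) \<odot> \<Delta>\<^sub>I"] by (simp add: circ.whisker_right)
  also have "\<zeta> X Y (I \<odot> I) I \<cdot> ((X \<bullet> Y) \<odot> (Inv (r\<^sub>o I) \<bullet> I)) \<cdot> ((X \<bullet> Y) \<odot> \<Delta>\<^sub>I)
      = ((X \<odot> Inv (r\<^sub>o I)) \<bullet> (Y \<odot> I)) \<cdot> ?z"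
    using red[OF zeta_nat[of X Y "Inv (r\<^sub>o I)" I]] by simp
  also have "\<dots> = (((X \<odot> Inv (r\<^sub>o I)) \<cdot> Inv (r\<^sub>o X)) \<bullet> Inv (r\<^sub>o Y)) \<cdot> r\<^sub>o (X \<bullet> Y)"
    unfolding z by (simp add: bull.tensor_comp_reduce)
  also have "(X \<odot> Inv (r\<^sub>o I)) \<cdot> Inv (r\<^sub>o X) = a\<^sub>o X I I \<cdot> (Inv (r\<^sub>o X) \<odot> I) \<cdot> Inv (r\<^sub>o X)"
    using red[OF circ.triangle_inv[of X I]] by (simp add: circ.lunit_eq_runit)
  also have "((((a\<^sub>o X I I \<cdot> (Inv (r\<^sub>o X) \<odot> I) \<cdot> Inv (r\<^sub>o X)) \<bullet> Inv (r\<^sub>o Y)) \<cdot> r\<^sub>o (X \<bullet> Y)) \<odot> I) \<cdot> Inv (r\<^sub>o ((X \<bullet> Y) \<odot> I))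
    = ?p \<cdot> (((Inv (r\<^sub>o X) \<bullet> Y) \<odot> I) \<cdot> Inv (r\<^sub>o (X \<bullet> Y))) \<cdot> r\<^sub>o (X \<bullet> Y)"
    by (simp add: circ.runit_of_runit circ.inv_tensor merge)
  finally have "?p \<cdot> ?lhs \<cdot> r\<^sub>o (X \<bullet> Y)
    = ?p \<cdot> (((Inv (r\<^sub>o X) \<bullet> Y) \<odot> I) \<cdot> Inv (r\<^sub>o (X \<bullet> Y))) \<cdot> r\<^sub>o (X \<bullet> Y)" .
  moreover have "iso ?p"
    by (rule circ.iso_arrI(1)[where g="(((r\<^sub>o X \<odot> I) \<bullet> r\<^sub>o Y) \<odot> I) \<cdot> ((Inv (a\<^sub>o X I I) \<bullet> (Y \<odot> I)) \<odot> I)"])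
      (simp_all add: merge)
  ultimately have "?lhs \<cdot> r\<^sub>o (X \<bullet> Y) = (((Inv (r\<^sub>o X) \<bullet> Y) \<odot> I) \<cdot> Inv (r\<^sub>o (X \<bullet> Y))) \<cdot> r\<^sub>o (X \<bullet> Y)"
    by (rule circ.iso_cancel_left[of ?p, rotated -1]) simp_all
  then show ?thesis
    unfolding w_def[symmetric] by (rule circ.iso_cancel_right[of "r\<^sub>o (X \<bullet> Y)", rotated -1]) simp_all
qed

text \<open>The mirror image for \<gamma>, extending R6: \<open>zeta_lunit_o\<close> makes
  \<open>?z\<close> invertible, and R1 splits off \<open>Z \<bullet> T\<close> and leaves
  \<open>\<gamma> I I I I\<close>.\<close>

lemma gamma_unit:
  assumes [simp]: "ob Z" "ob T"
  shows "\<gamma> I I Z T \<cdot> ((((I \<bullet> \<phi>\<^sub>o\<^sub>0) \<cdot> \<Delta>\<^sub>I) \<odot> Z) \<bullet> T)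
    = (I \<odot> (Z \<bullet> Inv (l\<^sub>o T))) \<cdot> Inv (l\<^sub>o (Z \<bullet> T)) \<cdot> (l\<^sub>o Z \<bullet> T)"
proof -
  define w where "w = (I \<bullet> \<phi>\<^sub>o\<^sub>0) \<cdot> \<Delta>\<^sub>I"
  have w [simp]: "Ar w" "dom w = I" "cod w = I \<bullet> I\<^sup>-"
    by (simp_all add: w_def)
  let ?z = "\<zeta> I I Z T \<cdot> (\<Delta>\<^sub>I \<odot> (Z \<bullet> T))"
  let ?d = "(Inv (l\<^sub>o I) \<bullet> I) \<cdot> \<Delta>\<^sub>I"
  let ?e = "I \<odot> (Inv (l\<^sub>o Z) \<bullet> (I \<odot> Inv (l\<^sub>o T)))"
  let ?lhs = "\<gamma> I I Z T \<cdot> ((w \<odot> Z) \<bullet> T)"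
  have z: "?z = (Inv (l\<^sub>o Z) \<bullet> Inv (l\<^sub>o T)) \<cdot> l\<^sub>o (Z \<bullet> T)"
    by (rule circ.iso_cancel_left[of "l\<^sub>o Z \<bullet> l\<^sub>o T"]) (simp_all add: zeta_lunit_o bull.tensor_comp_reduce)
  \<comment> \<open>R6 is put in this form, behind \<open>?d\<close>, because
    \<open>\<Delta>\<^sub>I\<close> arrives together with \<open>?z\<close>.\<close>
  have R6': "\<gamma> I I I I \<cdot> ((w \<odot> I) \<bullet> I) \<cdot> ?d = (I \<odot> (I \<bullet> Inv (l\<^sub>o I))) \<cdot> Inv (l\<^sub>o (I \<bullet> I)) \<cdot> \<Delta>\<^sub>I"
  proof (rule circ.iso_cancel_left[of "l\<^sub>o (I \<bullet> I) \<cdot> (I \<odot> (I \<bullet> l\<^sub>o I))"])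
    show "iso (l\<^sub>o (I \<bullet> I) \<cdot> (I \<odot> (I \<bullet> l\<^sub>o I)))"
      by (rule circ.iso_arrI(1)[where g="(I \<odot> (I \<bullet> Inv (l\<^sub>o I))) \<cdot> Inv (l\<^sub>o (I \<bullet> I))"]) (simp_all add: merge)
    have "(l\<^sub>o (I \<bullet> I) \<cdot> (I \<odot> (I \<bullet> l\<^sub>o I))) \<cdot> \<gamma> I I I I \<cdot> ((w \<odot> I) \<bullet> I) \<cdot> ?d
      = (l\<^sub>o (I \<bullet> I) \<cdot> (I \<odot> (I \<bullet> l\<^sub>o I)) \<cdot> \<gamma> I I I I \<cdot> ((w \<odot> I) \<bullet> I)) \<cdot> ?d"
      by simp
    also have "\<dots> = \<Delta>\<^sub>I"
      unfolding w_def R6 by (simp add: bull.tensor_comp_reduce)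
    finally show "(l\<^sub>o (I \<bullet> I) \<cdot> (I \<odot> (I \<bullet> l\<^sub>o I))) \<cdot> \<gamma> I I I I \<cdot> ((w \<odot> I) \<bullet> I) \<cdot> ?d
      = (l\<^sub>o (I \<bullet> I) \<cdot> (I \<odot> (I \<bullet> l\<^sub>o I))) \<cdot> (I \<odot> (I \<bullet> Inv (l\<^sub>o I))) \<cdot> Inv (l\<^sub>o (I \<bullet> I)) \<cdot> \<Delta>\<^sub>I"
      by (simp add: merge)
  qed simp_all
  have "?e \<cdot> ?lhs \<cdot> (Inv (l\<^sub>o Z) \<bullet> T) \<cdot> l\<^sub>o (Z \<bullet> T)
      = \<gamma> I I (I \<odot> Z) (I \<odot> T) \<cdot> (((I \<bullet> I\<^sup>-) \<odot> Inv (l\<^sub>o Z)) \<bullet> Inv (l\<^sub>o T)) \<cdot> ((w \<odot> Z) \<bullet> T)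
        \<cdot> (Inv (l\<^sub>o Z) \<bullet> T) \<cdot> l\<^sub>o (Z \<bullet> T)"
    using red[OF gamma_nat[of I I "Inv (l\<^sub>o Z)" "Inv (l\<^sub>o T)", symmetric]] by simp
  also have "\<dots> = \<gamma> I I (I \<odot> Z) (I \<odot> T)
      \<cdot> (((w \<odot> (I \<odot> Z)) \<cdot> (I \<odot> Inv (l\<^sub>o Z)) \<cdot> Inv (l\<^sub>o Z)) \<bullet> Inv (l\<^sub>o T)) \<cdot> l\<^sub>o (Z \<bullet> T)"
    by (simp add: merge)
  also have "(w \<odot> (I \<odot> Z)) \<cdot> (I \<odot> Inv (l\<^sub>o Z)) \<cdot> Inv (l\<^sub>o Z)
      = a\<^sub>o (I \<bullet> I\<^sup>-) I Z \<cdot> ((w \<odot> I) \<odot> Z) \<cdot> (Inv (l\<^sub>o I) \<odot> Z) \<cdot> Inv (l\<^sub>o Z)"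
    using red[OF circ.assoc_nat[of w I Z]] red[OF circ.triangle_inv[of I Z]]
    by (simp add: circ.lunit_eq_runit)
  also have "\<gamma> I I (I \<odot> Z) (I \<odot> T)
      \<cdot> ((a\<^sub>o (I \<bullet> I\<^sup>-) I Z \<cdot> ((w \<odot> I) \<odot> Z) \<cdot> (Inv (l\<^sub>o I) \<odot> Z) \<cdot> Inv (l\<^sub>o Z)) \<bullet> Inv (l\<^sub>o T)) \<cdot> l\<^sub>o (Z \<bullet> T)
      = \<gamma> I I (I \<odot> Z) (I \<odot> T) \<cdot> (a\<^sub>o (I \<bullet> I\<^sup>-) I Z \<bullet> (I \<odot> T))
        \<cdot> (((w \<odot> I) \<odot> Z) \<bullet> (I \<odot> T)) \<cdot> ((Inv (l\<^sub>o I) \<odot> Z) \<bullet> (I \<odot> T)) \<cdot> ?z"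
    unfolding z by (simp add: bull.tensor_comp_reduce)
  also have "((Inv (l\<^sub>o I) \<odot> Z) \<bullet> (I \<odot> T)) \<cdot> ?z = \<zeta> (I \<odot> I) I Z T \<cdot> (?d \<odot> (Z \<bullet> T))"
    using red[OF zeta_nat[of "Inv (l\<^sub>o I)" I Z T]] by (simp add: circ.whisker_right)
  also have "(((w \<odot> I) \<odot> Z) \<bullet> (I \<odot> T)) \<cdot> (\<zeta> (I \<odot> I) I Z T \<cdot> (?d \<odot> (Z \<bullet> T)))
      = \<zeta> ((I \<bullet> I\<^sup>-) \<odot> I) I Z T \<cdot> ((((w \<odot> I) \<bullet> I) \<cdot> ?d) \<odot> (Z \<bullet> T))"
    using red[OF zeta_nat[of "w \<odot> I" I Z T]] by (simp add: circ.whisker_right)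
  also have "\<gamma> I I (I \<odot> Z) (I \<odot> T) \<cdot> (a\<^sub>o (I \<bullet> I\<^sup>-) I Z \<bullet> (I \<odot> T))
      \<cdot> \<zeta> ((I \<bullet> I\<^sup>-) \<odot> I) I Z T \<cdot> ((((w \<odot> I) \<bullet> I) \<cdot> ?d) \<odot> (Z \<bullet> T))
    = (\<gamma> I I (I \<odot> Z) (I \<odot> T) \<cdot> (a\<^sub>o (I \<bullet> I\<^sup>-) I Z \<bullet> (I \<odot> T)) \<cdot> \<zeta> ((I \<bullet> I\<^sup>-) \<odot> I) I Z T)
      \<cdot> ((((w \<odot> I) \<bullet> I) \<cdot> ?d) \<odot> (Z \<bullet> T))"
    by simp
  also have "\<dots> = (I \<odot> ((I \<odot> Z) \<bullet> a\<^sub>o I I T)) \<cdot> (I \<odot> \<zeta> I (I \<odot> I) Z T)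
      \<cdot> a\<^sub>o I (I \<bullet> (I \<odot> I)) (Z \<bullet> T) \<cdot> ((\<gamma> I I I I \<cdot> ((w \<odot> I) \<bullet> I) \<cdot> ?d) \<odot> (Z \<bullet> T))"
    by (subst R1) (simp_all add: circ.tensor_comp)
  also have "\<dots> = (I \<odot> ((I \<odot> Z) \<bullet> a\<^sub>o I I T)) \<cdot> (I \<odot> \<zeta> I (I \<odot> I) Z T)
      \<cdot> a\<^sub>o I (I \<bullet> (I \<odot> I)) (Z \<bullet> T) \<cdot> ((I \<odot> (I \<bullet> Inv (l\<^sub>o I))) \<odot> (Z \<bullet> T))
      \<cdot> (Inv (l\<^sub>o (I \<bullet> I)) \<odot> (Z \<bullet> T)) \<cdot> (\<Delta>\<^sub>I \<odot> (Z \<bullet> T))"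
    unfolding R6' by (simp add: circ.whisker_right)
  also have "\<dots> = (I \<odot> ((I \<odot> Z) \<bullet> a\<^sub>o I I T)) \<cdot> (I \<odot> \<zeta> I (I \<odot> I) Z T)
      \<cdot> (I \<odot> ((I \<bullet> Inv (l\<^sub>o I)) \<odot> (Z \<bullet> T))) \<cdot> Inv (l\<^sub>o ((I \<bullet> I) \<odot> (Z \<bullet> T))) \<cdot> (\<Delta>\<^sub>I \<odot> (Z \<bullet> T))"
    using red[OF circ.assoc_nat[of I "I \<bullet> Inv (l\<^sub>o I)" "Z \<bullet> T"]]
      red[OF circ.lunit_inv_tensor[of "I \<bullet> I" "Z \<bullet> T"]] by simp
  also have "\<dots> = (I \<odot> (((I \<odot> Z) \<bullet> a\<^sub>o I I T) \<cdot> \<zeta> I (I \<odot> I) Z T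
      \<cdot> ((I \<bullet> Inv (l\<^sub>o I)) \<odot> (Z \<bullet> T)) \<cdot> (\<Delta>\<^sub>I \<odot> (Z \<bullet> T)))) \<cdot> Inv (l\<^sub>o (I \<odot> (Z \<bullet> T)))"
    using circ.lunit_inv_nat[of "\<Delta>\<^sub>I \<odot> (Z \<bullet> T)"] by (simp add: circ.whisker_left)
  also have "\<zeta> I (I \<odot> I) Z T \<cdot> ((I \<bullet> Inv (l\<^sub>o I)) \<odot> (Z \<bullet> T)) \<cdot> (\<Delta>\<^sub>I \<odot> (Z \<bullet> T))
      = ((I \<odot> Z) \<bullet> (Inv (l\<^sub>o I) \<odot> T)) \<cdot> ?z"
    using red[OF zeta_nat[of I "Inv (l\<^sub>o I)" Z T]] by simp
  also have "((I \<odot> Z) \<bullet> a\<^sub>o I I T) \<cdot> ((I \<odot> Z) \<bullet> (Inv (l\<^sub>o I) \<odot> T)) \<cdot> ?z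
      = (Inv (l\<^sub>o Z) \<bullet> ((I \<odot> Inv (l\<^sub>o T)) \<cdot> Inv (l\<^sub>o T))) \<cdot> l\<^sub>o (Z \<bullet> T)"
    unfolding z using red[OF circ.triangle_inv[of I T]] by (simp add: merge circ.lunit_eq_runit)
  also have "(I \<odot> ((Inv (l\<^sub>o Z) \<bullet> ((I \<odot> Inv (l\<^sub>o T)) \<cdot> Inv (l\<^sub>o T))) \<cdot> l\<^sub>o (Z \<bullet> T))) \<cdot> Inv (l\<^sub>o (I \<odot> (Z \<bullet> T)))
      = ?e \<cdot> ((I \<odot> (Z \<bullet> Inv (l\<^sub>o T))) \<cdot> Inv (l\<^sub>o (Z \<bullet> T)) \<cdot> (l\<^sub>o Z \<bullet> T)) \<cdot> (Inv (l\<^sub>o Z) \<bullet> T) \<cdot> l\<^sub>o (Z \<bullet> T)"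
    by (simp add: circ.lunit_of_lunit circ.inv_tensor merge)
  finally have "?e \<cdot> ?lhs \<cdot> (Inv (l\<^sub>o Z) \<bullet> T) \<cdot> l\<^sub>o (Z \<bullet> T)
    = ?e \<cdot> ((I \<odot> (Z \<bullet> Inv (l\<^sub>o T))) \<cdot> Inv (l\<^sub>o (Z \<bullet> T)) \<cdot> (l\<^sub>o Z \<bullet> T)) \<cdot> (Inv (l\<^sub>o Z) \<bullet> T) \<cdot> l\<^sub>o (Z \<bullet> T)" .
  then have "?lhs \<cdot> (Inv (l\<^sub>o Z) \<bullet> T) \<cdot> l\<^sub>o (Z \<bullet> T)
    = ((I \<odot> (Z \<bullet> Inv (l\<^sub>o T))) \<cdot> Inv (l\<^sub>o (Z \<bullet> T)) \<cdot> (l\<^sub>o Z \<bullet> T)) \<cdot> (Inv (l\<^sub>o Z) \<bullet> T) \<cdot> l\<^sub>o (Z \<bullet> T)"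
    by (rule circ.iso_cancel_left[of ?e, rotated -1]) simp_all
  then have "?lhs = (I \<odot> (Z \<bullet> Inv (l\<^sub>o T))) \<cdot> Inv (l\<^sub>o (Z \<bullet> T)) \<cdot> (l\<^sub>o Z \<bullet> T)"
  proof (rule circ.iso_cancel_right[of "(Inv (l\<^sub>o Z) \<bullet> T) \<cdot> l\<^sub>o (Z \<bullet> T)", rotated -1])
    show "iso ((Inv (l\<^sub>o Z) \<bullet> T) \<cdot> l\<^sub>o (Z \<bullet> T))"
      by (rule circ.iso_arrI(1)[where g="Inv (l\<^sub>o (Z \<bullet> T)) \<cdot> (l\<^sub>o Z \<bullet> T)"]) (simp_all add: merge)
  qed simp_all
  then show ?thesis
    by (simp add: w_def)
qed

end

section \<open>The Hopf isomorphism\<close>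

context duoidal_category
begin

lemma bimonoid_arr [simp]:
  assumes "bimonoid D H"
  shows "ob (obj H)" "Ar (mult H)" "dom (mult H) = obj H \<odot> obj H" "cod (mult H) = obj H"
    "Ar (unt H)" "dom (unt H) = I" "cod (unt H) = obj H"
    "Ar (comult H)" "dom (comult H) = obj H" "cod (comult H) = obj H \<bullet> obj H"
    "Ar (counit H)" "dom (counit H) = obj H" "cod (counit H) = J"
  using bimonoid.monoid[OF assms] bimonoid.comonoid[OF assms]
  unfolding monoid_object_def comonoid_object_def by (auto dest: homD)

definition monof :: "'m bimon \<Rightarrow> 'm mon" where
  "monof H = \<lparr>car = obj H, mul = mult H, un = unt H\<rparr>"

lemma monof_sel [simp]: "car (monof H) = obj H" "mul (monof H) = mult H" "un (monof H) = unt H"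
  by (simp_all add: monof_def)

lemma ismon_monof [simp]: "bimonoid D H \<Longrightarrow> ismon (monof H)"
  by (simp add: ismon_def bimonoid.monoid)

end

context reversion
begin

lemma psi_arr [simp]:
  assumes "ob X" "ob Y"
  shows "Ar (psi X Y)" "dom (psi X Y) = X\<^sup>- \<bullet> Y" "cod (psi X Y) = J \<odot> (I \<bullet> (X \<odot> Y))"
  using assms by (simp_all add: psi_def)

lemma phi_arr [simp]:
  assumes "ob X" "ob Y"
  shows "Ar (phi X Y)" "dom (phi X Y) = X \<bullet> Y\<^sup>-" "cod (phi X Y) = ((X \<odot> Y) \<bullet> I) \<odot> J"
  using assms by (simp_all add: phi_def)

text \<open>R9 at \<open>Z = I\<close>, with \<open>\<phi>\<^sub>o\<^sub>0\<close> filling the slot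
  \<open>I\<^sup>-\<close>. It makes \<open>psi\<close> appear behind \<delta>, and
  \<open>psi\<close> is what the left antipode axiom speaks about.\<close>

lemma delta_psi:
  assumes [simp]: "ob X" "ob Y" "ob U"
  shows "a\<^sub>o X Y U \<cdot> (r\<^sub>b (X \<odot> Y) \<odot> U) \<cdot> \<delta> X J Y U
    = ((r\<^sub>o X \<cdot> r\<^sub>b (X \<odot> I) \<cdot> ((X \<odot> I) \<bullet> m\<^sub>J)) \<odot> (Y \<odot> U)) \<cdot> \<delta> X (J \<odot> J) I (Y \<odot> U)
      \<cdot> (X \<bullet> (Inv (a\<^sub>o J J (I\<^sup>- \<bullet> (Y \<odot> U))) \<cdot> (J \<odot> ((J \<odot> (\<phi>\<^sub>o\<^sub>0 \<bullet> (Y \<odot> U))) \<cdot> psi Y U))))"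
proof -
  let ?q = "r\<^sub>o X \<cdot> r\<^sub>b (X \<odot> I) \<cdot> ((X \<odot> I) \<bullet> m\<^sub>J)"
  let ?k = "X \<bullet> (J \<odot> (((Y\<^sup>- \<odot> \<phi>\<^sub>o\<^sub>0) \<cdot> Inv (r\<^sub>o (Y\<^sup>-))) \<bullet> U))"
  let ?A = "\<delta> X (J \<odot> J) I (Y \<odot> U) \<cdot> (X \<bullet> Inv (a\<^sub>o J J (I\<^sup>- \<bullet> (Y \<odot> U))))
    \<cdot> (X \<bullet> (J \<odot> \<gamma> J Y (I\<^sup>-) U)) \<cdot> (X \<bullet> (J \<odot> ((Inv (l\<^sub>b (Y\<^sup>-)) \<odot> I\<^sup>-) \<bullet> U)))"
  let ?B = "(\<zeta> X J I J \<odot> (Y \<odot> U)) \<cdot> ((Inv (r\<^sub>b X) \<odot> Inv (r\<^sub>b I)) \<odot> (Y \<odot> U))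
    \<cdot> a\<^sub>o (X \<odot> I) Y U \<cdot> (Inv (a\<^sub>o X I Y) \<odot> U) \<cdot> (r\<^sub>b (X \<odot> (I \<odot> Y)) \<odot> U) \<cdot> \<delta> X J (I \<odot> Y) U"
  have AB: "?A = ?B \<cdot> (X \<bullet> (J \<odot> (\<phi>\<^sub>o Y I \<bullet> U)))"
    using R9[of X Y I U] by simp
  \<comment> \<open>Preceded by \<open>\<phi>\<^sub>o\<^sub>0\<close>, the structure arrow
    \<open>\<phi>\<^sub>o Y I\<close> is a unit constraint; so the \<phi>-term on the right of R9
    disappears by naturality of \<delta>.\<close>
  have rev_l: "\<phi>\<^sub>o Y I \<cdot> (Y\<^sup>- \<odot> \<phi>\<^sub>o\<^sub>0) \<cdot> Inv (r\<^sub>o (Y\<^sup>-)) = (Inv (l\<^sub>o Y))\<^sup>-"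
  proof -
    have "(Inv (l\<^sub>o Y))\<^sup>- \<cdot> (l\<^sub>o Y)\<^sup>- = (I \<odot> Y)\<^sup>-"
      by (simp add: rev_comp[symmetric])
    from red[OF this, of "\<phi>\<^sub>o Y I \<cdot> (Y\<^sup>- \<odot> \<phi>\<^sub>o\<^sub>0)"]
    have "(Inv (l\<^sub>o Y))\<^sup>- \<cdot> r\<^sub>o (Y\<^sup>-) = \<phi>\<^sub>o Y I \<cdot> (Y\<^sup>- \<odot> \<phi>\<^sub>o\<^sub>0)"
      by (simp add: phi_o_unit)
    then have "((Inv (l\<^sub>o Y))\<^sup>- \<cdot> r\<^sub>o (Y\<^sup>-)) \<cdot> Inv (r\<^sub>o (Y\<^sup>-)) = (\<phi>\<^sub>o Y I \<cdot> (Y\<^sup>- \<odot> \<phi>\<^sub>o\<^sub>0)) \<cdot> Inv (r\<^sub>o (Y\<^sup>-))"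
      by simp
    then show ?thesis by simp
  qed
  have "\<delta> X J (I \<odot> Y) U \<cdot> (X \<bullet> (J \<odot> (\<phi>\<^sub>o Y I \<bullet> U))) \<cdot> ?k
      = \<delta> X J (I \<odot> Y) U \<cdot> (X \<bullet> (J \<odot> ((Inv (l\<^sub>o Y))\<^sup>- \<bullet> U)))"
    by (simp add: merge rev_l)
  also have "\<dots> = (((X \<odot> Inv (l\<^sub>o Y)) \<bullet> J) \<odot> U) \<cdot> \<delta> X J Y U"
    using delta_nat[of X J "Inv (l\<^sub>o Y)" U] by simp
  finally have d: "\<delta> X J (I \<odot> Y) U \<cdot> (X \<bullet> (J \<odot> (\<phi>\<^sub>o Y I \<bullet> U))) \<cdot> ?k
    = (((X \<odot> Inv (l\<^sub>o Y)) \<bullet> J) \<odot> U) \<cdot> \<delta> X J Y U" .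
  \<comment> \<open>\<open>?q\<close> is chosen so that \<open>zeta_runit_b\<close> cancels the
    \<zeta> that R9 leaves in front.\<close>
  have q: "?q \<cdot> \<zeta> X J I J \<cdot> (Inv (r\<^sub>b X) \<odot> Inv (r\<^sub>b I)) \<cdot> Inv (r\<^sub>o X) = X"
    using red[OF zeta_runit_b[of X I], of "(Inv (r\<^sub>b X) \<odot> Inv (r\<^sub>b I)) \<cdot> Inv (r\<^sub>o X)"]
    by (simp add: circ.tensor_comp_reduce)
  have "(?q \<odot> (Y \<odot> U)) \<cdot> ?A \<cdot> ?k = (?q \<odot> (Y \<odot> U)) \<cdot> (\<zeta> X J I J \<odot> (Y \<odot> U)) \<cdot> ((Inv (r\<^sub>b X) \<odot> Inv (r\<^sub>b I)) \<odot> (Y \<odot> U))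
    \<cdot> a\<^sub>o (X \<odot> I) Y U \<cdot> (Inv (a\<^sub>o X I Y) \<odot> U) \<cdot> (r\<^sub>b (X \<odot> (I \<odot> Y)) \<odot> U) \<cdot> (((X \<odot> Inv (l\<^sub>o Y)) \<bullet> J) \<odot> U) \<cdot> \<delta> X J Y U"
    unfolding AB using d by simp
  also have "\<dots> = ((?q \<cdot> \<zeta> X J I J \<cdot> (Inv (r\<^sub>b X) \<odot> Inv (r\<^sub>b I))) \<odot> (Y \<odot> U))
    \<cdot> a\<^sub>o (X \<odot> I) Y U \<cdot> ((Inv (a\<^sub>o X I Y) \<cdot> r\<^sub>b (X \<odot> (I \<odot> Y)) \<cdot> ((X \<odot> Inv (l\<^sub>o Y)) \<bullet> J)) \<odot> U) \<cdot> \<delta> X J Y U"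
    by (simp add: circ.tensor_comp_reduce)
  also have "Inv (a\<^sub>o X I Y) \<cdot> r\<^sub>b (X \<odot> (I \<odot> Y)) \<cdot> ((X \<odot> Inv (l\<^sub>o Y)) \<bullet> J) = (Inv (r\<^sub>o X) \<odot> Y) \<cdot> r\<^sub>b (X \<odot> Y)"
    using bull.runit_nat[of "X \<odot> Inv (l\<^sub>o Y)"] red[OF circ.triangle_inv'[of X Y]] by simp
  also have "a\<^sub>o (X \<odot> I) Y U \<cdot> (((Inv (r\<^sub>o X) \<odot> Y) \<cdot> r\<^sub>b (X \<odot> Y)) \<odot> U) \<cdot> \<delta> X J Y U
    = (Inv (r\<^sub>o X) \<odot> (Y \<odot> U)) \<cdot> a\<^sub>o X Y U \<cdot> (r\<^sub>b (X \<odot> Y) \<odot> U) \<cdot> \<delta> X J Y U"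
    using red[OF circ.assoc_nat[of "Inv (r\<^sub>o X)" Y U]] by (simp add: circ.whisker_right)
  also have "((?q \<cdot> \<zeta> X J I J \<cdot> (Inv (r\<^sub>b X) \<odot> Inv (r\<^sub>b I))) \<odot> (Y \<odot> U)) \<cdot> \<dots>
    = a\<^sub>o X Y U \<cdot> (r\<^sub>b (X \<odot> Y) \<odot> U) \<cdot> \<delta> X J Y U"
    using q by (simp add: circ.tensor_comp_reduce)
  finally have main: "a\<^sub>o X Y U \<cdot> (r\<^sub>b (X \<odot> Y) \<odot> U) \<cdot> \<delta> X J Y U = (?q \<odot> (Y \<odot> U)) \<cdot> ?A \<cdot> ?k"
    by simp
  have "\<gamma> J Y (I\<^sup>-) U \<cdot> ((Inv (l\<^sub>b (Y\<^sup>-)) \<odot> I\<^sup>-) \<bullet> U) \<cdot> (((Y\<^sup>- \<odot> \<phi>\<^sub>o\<^sub>0) \<cdot> Inv (r\<^sub>o (Y\<^sup>-))) \<bullet> U)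
    = \<gamma> J Y (I\<^sup>-) U \<cdot> (((J \<bullet> Y\<^sup>-) \<odot> \<phi>\<^sub>o\<^sub>0) \<bullet> U) \<cdot> ((Inv (l\<^sub>b (Y\<^sup>-)) \<odot> I) \<bullet> U) \<cdot> (Inv (r\<^sub>o (Y\<^sup>-)) \<bullet> U)"
    by (simp add: merge)
  also have "\<dots> = (J \<odot> (\<phi>\<^sub>o\<^sub>0 \<bullet> (Y \<odot> U))) \<cdot> psi Y U"
    using red[OF gamma_nat[of J Y "\<phi>\<^sub>o\<^sub>0" U]] by (simp add: psi_def)
  finally have g: "\<gamma> J Y (I\<^sup>-) U \<cdot> ((Inv (l\<^sub>b (Y\<^sup>-)) \<odot> I\<^sup>-) \<bullet> U) \<cdot> (((Y\<^sup>- \<odot> \<phi>\<^sub>o\<^sub>0) \<cdot> Inv (r\<^sub>o (Y\<^sup>-))) \<bullet> U)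
    = (J \<odot> (\<phi>\<^sub>o\<^sub>0 \<bullet> (Y \<odot> U))) \<cdot> psi Y U" .
  show ?thesis
    unfolding main g[symmetric] by (simp add: bull.whisker_left circ.whisker_left)
qed

text \<open>R5, taken at \<open>\<delta> X (I \<bullet> I\<^sup>-) Y J\<close>. The arrow
  \<open>w\<close> creates the \<open>I\<^sup>-\<close> that R5 demands, and
  \<open>gamma_unit\<close> evaluates the \<gamma> on its other side. The result exposes
  \<open>phi\<close>, about which the right antipode axiom speaks.\<close>

lemma delta_phi:
  assumes [simp]: "ob X" "ob Y" "ob V"
  shows "\<delta> X I Y V \<cdot> (X \<bullet> Inv (l\<^sub>o (Y\<^sup>- \<bullet> V))) \<cdot> a\<^sub>b X (Y\<^sup>-) V
    = (((X \<odot> Y) \<bullet> I) \<odot> (l\<^sub>b V \<cdot> (J \<bullet> l\<^sub>o V))) \<cdot> \<gamma> ((X \<odot> Y) \<bullet> I) I J V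
      \<cdot> (((Inv (a\<^sub>b (X \<odot> Y) I (I\<^sup>-)) \<cdot> ((X \<odot> Y) \<bullet> ((I \<bullet> \<phi>\<^sub>o\<^sub>0) \<cdot> \<Delta>\<^sub>I))) \<odot> J) \<bullet> V) \<cdot> (phi X Y \<bullet> V)"
proof -
  define w where "w = (I \<bullet> \<phi>\<^sub>o\<^sub>0) \<cdot> \<Delta>\<^sub>I"
  have w [simp]: "Ar w" "dom w = I" "cod w = I \<bullet> I\<^sup>-"
    by (simp_all add: w_def)
  let ?p = "(I \<odot> Inv (r\<^sub>b (Y\<^sup>-))) \<cdot> Inv (l\<^sub>o (Y\<^sup>-))"
  let ?k = "(w \<odot> (Y\<^sup>- \<bullet> J)) \<cdot> ?p"
  let ?n = "((X \<odot> Y) \<bullet> I) \<odot> (l\<^sub>b V \<cdot> (J \<bullet> l\<^sub>o V))"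
  have "\<gamma> ((X \<odot> Y) \<bullet> I) I J V \<cdot> (((Inv (a\<^sub>b (X \<odot> Y) I (I\<^sup>-)) \<cdot> ((X \<odot> Y) \<bullet> w)) \<odot> J) \<bullet> V) \<cdot> (phi X Y \<bullet> V)
    = \<gamma> ((X \<odot> Y) \<bullet> I) I J V \<cdot> ((Inv (a\<^sub>b (X \<odot> Y) I (I\<^sup>-)) \<odot> J) \<bullet> V)
      \<cdot> (((((X \<odot> Y) \<bullet> w) \<odot> J) \<cdot> \<delta> X I Y J \<cdot> (X \<bullet> ?p)) \<bullet> V)"
    by (simp add: phi_def circ.whisker_right bull.whisker_right bull.whisker_left)
  also have "(((X \<odot> Y) \<bullet> w) \<odot> J) \<cdot> \<delta> X I Y J \<cdot> (X \<bullet> ?p) = \<delta> X (I \<bullet> I\<^sup>-) Y J \<cdot> (X \<bullet> ?k)"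
    using red[OF delta_nat[of X w Y J, symmetric]] by (simp add: bull.whisker_left)
  also have "\<gamma> ((X \<odot> Y) \<bullet> I) I J V \<cdot> ((Inv (a\<^sub>b (X \<odot> Y) I (I\<^sup>-)) \<odot> J) \<bullet> V) \<cdot> ((\<delta> X (I \<bullet> I\<^sup>-) Y J \<cdot> (X \<bullet> ?k)) \<bullet> V)
    = (\<gamma> ((X \<odot> Y) \<bullet> I) I J V \<cdot> ((Inv (a\<^sub>b (X \<odot> Y) I (I\<^sup>-)) \<odot> J) \<bullet> V) \<cdot> (\<delta> X (I \<bullet> I\<^sup>-) Y J \<bullet> V)) \<cdot> ((X \<bullet> ?k) \<bullet> V)"
    by (simp add: bull.whisker_right)
  also have "\<dots> = \<delta> X I Y (J \<bullet> (I \<odot> V)) \<cdot> (X \<bullet> (I \<odot> a\<^sub>b (Y\<^sup>-) J (I \<odot> V)))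
      \<cdot> (X \<bullet> \<gamma> I I (Y\<^sup>- \<bullet> J) V) \<cdot> a\<^sub>b X ((I \<bullet> I\<^sup>-) \<odot> (Y\<^sup>- \<bullet> J)) V \<cdot> ((X \<bullet> ?k) \<bullet> V)"
    by (subst R5[symmetric]) simp_all
  also have "\<dots> = \<delta> X I Y (J \<bullet> (I \<odot> V)) \<cdot> (X \<bullet> (I \<odot> a\<^sub>b (Y\<^sup>-) J (I \<odot> V)))
      \<cdot> (X \<bullet> (\<gamma> I I (Y\<^sup>- \<bullet> J) V \<cdot> (?k \<bullet> V))) \<cdot> a\<^sub>b X (Y\<^sup>-) V"
    using red[OF bull.assoc_nat[of X ?k V]] bull.assoc_nat[of X ?k V] by (simp add: bull.whisker_left)
  also have "\<gamma> I I (Y\<^sup>- \<bullet> J) V \<cdot> (?k \<bullet> V) = (\<gamma> I I (Y\<^sup>- \<bullet> J) V \<cdot> ((w \<odot> (Y\<^sup>- \<bullet> J)) \<bullet> V)) \<cdot> (?p \<bullet> V)"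
    by (simp add: bull.tensor_comp)
  also have "\<dots> = (I \<odot> ((Y\<^sup>- \<bullet> J) \<bullet> Inv (l\<^sub>o V))) \<cdot> Inv (l\<^sub>o ((Y\<^sup>- \<bullet> J) \<bullet> V)) \<cdot> ((l\<^sub>o (Y\<^sup>- \<bullet> J) \<cdot> ?p) \<bullet> V)"
    unfolding w_def by (subst gamma_unit) (simp_all add: bull.tensor_comp)
  also have "l\<^sub>o (Y\<^sup>- \<bullet> J) \<cdot> ?p = Inv (r\<^sub>b (Y\<^sup>-))"
    using red[OF circ.lunit_nat[of "Inv (r\<^sub>b (Y\<^sup>-))"]] by simp
  also have "Inv (l\<^sub>o ((Y\<^sup>- \<bullet> J) \<bullet> V)) \<cdot> (Inv (r\<^sub>b (Y\<^sup>-)) \<bullet> V) = (I \<odot> (Inv (r\<^sub>b (Y\<^sup>-)) \<bullet> V)) \<cdot> Inv (l\<^sub>o (Y\<^sup>- \<bullet> V))"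
    using circ.lunit_inv_nat[of "Inv (r\<^sub>b (Y\<^sup>-)) \<bullet> V"] by simp
  finally have "?n \<cdot> \<gamma> ((X \<odot> Y) \<bullet> I) I J V \<cdot> (((Inv (a\<^sub>b (X \<odot> Y) I (I\<^sup>-)) \<cdot> ((X \<odot> Y) \<bullet> w)) \<odot> J) \<bullet> V) \<cdot> (phi X Y \<bullet> V)
    = ?n \<cdot> \<delta> X I Y (J \<bullet> (I \<odot> V)) \<cdot> (X \<bullet> (I \<odot> a\<^sub>b (Y\<^sup>-) J (I \<odot> V)))
      \<cdot> (X \<bullet> ((I \<odot> ((Y\<^sup>- \<bullet> J) \<bullet> Inv (l\<^sub>o V))) \<cdot> (I \<odot> (Inv (r\<^sub>b (Y\<^sup>-)) \<bullet> V)) \<cdot> Inv (l\<^sub>o (Y\<^sup>- \<bullet> V)))) \<cdot> a\<^sub>b X (Y\<^sup>-) V"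
    by simp
  also have "\<dots> = \<delta> X I Y V \<cdot> (X \<bullet> (I \<odot> (Y\<^sup>- \<bullet> (l\<^sub>b V \<cdot> (J \<bullet> l\<^sub>o V))))) \<cdot> (X \<bullet> (I \<odot> a\<^sub>b (Y\<^sup>-) J (I \<odot> V)))
      \<cdot> (X \<bullet> ((I \<odot> ((Y\<^sup>- \<bullet> J) \<bullet> Inv (l\<^sub>o V))) \<cdot> (I \<odot> (Inv (r\<^sub>b (Y\<^sup>-)) \<bullet> V)) \<cdot> Inv (l\<^sub>o (Y\<^sup>- \<bullet> V)))) \<cdot> a\<^sub>b X (Y\<^sup>-) V"
    using red[OF delta_nat[of X I Y "l\<^sub>b V \<cdot> (J \<bullet> l\<^sub>o V)", symmetric]] by simp
  also have "\<dots> = \<delta> X I Y V \<cdot> (X \<bullet> ((I \<odot> ((Y\<^sup>- \<bullet> l\<^sub>b V) \<cdot> (Y\<^sup>- \<bullet> (J \<bullet> l\<^sub>o V)) \<cdot> a\<^sub>b (Y\<^sup>-) J (I \<odot> V)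
      \<cdot> ((Y\<^sup>- \<bullet> J) \<bullet> Inv (l\<^sub>o V)) \<cdot> (Inv (r\<^sub>b (Y\<^sup>-)) \<bullet> V))) \<cdot> Inv (l\<^sub>o (Y\<^sup>- \<bullet> V)))) \<cdot> a\<^sub>b X (Y\<^sup>-) V"
    by (simp add: bull.whisker_left circ.whisker_left)
  also have "(Y\<^sup>- \<bullet> l\<^sub>b V) \<cdot> (Y\<^sup>- \<bullet> (J \<bullet> l\<^sub>o V)) \<cdot> a\<^sub>b (Y\<^sup>-) J (I \<odot> V)
      \<cdot> ((Y\<^sup>- \<bullet> J) \<bullet> Inv (l\<^sub>o V)) \<cdot> (Inv (r\<^sub>b (Y\<^sup>-)) \<bullet> V)
    = (Y\<^sup>- \<bullet> l\<^sub>b V) \<cdot> a\<^sub>b (Y\<^sup>-) J V \<cdot> (Inv (r\<^sub>b (Y\<^sup>-)) \<bullet> V)"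
    using red[OF bull.assoc_nat[of "Y\<^sup>-" J "l\<^sub>o V", symmetric]] by (simp add: merge)
  also have "\<dots> = Y\<^sup>- \<bullet> V"
    using red[OF bull.triangle[of "Y\<^sup>-" V]] by (simp add: merge)
  finally show ?thesis
    by (simp add: w_def)
qed

context
  fixes H :: "'m bimon" and \<Sigma> :: 'm
  assumes bimonoid_H [simp]: "bimonoid D H"
    and antipode_H: "antipode D R H \<Sigma>"
begin

lemma antipode_arr [simp]: "Ar \<Sigma>" "dom \<Sigma> = (obj H)" "cod \<Sigma> = (obj H)\<^sup>-"
  using antipode.antipode_in_hom[OF antipode_H] by (auto dest: homD)

text \<open>The law \<open>\<Sigma>(h_1) h_2 = \<epsilon>(h)\<close> with spectators:
  \<open>delta_psi\<close> exposes \<open>psi\<close>, naturality of \<delta> moves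
  \<open>mult H\<close> next to it, the antipode axiom puts unit after counit, and
  \<open>delta_unit\<close> evaluates the \<delta> that remains.\<close>

lemma antipode_delta_left:
  assumes [simp]: "ob X"
  shows "(X \<odot> mult H) \<cdot> a\<^sub>o X (obj H) (obj H) \<cdot> (r\<^sub>b (X \<odot> (obj H)) \<odot> (obj H)) \<cdot> \<delta> X J (obj H) (obj H) \<cdot> (X \<bullet> (J \<odot> ((\<Sigma> \<bullet> (obj H)) \<cdot> comult H)))
    = (X \<odot> unt H) \<cdot> Inv (r\<^sub>o X) \<cdot> r\<^sub>b X \<cdot> (X \<bullet> (m\<^sub>J \<cdot> (J \<odot> counit H)))"
proof -
  let ?q = "r\<^sub>o X \<cdot> r\<^sub>b (X \<odot> I) \<cdot> ((X \<odot> I) \<bullet> m\<^sub>J)"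
  let ?S = "(\<Sigma> \<bullet> (obj H)) \<cdot> comult H"
  let ?w = "(\<phi>\<^sub>o\<^sub>0 \<bullet> I) \<cdot> \<Delta>\<^sub>I"
  let ?ia = "\<lambda>Z. Inv (a\<^sub>o J J (I\<^sup>- \<bullet> Z))"
  let ?k = "J \<odot> ((J \<odot> (\<phi>\<^sub>o\<^sub>0 \<bullet> ((obj H) \<odot> (obj H)))) \<cdot> psi (obj H) (obj H) \<cdot> ?S)"
  have "(X \<odot> mult H) \<cdot> a\<^sub>o X (obj H) (obj H) \<cdot> (r\<^sub>b (X \<odot> (obj H)) \<odot> (obj H)) \<cdot> \<delta> X J (obj H) (obj H) \<cdot> (X \<bullet> (J \<odot> ?S))
    = (X \<odot> mult H) \<cdot> (a\<^sub>o X (obj H) (obj H) \<cdot> (r\<^sub>b (X \<odot> (obj H)) \<odot> (obj H)) \<cdot> \<delta> X J (obj H) (obj H)) \<cdot> (X \<bullet> (J \<odot> ?S))"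
    by simp
  also have "\<dots> = (X \<odot> mult H) \<cdot> (?q \<odot> ((obj H) \<odot> (obj H))) \<cdot> \<delta> X (J \<odot> J) I ((obj H) \<odot> (obj H)) \<cdot> (X \<bullet> (?ia ((obj H) \<odot> (obj H)) \<cdot> ?k))"
    by (subst delta_psi) (simp_all add: merge)
  also have "\<dots> = (?q \<odot> (obj H)) \<cdot> ((((X \<odot> I) \<bullet> (J \<odot> J)) \<odot> mult H) \<cdot> \<delta> X (J \<odot> J) I ((obj H) \<odot> (obj H))) \<cdot> (X \<bullet> (?ia ((obj H) \<odot> (obj H)) \<cdot> ?k))"
    by (simp add: circ.tensor_comp_reduce)
  also have "((X \<odot> I) \<bullet> (J \<odot> J)) \<odot> mult H \<cdot> \<delta> X (J \<odot> J) I ((obj H) \<odot> (obj H))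
    = \<delta> X (J \<odot> J) I (obj H) \<cdot> (X \<bullet> ((J \<odot> J) \<odot> (I\<^sup>- \<bullet> mult H)))"
    using delta_nat[of X "J \<odot> J" I "mult H"] by simp
  also have "(?q \<odot> (obj H)) \<cdot> \<dots> \<cdot> (X \<bullet> (?ia ((obj H) \<odot> (obj H)) \<cdot> ?k))
    = (?q \<odot> (obj H)) \<cdot> \<delta> X (J \<odot> J) I (obj H) \<cdot> (X \<bullet> (((J \<odot> J) \<odot> (I\<^sup>- \<bullet> mult H)) \<cdot> ?ia ((obj H) \<odot> (obj H)) \<cdot> ?k))"
    by (simp add: bull.tensor_comp)
  also have "((J \<odot> J) \<odot> (I\<^sup>- \<bullet> mult H)) \<cdot> ?ia ((obj H) \<odot> (obj H)) \<cdot> ?k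
    = ?ia (obj H) \<cdot> (J \<odot> ((J \<odot> (\<phi>\<^sub>o\<^sub>0 \<bullet> (obj H))) \<cdot> ((J \<odot> (I \<bullet> mult H)) \<cdot> psi (obj H) (obj H) \<cdot> (\<Sigma> \<bullet> (obj H)) \<cdot> comult H)))"
    using red[OF circ.assoc_inv_nat[of J J "I\<^sup>- \<bullet> mult H", symmetric]] by (simp add: merge)
  also have "\<dots> = ?ia (obj H) \<cdot> (J \<odot> (J \<odot> ((I\<^sup>- \<bullet> unt H) \<cdot> ?w))) \<cdot> (J \<odot> Inv (r\<^sub>o J)) \<cdot> (J \<odot> counit H)"
    unfolding antipode.antipode_left[OF antipode_H] by (simp add: merge)
  also have "\<dots> = ((J \<odot> J) \<odot> (I\<^sup>- \<bullet> unt H)) \<cdot> ((J \<odot> J) \<odot> ?w) \<cdot> Inv (r\<^sub>o (J \<odot> J)) \<cdot> (J \<odot> counit H)"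
    using red[OF circ.assoc_inv_nat[of J J "(I\<^sup>- \<bullet> unt H) \<cdot> ?w"]] red[OF circ.runit_inv_tensor[of J J]]
    by (simp add: circ.whisker_left)
  also have "(?q \<odot> (obj H)) \<cdot> \<delta> X (J \<odot> J) I (obj H) \<cdot> (X \<bullet> \<dots>)
    = (?q \<odot> (obj H)) \<cdot> \<delta> X (J \<odot> J) I (obj H) \<cdot> (X \<bullet> ((J \<odot> J) \<odot> (I\<^sup>- \<bullet> unt H)))
      \<cdot> (X \<bullet> (((J \<odot> J) \<odot> ?w) \<cdot> Inv (r\<^sub>o (J \<odot> J)))) \<cdot> (X \<bullet> (J \<odot> counit H))"
    by (simp add: bull.tensor_comp)
  also have "\<dots> = (?q \<odot> unt H) \<cdot> (\<delta> X (J \<odot> J) I I \<cdot> (X \<bullet> (((J \<odot> J) \<odot> ?w) \<cdot> Inv (r\<^sub>o (J \<odot> J))))) \<cdot> (X \<bullet> (J \<odot> counit H))"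
    using red[OF delta_nat[of X "J \<odot> J" I "unt H"]] by (simp add: circ.tensor_comp_reduce)
  also have "\<dots> = ((?q \<cdot> (Inv (r\<^sub>o X) \<bullet> (J \<odot> J))) \<odot> unt H) \<cdot> Inv (r\<^sub>o (X \<bullet> (J \<odot> J))) \<cdot> (X \<bullet> (J \<odot> counit H))"
    by (subst delta_unit) (simp_all add: circ.tensor_comp_reduce)
  also have "?q \<cdot> (Inv (r\<^sub>o X) \<bullet> (J \<odot> J)) = r\<^sub>b X \<cdot> (X \<bullet> m\<^sub>J)"
    using red[OF bull.runit_nat[of "Inv (r\<^sub>o X)"], of "X \<bullet> m\<^sub>J"] by (simp add: bull.tensor_comp)
  also have "((r\<^sub>b X \<cdot> (X \<bullet> m\<^sub>J)) \<odot> unt H) \<cdot> Inv (r\<^sub>o (X \<bullet> (J \<odot> J))) \<cdot> (X \<bullet> (J \<odot> counit H))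
    = (X \<odot> unt H) \<cdot> ((r\<^sub>b X \<cdot> (X \<bullet> m\<^sub>J)) \<odot> I) \<cdot> Inv (r\<^sub>o (X \<bullet> (J \<odot> J))) \<cdot> (X \<bullet> (J \<odot> counit H))"
    by (simp add: circ.tensor_comp_reduce)
  also have "\<dots> = (X \<odot> unt H) \<cdot> Inv (r\<^sub>o X) \<cdot> r\<^sub>b X \<cdot> (X \<bullet> (m\<^sub>J \<cdot> (J \<odot> counit H)))"
    using red[OF circ.runit_inv_nat[of "r\<^sub>b X \<cdot> (X \<bullet> m\<^sub>J)", symmetric], of "X \<bullet> (J \<odot> counit H)"] by (simp add: bull.whisker_left)
  finally show ?thesis .
qed

text \<open>The law \<open>h_1 \<Sigma>(h_2) = \<epsilon>(h)\<close> with a spectator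
  \<open>T\<close>: \<open>delta_phi\<close> exposes \<open>phi\<close>, naturality of \<gamma>
  moves \<open>mult H\<close> next to it, and after the antipode axiom \<open>gamma_unit\<close>
  evaluates the remaining \<gamma>.\<close>

lemma antipode_delta_right:
  assumes [simp]: "ob T"
  shows "((mult H \<bullet> I) \<odot> T) \<cdot> \<delta> (obj H) I (obj H) T \<cdot> ((obj H) \<bullet> (Inv (l\<^sub>o ((obj H)\<^sup>- \<bullet> T)) \<cdot> (\<Sigma> \<bullet> T))) \<cdot> a\<^sub>b (obj H) (obj H) T \<cdot> (comult H \<bullet> T)
    = (((unt H \<bullet> I) \<cdot> \<Delta>\<^sub>I) \<odot> T) \<cdot> Inv (l\<^sub>o T) \<cdot> l\<^sub>b T \<cdot> (counit H \<bullet> T)"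
proof -
  define w where "w = (I \<bullet> \<phi>\<^sub>o\<^sub>0) \<cdot> \<Delta>\<^sub>I"
  have w [simp]: "Ar w" "dom w = I" "cod w = I \<bullet> I\<^sup>-"
    by (simp_all add: w_def)
  let ?K = "l\<^sub>b T \<cdot> (J \<bullet> l\<^sub>o T)"
  let ?S = "((obj H) \<bullet> \<Sigma>) \<cdot> comult H"
  let ?d = "(unt H \<bullet> I) \<cdot> \<Delta>\<^sub>I"
  \<comment> \<open>Coassociativity of \<open>\<Delta>\<^sub>I\<close>: the unit of \<open>H\<close>
    and \<open>\<phi>\<^sub>o\<^sub>0\<close> act on different legs of \<open>I\<close>.\<close>
  have d: "Inv (a\<^sub>b (obj H) I (I\<^sup>-)) \<cdot> ((obj H) \<bullet> w) \<cdot> ?d = (?d \<bullet> I\<^sup>-) \<cdot> w"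
  proof -
    have "Inv (a\<^sub>b (obj H) I (I\<^sup>-)) \<cdot> ((obj H) \<bullet> w) \<cdot> ?d = Inv (a\<^sub>b (obj H) I (I\<^sup>-)) \<cdot> (unt H \<bullet> (I \<bullet> \<phi>\<^sub>o\<^sub>0)) \<cdot> (I \<bullet> \<Delta>\<^sub>I) \<cdot> \<Delta>\<^sub>I"
      by (simp add: w_def merge)
    also have "\<dots> = Inv (a\<^sub>b (obj H) I (I\<^sup>-)) \<cdot> (unt H \<bullet> (I \<bullet> \<phi>\<^sub>o\<^sub>0)) \<cdot> a\<^sub>b I I I \<cdot> (\<Delta>\<^sub>I \<bullet> I) \<cdot> \<Delta>\<^sub>I"
      by (simp add: DelI_assoc)
    also have "\<dots> = ((unt H \<bullet> I) \<bullet> \<phi>\<^sub>o\<^sub>0) \<cdot> (\<Delta>\<^sub>I \<bullet> I) \<cdot> \<Delta>\<^sub>I"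
      using red[OF bull.assoc_inv_nat[of "unt H" I "\<phi>\<^sub>o\<^sub>0"]] by simp
    also have "\<dots> = (?d \<bullet> I\<^sup>-) \<cdot> w"
      by (simp add: w_def merge)
    finally show ?thesis .
  qed
  have "((mult H \<bullet> I) \<odot> T) \<cdot> \<delta> (obj H) I (obj H) T \<cdot> ((obj H) \<bullet> (Inv (l\<^sub>o ((obj H)\<^sup>- \<bullet> T)) \<cdot> (\<Sigma> \<bullet> T))) \<cdot> a\<^sub>b (obj H) (obj H) T \<cdot> (comult H \<bullet> T)
    = ((mult H \<bullet> I) \<odot> T) \<cdot> (\<delta> (obj H) I (obj H) T \<cdot> ((obj H) \<bullet> Inv (l\<^sub>o ((obj H)\<^sup>- \<bullet> T))) \<cdot> a\<^sub>b (obj H) ((obj H)\<^sup>-) T) \<cdot> (?S \<bullet> T)"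
    using red[OF bull.assoc_nat[of "obj H" \<Sigma> T]] by (simp add: bull.whisker_right bull.whisker_left)
  also have "\<dots> = ((mult H \<bullet> I) \<odot> ?K) \<cdot> \<gamma> (((obj H) \<odot> (obj H)) \<bullet> I) I J T
      \<cdot> (((Inv (a\<^sub>b ((obj H) \<odot> (obj H)) I (I\<^sup>-)) \<cdot> (((obj H) \<odot> (obj H)) \<bullet> w)) \<odot> J) \<bullet> T) \<cdot> ((phi (obj H) (obj H) \<cdot> ?S) \<bullet> T)"
    unfolding w_def by (subst delta_phi) (simp_all add: circ.tensor_comp_reduce bull.tensor_comp)
  also have "\<dots> = (((obj H) \<bullet> I) \<odot> ?K) \<cdot> (((mult H \<bullet> I) \<odot> (J \<bullet> (I \<odot> T))) \<cdot> \<gamma> (((obj H) \<odot> (obj H)) \<bullet> I) I J T)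
      \<cdot> (((Inv (a\<^sub>b ((obj H) \<odot> (obj H)) I (I\<^sup>-)) \<cdot> (((obj H) \<odot> (obj H)) \<bullet> w)) \<odot> J) \<bullet> T) \<cdot> ((phi (obj H) (obj H) \<cdot> ?S) \<bullet> T)"
    by (simp add: circ.tensor_comp_reduce)
  also have "((mult H \<bullet> I) \<odot> (J \<bullet> (I \<odot> T))) \<cdot> \<gamma> (((obj H) \<odot> (obj H)) \<bullet> I) I J T
    = \<gamma> ((obj H) \<bullet> I) I J T \<cdot> ((((mult H \<bullet> I) \<bullet> I\<^sup>-) \<odot> J) \<bullet> T)"
    using gamma_nat[of "mult H \<bullet> I" I J T] by simp
  also have "(((obj H) \<bullet> I) \<odot> ?K) \<cdot> \<dots> \<cdot> (((Inv (a\<^sub>b ((obj H) \<odot> (obj H)) I (I\<^sup>-)) \<cdot> (((obj H) \<odot> (obj H)) \<bullet> w)) \<odot> J) \<bullet> T) \<cdot> ((phi (obj H) (obj H) \<cdot> ?S) \<bullet> T)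
    = (((obj H) \<bullet> I) \<odot> ?K) \<cdot> \<gamma> ((obj H) \<bullet> I) I J T
      \<cdot> (((((mult H \<bullet> I) \<bullet> I\<^sup>-) \<cdot> Inv (a\<^sub>b ((obj H) \<odot> (obj H)) I (I\<^sup>-)) \<cdot> (((obj H) \<odot> (obj H)) \<bullet> w)) \<odot> J) \<bullet> T) \<cdot> ((phi (obj H) (obj H) \<cdot> ?S) \<bullet> T)"
    by (simp add: merge)
  also have "((mult H \<bullet> I) \<bullet> I\<^sup>-) \<cdot> Inv (a\<^sub>b ((obj H) \<odot> (obj H)) I (I\<^sup>-)) \<cdot> (((obj H) \<odot> (obj H)) \<bullet> w)
    = Inv (a\<^sub>b (obj H) I (I\<^sup>-)) \<cdot> ((obj H) \<bullet> w) \<cdot> (mult H \<bullet> I)"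
    using red[OF bull.assoc_inv_nat[of "mult H" I "I\<^sup>-", symmetric]] by (simp add: merge)
  also have "\<gamma> ((obj H) \<bullet> I) I J T \<cdot> (((Inv (a\<^sub>b (obj H) I (I\<^sup>-)) \<cdot> ((obj H) \<bullet> w) \<cdot> (mult H \<bullet> I)) \<odot> J) \<bullet> T) \<cdot> ((phi (obj H) (obj H) \<cdot> ?S) \<bullet> T)
    = \<gamma> ((obj H) \<bullet> I) I J T \<cdot> (((Inv (a\<^sub>b (obj H) I (I\<^sup>-)) \<cdot> ((obj H) \<bullet> w)) \<odot> J) \<bullet> T)
      \<cdot> ((((mult H \<bullet> I) \<odot> J) \<cdot> phi (obj H) (obj H) \<cdot> ((obj H) \<bullet> \<Sigma>) \<cdot> comult H) \<bullet> T)"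
    by (simp add: merge)
  also have "\<dots> = \<gamma> ((obj H) \<bullet> I) I J T \<cdot> (((Inv (a\<^sub>b (obj H) I (I\<^sup>-)) \<cdot> ((obj H) \<bullet> w) \<cdot> ?d) \<odot> J) \<bullet> T) \<cdot> ((Inv (l\<^sub>o J) \<cdot> counit H) \<bullet> T)"
    unfolding antipode.antipode_right[OF antipode_H] by (simp add: merge)
  also have "\<dots> = \<gamma> ((obj H) \<bullet> I) I J T \<cdot> (((?d \<bullet> I\<^sup>-) \<odot> J) \<bullet> T) \<cdot> ((w \<odot> J) \<bullet> T) \<cdot> ((Inv (l\<^sub>o J) \<cdot> counit H) \<bullet> T)"
    unfolding d by (simp add: circ.whisker_right bull.whisker_right)
  also have "\<dots> = (?d \<odot> (J \<bullet> (I \<odot> T))) \<cdot> (\<gamma> I I J T \<cdot> ((w \<odot> J) \<bullet> T)) \<cdot> ((Inv (l\<^sub>o J) \<cdot> counit H) \<bullet> T)"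
    using red[OF gamma_nat[of ?d I J T]] by simp
  also have "\<dots> = (?d \<odot> (J \<bullet> (I \<odot> T))) \<cdot> (I \<odot> (J \<bullet> Inv (l\<^sub>o T))) \<cdot> Inv (l\<^sub>o (J \<bullet> T)) \<cdot> (counit H \<bullet> T)"
    unfolding w_def by (subst gamma_unit) (simp_all add: bull.tensor_comp)
  also have "(((obj H) \<bullet> I) \<odot> ?K) \<cdot> \<dots> = (?d \<odot> T) \<cdot> (I \<odot> l\<^sub>b T) \<cdot> Inv (l\<^sub>o (J \<bullet> T)) \<cdot> (counit H \<bullet> T)"
    by (simp add: merge)
  also have "\<dots> = (?d \<odot> T) \<cdot> Inv (l\<^sub>o T) \<cdot> l\<^sub>b T \<cdot> (counit H \<bullet> T)"
    using red[OF circ.lunit_inv_nat[of "l\<^sub>b T", symmetric], of "counit H \<bullet> T"] by simp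
  finally show ?thesis .
qed

end

end

section \<open>Modules, comodules and the canonical map between them\<close>

context duoidal_category
begin

definition rmodule :: "'m bimon \<Rightarrow> 'm \<Rightarrow> 'm \<Rightarrow> bool" where
  "rmodule H V \<mu> \<longleftrightarrow> ob V \<and> \<guillemotleft>\<mu> : V \<odot> obj H \<rightarrow> V\<guillemotright> \<and> \<mu> \<cdot> (V \<odot> unt H) = r\<^sub>o V \<and>
    \<mu> \<cdot> (\<mu> \<odot> obj H) = \<mu> \<cdot> (V \<odot> mult H) \<cdot> a\<^sub>o V (obj H) (obj H)"

definition lcomodule :: "'m bimon \<Rightarrow> 'm \<Rightarrow> 'm \<Rightarrow> bool" where
  "lcomodule H T \<rho> \<longleftrightarrow> ob T \<and> \<guillemotleft>\<rho> : T \<rightarrow> obj H \<bullet> T\<guillemotright> \<and> l\<^sub>b T \<cdot> (counit H \<bullet> T) \<cdot> \<rho> = T \<and>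
    a\<^sub>b (obj H) (obj H) T \<cdot> (comult H \<bullet> T) \<cdot> \<rho> = (obj H \<bullet> \<rho>) \<cdot> \<rho>"

text \<open>If \<odot> and \<bullet> coincide, this is the Galois map
  \<open>v \<otimes> t \<mapsto> v t_(-1) \<otimes> t_(0)\<close>. The factor \<open>I\<close>
  occupies the slot of \<zeta> next to \<open>V\<close>, so that \<zeta> pairs \<open>V\<close> with
  the coaction leg \<open>H\<close> and \<open>I\<close> with \<open>T\<close>.\<close>

definition hopf_map :: "'m bimon \<Rightarrow> 'm \<Rightarrow> 'm \<Rightarrow> 'm \<Rightarrow> 'm \<Rightarrow> 'm" where
  "hopf_map H V \<mu> T \<rho> = (\<mu> \<bullet> l\<^sub>o T) \<cdot> \<zeta> V I (obj H) T \<cdot> ((V \<bullet> I) \<odot> \<rho>)"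

lemma rmodule_arr:
  assumes "rmodule H V \<mu>"
  shows "ob V" "Ar \<mu>" "dom \<mu> = V \<odot> obj H" "cod \<mu> = V"
  using assms unfolding rmodule_def by (auto dest: homD)

lemma lcomodule_arr:
  assumes "lcomodule H T \<rho>"
  shows "ob T" "Ar \<rho>" "dom \<rho> = T" "cod \<rho> = obj H \<bullet> T"
  using assms unfolding lcomodule_def by (auto dest: homD)

lemma rmodule_laws:
  assumes "rmodule H V \<mu>"
  shows "\<mu> \<cdot> (V \<odot> unt H) = r\<^sub>o V"
    "\<mu> \<cdot> (\<mu> \<odot> obj H) = \<mu> \<cdot> (V \<odot> mult H) \<cdot> a\<^sub>o V (obj H) (obj H)"
  using assms unfolding rmodule_def by auto

lemma lcomodule_laws:
  assumes "lcomodule H T \<rho>"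
  shows "l\<^sub>b T \<cdot> (counit H \<bullet> T) \<cdot> \<rho> = T"
    "a\<^sub>b (obj H) (obj H) T \<cdot> (comult H \<bullet> T) \<cdot> \<rho> = (obj H \<bullet> \<rho>) \<cdot> \<rho>"
  using assms unfolding lcomodule_def by auto

lemma hopf_map_arr:
  assumes "bimonoid D H" "rmodule H V \<mu>" "lcomodule H T \<rho>"
  shows "Ar (hopf_map H V \<mu> T \<rho>)" "dom (hopf_map H V \<mu> T \<rho>) = (V \<bullet> I) \<odot> T"
    "cod (hopf_map H V \<mu> T \<rho>) = V \<bullet> T"
  using assms by (simp_all add: hopf_map_def rmodule_arr lcomodule_arr)

end

context reversion
begin

text \<open>R4 at \<open>\<delta> V (J \<bullet> I) U (U \<bullet> T)\<close>, after replacing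
  \<open>I\<close> by \<open>J \<bullet> I\<close>. It separates \<open>T\<close> from the copies of
  \<open>U\<close>, so that \<open>antipode_delta_left\<close> can be applied to
  \<open>\<delta> V J U U\<close>.\<close>

lemma zeta_delta_b:
  assumes [simp]: "ob V" "ob U" "ob T"
  shows "\<zeta> (V \<odot> U) I U T \<cdot> \<delta> V I U (U \<bullet> T) \<cdot> (V \<bullet> (I \<odot> a\<^sub>b (U\<^sup>-) U T))
    = ((r\<^sub>b (V \<odot> U) \<odot> U) \<bullet> (I \<odot> T)) \<cdot> (\<delta> V J U U \<bullet> (I \<odot> T)) \<cdot> Inv (a\<^sub>b V (J \<odot> (U\<^sup>- \<bullet> U)) (I \<odot> T))
      \<cdot> (V \<bullet> \<zeta> J I (U\<^sup>- \<bullet> U) T) \<cdot> (V \<bullet> (Inv (l\<^sub>b I) \<odot> ((U\<^sup>- \<bullet> U) \<bullet> T)))"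
proof -
  have tri: "(V \<odot> U) \<bullet> l\<^sub>b I = (r\<^sub>b (V \<odot> U) \<bullet> I) \<cdot> Inv (a\<^sub>b (V \<odot> U) J I)"
    using bull.triangle[of "V \<odot> U" I, symmetric] by simp
  have "\<zeta> (V \<odot> U) I U T \<cdot> \<delta> V I U (U \<bullet> T) \<cdot> (V \<bullet> (I \<odot> a\<^sub>b (U\<^sup>-) U T))
    = \<zeta> (V \<odot> U) I U T \<cdot> (\<delta> V I U (U \<bullet> T) \<cdot> (V \<bullet> (l\<^sub>b I \<odot> (U\<^sup>- \<bullet> (U \<bullet> T))))) \<cdot> (V \<bullet> (Inv (l\<^sub>b I) \<odot> a\<^sub>b (U\<^sup>-) U T))"
    by (simp add: merge)
  also have "\<delta> V I U (U \<bullet> T) \<cdot> (V \<bullet> (l\<^sub>b I \<odot> (U\<^sup>- \<bullet> (U \<bullet> T)))) = (((V \<odot> U) \<bullet> l\<^sub>b I) \<odot> (U \<bullet> T)) \<cdot> \<delta> V (J \<bullet> I) U (U \<bullet> T)"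
    using delta_nat[of V "l\<^sub>b I" U "U \<bullet> T"] by simp
  also have "\<zeta> (V \<odot> U) I U T \<cdot> \<dots> \<cdot> (V \<bullet> (Inv (l\<^sub>b I) \<odot> a\<^sub>b (U\<^sup>-) U T))
    = \<zeta> (V \<odot> U) I U T \<cdot> ((r\<^sub>b (V \<odot> U) \<bullet> I) \<odot> (U \<bullet> T)) \<cdot> (Inv (a\<^sub>b (V \<odot> U) J I) \<odot> (U \<bullet> T))
      \<cdot> \<delta> V (J \<bullet> I) U (U \<bullet> T) \<cdot> (V \<bullet> (Inv (l\<^sub>b I) \<odot> a\<^sub>b (U\<^sup>-) U T))"
    unfolding tri by (simp add: circ.whisker_right)
  also have "\<dots> = ((r\<^sub>b (V \<odot> U) \<odot> U) \<bullet> (I \<odot> T)) \<cdot> (\<zeta> ((V \<odot> U) \<bullet> J) I U T \<cdot> (Inv (a\<^sub>b (V \<odot> U) J I) \<odot> (U \<bullet> T))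
      \<cdot> \<delta> V (J \<bullet> I) U (U \<bullet> T) \<cdot> (V \<bullet> ((J \<bullet> I) \<odot> a\<^sub>b (U\<^sup>-) U T))) \<cdot> (V \<bullet> (Inv (l\<^sub>b I) \<odot> ((U\<^sup>- \<bullet> U) \<bullet> T)))"
    using red[OF zeta_nat[of "r\<^sub>b (V \<odot> U)" I U T]]
    by (simp add: bull.tensor_comp bull.tensor_comp_reduce circ.tensor_comp)
  also have "\<dots> = ((r\<^sub>b (V \<odot> U) \<odot> U) \<bullet> (I \<odot> T)) \<cdot> (\<delta> V J U U \<bullet> (I \<odot> T)) \<cdot> Inv (a\<^sub>b V (J \<odot> (U\<^sup>- \<bullet> U)) (I \<odot> T))
      \<cdot> (V \<bullet> \<zeta> J I (U\<^sup>- \<bullet> U) T) \<cdot> (V \<bullet> (Inv (l\<^sub>b I) \<odot> ((U\<^sup>- \<bullet> U) \<bullet> T)))"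
    by (subst R4[symmetric]) simp_all
  finally show ?thesis .
qed

text \<open>R3 with \<open>I \<odot> I\<close> in place of \<open>I\<close>. It isolates
  \<open>\<delta> U I U T\<close> beside the spectator \<open>V \<bullet> I\<close>, so that
  \<open>antipode_delta_right\<close> can be applied.\<close>

lemma delta_zeta_o:
  assumes [simp]: "ob V" "ob U" "ob T"
  shows "\<delta> (V \<odot> U) I U T \<cdot> \<zeta> V I U (U\<^sup>- \<bullet> T)
    = ((Inv (a\<^sub>o V U U) \<bullet> l\<^sub>o I) \<odot> T) \<cdot> (\<zeta> V I (U \<odot> U) I \<odot> T) \<cdot> Inv (a\<^sub>o (V \<bullet> I) ((U \<odot> U) \<bullet> I) T)
      \<cdot> ((V \<bullet> I) \<odot> (\<delta> U I U T \<cdot> (U \<bullet> Inv (l\<^sub>o (U\<^sup>- \<bullet> T)))))"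
proof -
  let ?W = "U\<^sup>- \<bullet> T"
  have i: "(l\<^sub>o I \<odot> ?W) \<cdot> Inv (a\<^sub>o I I ?W) \<cdot> (I \<odot> Inv (l\<^sub>o ?W)) = I \<odot> ?W"
    using circ.triangle_inv'[of I ?W] by (simp add: circ.lunit_eq_runit circ.tensor_comp)
  have "\<delta> (V \<odot> U) I U T \<cdot> \<zeta> V I U ?W
    = \<delta> (V \<odot> U) I U T \<cdot> ((V \<odot> U) \<bullet> ((l\<^sub>o I \<odot> ?W) \<cdot> Inv (a\<^sub>o I I ?W) \<cdot> (I \<odot> Inv (l\<^sub>o ?W)))) \<cdot> \<zeta> V I U ?W"
    unfolding i by simp
  also have "\<dots> = (\<delta> (V \<odot> U) I U T \<cdot> ((V \<odot> U) \<bullet> (l\<^sub>o I \<odot> ?W))) \<cdot> ((V \<odot> U) \<bullet> Inv (a\<^sub>o I I ?W))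
      \<cdot> ((V \<odot> U) \<bullet> (I \<odot> Inv (l\<^sub>o ?W))) \<cdot> \<zeta> V I U ?W"
    by (simp add: bull.whisker_left)
  also have "\<delta> (V \<odot> U) I U T \<cdot> ((V \<odot> U) \<bullet> (l\<^sub>o I \<odot> ?W)) = ((((V \<odot> U) \<odot> U) \<bullet> l\<^sub>o I) \<odot> T) \<cdot> \<delta> (V \<odot> U) (I \<odot> I) U T"
    using delta_nat[of "V \<odot> U" "l\<^sub>o I" U T] by simp
  also have "((V \<odot> U) \<bullet> (I \<odot> Inv (l\<^sub>o ?W))) \<cdot> \<zeta> V I U ?W = \<zeta> V I U (I \<odot> ?W) \<cdot> ((V \<bullet> I) \<odot> (U \<bullet> Inv (l\<^sub>o ?W)))"
    using zeta_nat[of V I U "Inv (l\<^sub>o ?W)"] by simp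
  finally have "\<delta> (V \<odot> U) I U T \<cdot> \<zeta> V I U ?W = ((Inv (a\<^sub>o V U U) \<bullet> l\<^sub>o I) \<odot> T)
    \<cdot> (((a\<^sub>o V U U \<bullet> (I \<odot> I)) \<odot> T) \<cdot> \<delta> (V \<odot> U) (I \<odot> I) U T \<cdot> ((V \<odot> U) \<bullet> Inv (a\<^sub>o I I ?W)) \<cdot> \<zeta> V I U (I \<odot> ?W))
    \<cdot> ((V \<bullet> I) \<odot> (U \<bullet> Inv (l\<^sub>o ?W)))"
    by (simp add: merge)
  then show ?thesis
    by (subst (asm) R3) (simp_all add: circ.tensor_comp)
qed

context
  fixes H :: "'m bimon" and \<Sigma> V \<mu> T \<rho> :: 'm
  assumes bimonoid_H [simp]: "bimonoid D H"
    and antipode_H: "antipode D R H \<Sigma>"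
    and module_V: "rmodule H V \<mu>"
    and comodule_T: "lcomodule H T \<rho>"
begin

lemmas [simp] = antipode_arr[OF bimonoid_H antipode_H] rmodule_arr[OF module_V] lcomodule_arr[OF comodule_T]
  hopf_map_arr[OF bimonoid_H module_V comodule_T]

text \<open>Corresponds to
  \<open>v \<otimes> t \<mapsto> v \<Sigma>(t_(-1)) \<otimes> t_(0)\<close>. As \<Sigma> ends in
  \<open>(obj H)\<^sup>-\<close>, which does not act on \<open>V\<close>, the arrow \<delta> takes
  over the part of \<zeta> and delivers \<open>V \<odot> obj H\<close>.\<close>

definition hopf_inv where
  "hopf_inv = ((\<mu> \<bullet> I) \<odot> T) \<cdot> \<delta> V I (obj H) T \<cdot> (V \<bullet> (Inv (l\<^sub>o ((obj H)\<^sup>- \<bullet> T)) \<cdot> (\<Sigma> \<bullet> T) \<cdot> \<rho>))"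

lemma hopf_inv_arr: "Ar hopf_inv" "dom hopf_inv = V \<bullet> T" "cod hopf_inv = (V \<bullet> I) \<odot> T"
  by (simp_all add: hopf_inv_def)

text \<open>On elements \<open>v \<Sigma>(t_(-2)) t_(-1) \<otimes> t_(0) = v \<otimes> t\<close>:
  coassociativity of \<open>T\<close>, associativity of \<open>V\<close>, the left antipode law,
  then the unit law of \<open>V\<close> and the counit law of \<open>T\<close>.\<close>

lemma hopf_map_inv: "hopf_map H V \<mu> T \<rho> \<cdot> hopf_inv = V \<bullet> T"
proof -
  let ?h = "obj H"
  let ?S = "(\<Sigma> \<bullet> ?h) \<cdot> comult H"
  let ?\<kappa> = "Inv (l\<^sub>o (?h\<^sup>- \<bullet> T)) \<cdot> (\<Sigma> \<bullet> T) \<cdot> \<rho>"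
  let ?n = "m\<^sub>J \<cdot> (J \<odot> counit H)"
  let ?\<beta> = "\<zeta> J I ?h T \<cdot> (Inv (l\<^sub>b I) \<odot> \<rho>) \<cdot> Inv (l\<^sub>o T)"
  have n_split: "?n \<bullet> l\<^sub>o T = (m\<^sub>J \<bullet> l\<^sub>o T) \<cdot> ((J \<odot> counit H) \<bullet> (I \<odot> T))"
    by (simp add: bull.tensor_comp)
  have inv_counit: "(counit H \<bullet> T) \<cdot> \<rho> = Inv (l\<^sub>b T)"
    by (rule circ.iso_cancel_left[of "l\<^sub>b T"]) (simp_all add: lcomodule_laws[OF comodule_T])
  \<comment> \<open>Coassociativity turns the second use of \<rho> into \<open>comult H\<close>; so
    \<Sigma> acts on one leg of a comultiplication, as the antipode axiom requires.\<close>
  have \<kappa>: "(I \<odot> (?h\<^sup>- \<bullet> \<rho>)) \<cdot> ?\<kappa> = (I \<odot> a\<^sub>b (?h\<^sup>-) ?h T) \<cdot> (I \<odot> (?S \<bullet> T)) \<cdot> (I \<odot> \<rho>) \<cdot> Inv (l\<^sub>o T)"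
  proof -
    have "(I \<odot> (?h\<^sup>- \<bullet> \<rho>)) \<cdot> ?\<kappa> = Inv (l\<^sub>o (?h\<^sup>- \<bullet> (?h \<bullet> T))) \<cdot> (\<Sigma> \<bullet> (?h \<bullet> T)) \<cdot> (?h \<bullet> \<rho>) \<cdot> \<rho>"
      using red[OF circ.lunit_inv_nat[of "?h\<^sup>- \<bullet> \<rho>", symmetric], of "(\<Sigma> \<bullet> T) \<cdot> \<rho>"]
      by (simp add: bull.tensor_comp_reduce)
    also have "\<dots> = Inv (l\<^sub>o (?h\<^sup>- \<bullet> (?h \<bullet> T))) \<cdot> a\<^sub>b (?h\<^sup>-) ?h T \<cdot> (?S \<bullet> T) \<cdot> \<rho>"
      unfolding lcomodule_laws(2)[OF comodule_T, symmetric]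
      using red[OF bull.assoc_nat[of \<Sigma> ?h T], symmetric] by (simp add: bull.whisker_right)
    also have "\<dots> = (I \<odot> (a\<^sub>b (?h\<^sup>-) ?h T \<cdot> (?S \<bullet> T) \<cdot> \<rho>)) \<cdot> Inv (l\<^sub>o T)"
      using circ.lunit_inv_nat[of "a\<^sub>b (?h\<^sup>-) ?h T \<cdot> (?S \<bullet> T) \<cdot> \<rho>"] by simp
    finally show ?thesis by (simp add: circ.whisker_left)
  qed
  \<comment> \<open>The convolution of \<Sigma> with the identity acts trivially on
    \<open>V\<close>; what remains is \<open>?n\<close>, the counit multiplied into
    \<open>J\<close>.\<close>
  have X: "\<mu> \<cdot> (\<mu> \<odot> ?h) \<cdot> (r\<^sub>b (V \<odot> ?h) \<odot> ?h) \<cdot> \<delta> V J ?h ?h \<cdot> (V \<bullet> (J \<odot> ?S)) = r\<^sub>b V \<cdot> (V \<bullet> ?n)"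
  proof -
    have "\<mu> \<cdot> (\<mu> \<odot> ?h) \<cdot> (r\<^sub>b (V \<odot> ?h) \<odot> ?h) \<cdot> \<delta> V J ?h ?h \<cdot> (V \<bullet> (J \<odot> ?S))
      = \<mu> \<cdot> (V \<odot> mult H) \<cdot> a\<^sub>o V ?h ?h \<cdot> (r\<^sub>b (V \<odot> ?h) \<odot> ?h) \<cdot> \<delta> V J ?h ?h \<cdot> (V \<bullet> (J \<odot> ?S))"
      using red[OF rmodule_laws(2)[OF module_V]] by simp
    also have "\<dots> = \<mu> \<cdot> (V \<odot> unt H) \<cdot> Inv (r\<^sub>o V) \<cdot> r\<^sub>b V \<cdot> (V \<bullet> ?n)"
      by (subst antipode_delta_left[OF bimonoid_H antipode_H]) simp_all
    also have "\<dots> = r\<^sub>b V \<cdot> (V \<bullet> ?n)"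
      using red[OF rmodule_laws(1)[OF module_V]] by simp
    finally show ?thesis .
  qed
  have "hopf_map H V \<mu> T \<rho> \<cdot> hopf_inv
    = (\<mu> \<bullet> l\<^sub>o T) \<cdot> \<zeta> V I ?h T \<cdot> ((\<mu> \<bullet> I) \<odot> (?h \<bullet> T)) \<cdot> (((V \<odot> ?h) \<bullet> I) \<odot> \<rho>) \<cdot> \<delta> V I ?h T \<cdot> (V \<bullet> ?\<kappa>)"
    by (simp add: hopf_map_def hopf_inv_def circ.tensor_comp_reduce)
  also have "\<dots> = ((\<mu> \<cdot> (\<mu> \<odot> ?h)) \<bullet> l\<^sub>o T) \<cdot> \<zeta> (V \<odot> ?h) I ?h T \<cdot> (((V \<odot> ?h) \<bullet> I) \<odot> \<rho>) \<cdot> \<delta> V I ?h T \<cdot> (V \<bullet> ?\<kappa>)"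
    using red[OF zeta_nat[of \<mu> I ?h T]] by (simp add: bull.tensor_comp_reduce)
  also have "\<dots> = ((\<mu> \<cdot> (\<mu> \<odot> ?h)) \<bullet> l\<^sub>o T) \<cdot> \<zeta> (V \<odot> ?h) I ?h T \<cdot> \<delta> V I ?h (?h \<bullet> T)
      \<cdot> (V \<bullet> ((I \<odot> (?h\<^sup>- \<bullet> \<rho>)) \<cdot> ?\<kappa>))"
    using red[OF delta_nat[of V I ?h \<rho>, symmetric]] by (simp add: bull.tensor_comp)
  also have "\<dots> = ((\<mu> \<cdot> (\<mu> \<odot> ?h)) \<bullet> l\<^sub>o T) \<cdot> (\<zeta> (V \<odot> ?h) I ?h T \<cdot> \<delta> V I ?h (?h \<bullet> T) \<cdot> (V \<bullet> (I \<odot> a\<^sub>b (?h\<^sup>-) ?h T)))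
      \<cdot> (V \<bullet> ((I \<odot> (?S \<bullet> T)) \<cdot> (I \<odot> \<rho>) \<cdot> Inv (l\<^sub>o T)))"
    unfolding \<kappa> by (simp add: bull.tensor_comp)
  also have "\<dots> = ((\<mu> \<cdot> (\<mu> \<odot> ?h) \<cdot> (r\<^sub>b (V \<odot> ?h) \<odot> ?h) \<cdot> \<delta> V J ?h ?h) \<bullet> l\<^sub>o T) \<cdot> Inv (a\<^sub>b V (J \<odot> (?h\<^sup>- \<bullet> ?h)) (I \<odot> T))
      \<cdot> (V \<bullet> (\<zeta> J I (?h\<^sup>- \<bullet> ?h) T \<cdot> ((J \<bullet> I) \<odot> (?S \<bullet> T)) \<cdot> (Inv (l\<^sub>b I) \<odot> \<rho>) \<cdot> Inv (l\<^sub>o T)))"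
    by (subst zeta_delta_b) (simp_all add: merge)
  also have "\<zeta> J I (?h\<^sup>- \<bullet> ?h) T \<cdot> ((J \<bullet> I) \<odot> (?S \<bullet> T)) \<cdot> (Inv (l\<^sub>b I) \<odot> \<rho>) \<cdot> Inv (l\<^sub>o T)
      = ((J \<odot> ?S) \<bullet> (I \<odot> T)) \<cdot> ?\<beta>"
    using red[OF zeta_nat[of J I ?S T]] by simp
  also have "Inv (a\<^sub>b V (J \<odot> (?h\<^sup>- \<bullet> ?h)) (I \<odot> T)) \<cdot> (V \<bullet> (((J \<odot> ?S) \<bullet> (I \<odot> T)) \<cdot> ?\<beta>))
      = ((V \<bullet> (J \<odot> ?S)) \<bullet> (I \<odot> T)) \<cdot> Inv (a\<^sub>b V (J \<odot> ?h) (I \<odot> T)) \<cdot> (V \<bullet> ?\<beta>)"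
    using red[OF bull.assoc_inv_nat[of V "J \<odot> ?S" "I \<odot> T"]] by (simp add: bull.whisker_left)
  also have "((\<mu> \<cdot> (\<mu> \<odot> ?h) \<cdot> (r\<^sub>b (V \<odot> ?h) \<odot> ?h) \<cdot> \<delta> V J ?h ?h) \<bullet> l\<^sub>o T) \<cdot> \<dots>
      = ((r\<^sub>b V \<cdot> (V \<bullet> ?n)) \<bullet> l\<^sub>o T) \<cdot> Inv (a\<^sub>b V (J \<odot> ?h) (I \<odot> T)) \<cdot> (V \<bullet> ?\<beta>)"
    unfolding X[symmetric] by (simp add: bull.tensor_comp_reduce)
  also have "\<dots> = (r\<^sub>b V \<bullet> T) \<cdot> ((V \<bullet> ?n) \<bullet> l\<^sub>o T) \<cdot> Inv (a\<^sub>b V (J \<odot> ?h) (I \<odot> T)) \<cdot> (V \<bullet> ?\<beta>)"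
    by (simp add: bull.tensor_comp_reduce)
  also have "\<dots> = (r\<^sub>b V \<bullet> T) \<cdot> Inv (a\<^sub>b V J T) \<cdot> (V \<bullet> ((?n \<bullet> l\<^sub>o T) \<cdot> ?\<beta>))"
    using red[OF bull.assoc_inv_nat[of V ?n "l\<^sub>o T", symmetric]] by (simp add: bull.whisker_left)
  also have "\<dots> = V \<bullet> (l\<^sub>b T \<cdot> (?n \<bullet> l\<^sub>o T) \<cdot> ?\<beta>)"
    using bull.triangle[of V T, symmetric] by (simp add: bull.whisker_left)
  also have "l\<^sub>b T \<cdot> (?n \<bullet> l\<^sub>o T) \<cdot> ?\<beta> = l\<^sub>b T \<cdot> (m\<^sub>J \<bullet> l\<^sub>o T) \<cdot> \<zeta> J I J T \<cdot> (Inv (l\<^sub>b I) \<odot> ((counit H \<bullet> T) \<cdot> \<rho>)) \<cdot> Inv (l\<^sub>o T)"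
    using red[OF zeta_nat[of J I "counit H" T, symmetric], of "(Inv (l\<^sub>b I) \<odot> \<rho>) \<cdot> Inv (l\<^sub>o T)"]
    by (simp add: n_split circ.tensor_comp circ.tensor_comp_reduce)
  also have "\<dots> = l\<^sub>b T \<cdot> (J \<bullet> l\<^sub>o T) \<cdot> (m\<^sub>J \<bullet> (I \<odot> T)) \<cdot> \<zeta> J I J T \<cdot> (Inv (l\<^sub>b I) \<odot> Inv (l\<^sub>b T)) \<cdot> Inv (l\<^sub>o T)"
    unfolding inv_counit by (simp add: bull.tensor_comp_reduce)
  also have "\<dots> = l\<^sub>o T \<cdot> (l\<^sub>b (I \<odot> T) \<cdot> (m\<^sub>J \<bullet> (I \<odot> T)) \<cdot> \<zeta> J I J T) \<cdot> (Inv (l\<^sub>b I) \<odot> Inv (l\<^sub>b T)) \<cdot> Inv (l\<^sub>o T)"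
    using red[OF bull.lunit_nat[of "l\<^sub>o T"]] by simp
  also have "\<dots> = T"
    by (subst zeta_lunit_b) (simp_all add: circ.tensor_comp_reduce)
  finally show ?thesis by simp
qed

text \<open>On elements \<open>v t_(-2) \<Sigma>(t_(-1)) \<otimes> t_(0) = v \<otimes> t\<close>, by
  the right antipode law.\<close>

lemma hopf_inv_map: "hopf_inv \<cdot> hopf_map H V \<mu> T \<rho> = (V \<bullet> I) \<odot> T"
proof -
  let ?h = "obj H"
  let ?g = "(\<Sigma> \<bullet> T) \<cdot> \<rho>"
  let ?d = "(unt H \<bullet> I) \<cdot> \<Delta>\<^sub>I"
  let ?i = "Inv (l\<^sub>o (?h\<^sup>- \<bullet> T))"
  have "hopf_inv \<cdot> hopf_map H V \<mu> T \<rho>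
    = ((\<mu> \<bullet> I) \<odot> T) \<cdot> \<delta> V I ?h T \<cdot> (\<mu> \<bullet> (?i \<cdot> ?g \<cdot> l\<^sub>o T)) \<cdot> \<zeta> V I ?h T \<cdot> ((V \<bullet> I) \<odot> \<rho>)"
    by (simp add: hopf_map_def hopf_inv_def bull.tensor_comp_reduce)
  also have "?i \<cdot> ?g \<cdot> l\<^sub>o T = I \<odot> ?g"
    using red[OF circ.lunit_inv_nat[of ?g], of "l\<^sub>o T"] by simp
  also have "((\<mu> \<bullet> I) \<odot> T) \<cdot> \<delta> V I ?h T \<cdot> (\<mu> \<bullet> (I \<odot> ?g)) \<cdot> \<zeta> V I ?h T \<cdot> ((V \<bullet> I) \<odot> \<rho>)
    = ((\<mu> \<bullet> I) \<odot> T) \<cdot> (\<delta> V I ?h T \<cdot> (\<mu> \<bullet> (I \<odot> (?h\<^sup>- \<bullet> T)))) \<cdot> (((V \<odot> ?h) \<bullet> (I \<odot> ?g)) \<cdot> \<zeta> V I ?h T) \<cdot> ((V \<bullet> I) \<odot> \<rho>)"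
    by (simp add: bull.tensor_comp_reduce)
  also have "\<delta> V I ?h T \<cdot> (\<mu> \<bullet> (I \<odot> (?h\<^sup>- \<bullet> T))) = (((\<mu> \<odot> ?h) \<bullet> I) \<odot> T) \<cdot> \<delta> (V \<odot> ?h) I ?h T"
    using delta_nat[of \<mu> I ?h T] by simp
  also have "((V \<odot> ?h) \<bullet> (I \<odot> ?g)) \<cdot> \<zeta> V I ?h T = \<zeta> V I ?h (?h\<^sup>- \<bullet> T) \<cdot> ((V \<bullet> I) \<odot> (?h \<bullet> ?g))"
    using zeta_nat[of V I ?h ?g] by simp
  finally have "hopf_inv \<cdot> hopf_map H V \<mu> T \<rho> = (((\<mu> \<cdot> (\<mu> \<odot> ?h)) \<bullet> I) \<odot> T)
    \<cdot> (\<delta> (V \<odot> ?h) I ?h T \<cdot> \<zeta> V I ?h (?h\<^sup>- \<bullet> T)) \<cdot> ((V \<bullet> I) \<odot> ((?h \<bullet> ?g) \<cdot> \<rho>))"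
    by (simp add: merge)
  also have "\<dots> = (((\<mu> \<cdot> (\<mu> \<odot> ?h) \<cdot> Inv (a\<^sub>o V ?h ?h)) \<bullet> l\<^sub>o I) \<odot> T) \<cdot> (\<zeta> V I (?h \<odot> ?h) I \<odot> T)
      \<cdot> Inv (a\<^sub>o (V \<bullet> I) ((?h \<odot> ?h) \<bullet> I) T) \<cdot> ((V \<bullet> I) \<odot> (\<delta> ?h I ?h T \<cdot> (?h \<bullet> ?i) \<cdot> (?h \<bullet> ?g) \<cdot> \<rho>))"
    by (subst delta_zeta_o) (simp_all add: merge)
  also have "\<mu> \<cdot> (\<mu> \<odot> ?h) \<cdot> Inv (a\<^sub>o V ?h ?h) = \<mu> \<cdot> (V \<odot> mult H)"
    using red[OF rmodule_laws(2)[OF module_V], of "Inv (a\<^sub>o V ?h ?h)"] by simp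
  also have "(((\<mu> \<cdot> (V \<odot> mult H)) \<bullet> l\<^sub>o I) \<odot> T) \<cdot> (\<zeta> V I (?h \<odot> ?h) I \<odot> T)
      \<cdot> Inv (a\<^sub>o (V \<bullet> I) ((?h \<odot> ?h) \<bullet> I) T) \<cdot> ((V \<bullet> I) \<odot> (\<delta> ?h I ?h T \<cdot> (?h \<bullet> ?i) \<cdot> (?h \<bullet> ?g) \<cdot> \<rho>))
    = (((\<mu> \<bullet> l\<^sub>o I) \<cdot> ((V \<odot> mult H) \<bullet> (I \<odot> I)) \<cdot> \<zeta> V I (?h \<odot> ?h) I) \<odot> T)
      \<cdot> Inv (a\<^sub>o (V \<bullet> I) ((?h \<odot> ?h) \<bullet> I) T) \<cdot> ((V \<bullet> I) \<odot> (\<delta> ?h I ?h T \<cdot> (?h \<bullet> ?i) \<cdot> (?h \<bullet> ?g) \<cdot> \<rho>))"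
    by (simp add: merge)
  also have "((V \<odot> mult H) \<bullet> (I \<odot> I)) \<cdot> \<zeta> V I (?h \<odot> ?h) I = \<zeta> V I ?h I \<cdot> ((V \<bullet> I) \<odot> (mult H \<bullet> I))"
    using zeta_nat[of V I "mult H" I] by simp
  also have "(((\<mu> \<bullet> l\<^sub>o I) \<cdot> \<zeta> V I ?h I \<cdot> ((V \<bullet> I) \<odot> (mult H \<bullet> I))) \<odot> T)
      \<cdot> Inv (a\<^sub>o (V \<bullet> I) ((?h \<odot> ?h) \<bullet> I) T) \<cdot> ((V \<bullet> I) \<odot> (\<delta> ?h I ?h T \<cdot> (?h \<bullet> ?i) \<cdot> (?h \<bullet> ?g) \<cdot> \<rho>))
    = (((\<mu> \<bullet> l\<^sub>o I) \<cdot> \<zeta> V I ?h I) \<odot> T) \<cdot> Inv (a\<^sub>o (V \<bullet> I) (?h \<bullet> I) T)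
      \<cdot> ((V \<bullet> I) \<odot> (((mult H \<bullet> I) \<odot> T) \<cdot> \<delta> ?h I ?h T \<cdot> (?h \<bullet> ?i) \<cdot> (?h \<bullet> ?g) \<cdot> \<rho>))"
    using red[OF circ.assoc_inv_nat[of "V \<bullet> I" "mult H \<bullet> I" T, symmetric]]
    by (simp add: circ.whisker_left circ.whisker_right)
  also have "((mult H \<bullet> I) \<odot> T) \<cdot> \<delta> ?h I ?h T \<cdot> (?h \<bullet> ?i) \<cdot> (?h \<bullet> ?g) \<cdot> \<rho>
    = (((mult H \<bullet> I) \<odot> T) \<cdot> \<delta> ?h I ?h T \<cdot> (?h \<bullet> (?i \<cdot> (\<Sigma> \<bullet> T))) \<cdot> a\<^sub>b ?h ?h T \<cdot> (comult H \<bullet> T)) \<cdot> \<rho>"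
    by (simp add: lcomodule_laws(2)[OF comodule_T] bull.whisker_left)
  also have "\<dots> = (?d \<odot> T) \<cdot> Inv (l\<^sub>o T)"
    by (subst antipode_delta_right[OF bimonoid_H antipode_H])
      (simp_all add: lcomodule_laws(1)[OF comodule_T])
  also have "Inv (a\<^sub>o (V \<bullet> I) (?h \<bullet> I) T) \<cdot> ((V \<bullet> I) \<odot> ((?d \<odot> T) \<cdot> Inv (l\<^sub>o T)))
    = (((V \<bullet> I) \<odot> ?d) \<odot> T) \<cdot> (Inv (r\<^sub>o (V \<bullet> I)) \<odot> T)"
    using red[OF circ.assoc_inv_nat[of "V \<bullet> I" ?d T]] circ.triangle_inv'[of "V \<bullet> I" T]
    by (simp add: circ.whisker_left[of _ "Inv (l\<^sub>o T)"])
  also have "(((\<mu> \<bullet> l\<^sub>o I) \<cdot> \<zeta> V I ?h I) \<odot> T) \<cdot> \<dots>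
    = ((((\<mu> \<bullet> l\<^sub>o I) \<cdot> \<zeta> V I ?h I \<cdot> ((V \<bullet> I) \<odot> (unt H \<bullet> I)) \<cdot> ((V \<bullet> I) \<odot> \<Delta>\<^sub>I)) \<cdot> Inv (r\<^sub>o (V \<bullet> I))) \<odot> T)"
    by (simp add: circ.whisker_left circ.whisker_right)
  also have "(\<mu> \<bullet> l\<^sub>o I) \<cdot> \<zeta> V I ?h I \<cdot> ((V \<bullet> I) \<odot> (unt H \<bullet> I)) \<cdot> ((V \<bullet> I) \<odot> \<Delta>\<^sub>I)
    = ((\<mu> \<cdot> (V \<odot> unt H)) \<bullet> l\<^sub>o I) \<cdot> \<zeta> V I I I \<cdot> ((V \<bullet> I) \<odot> \<Delta>\<^sub>I)"
    using red[OF zeta_nat[of V I "unt H" I]] by (simp add: bull.tensor_comp_reduce)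
  also have "\<dots> = r\<^sub>o (V \<bullet> I)"
    by (simp add: rmodule_laws(1)[OF module_V] circ.lunit_eq_runit zeta_runit_o)
  finally show ?thesis by simp
qed

lemma hopf_map_iso: "iso (hopf_map H V \<mu> T \<rho>)"
  by (rule circ.iso_arrI(1)[where g=hopf_inv])
    (simp_all add: hopf_inv_arr hopf_map_inv hopf_inv_map)

end

end

section \<open>The double braiding on a relative product\<close>

context duoidal_category
begin

lemma bimonoid_laws:
  assumes "bimonoid D H"
  shows comult_coassoc: "a\<^sub>b (obj H) (obj H) (obj H) \<cdot> (comult H \<bullet> obj H) \<cdot> comult H = (obj H \<bullet> comult H) \<cdot> comult H"
    and counit_left: "l\<^sub>b (obj H) \<cdot> (counit H \<bullet> obj H) \<cdot> comult H = obj H"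
    and counit_right: "r\<^sub>b (obj H) \<cdot> (obj H \<bullet> counit H) \<cdot> comult H = obj H"
  using bimonoid.comonoid[OF assms] unfolding comonoid_object_def by auto

lemma mhom_comult:
  assumes [simp]: "bimonoid D H"
  shows "mhom (monof H) (comult H) (prodmon (monof H) (monof H))"
  by (rule mhomI) (simp_all add: bimonoid.comult_mult bimonoid.comult_unit)

lemma mhom_counit:
  assumes [simp]: "bimonoid D H"
  shows "mhom (monof H) (counit H) Jmon"
  by (rule mhomI) (simp_all add: bimonoid.counit_mult bimonoid.counit_unit)

lemma morphism_arr:
  assumes "bimonoid_morphism D A f B"
  shows "bimonoid D A" "bimonoid D B" "Ar f" "dom f = obj A" "cod f = obj B"
  using bimonoid_morphism.in_hom[OF assms] assms
  by (auto dest: homD simp: bimonoid_morphism_def)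

lemma morphism_comult:
  assumes "bimonoid_morphism D A f B"
  shows "comult B \<cdot> f = (f \<bullet> f) \<cdot> comult A"
  using bimonoid_morphism.comult[OF assms] .

lemma mhom_morphism:
  assumes "bimonoid_morphism D A f B"
  shows "mhom (monof A) f (monof B)"
  by (rule mhomI) (simp_all add: morphism_arr[OF assms] bimonoid_morphism.mult[OF assms] bimonoid_morphism.unit[OF assms])

text \<open>Restriction of scalars: the regular module of the monoid \<open>N\<close> along
  \<open>s\<close>.\<close>

lemma rmodule_mhom:
  assumes [simp]: "bimonoid D H" and s: "mhom (monof H) s N"
  shows "rmodule H (car N) (mul N \<cdot> (car N \<odot> s))"
proof -
  note [simp] = mhomD(1-5)[OF s]
  let ?V = "car N" and ?h = "obj H"
  let ?\<mu> = "mul N \<cdot> (?V \<odot> s)"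
  have "?\<mu> \<cdot> (?V \<odot> unt H) = mul N \<cdot> (?V \<odot> un N)"
    using mhomD(7)[OF s] by (simp add: circ.tensor_comp)
  then have u: "?\<mu> \<cdot> (?V \<odot> unt H) = r\<^sub>o ?V"
    by (simp add: ismon_unit_right)
  have "?\<mu> \<cdot> (?\<mu> \<odot> ?h) = (mul N \<cdot> (mul N \<odot> ?V)) \<cdot> ((?V \<odot> s) \<odot> s)"
    by (simp add: merge)
  also have "\<dots> = mul N \<cdot> (?V \<odot> mul N) \<cdot> (?V \<odot> (s \<odot> s)) \<cdot> a\<^sub>o ?V ?h ?h"
    unfolding ismon_assoc[OF mhomD(2)[OF s]] using circ.assoc_nat[of ?V s s] by simp
  also have "\<dots> = mul N \<cdot> (?V \<odot> (mul N \<cdot> (s \<odot> s))) \<cdot> a\<^sub>o ?V ?h ?h"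
    by (simp add: merge)
  also have "\<dots> = ?\<mu> \<cdot> (?V \<odot> mult H) \<cdot> a\<^sub>o ?V ?h ?h"
    unfolding mhomD(6)[OF s, symmetric] by (simp add: merge)
  finally show ?thesis
    using u unfolding rmodule_def by (auto intro!: homI)
qed

lemma hopf_map_module_hom:
  assumes "bimonoid D H" and V: "rmodule H V \<mu>" and V': "rmodule H V' \<mu>'" and T: "lcomodule H T \<rho>"
    and f: "Ar f" "dom f = V" "cod f = V'" "f \<cdot> \<mu> = \<mu>' \<cdot> (f \<odot> obj H)"
  shows "hopf_map H V' \<mu>' T \<rho> \<cdot> ((f \<bullet> I) \<odot> T) = (f \<bullet> T) \<cdot> hopf_map H V \<mu> T \<rho>"
proof -
  note [simp] = assms(1) f(1-3) rmodule_arr[OF V] rmodule_arr[OF V'] lcomodule_arr[OF T]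
  have "hopf_map H V' \<mu>' T \<rho> \<cdot> ((f \<bullet> I) \<odot> T)
    = (\<mu>' \<bullet> l\<^sub>o T) \<cdot> \<zeta> V' I (obj H) T \<cdot> ((f \<bullet> I) \<odot> (obj H \<bullet> T)) \<cdot> ((V \<bullet> I) \<odot> \<rho>)"
    by (simp add: hopf_map_def merge)
  also have "\<dots> = ((\<mu>' \<cdot> (f \<odot> obj H)) \<bullet> l\<^sub>o T) \<cdot> \<zeta> V I (obj H) T \<cdot> ((V \<bullet> I) \<odot> \<rho>)"
    using red[OF zeta_nat[of f I "obj H" T]] by (simp add: bull.tensor_comp_reduce)
  also have "\<dots> = (f \<bullet> T) \<cdot> hopf_map H V \<mu> T \<rho>"
    unfolding f(4)[symmetric] by (simp add: hopf_map_def bull.tensor_comp_reduce)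
  finally show ?thesis .
qed

text \<open>Under the diagonal action \<open>(v \<otimes> 1) \<otimes> t\<close> goes to
  \<open>v t_(-2) \<otimes> t_(-1) \<otimes> t_(0)\<close>, which by coassociativity is the coaction
  applied to the last factor of \<open>v t_(-1) \<otimes> t_(0)\<close>. Thus the coaction of
  \<open>T\<close> is traded for the insertion of a unit beside \<open>V\<close>.\<close>

lemma hopf_map_tensor:
  assumes [simp]: "bimonoid D H" and V: "rmodule H V \<mu>" and T: "lcomodule H T \<rho>"
  shows "hopf_map H (V \<bullet> obj H) ((\<mu> \<bullet> mult H) \<cdot> \<zeta> V (obj H) (obj H) (obj H) \<cdot> ((V \<bullet> obj H) \<odot> comult H)) T \<rho>
      \<cdot> ((Inv (a\<^sub>b V (obj H) I) \<cdot> (V \<bullet> ((unt H \<bullet> I) \<cdot> \<Delta>\<^sub>I))) \<odot> T)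
    = Inv (a\<^sub>b V (obj H) T) \<cdot> (V \<bullet> \<rho>) \<cdot> hopf_map H V \<mu> T \<rho>"
proof -
  note [simp] = rmodule_arr[OF V] lcomodule_arr[OF T]
  let ?h = "obj H"
  let ?d = "(unt H \<bullet> I) \<cdot> \<Delta>\<^sub>I"
  let ?j = "Inv (a\<^sub>b V ?h I) \<cdot> (V \<bullet> ?d)"
  have "hopf_map H (V \<bullet> ?h) ((\<mu> \<bullet> mult H) \<cdot> \<zeta> V ?h ?h ?h \<cdot> ((V \<bullet> ?h) \<odot> comult H)) T \<rho> \<cdot> (?j \<odot> T)
    = ((\<mu> \<bullet> mult H) \<bullet> l\<^sub>o T) \<cdot> (\<zeta> V ?h ?h ?h \<bullet> (I \<odot> T)) \<cdot> (((V \<bullet> ?h) \<odot> comult H) \<bullet> (I \<odot> T))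
      \<cdot> \<zeta> (V \<bullet> ?h) I ?h T \<cdot> (?j \<odot> \<rho>)"
    by (simp add: hopf_map_def merge)
  also have "\<dots> = ((\<mu> \<bullet> mult H) \<bullet> l\<^sub>o T) \<cdot> (\<zeta> V ?h ?h ?h \<bullet> (I \<odot> T)) \<cdot> \<zeta> (V \<bullet> ?h) I (?h \<bullet> ?h) T
      \<cdot> (?j \<odot> ((comult H \<bullet> T) \<cdot> \<rho>))"
    using red[OF zeta_nat[of "V \<bullet> ?h" I "comult H" T, symmetric]] by (simp add: circ.tensor_comp)
  also have "\<dots> = ((\<mu> \<bullet> mult H) \<bullet> l\<^sub>o T) \<cdot> Inv (a\<^sub>b (V \<odot> ?h) (?h \<odot> ?h) (I \<odot> T))
      \<cdot> (a\<^sub>b (V \<odot> ?h) (?h \<odot> ?h) (I \<odot> T) \<cdot> (\<zeta> V ?h ?h ?h \<bullet> (I \<odot> T)) \<cdot> \<zeta> (V \<bullet> ?h) I (?h \<bullet> ?h) T)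
      \<cdot> (?j \<odot> ((comult H \<bullet> T) \<cdot> \<rho>))"
    by simp
  also have "\<dots> = ((\<mu> \<bullet> mult H) \<bullet> l\<^sub>o T) \<cdot> Inv (a\<^sub>b (V \<odot> ?h) (?h \<odot> ?h) (I \<odot> T))
      \<cdot> ((V \<odot> ?h) \<bullet> \<zeta> ?h I ?h T) \<cdot> \<zeta> V (?h \<bullet> I) ?h (?h \<bullet> T)
      \<cdot> ((a\<^sub>b V ?h I \<cdot> ?j) \<odot> (a\<^sub>b ?h ?h T \<cdot> (comult H \<bullet> T) \<cdot> \<rho>))"
    by (subst zeta_assoc_b[symmetric]) (simp_all add: circ.tensor_comp)
  also have "(a\<^sub>b V ?h I \<cdot> ?j) \<odot> (a\<^sub>b ?h ?h T \<cdot> (comult H \<bullet> T) \<cdot> \<rho>) = ((V \<bullet> ?d) \<odot> (?h \<bullet> \<rho>)) \<cdot> ((V \<bullet> I) \<odot> \<rho>)"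
    unfolding lcomodule_laws(2)[OF T] by (simp add: circ.tensor_comp)
  also have "\<zeta> V (?h \<bullet> I) ?h (?h \<bullet> T) \<cdot> ((V \<bullet> ?d) \<odot> (?h \<bullet> \<rho>)) \<cdot> ((V \<bullet> I) \<odot> \<rho>)
    = ((V \<odot> ?h) \<bullet> (?d \<odot> \<rho>)) \<cdot> \<zeta> V I ?h T \<cdot> ((V \<bullet> I) \<odot> \<rho>)"
    using red[OF zeta_nat[of V ?d ?h \<rho>]] by simp
  also have "((\<mu> \<bullet> mult H) \<bullet> l\<^sub>o T) \<cdot> Inv (a\<^sub>b (V \<odot> ?h) (?h \<odot> ?h) (I \<odot> T)) \<cdot> ((V \<odot> ?h) \<bullet> \<zeta> ?h I ?h T)
      \<cdot> ((V \<odot> ?h) \<bullet> (?d \<odot> \<rho>)) \<cdot> \<zeta> V I ?h T \<cdot> ((V \<bullet> I) \<odot> \<rho>)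
    = Inv (a\<^sub>b V ?h T) \<cdot> (\<mu> \<bullet> ((mult H \<bullet> l\<^sub>o T) \<cdot> \<zeta> ?h I ?h T \<cdot> (?d \<odot> \<rho>))) \<cdot> \<zeta> V I ?h T \<cdot> ((V \<bullet> I) \<odot> \<rho>)"
    using red[OF bull.assoc_inv_nat[of \<mu> "mult H" "l\<^sub>o T", symmetric]] by (simp add: bull.tensor_comp bull.tensor_comp_reduce)
  also have "(mult H \<bullet> l\<^sub>o T) \<cdot> \<zeta> ?h I ?h T \<cdot> (?d \<odot> \<rho>)
    = (mult H \<bullet> l\<^sub>o T) \<cdot> \<zeta> ?h I ?h T \<cdot> ((unt H \<bullet> I) \<odot> (?h \<bullet> T)) \<cdot> (\<Delta>\<^sub>I \<odot> \<rho>)"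
    by (simp add: circ.tensor_comp)
  also have "\<dots> = ((mult H \<cdot> (unt H \<odot> ?h)) \<bullet> l\<^sub>o T) \<cdot> \<zeta> I I ?h T \<cdot> (\<Delta>\<^sub>I \<odot> \<rho>)"
    using red[OF zeta_nat[of "unt H" I ?h T]] by (simp add: bull.tensor_comp_reduce)
  also have "\<dots> = ((l\<^sub>o ?h \<bullet> l\<^sub>o T) \<cdot> \<zeta> I I ?h T \<cdot> (\<Delta>\<^sub>I \<odot> (?h \<bullet> T))) \<cdot> (I \<odot> \<rho>)"
    using ismon_unit_left[of "monof H"] by (simp add: circ.tensor_comp)
  also have "\<dots> = \<rho> \<cdot> l\<^sub>o T"
    using circ.lunit_nat[of \<rho>] by (simp add: zeta_lunit_o)
  also have "Inv (a\<^sub>b V ?h T) \<cdot> (\<mu> \<bullet> (\<rho> \<cdot> l\<^sub>o T)) \<cdot> \<zeta> V I ?h T \<cdot> ((V \<bullet> I) \<odot> \<rho>)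
    = Inv (a\<^sub>b V ?h T) \<cdot> (V \<bullet> \<rho>) \<cdot> hopf_map H V \<mu> T \<rho>"
    by (simp add: hopf_map_def bull.tensor_comp_reduce)
  finally show ?thesis .
qed

lemma lcomodule_cofree:
  assumes [simp]: "bimonoid D H" "ob W"
  shows "lcomodule H (obj H \<bullet> W) (a\<^sub>b (obj H) (obj H) W \<cdot> (comult H \<bullet> W))"
proof -
  let ?h = "obj H" and ?d = "comult H"
  let ?\<rho> = "a\<^sub>b ?h ?h W \<cdot> (?d \<bullet> W)"
  have "l\<^sub>b (?h \<bullet> W) \<cdot> (counit H \<bullet> (?h \<bullet> W)) \<cdot> ?\<rho> = l\<^sub>b (?h \<bullet> W) \<cdot> a\<^sub>b J ?h W \<cdot> ((counit H \<bullet> ?h) \<bullet> W) \<cdot> (?d \<bullet> W)"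
    using red[OF bull.assoc_nat[of "counit H" ?h W]] by simp
  also have "\<dots> = (l\<^sub>b ?h \<cdot> (counit H \<bullet> ?h) \<cdot> ?d) \<bullet> W"
    using red[OF bull.lunit_tensor[of ?h W]] by (simp add: merge)
  finally have u: "l\<^sub>b (?h \<bullet> W) \<cdot> (counit H \<bullet> (?h \<bullet> W)) \<cdot> ?\<rho> = ?h \<bullet> W"
    by (simp add: counit_left)
  have "a\<^sub>b ?h ?h (?h \<bullet> W) \<cdot> (?d \<bullet> (?h \<bullet> W)) \<cdot> ?\<rho>
    = (a\<^sub>b ?h ?h (?h \<bullet> W) \<cdot> a\<^sub>b (?h \<bullet> ?h) ?h W) \<cdot> ((?d \<bullet> ?h) \<bullet> W) \<cdot> (?d \<bullet> W)"
    using red[OF bull.assoc_nat[of ?d ?h W]] by simp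
  also have "\<dots> = (?h \<bullet> a\<^sub>b ?h ?h W) \<cdot> a\<^sub>b ?h (?h \<bullet> ?h) W \<cdot> ((a\<^sub>b ?h ?h ?h \<cdot> (?d \<bullet> ?h) \<cdot> ?d) \<bullet> W)"
    by (subst bull.pentagon[symmetric]) (simp_all add: merge)
  also have "\<dots> = (?h \<bullet> a\<^sub>b ?h ?h W) \<cdot> (?h \<bullet> (?d \<bullet> W)) \<cdot> a\<^sub>b ?h ?h W \<cdot> (?d \<bullet> W)"
    using red[OF bull.assoc_nat[of ?h ?d W]] by (simp add: comult_coassoc bull.whisker_right)
  also have "\<dots> = (?h \<bullet> ?\<rho>) \<cdot> ?\<rho>"
    by (simp add: bull.whisker_left)
  finally show ?thesis
    using u unfolding lcomodule_def by (auto intro!: homI)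
qed

lemma lcomodule_morphism:
  assumes f: "bimonoid_morphism D A f H"
  shows "lcomodule H (obj A) ((f \<bullet> obj A) \<cdot> comult A)"
proof -
  note [simp] = morphism_arr[OF f]
  let ?a = "obj A" and ?h = "obj H"
  let ?\<rho> = "(f \<bullet> ?a) \<cdot> comult A"
  have u: "l\<^sub>b ?a \<cdot> (counit H \<bullet> ?a) \<cdot> ?\<rho> = ?a"
    by (simp add: merge bimonoid_morphism.counit[OF f] counit_left)
  have "a\<^sub>b ?h ?h ?a \<cdot> (comult H \<bullet> ?a) \<cdot> ?\<rho> = a\<^sub>b ?h ?h ?a \<cdot> ((f \<bullet> f) \<bullet> ?a) \<cdot> (comult A \<bullet> ?a) \<cdot> comult A"
    by (simp add: merge morphism_comult[OF f])
  also have "\<dots> = (f \<bullet> (f \<bullet> ?a)) \<cdot> (?a \<bullet> comult A) \<cdot> comult A"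
    using red[OF bull.assoc_nat[of f f ?a]] by (simp add: comult_coassoc)
  also have "\<dots> = (?h \<bullet> ?\<rho>) \<cdot> ?\<rho>"
    by (simp add: merge)
  finally show ?thesis
    using u unfolding lcomodule_def by (auto intro!: homI)
qed

end

section \<open>The projection onto coinvariants and the double braiding\<close>

context bullet_braided_duoidal_category
begin

text \<open>The arrow \<open>t\<close> of the overview. It is natural in both arguments, and by
  \<open>dbl_zeta\<close> it acts on the two factors of the source of a \<zeta> separately; this
  carries it through \<open>hopf_map\<close>.\<close>

definition dbl :: "'m \<Rightarrow> 'm \<Rightarrow> 'm" where
  "dbl X Y = c Y X \<cdot> c X Y"

lemma dbl_arr [simp]:
  assumes "ob X" "ob Y"
  shows "Ar (dbl X Y)" "dom (dbl X Y) = X \<bullet> Y" "cod (dbl X Y) = X \<bullet> Y"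
  using assms by (simp_all add: dbl_def)

lemma dbl_nat:
  assumes [simp]: "Ar f" "Ar g"
  shows "dbl (cod f) (cod g) \<cdot> (f \<bullet> g) = (f \<bullet> g) \<cdot> dbl (dom f) (dom g)"
  using red[OF braid_nat[of g f]] by (simp add: dbl_def braid_nat)

lemma dbl_zeta:
  assumes [simp]: "ob A" "ob B" "ob X" "ob Y"
  shows "dbl (A \<odot> X) (B \<odot> Y) \<cdot> \<zeta> A B X Y = \<zeta> A B X Y \<cdot> (dbl A B \<odot> dbl X Y)"
  using red[OF braiding_zeta[of B A Y X]] by (simp add: dbl_def braiding_zeta circ.tensor_comp)

lemma dbl_comult:
  assumes "bimonoid D A" "cocommutative D c A"
  shows "dbl (obj A) (obj A) \<cdot> comult A = comult A"
  using assms by (simp add: dbl_def cocommutative_def)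

context
  fixes A H :: "'m bimon" and \<pi> \<sigma> :: 'm
  assumes \<pi>: "bimonoid_morphism D A \<pi> H" and \<sigma>: "bimonoid_morphism D H \<sigma> A"
    and \<pi>\<sigma>: "\<pi> \<cdot> \<sigma> = obj H" and cocomm_A: "cocommutative D c A"
    and hopf: "\<And>V \<mu> T \<rho>. rmodule H V \<mu> \<Longrightarrow> lcomodule H T \<rho> \<Longrightarrow> iso (hopf_map H V \<mu> T \<rho>)"
    and mono_u: "mono (obj A \<bullet> unt H)"
begin

lemmas [simp] = morphism_arr[OF \<pi>] morphism_arr(3-5)[OF \<sigma>]

abbreviation (input) X\<^sub>A where "X\<^sub>A \<equiv> obj A"
abbreviation (input) X\<^sub>H where "X\<^sub>H \<equiv> obj H"

definition nu where "nu = (obj A \<bullet> \<pi>) \<cdot> comult A"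
definition modA where "modA = mult A \<cdot> (obj A \<odot> \<sigma>)"
text \<open>The diagonal action of \<open>H\<close> on \<open>A \<bullet> H\<close>, in the form in
  which \<open>hopf_map_tensor\<close> produces it.\<close>

definition modAH where
  "modAH = (modA \<bullet> mult H) \<cdot> \<zeta> X\<^sub>A X\<^sub>H X\<^sub>H X\<^sub>H \<cdot> ((X\<^sub>A \<bullet> X\<^sub>H) \<odot> comult H)"
definition dI where "dI = (unt H \<bullet> I) \<cdot> \<Delta>\<^sub>I"
definition jI where "jI = Inv (a\<^sub>b X\<^sub>A X\<^sub>H I) \<cdot> (X\<^sub>A \<bullet> dI)"

lemma nu_arr [simp]: "Ar nu" "dom nu = obj A" "cod nu = obj A \<bullet> obj H"
  by (simp_all add: nu_def)

lemma dI_arr [simp]: "Ar dI" "dom dI = I" "cod dI = obj H \<bullet> I"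
  by (simp_all add: dI_def)

lemma jI_arr [simp]: "Ar jI" "dom jI = obj A \<bullet> I" "cod jI = (obj A \<bullet> obj H) \<bullet> I"
  by (simp_all add: jI_def)

lemma rmodule_A: "rmodule H (obj A) modA"
  using rmodule_mhom[OF _ mhom_morphism[OF \<sigma>]] by (simp add: modA_def)

lemma modA_arr [simp]: "Ar modA" "dom modA = obj A \<odot> obj H" "cod modA = obj A"
  by (simp_all add: modA_def)

lemma mhom_nu: "mhom (monof A) nu (prodmon (monof A) (monof H))"
  unfolding nu_def
  by (rule mhom_comp[OF mhom_comult mhom_tensor[OF mhom_id[of "monof A", simplified] mhom_morphism[OF \<pi>]]]) simp_all

lemma nu_sigma: "nu \<cdot> \<sigma> = (\<sigma> \<bullet> X\<^sub>H) \<cdot> comult H"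
  by (simp add: nu_def morphism_comult[OF \<sigma>] bull.tensor_comp_reduce \<pi>\<sigma>)

text \<open>As \<open>\<pi> \<cdot> \<sigma>\<close> is the identity,
  \<open>nu \<cdot> \<sigma>\<close> is the comultiplication with \<sigma> on its first leg. So the
  diagonal action is the regular action of \<open>A \<bullet> H\<close> restricted along a morphism
  of monoids. This gives the module laws at once, and linearity of \<open>nu\<close>, which is
  itself multiplicative.\<close>

lemma modAH_eq: "modAH = mul (prodmon (monof A) (monof H)) \<cdot> ((X\<^sub>A \<bullet> X\<^sub>H) \<odot> (nu \<cdot> \<sigma>))"
proof -
  have "mul (prodmon (monof A) (monof H)) \<cdot> ((X\<^sub>A \<bullet> X\<^sub>H) \<odot> (nu \<cdot> \<sigma>))
    = (mult A \<bullet> mult H) \<cdot> \<zeta> X\<^sub>A X\<^sub>H X\<^sub>A X\<^sub>H \<cdot> ((X\<^sub>A \<bullet> X\<^sub>H) \<odot> (\<sigma> \<bullet> X\<^sub>H)) \<cdot> ((X\<^sub>A \<bullet> X\<^sub>H) \<odot> comult H)"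
    by (simp add: nu_sigma circ.whisker_left)
  also have "\<dots> = modAH"
    using red[OF zeta_nat[of X\<^sub>A X\<^sub>H \<sigma> X\<^sub>H]] by (simp add: modAH_def modA_def bull.tensor_comp_reduce)
  finally show ?thesis by simp
qed

lemma rmodule_AH: "rmodule H (obj A \<bullet> obj H) modAH"
  using rmodule_mhom[OF _ mhom_comp[OF mhom_morphism[OF \<sigma>] mhom_nu]] by (simp add: modAH_eq)

lemma nu_modA: "nu \<cdot> modA = modAH \<cdot> (nu \<odot> X\<^sub>H)"
proof -
  have "nu \<cdot> modA = (nu \<cdot> mul (monof A)) \<cdot> (X\<^sub>A \<odot> \<sigma>)"
    by (simp add: modA_def)
  also have "\<dots> = mul (prodmon (monof A) (monof H)) \<cdot> (nu \<odot> nu) \<cdot> (X\<^sub>A \<odot> \<sigma>)"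
    unfolding mhomD(6)[OF mhom_nu] by simp
  also have "\<dots> = modAH \<cdot> (nu \<odot> X\<^sub>H)"
    unfolding modAH_eq by (simp add: circ.tensor_comp)
  finally show ?thesis .
qed

lemma nu_coassoc: "(nu \<bullet> X\<^sub>H) \<cdot> nu = Inv (a\<^sub>b X\<^sub>A X\<^sub>H X\<^sub>H) \<cdot> (X\<^sub>A \<bullet> comult H) \<cdot> nu"
proof -
  have "(nu \<bullet> X\<^sub>H) \<cdot> nu = ((X\<^sub>A \<bullet> \<pi>) \<bullet> \<pi>) \<cdot> (comult A \<bullet> X\<^sub>A) \<cdot> comult A"
    by (simp add: nu_def merge)
  also have "(comult A \<bullet> X\<^sub>A) \<cdot> comult A = Inv (a\<^sub>b X\<^sub>A X\<^sub>A X\<^sub>A) \<cdot> (X\<^sub>A \<bullet> comult A) \<cdot> comult A"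
    by (simp add: comult_coassoc[symmetric])
  also have "((X\<^sub>A \<bullet> \<pi>) \<bullet> \<pi>) \<cdot> \<dots> = Inv (a\<^sub>b X\<^sub>A X\<^sub>H X\<^sub>H) \<cdot> (X\<^sub>A \<bullet> (\<pi> \<bullet> \<pi>)) \<cdot> (X\<^sub>A \<bullet> comult A) \<cdot> comult A"
    using red[OF bull.assoc_inv_nat[of X\<^sub>A \<pi> \<pi>, symmetric]] by simp
  also have "\<dots> = Inv (a\<^sub>b X\<^sub>A X\<^sub>H X\<^sub>H) \<cdot> (X\<^sub>A \<bullet> comult H) \<cdot> nu"
    by (simp add: nu_def merge morphism_comult[OF \<pi>])
  finally show ?thesis .
qed

lemma dbl_nu: "dbl (obj A) (obj H) \<cdot> nu = nu"
  using red[OF dbl_nat[of X\<^sub>A \<pi>]] by (simp add: nu_def dbl_comult cocomm_A)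

text \<open>Both sides are compared behind the invertible \<open>?B'\<close>: linearity of
  \<open>nu\<close> turns the left side into the left side of \<open>eq\<close>, and
  \<open>hopf_map_tensor\<close> turns the right side into the right side of
  \<open>eq\<close>.\<close>

lemma hopf_lift:
  assumes T: "lcomodule H T \<rho>" and e: "Ar e" "cod e = X\<^sub>A \<bullet> T"
    and eq: "(nu \<bullet> T) \<cdot> e = Inv (a\<^sub>b X\<^sub>A X\<^sub>H T) \<cdot> (X\<^sub>A \<bullet> \<rho>) \<cdot> e"
  shows "((nu \<bullet> I) \<odot> T) \<cdot> Inv (hopf_map H X\<^sub>A modA T \<rho>) \<cdot> e = (jI \<odot> T) \<cdot> Inv (hopf_map H X\<^sub>A modA T \<rho>) \<cdot> e"
proof -
  let ?B = "hopf_map H X\<^sub>A modA T \<rho>" and ?B' = "hopf_map H (X\<^sub>A \<bullet> X\<^sub>H) modAH T \<rho>"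
  note [simp] = e lcomodule_arr[OF T] hopf[OF rmodule_A T] hopf[OF rmodule_AH T]
    hopf_map_arr[OF _ rmodule_A T] hopf_map_arr[OF _ rmodule_AH T]
  have "?B' \<cdot> ((nu \<bullet> I) \<odot> T) \<cdot> Inv ?B \<cdot> e = (nu \<bullet> T) \<cdot> e"
    using red[OF hopf_map_module_hom[OF _ rmodule_A rmodule_AH T _ _ _ nu_modA]] by simp
  also have "\<dots> = ?B' \<cdot> (jI \<odot> T) \<cdot> Inv ?B \<cdot> e"
    unfolding eq using red[OF hopf_map_tensor[OF _ rmodule_A T, folded modAH_def dI_def]] by (simp add: jI_def)
  finally show ?thesis
    by (rule circ.iso_cancel_left[of ?B', rotated -1]) simp_all
qed

definition cofreeI where "cofreeI = a\<^sub>b X\<^sub>H X\<^sub>H I \<cdot> (comult H \<bullet> I)"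
text \<open>Corresponds to \<open>a \<otimes> h \<mapsto> a \<sigma>(\<Sigma> h)\<close>: the
  inverse Hopf isomorphism for the cofree comodule on \<open>I\<close>, followed by the counit on
  its free leg. The inverse supplies the antipode without naming it.\<close>

definition theta where
  "theta = r\<^sub>o (X\<^sub>A \<bullet> I) \<cdot> ((X\<^sub>A \<bullet> I) \<odot> (l\<^sub>b I \<cdot> (counit H \<bullet> I)))
    \<cdot> Inv (hopf_map H X\<^sub>A modA (X\<^sub>H \<bullet> I) cofreeI) \<cdot> a\<^sub>b X\<^sub>A X\<^sub>H I"

lemma lcomodule_cofreeI: "lcomodule H (X\<^sub>H \<bullet> I) cofreeI"
  unfolding cofreeI_def by (rule lcomodule_cofree) simp_all

lemmas [simp] = lcomodule_arr[OF lcomodule_cofreeI] hopf[OF rmodule_A lcomodule_cofreeI]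
  hopf_map_arr[OF morphism_arr(2)[OF \<pi>] rmodule_A lcomodule_cofreeI]

lemma theta_arr [simp]: "Ar theta" "dom theta = (obj A \<bullet> obj H) \<bullet> I" "cod theta = obj A \<bullet> I"
  by (simp_all add: theta_def)

lemma dI_counit: "l\<^sub>b I \<cdot> (counit H \<bullet> I) \<cdot> dI = I"
  by (simp add: dI_def bull.tensor_comp_reduce bimonoid.counit_unit DelI_counit_left)

text \<open>The cofree coaction duplicates the unit (\<open>cd\<close>), and the unit of
  \<open>H\<close> acts trivially. Hence the Hopf map carries the unit inserted in the comodule to
  the unit inserted beside \<open>A\<close>, and the counit then removes it.\<close>

lemma theta_j: "theta \<cdot> jI = X\<^sub>A \<bullet> I"
proof -
  let ?B = "hopf_map H X\<^sub>A modA (X\<^sub>H \<bullet> I) cofreeI"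
  have cd: "cofreeI \<cdot> dI = (unt H \<bullet> dI) \<cdot> \<Delta>\<^sub>I"
  proof -
    have "cofreeI \<cdot> dI = a\<^sub>b X\<^sub>H X\<^sub>H I \<cdot> ((unt H \<bullet> unt H) \<bullet> I) \<cdot> (\<Delta>\<^sub>I \<bullet> I) \<cdot> \<Delta>\<^sub>I"
      by (simp add: cofreeI_def dI_def merge bimonoid.comult_unit)
    also have "\<dots> = (unt H \<bullet> (unt H \<bullet> I)) \<cdot> (I \<bullet> \<Delta>\<^sub>I) \<cdot> \<Delta>\<^sub>I"
      using red[OF bull.assoc_nat[of "unt H" "unt H" I]] by (simp add: DelI_assoc)
    also have "\<dots> = (unt H \<bullet> dI) \<cdot> \<Delta>\<^sub>I"
      by (simp add: dI_def merge)
    finally show ?thesis .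
  qed
  have "?B \<cdot> ((X\<^sub>A \<bullet> I) \<odot> dI) = (modA \<bullet> l\<^sub>o (X\<^sub>H \<bullet> I)) \<cdot> \<zeta> X\<^sub>A I X\<^sub>H (X\<^sub>H \<bullet> I) \<cdot> ((X\<^sub>A \<bullet> I) \<odot> (unt H \<bullet> dI)) \<cdot> ((X\<^sub>A \<bullet> I) \<odot> \<Delta>\<^sub>I)"
    by (simp add: hopf_map_def circ.tensor_comp cd)
  also have "\<dots> = ((modA \<cdot> (X\<^sub>A \<odot> unt H)) \<bullet> (l\<^sub>o (X\<^sub>H \<bullet> I) \<cdot> (I \<odot> dI))) \<cdot> \<zeta> X\<^sub>A I I I \<cdot> ((X\<^sub>A \<bullet> I) \<odot> \<Delta>\<^sub>I)"
    using red[OF zeta_nat[of X\<^sub>A I "unt H" dI]] by (simp add: bull.tensor_comp_reduce)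
  also have "\<dots> = (X\<^sub>A \<bullet> dI) \<cdot> (r\<^sub>o X\<^sub>A \<bullet> r\<^sub>o I) \<cdot> \<zeta> X\<^sub>A I I I \<cdot> ((X\<^sub>A \<bullet> I) \<odot> \<Delta>\<^sub>I)"
    using circ.lunit_nat[of dI] rmodule_laws(1)[OF rmodule_A]
    by (simp add: bull.tensor_comp_reduce circ.lunit_eq_runit)
  also have "\<dots> = (X\<^sub>A \<bullet> dI) \<cdot> r\<^sub>o (X\<^sub>A \<bullet> I)"
    by (simp add: zeta_runit_o)
  finally have "?B \<cdot> ((X\<^sub>A \<bullet> I) \<odot> dI) = (X\<^sub>A \<bullet> dI) \<cdot> r\<^sub>o (X\<^sub>A \<bullet> I)" .
  then have "(?B \<cdot> ((X\<^sub>A \<bullet> I) \<odot> dI)) \<cdot> Inv (r\<^sub>o (X\<^sub>A \<bullet> I)) = ((X\<^sub>A \<bullet> dI) \<cdot> r\<^sub>o (X\<^sub>A \<bullet> I)) \<cdot> Inv (r\<^sub>o (X\<^sub>A \<bullet> I))"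
    by simp
  then have *: "X\<^sub>A \<bullet> dI = ?B \<cdot> ((X\<^sub>A \<bullet> I) \<odot> dI) \<cdot> Inv (r\<^sub>o (X\<^sub>A \<bullet> I))"
    by simp
  show ?thesis
    unfolding theta_def jI_def by (simp add: * circ.tensor_comp_reduce dI_counit)
qed

text \<open>The projection \<open>a \<mapsto> a_1 \<sigma>(\<Sigma>(\<pi> a_2))\<close> onto the
  coinvariants of \<open>A\<close>. It is idempotent by \<open>nu_varpi\<close> and
  \<open>theta_j\<close>.\<close>

definition varpi where "varpi = theta \<cdot> (nu \<bullet> I)"

lemma varpi_arr [simp]: "Ar varpi" "dom varpi = obj A \<bullet> I" "cod varpi = obj A \<bullet> I"
  by (simp_all add: varpi_def)

text \<open>\<open>hopf_lift\<close> for the cofree comodule, applied to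
  \<open>nu \<bullet> I\<close> rebracketed, where the premise is the coassociativity
  \<open>nu_coassoc\<close>. Applying the counit to the comodule on both sides leaves
  \<open>varpi\<close>.\<close>

lemma nu_varpi: "(nu \<bullet> I) \<cdot> varpi = jI \<cdot> varpi"
proof -
  let ?T = "X\<^sub>H \<bullet> I"
  let ?e = "a\<^sub>b X\<^sub>A X\<^sub>H I \<cdot> (nu \<bullet> I)"
  let ?w = "Inv (hopf_map H X\<^sub>A modA ?T cofreeI) \<cdot> ?e"
  let ?\<eta> = "l\<^sub>b I \<cdot> (counit H \<bullet> I)"
  have "(nu \<bullet> ?T) \<cdot> ?e = a\<^sub>b (X\<^sub>A \<bullet> X\<^sub>H) X\<^sub>H I \<cdot> (((nu \<bullet> X\<^sub>H) \<cdot> nu) \<bullet> I)"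
    using red[OF bull.assoc_nat[of nu X\<^sub>H I, symmetric]] by (simp add: bull.whisker_right)
  also have "\<dots> = Inv (a\<^sub>b X\<^sub>A X\<^sub>H (X\<^sub>H \<bullet> I)) \<cdot> (a\<^sub>b X\<^sub>A X\<^sub>H (X\<^sub>H \<bullet> I) \<cdot> a\<^sub>b (X\<^sub>A \<bullet> X\<^sub>H) X\<^sub>H I)
      \<cdot> ((Inv (a\<^sub>b X\<^sub>A X\<^sub>H X\<^sub>H) \<cdot> (X\<^sub>A \<bullet> comult H) \<cdot> nu) \<bullet> I)"
    by (simp add: nu_coassoc)
  also have "\<dots> = Inv (a\<^sub>b X\<^sub>A X\<^sub>H (X\<^sub>H \<bullet> I)) \<cdot> (X\<^sub>A \<bullet> a\<^sub>b X\<^sub>H X\<^sub>H I) \<cdot> a\<^sub>b X\<^sub>A (X\<^sub>H \<bullet> X\<^sub>H) I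
      \<cdot> ((X\<^sub>A \<bullet> comult H) \<bullet> I) \<cdot> (nu \<bullet> I)"
    by (subst bull.pentagon[symmetric]) (simp_all add: bull.tensor_comp)
  also have "\<dots> = Inv (a\<^sub>b X\<^sub>A X\<^sub>H ?T) \<cdot> (X\<^sub>A \<bullet> cofreeI) \<cdot> ?e"
    using red[OF bull.assoc_nat[of X\<^sub>A "comult H" I]] by (simp add: cofreeI_def bull.whisker_left)
  finally have "((nu \<bullet> I) \<odot> ?T) \<cdot> ?w = (jI \<odot> ?T) \<cdot> ?w"
    by (intro hopf_lift[OF lcomodule_cofreeI]) simp_all
  then have "(r\<^sub>o ((X\<^sub>A \<bullet> X\<^sub>H) \<bullet> I) \<cdot> (((X\<^sub>A \<bullet> X\<^sub>H) \<bullet> I) \<odot> ?\<eta>)) \<cdot> ((nu \<bullet> I) \<odot> ?T) \<cdot> ?w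
    = (r\<^sub>o ((X\<^sub>A \<bullet> X\<^sub>H) \<bullet> I) \<cdot> (((X\<^sub>A \<bullet> X\<^sub>H) \<bullet> I) \<odot> ?\<eta>)) \<cdot> (jI \<odot> ?T) \<cdot> ?w"
    by simp
  moreover have "(r\<^sub>o ((X\<^sub>A \<bullet> X\<^sub>H) \<bullet> I) \<cdot> (((X\<^sub>A \<bullet> X\<^sub>H) \<bullet> I) \<odot> ?\<eta>)) \<cdot> (f \<odot> ?T) \<cdot> ?w = f \<cdot> varpi"
    if [simp]: "Ar f" "dom f = X\<^sub>A \<bullet> I" "cod f = (X\<^sub>A \<bullet> X\<^sub>H) \<bullet> I" for f
  proof -
    have "(r\<^sub>o ((X\<^sub>A \<bullet> X\<^sub>H) \<bullet> I) \<cdot> (((X\<^sub>A \<bullet> X\<^sub>H) \<bullet> I) \<odot> ?\<eta>)) \<cdot> (f \<odot> ?T) \<cdot> ?w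
      = r\<^sub>o ((X\<^sub>A \<bullet> X\<^sub>H) \<bullet> I) \<cdot> (f \<odot> I) \<cdot> ((X\<^sub>A \<bullet> I) \<odot> ?\<eta>) \<cdot> ?w"
      by (simp add: circ.tensor_comp_reduce)
    also have "\<dots> = f \<cdot> varpi"
      using red[OF circ.runit_nat[of f]] by (simp add: varpi_def theta_def)
    finally show ?thesis .
  qed
  ultimately show ?thesis by simp
qed

text \<open>\<open>?p\<close> removes \<open>I\<close> by means of
  \<open>\<epsilon>\<^sub>I\<close>, and with \<open>nu_varpi\<close> it shows that
  \<open>(X\<^sub>A \<bullet> unt H) \<cdot> varpi\<close> factors through \<open>nu\<close>. The
  double braiding fixes \<open>nu\<close>, by cocommutativity of \<open>A\<close>, and by naturality
  it commutes with \<open>X\<^sub>A \<bullet> unt H\<close>, which is monic and can be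
  cancelled.\<close>

lemma dbl_varpi: "dbl (obj A) I \<cdot> varpi = varpi"
proof -
  let ?g = "r\<^sub>b X\<^sub>A \<cdot> (X\<^sub>A \<bullet> \<epsilon>\<^sub>I) \<cdot> varpi"
  let ?p = "r\<^sub>b (X\<^sub>A \<bullet> X\<^sub>H) \<cdot> ((X\<^sub>A \<bullet> X\<^sub>H) \<bullet> \<epsilon>\<^sub>I)"
  have "?p \<cdot> jI = r\<^sub>b (X\<^sub>A \<bullet> X\<^sub>H) \<cdot> Inv (a\<^sub>b X\<^sub>A X\<^sub>H J) \<cdot> (X\<^sub>A \<bullet> ((X\<^sub>H \<bullet> \<epsilon>\<^sub>I) \<cdot> dI))"
    using red[OF bull.assoc_inv_nat[of X\<^sub>A X\<^sub>H \<epsilon>\<^sub>I, symmetric]] by (simp add: jI_def bull.whisker_left)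
  also have "\<dots> = X\<^sub>A \<bullet> (r\<^sub>b X\<^sub>H \<cdot> (X\<^sub>H \<bullet> \<epsilon>\<^sub>I) \<cdot> dI)"
    by (simp add: bull.runit_tensor[symmetric] bull.whisker_left)
  also have "r\<^sub>b X\<^sub>H \<cdot> (X\<^sub>H \<bullet> \<epsilon>\<^sub>I) \<cdot> dI = r\<^sub>b X\<^sub>H \<cdot> (unt H \<bullet> J) \<cdot> (I \<bullet> \<epsilon>\<^sub>I) \<cdot> \<Delta>\<^sub>I"
    by (simp add: dI_def merge)
  also have "\<dots> = unt H"
    using red[OF bull.runit_nat[of "unt H"]] by (simp add: DelI_counit_right)
  finally have pj: "?p \<cdot> jI = X\<^sub>A \<bullet> unt H" .
  have "(X\<^sub>A \<bullet> unt H) \<cdot> varpi = ?p \<cdot> (nu \<bullet> I) \<cdot> varpi"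
    unfolding nu_varpi pj[symmetric] by simp
  also have "\<dots> = r\<^sub>b (X\<^sub>A \<bullet> X\<^sub>H) \<cdot> (nu \<bullet> J) \<cdot> (X\<^sub>A \<bullet> \<epsilon>\<^sub>I) \<cdot> varpi"
    by (simp add: bull.tensor_comp_reduce)
  also have "\<dots> = nu \<cdot> ?g"
    using red[OF bull.runit_nat[of nu]] by simp
  finally have g: "(X\<^sub>A \<bullet> unt H) \<cdot> varpi = nu \<cdot> ?g" .
  have "(X\<^sub>A \<bullet> unt H) \<cdot> dbl X\<^sub>A I \<cdot> varpi = dbl X\<^sub>A X\<^sub>H \<cdot> (X\<^sub>A \<bullet> unt H) \<cdot> varpi"
    using red[OF dbl_nat[of X\<^sub>A "unt H"]] by simp
  also have "\<dots> = (X\<^sub>A \<bullet> unt H) \<cdot> varpi"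
    unfolding g using red[OF dbl_nu, of ?g] by simp
  finally show ?thesis
    by (rule circ.mono_cancel[OF mono_u, rotated -1]) simp_all
qed

text \<open>Along the Hopf isomorphism \<open>?B\<close> the double braiding becomes
  \<open>dbl X\<^sub>A I \<odot> T\<close>, because it fixes \<rho>. The preimage \<open>?s\<close>
  of \<open>e\<close> is fixed by \<open>varpi \<odot> T\<close>, and \<open>dbl_varpi\<close>
  finishes.\<close>

lemma dbl_relative_product:
  assumes T: "lcomodule H T \<rho>" and dT: "dbl X\<^sub>H T \<cdot> \<rho> = \<rho>"
    and e: "Ar e" "cod e = X\<^sub>A \<bullet> T"
    and eq: "(((X\<^sub>A \<bullet> \<pi>) \<cdot> comult A) \<bullet> T) \<cdot> e = Inv (a\<^sub>b X\<^sub>A X\<^sub>H T) \<cdot> (X\<^sub>A \<bullet> \<rho>) \<cdot> e"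
  shows "dbl X\<^sub>A T \<cdot> e = e"
proof -
  let ?B = "hopf_map H X\<^sub>A modA T \<rho>"
  note [simp] = e lcomodule_arr[OF T] hopf[OF rmodule_A T] hopf_map_arr[OF _ rmodule_A T]
  let ?s = "Inv ?B \<cdot> e"
  \<comment> \<open>On \<open>?s\<close> the arrow \<open>nu \<bullet> I\<close> may be exchanged
    for \<open>jI\<close> by \<open>hopf_lift\<close>, and \<open>theta\<close> retracts
    \<open>jI\<close>.\<close>
  have "(varpi \<odot> T) \<cdot> ?s = (theta \<odot> T) \<cdot> ((nu \<bullet> I) \<odot> T) \<cdot> ?s"
    by (simp add: varpi_def circ.tensor_comp_reduce)
  also have "\<dots> = ((theta \<cdot> jI) \<odot> T) \<cdot> ?s"
    unfolding hopf_lift[OF T e eq[folded nu_def]] by (simp add: circ.tensor_comp_reduce)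
  finally have s: "(varpi \<odot> T) \<cdot> ?s = ?s"
    by (simp add: theta_j)
  have "dbl X\<^sub>A T \<cdot> ?B = (modA \<bullet> l\<^sub>o T) \<cdot> dbl (X\<^sub>A \<odot> X\<^sub>H) (I \<odot> T) \<cdot> \<zeta> X\<^sub>A I X\<^sub>H T \<cdot> ((X\<^sub>A \<bullet> I) \<odot> \<rho>)"
    using red[OF dbl_nat[of modA "l\<^sub>o T"]] by (simp add: hopf_map_def)
  also have "\<dots> = (modA \<bullet> l\<^sub>o T) \<cdot> \<zeta> X\<^sub>A I X\<^sub>H T \<cdot> (dbl X\<^sub>A I \<odot> (dbl X\<^sub>H T \<cdot> \<rho>))"
    using red[OF dbl_zeta[of X\<^sub>A I X\<^sub>H T]] by (simp add: circ.tensor_comp)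
  also have "\<dots> = ?B \<cdot> (dbl X\<^sub>A I \<odot> T)"
    unfolding dT by (simp add: hopf_map_def circ.tensor_comp)
  finally have B: "dbl X\<^sub>A T \<cdot> ?B = ?B \<cdot> (dbl X\<^sub>A I \<odot> T)" .
  have "dbl X\<^sub>A T \<cdot> e = dbl X\<^sub>A T \<cdot> ?B \<cdot> ?s"
    by simp
  also have "\<dots> = ?B \<cdot> (dbl X\<^sub>A I \<odot> T) \<cdot> (varpi \<odot> T) \<cdot> ?s"
    unfolding s by (subst red[OF B]) simp_all
  also have "\<dots> = ?B \<cdot> ((dbl X\<^sub>A I \<cdot> varpi) \<odot> T) \<cdot> ?s"
    by (simp add: circ.tensor_comp_reduce)
  also have "\<dots> = e"
    unfolding dbl_varpi s by simp
  finally show ?thesis .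
qed

end

end

section \<open>Comonoids in a braided monoidal category\<close>

context category
begin

lemma pullbackD:
  assumes "is_pullback C f g p q"
  shows "f \<in> Arr C" "g \<in> Arr C" "Cod C g = Cod C f" "p \<in> Arr C" "q \<in> Arr C" "Dom C q = Dom C p"
    "Cod C p = Dom C f" "Cod C q = Dom C g" "Comp C f p = Comp C g q"
  using assms unfolding is_pullback_def hom_def by auto

lemma pullback_factor:
  assumes "is_pullback C f g e e" "x \<in> Arr C" "Cod C x = Dom C f" "Comp C f x = Comp C g x"
  shows "\<exists>!h. h \<in> Arr C \<and> Dom C h = Dom C x \<and> Cod C h = Dom C e \<and> Comp C e h = x"
proof -
  obtain P where P: "e \<in> hom C P (Dom C f)"
    "\<And>Q x y. x \<in> hom C Q (Dom C f) \<and> y \<in> hom C Q (Dom C g) \<and> Comp C f x = Comp C g y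
      \<Longrightarrow> \<exists>!h. h \<in> hom C Q P \<and> Comp C e h = x \<and> Comp C e h = y"
    using assms(1) unfolding is_pullback_def by blast
  have "\<exists>!h. h \<in> hom C (Dom C x) P \<and> Comp C e h = x \<and> Comp C e h = x"
    using assms(2-4) pullbackD[OF assms(1)] by (intro P(2)) (auto simp: hom_def)
  then show ?thesis
    using P(1) by (auto simp: hom_def)
qed

lemma pullback_mono:
  assumes "is_pullback C f g e e"
  shows "mono_arr C e"
proof (rule monoI)
  have e: "f \<in> Arr C" "g \<in> Arr C" "e \<in> Arr C" "Cod C e = Dom C f" "Dom C g = Dom C f" "Comp C f e = Comp C g e"
    using pullbackD[OF assms] by simp_all
  note [simp] = e(1-5)
  show "e \<in> Arr C" by simp
  fix h k
  assume hk: "h \<in> Arr C" "k \<in> Arr C" "Cod C h = Dom C e" "Cod C k = Dom C e" "Dom C h = Dom C k"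
    and eq: "Comp C e h = Comp C e k"
  have "\<exists>!h'. h' \<in> Arr C \<and> Dom C h' = Dom C (Comp C e h) \<and> Cod C h' = Dom C e \<and> Comp C e h' = Comp C e h"
    using hk comp_reduce[OF e(6), of h] by (intro pullback_factor[OF assms]) simp_all
  moreover have "h \<in> Arr C \<and> Dom C h = Dom C (Comp C e h) \<and> Cod C h = Dom C e \<and> Comp C e h = Comp C e h"
    "k \<in> Arr C \<and> Dom C k = Dom C (Comp C e h) \<and> Cod C k = Dom C e \<and> Comp C e k = Comp C e h"
    using hk eq by simp_all
  ultimately show "h = k" by blast
qed

text \<open>The common retraction \<open>k\<close> makes both arrows split monomorphisms, so their
  intersection exists; its projections agree since \<open>p = k f p = k g q = q\<close>.\<close>

lemma coreflexive_equalizer: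
  assumes "has_binary_intersections C"
    and f: "f \<in> Arr C" "g \<in> Arr C" "Dom C g = Dom C f" "Cod C g = Cod C f"
    and k: "k \<in> Arr C" "Dom C k = Cod C f" "Comp C k f = Dom C f" "Comp C k g = Dom C f"
  shows "\<exists>e. is_pullback C f g e e"
proof -
  have "mono_arr C f" "mono_arr C g"
    using f k by (auto intro: split_mono[where k=k])
  then obtain p q where pq: "is_pullback C f g p q"
    using assms(1) f unfolding has_binary_intersections_def has_pullback_def by metis
  note [simp] = pullbackD(1-8)[OF pq] f(3) k(1,2)
  have "p = Comp C (Comp C k f) p"
    by (simp only: k(3)) simp
  also have "\<dots> = Comp C (Comp C k g) q"
    using pullbackD(9)[OF pq] by simp
  also have "\<dots> = q"
    by (simp only: k(4)) (simp add: f(3)[symmetric] del: f(3))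
  finally show ?thesis using pq by auto
qed

lemma pullback_self:
  assumes "mono_arr C f"
  shows "is_pullback C f f (Dom C f) (Dom C f)"
  unfolding is_pullback_def
proof (intro conjI exI[of _ "Dom C f"] allI impI)
  note [simp] = mono_is_arr[OF assms]
  show "f \<in> Arr C" "Cod C f = Cod C f" "Comp C f (Dom C f) = Comp C f (Dom C f)" by simp_all
  show "f \<in> Arr C" by simp
  show "Dom C f \<in> hom C (Dom C f) (Dom C f)" by (simp add: hom_def)
  show "Dom C f \<in> hom C (Dom C f) (Dom C f)" by (simp add: hom_def)
  fix Q x y
  assume *: "x \<in> hom C Q (Dom C f) \<and> y \<in> hom C Q (Dom C f) \<and> Comp C f x = Comp C f y"
  then have "x = y"
    using assms unfolding mono_arr_def by blast
  moreover have "Comp C (Dom C f) h = h" if "h \<in> hom C Q (Dom C f)" for h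
    using that by (simp add: hom_def)
  ultimately show "\<exists>!h. h \<in> hom C Q (Dom C f) \<and> Comp C (Dom C f) h = x \<and> Comp C (Dom C f) h = y"
    using * by metis
qed

text \<open>An arrow is monic if its pullback along itself is a pair of identities; for a
  monomorphism this pullback is a binary intersection, hence preserved.\<close>

lemma preserves_mono:
  assumes "preserves_binary_intersections C F" "mono_arr C f" "F (Dom C f) \<in> Ob C"
  shows "mono_arr C (F f)"
proof -
  have pb: "is_pullback C (F f) (F f) (F (Dom C f)) (F (Dom C f))"
    using assms(1,2) pullback_self[OF assms(2)] unfolding preserves_binary_intersections_def by blast
  have D: "Dom C (F f) = F (Dom C f)"
    using pullbackD(7)[OF pb] assms(3) by simp
  show ?thesis
  proof (rule monoI)
    show "F f \<in> Arr C" using pullbackD(1)[OF pb] .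
    fix g h
    assume gh: "g \<in> Arr C" "h \<in> Arr C" "Cod C g = Dom C (F f)" "Cod C h = Dom C (F f)"
      "Dom C g = Dom C h" "Comp C (F f) g = Comp C (F f) h"
    obtain P where P: "F (Dom C f) \<in> hom C P (Dom C (F f))"
      "\<And>Q x y. x \<in> hom C Q (Dom C (F f)) \<and> y \<in> hom C Q (Dom C (F f)) \<and> Comp C (F f) x = Comp C (F f) y
      \<Longrightarrow> \<exists>!h. h \<in> hom C Q P \<and> Comp C (F (Dom C f)) h = x \<and> Comp C (F (Dom C f)) h = y"
      using pb unfolding is_pullback_def by blast
    have "\<exists>!k. k \<in> hom C (Dom C g) P \<and> Comp C (F (Dom C f)) k = g \<and> Comp C (F (Dom C f)) k = h"
      using gh by (intro P(2)) (auto simp: hom_def)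
    then show "g = h" by auto
  qed
qed

end

section \<open>A calculus of rebracketed comultiplications, counits and braidings\<close>

context monoidal_category
begin

text \<open>
  The arrows \<open>hat Y Y' d Z\<close>, \<open>kill e Z\<close> and \<open>ch X Y Z\<close> are \<open>d \<otimes> Z\<close>, \<open>e \<otimes> Z\<close> and \<open>c \<otimes> Z\<close> rebracketed to
  the right. Calculating with them in right-nested tensor products keeps associators out of sight.
\<close>

definition hat where
  "hat Y Y' d Z = a Y Y' Z \<cdot> (d \<otimes> Z)"

definition kill where
  "kill e Z = l Z \<cdot> (e \<otimes> Z)"

lemma hat_arr [simp]:
  assumes "d \<in> Arr C" "Cod C d = Y \<otimes> Y'" "ob Y" "ob Y'" "ob Z"
  shows "hat Y Y' d Z \<in> Arr C" "Dom C (hat Y Y' d Z) = Dom C d \<otimes> Z" "Cod C (hat Y Y' d Z) = Y \<otimes> (Y' \<otimes> Z)"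
  using assms by (simp_all add: hat_def)

lemma kill_arr [simp]:
  assumes "e \<in> Arr C" "Cod C e = I" "ob Z"
  shows "kill e Z \<in> Arr C" "Dom C (kill e Z) = Dom C e \<otimes> Z" "Cod C (kill e Z) = Z"
  using assms by (simp_all add: kill_def)

lemma hat_nat:
  assumes [simp]: "d \<in> Arr C" "Cod C d = Y \<otimes> Y'" "ob Y" "ob Y'" "g \<in> Arr C"
  shows "hat Y Y' d (Cod C g) \<cdot> (Dom C d \<otimes> g) = (Y \<otimes> (Y' \<otimes> g)) \<cdot> hat Y Y' d (Dom C g)"
proof -
  have "hat Y Y' d (Cod C g) \<cdot> (Dom C d \<otimes> g) = a Y Y' (Cod C g) \<cdot> ((Y \<otimes> Y') \<otimes> g) \<cdot> (d \<otimes> Dom C g)"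
    by (simp add: hat_def tensor_comp)
  also have "\<dots> = (Y \<otimes> (Y' \<otimes> g)) \<cdot> hat Y Y' d (Dom C g)"
    using comp_reduce[OF assoc_nat[of Y Y' g]] by (simp add: hat_def)
  finally show ?thesis .
qed

lemma hat_post:
  assumes [simp]: "d \<in> Arr C" "Cod C d = Dom C u \<otimes> Dom C v" "u \<in> Arr C" "v \<in> Arr C" "ob Z"
  shows "(u \<otimes> (v \<otimes> Z)) \<cdot> hat (Dom C u) (Dom C v) d Z = hat (Cod C u) (Cod C v) ((u \<otimes> v) \<cdot> d) Z"
  using comp_reduce[OF assoc_nat[of u v Z]] by (simp add: hat_def whisker_right)

lemma kill_nat:
  assumes [simp]: "e \<in> Arr C" "Cod C e = I" "g \<in> Arr C"
  shows "kill e (Cod C g) \<cdot> (Dom C e \<otimes> g) = g \<cdot> kill e (Dom C g)"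
  using comp_reduce[OF lunit_nat[of g], of "e \<otimes> Dom C g"] by (simp add: kill_def tensor_comp)

lemma hat_tail:
  assumes [simp]: "d \<in> Arr C" "Cod C d = Y \<otimes> Y'" "ob Y" "ob Y'" "ob Z" "ob W"
  shows "(Y \<otimes> a Y' Z W) \<cdot> a Y (Y' \<otimes> Z) W \<cdot> (hat Y Y' d Z \<otimes> W) = hat Y Y' d (Z \<otimes> W) \<cdot> a (Dom C d) Z W"
proof -
  have "(Y \<otimes> a Y' Z W) \<cdot> a Y (Y' \<otimes> Z) W \<cdot> (hat Y Y' d Z \<otimes> W)
    = ((Y \<otimes> a Y' Z W) \<cdot> a Y (Y' \<otimes> Z) W \<cdot> (a Y Y' Z \<otimes> W)) \<cdot> ((d \<otimes> Z) \<otimes> W)"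
    by (simp add: hat_def whisker_right)
  also have "\<dots> = a Y Y' (Z \<otimes> W) \<cdot> a (Y \<otimes> Y') Z W \<cdot> ((d \<otimes> Z) \<otimes> W)"
    by (subst pentagon) simp_all
  also have "\<dots> = hat Y Y' d (Z \<otimes> W) \<cdot> a (Dom C d) Z W"
    using assoc_nat[of d Z W] by (simp add: hat_def)
  finally show ?thesis .
qed

lemma pentagon_inv:
  assumes [simp]: "ob W" "ob X" "ob Y" "ob Z"
  shows "a (W \<otimes> X) Y Z \<cdot> (Inv (a W X Y) \<otimes> Z) = Inv (a W X (Y \<otimes> Z)) \<cdot> (W \<otimes> a X Y Z) \<cdot> a W (X \<otimes> Y) Z"
proof (rule iso_cancel_left[of "a W X (Y \<otimes> Z)"])
  have "a W X (Y \<otimes> Z) \<cdot> a (W \<otimes> X) Y Z \<cdot> (Inv (a W X Y) \<otimes> Z)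
    = (a W X (Y \<otimes> Z) \<cdot> a (W \<otimes> X) Y Z) \<cdot> (Inv (a W X Y) \<otimes> Z)" by simp
  also have "\<dots> = (W \<otimes> a X Y Z) \<cdot> a W (X \<otimes> Y) Z"
    by (subst pentagon[symmetric]) (simp_all add: tensor_comp)
  finally show "a W X (Y \<otimes> Z) \<cdot> a (W \<otimes> X) Y Z \<cdot> (Inv (a W X Y) \<otimes> Z)
    = a W X (Y \<otimes> Z) \<cdot> Inv (a W X (Y \<otimes> Z)) \<cdot> (W \<otimes> a X Y Z) \<cdot> a W (X \<otimes> Y) Z"
    by simp
qed simp_all

lemma pentagon_inv':
  assumes [simp]: "ob W" "ob X" "ob Y" "ob Z"
  shows "a W (X \<otimes> Y) Z \<cdot> (a W X Y \<otimes> Z) \<cdot> Inv (a (W \<otimes> X) Y Z) = (W \<otimes> Inv (a X Y Z)) \<cdot> a W X (Y \<otimes> Z)"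
proof (rule iso_cancel_left[of "W \<otimes> a X Y Z"])
  have "(W \<otimes> a X Y Z) \<cdot> a W (X \<otimes> Y) Z \<cdot> (a W X Y \<otimes> Z) \<cdot> Inv (a (W \<otimes> X) Y Z)
    = ((W \<otimes> a X Y Z) \<cdot> a W (X \<otimes> Y) Z \<cdot> (a W X Y \<otimes> Z)) \<cdot> Inv (a (W \<otimes> X) Y Z)" by simp
  also have "\<dots> = a W X (Y \<otimes> Z)"
    by (subst pentagon) simp_all
  finally show "(W \<otimes> a X Y Z) \<cdot> a W (X \<otimes> Y) Z \<cdot> (a W X Y \<otimes> Z) \<cdot> Inv (a (W \<otimes> X) Y Z)
    = (W \<otimes> a X Y Z) \<cdot> (W \<otimes> Inv (a X Y Z)) \<cdot> a W X (Y \<otimes> Z)"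
    by (simp add: tensor_comp_reduce)
qed simp_all

lemma pentagon_inv3:
  assumes [simp]: "ob W" "ob X" "ob Y" "ob Z"
  shows "(Inv (a W X Y) \<otimes> Z) \<cdot> Inv (a W (X \<otimes> Y) Z) \<cdot> (W \<otimes> Inv (a X Y Z)) = Inv (a (W \<otimes> X) Y Z) \<cdot> Inv (a W X (Y \<otimes> Z))"
proof (rule iso_cancel_left[of "a (W \<otimes> X) Y Z"])
  show "a (W \<otimes> X) Y Z \<cdot> (Inv (a W X Y) \<otimes> Z) \<cdot> Inv (a W (X \<otimes> Y) Z) \<cdot> (W \<otimes> Inv (a X Y Z))
    = a (W \<otimes> X) Y Z \<cdot> Inv (a (W \<otimes> X) Y Z) \<cdot> Inv (a W X (Y \<otimes> Z))"
    using comp_reduce[OF pentagon_inv[of W X Y Z], of "Inv (a W (X \<otimes> Y) Z) \<cdot> (W \<otimes> Inv (a X Y Z))"]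
    by (simp add: tensor_comp)
qed simp_all

end

context braided_monoidal_category
begin

lemma braiding_arr [simp]:
  assumes "ob X" "ob Y"
  shows "c X Y \<in> Arr C" "Dom C (c X Y) = X \<otimes> Y" "Cod C (c X Y) = Y \<otimes> X" "iso_arr C (c X Y)"
  using braiding_in_hom[OF assms] braiding_iso[OF assms] by (auto dest: homD)

lemma braiding_nat:
  assumes "f \<in> Arr C" "g \<in> Arr C"
  shows "c (Cod C f) (Cod C g) \<cdot> (f \<otimes> g) = (g \<otimes> f) \<cdot> c (Dom C f) (Dom C g)"
  using assms by (intro braiding_natural) (auto intro!: homI)

text \<open>The definition of a braiding does not state this. The arrow \<open>k\<close> measures
  the failure, and \<open>hexagon2\<close> at \<open>I\<close>, \<open>I\<close>, \<open>B\<close>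
  shows that \<open>k \<otimes> I\<close> is an identity.\<close>

lemma braiding_unit_left:
  assumes [simp]: "ob B"
  shows "r B \<cdot> c I B = l B"
proof -
  define k where "k = r B \<cdot> c I B \<cdot> Inv (l B)"
  have [simp]: "k \<in> Arr C" "Dom C k = B" "Cod C k = B" by (simp_all add: k_def)
  have kl: "r B \<cdot> c I B = k \<cdot> l B" by (simp add: k_def)
  have "c (I \<otimes> I) B = a B I I \<cdot> (Inv (a B I I) \<cdot> c (I \<otimes> I) B \<cdot> Inv (a I I B)) \<cdot> a I I B"
    by simp
  also have "\<dots> = a B I I \<cdot> (c I B \<otimes> I) \<cdot> Inv (a I B I) \<cdot> (I \<otimes> c I B) \<cdot> a I I B"
    by (subst hexagon2) simp_all
  finally have "(B \<otimes> l I) \<cdot> c (I \<otimes> I) B = (B \<otimes> l I) \<cdot> a B I I \<cdot> (c I B \<otimes> I) \<cdot> Inv (a I B I) \<cdot> (I \<otimes> c I B) \<cdot> a I I B"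
    by simp
  also have "\<dots> = ((r B \<cdot> c I B) \<otimes> I) \<cdot> Inv (a I B I) \<cdot> (I \<otimes> c I B) \<cdot> a I I B"
    using comp_reduce[OF triangle[of B I]] by (simp add: tensor_comp_reduce)
  also have "\<dots> = (k \<otimes> I) \<cdot> (l B \<otimes> I) \<cdot> Inv (a I B I) \<cdot> (I \<otimes> c I B) \<cdot> a I I B"
    unfolding kl by (simp add: tensor_comp_reduce)
  also have "\<dots> = (k \<otimes> I) \<cdot> l (B \<otimes> I) \<cdot> (I \<otimes> c I B) \<cdot> a I I B"
    by (simp add: lunit_tensor[symmetric])
  also have "\<dots> = (k \<otimes> I) \<cdot> c I B \<cdot> l (I \<otimes> B) \<cdot> a I I B"
    using comp_reduce[OF lunit_nat[of "c I B"]] by simp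
  also have "\<dots> = (k \<otimes> I) \<cdot> c I B \<cdot> (l I \<otimes> B)"
    by (simp add: lunit_tensor)
  finally have "(k \<otimes> I) \<cdot> c I B \<cdot> (l I \<otimes> B) = (B \<otimes> I) \<cdot> c I B \<cdot> (l I \<otimes> B)"
    using braiding_nat[of "l I" B] by simp
  then have "k \<otimes> I = B \<otimes> I"
  proof (rule iso_cancel_right[of "c I B \<cdot> (l I \<otimes> B)", rotated -1])
    show "iso_arr C (c I B \<cdot> (l I \<otimes> B))"
      by (rule iso_arrI(1)[where g="(Inv (l I) \<otimes> B) \<cdot> Inv (c I B)"]) (simp_all add: tensor_comp tensor_comp_reduce)
  qed simp_all
  then have "k = B" by (rule runit_faithful[rotated -1]) simp_all
  then show ?thesis using kl by simp
qed

lemma braiding_unit_right: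
  assumes [simp]: "ob A"
  shows "l A \<cdot> c A I = r A"
proof -
  define k where "k = l A \<cdot> c A I \<cdot> Inv (r A)"
  have [simp]: "k \<in> Arr C" "Dom C k = A" "Cod C k = A" by (simp_all add: k_def)
  have kl: "l A \<cdot> c A I = k \<cdot> r A" by (simp add: k_def)
  have "c A (I \<otimes> I) = Inv (a I I A) \<cdot> (a I I A \<cdot> c A (I \<otimes> I) \<cdot> a A I I) \<cdot> Inv (a A I I)"
    by simp
  also have "\<dots> = Inv (a I I A) \<cdot> (I \<otimes> c A I) \<cdot> a I A I \<cdot> (c A I \<otimes> I) \<cdot> Inv (a A I I)"
    by (subst hexagon1) simp_all
  finally have "(r I \<otimes> A) \<cdot> c A (I \<otimes> I) = (r I \<otimes> A) \<cdot> Inv (a I I A) \<cdot> (I \<otimes> c A I) \<cdot> a I A I \<cdot> (c A I \<otimes> I) \<cdot> Inv (a A I I)"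
    by simp
  also have "\<dots> = (I \<otimes> (l A \<cdot> c A I)) \<cdot> a I A I \<cdot> (c A I \<otimes> I) \<cdot> Inv (a A I I)"
    by (simp add: triangle[symmetric] whisker_left)
  also have "\<dots> = (I \<otimes> k) \<cdot> (I \<otimes> r A) \<cdot> a I A I \<cdot> (c A I \<otimes> I) \<cdot> Inv (a A I I)"
    unfolding kl by (simp add: tensor_comp_reduce)
  also have "\<dots> = (I \<otimes> k) \<cdot> r (I \<otimes> A) \<cdot> (c A I \<otimes> I) \<cdot> Inv (a A I I)"
    using comp_reduce[OF runit_tensor[of I A]] by simp
  also have "\<dots> = (I \<otimes> k) \<cdot> c A I \<cdot> r (A \<otimes> I) \<cdot> Inv (a A I I)"
    using comp_reduce[OF runit_nat[of "c A I"]] by simp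
  also have "\<dots> = (I \<otimes> k) \<cdot> c A I \<cdot> (A \<otimes> r I)"
    by (simp add: runit_tensor[symmetric])
  finally have "(I \<otimes> k) \<cdot> c A I \<cdot> (A \<otimes> r I) = (I \<otimes> A) \<cdot> c A I \<cdot> (A \<otimes> r I)"
    using braiding_nat[of A "r I"] by simp
  then have "I \<otimes> k = I \<otimes> A"
  proof (rule iso_cancel_right[of "c A I \<cdot> (A \<otimes> r I)", rotated -1])
    show "iso_arr C (c A I \<cdot> (A \<otimes> r I))"
      by (rule iso_arrI(1)[where g="(A \<otimes> Inv (r I)) \<cdot> Inv (c A I)"]) (simp_all add: tensor_comp tensor_comp_reduce)
  qed simp_all
  then have "k = A" by (rule lunit_faithful[rotated -1]) simp_all
  then show ?thesis using kl by simp
qed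

definition ch where
  "ch X Y Z = hat Y X (c X Y) Z \<cdot> Inv (a X Y Z)"

lemma ch_arr [simp]:
  assumes "ob X" "ob Y" "ob Z"
  shows "ch X Y Z \<in> Arr C" "Dom C (ch X Y Z) = X \<otimes> (Y \<otimes> Z)" "Cod C (ch X Y Z) = Y \<otimes> (X \<otimes> Z)"
  using assms by (simp_all add: ch_def)

lemma ch_nat:
  assumes [simp]: "f \<in> Arr C" "g \<in> Arr C" "h \<in> Arr C"
  shows "ch (Cod C f) (Cod C g) (Cod C h) \<cdot> (f \<otimes> (g \<otimes> h)) = (g \<otimes> (f \<otimes> h)) \<cdot> ch (Dom C f) (Dom C g) (Dom C h)"
proof -
  have "ch (Cod C f) (Cod C g) (Cod C h) \<cdot> (f \<otimes> (g \<otimes> h))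
    = a (Cod C g) (Cod C f) (Cod C h) \<cdot> ((c (Cod C f) (Cod C g) \<cdot> (f \<otimes> g)) \<otimes> h) \<cdot> Inv (a (Dom C f) (Dom C g) (Dom C h))"
    using assoc_inv_nat[of f g h] by (simp add: ch_def hat_def tensor_comp_reduce)
  also have "\<dots> = a (Cod C g) (Cod C f) (Cod C h) \<cdot> ((g \<otimes> f) \<otimes> h) \<cdot> (c (Dom C f) (Dom C g) \<otimes> Dom C h) \<cdot> Inv (a (Dom C f) (Dom C g) (Dom C h))"
    by (simp add: braiding_nat tensor_comp_reduce)
  also have "\<dots> = (g \<otimes> (f \<otimes> h)) \<cdot> ch (Dom C f) (Dom C g) (Dom C h)"
    using comp_reduce[OF assoc_nat[of g f h]] by (simp add: ch_def hat_def)
  finally show ?thesis .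
qed

text \<open>\<open>hexagon1\<close> with a tail \<open>Z\<close>; what surrounds it is a repeated
  use of the pentagon. In the same way \<open>ch_tensor_left\<close> is
  \<open>hexagon2\<close>.\<close>

lemma ch_tensor_right:
  assumes [simp]: "ob X" "ob Y" "ob Y'" "ob Z"
  shows "a Y Y' (X \<otimes> Z) \<cdot> ch X (Y \<otimes> Y') Z = (Y \<otimes> ch X Y' Z) \<cdot> ch X Y (Y' \<otimes> Z) \<cdot> (X \<otimes> a Y Y' Z)"
proof -
  have "a Y Y' X \<cdot> c X (Y \<otimes> Y') = (a Y Y' X \<cdot> c X (Y \<otimes> Y') \<cdot> a X Y Y') \<cdot> Inv (a X Y Y')"
    by simp
  also have "\<dots> = (Y \<otimes> c X Y') \<cdot> a Y X Y' \<cdot> (c X Y \<otimes> Y') \<cdot> Inv (a X Y Y')"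
    by (subst hexagon1) simp_all
  finally have hex: "a Y Y' X \<cdot> c X (Y \<otimes> Y') = (Y \<otimes> c X Y') \<cdot> a Y X Y' \<cdot> (c X Y \<otimes> Y') \<cdot> Inv (a X Y Y')" .
  have canc: "(X \<otimes> Inv (a Y Y' Z)) \<cdot> (X \<otimes> a Y Y' Z) = X \<otimes> ((Y \<otimes> Y') \<otimes> Z)"
    by (simp add: tensor_comp)
  have "a Y Y' (X \<otimes> Z) \<cdot> ch X (Y \<otimes> Y') Z
    = (a Y Y' (X \<otimes> Z) \<cdot> a (Y \<otimes> Y') X Z) \<cdot> (c X (Y \<otimes> Y') \<otimes> Z) \<cdot> Inv (a X (Y \<otimes> Y') Z)"
    by (simp add: ch_def hat_def)
  also have "\<dots> = (Y \<otimes> a Y' X Z) \<cdot> a Y (Y' \<otimes> X) Z \<cdot> ((a Y Y' X \<cdot> c X (Y \<otimes> Y')) \<otimes> Z) \<cdot> Inv (a X (Y \<otimes> Y') Z)"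
    by (subst pentagon[symmetric]) (simp_all add: tensor_comp_reduce)
  also have "\<dots> = (Y \<otimes> a Y' X Z) \<cdot> a Y (Y' \<otimes> X) Z \<cdot> ((Y \<otimes> c X Y') \<otimes> Z) \<cdot> (a Y X Y' \<otimes> Z)
      \<cdot> ((c X Y \<otimes> Y') \<otimes> Z) \<cdot> (Inv (a X Y Y') \<otimes> Z) \<cdot> Inv (a X (Y \<otimes> Y') Z) \<cdot> (X \<otimes> Inv (a Y Y' Z)) \<cdot> (X \<otimes> a Y Y' Z)"
    unfolding hex by (simp add: whisker_right canc)
  also have "\<dots> = (Y \<otimes> a Y' X Z) \<cdot> a Y (Y' \<otimes> X) Z \<cdot> ((Y \<otimes> c X Y') \<otimes> Z) \<cdot> (a Y X Y' \<otimes> Z)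
      \<cdot> ((c X Y \<otimes> Y') \<otimes> Z) \<cdot> (Inv (a (X \<otimes> Y) Y' Z) \<cdot> Inv (a X Y (Y' \<otimes> Z))) \<cdot> (X \<otimes> a Y Y' Z)"
    by (subst pentagon_inv3[symmetric]) simp_all
  also have "\<dots> = (Y \<otimes> a Y' X Z) \<cdot> (Y \<otimes> (c X Y' \<otimes> Z)) \<cdot> (a Y (X \<otimes> Y') Z \<cdot> (a Y X Y' \<otimes> Z) \<cdot> Inv (a (Y \<otimes> X) Y' Z))
      \<cdot> (c X Y \<otimes> (Y' \<otimes> Z)) \<cdot> Inv (a X Y (Y' \<otimes> Z)) \<cdot> (X \<otimes> a Y Y' Z)"
    using comp_reduce[OF assoc_inv_nat[of "c X Y" Y' Z, symmetric]] comp_reduce[OF assoc_nat[of Y "c X Y'" Z]] by simp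
  also have "\<dots> = (Y \<otimes> ch X Y' Z) \<cdot> ch X Y (Y' \<otimes> Z) \<cdot> (X \<otimes> a Y Y' Z)"
    by (subst pentagon_inv') (simp_all add: ch_def hat_def tensor_comp_reduce)
  finally show ?thesis .
qed

lemma ch_tensor_left:
  assumes [simp]: "ob X" "ob X'" "ob Y" "ob Z"
  shows "(Y \<otimes> a X X' Z) \<cdot> ch (X \<otimes> X') Y Z = ch X Y (X' \<otimes> Z) \<cdot> (X \<otimes> ch X' Y Z) \<cdot> a X X' (Y \<otimes> Z)"
proof -
  have "c (X \<otimes> X') Y = a Y X X' \<cdot> (Inv (a Y X X') \<cdot> c (X \<otimes> X') Y \<cdot> Inv (a X X' Y)) \<cdot> a X X' Y"
    by simp
  also have "\<dots> = a Y X X' \<cdot> (c X Y \<otimes> X') \<cdot> Inv (a X Y X') \<cdot> (X \<otimes> c X' Y) \<cdot> a X X' Y"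
    by (subst hexagon2) simp_all
  finally have hex: "c (X \<otimes> X') Y = a Y X X' \<cdot> (c X Y \<otimes> X') \<cdot> Inv (a X Y X') \<cdot> (X \<otimes> c X' Y) \<cdot> a X X' Y" .
  have "(Y \<otimes> a X X' Z) \<cdot> ch (X \<otimes> X') Y Z
    = ((Y \<otimes> a X X' Z) \<cdot> a Y (X \<otimes> X') Z \<cdot> (a Y X X' \<otimes> Z)) \<cdot> ((c X Y \<otimes> X') \<otimes> Z) \<cdot> (Inv (a X Y X') \<otimes> Z)
      \<cdot> ((X \<otimes> c X' Y) \<otimes> Z) \<cdot> (a X X' Y \<otimes> Z) \<cdot> Inv (a (X \<otimes> X') Y Z)"
    unfolding ch_def hat_def hex by (simp add: whisker_right)
  also have "\<dots> = a Y X (X' \<otimes> Z) \<cdot> a (Y \<otimes> X) X' Z \<cdot> ((c X Y \<otimes> X') \<otimes> Z) \<cdot> (Inv (a X Y X') \<otimes> Z)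
      \<cdot> ((X \<otimes> c X' Y) \<otimes> Z) \<cdot> (a X X' Y \<otimes> Z) \<cdot> Inv (a (X \<otimes> X') Y Z)"
    by (subst pentagon) simp_all
  also have "\<dots> = a Y X (X' \<otimes> Z) \<cdot> (c X Y \<otimes> (X' \<otimes> Z)) \<cdot> (a (X \<otimes> Y) X' Z \<cdot> (Inv (a X Y X') \<otimes> Z))
      \<cdot> ((X \<otimes> c X' Y) \<otimes> Z) \<cdot> (a X X' Y \<otimes> Z) \<cdot> Inv (a (X \<otimes> X') Y Z)"
    using comp_reduce[OF assoc_nat[of "c X Y" X' Z]] by simp
  also have "\<dots> = a Y X (X' \<otimes> Z) \<cdot> (c X Y \<otimes> (X' \<otimes> Z)) \<cdot> Inv (a X Y (X' \<otimes> Z)) \<cdot> (X \<otimes> a Y X' Z) \<cdot> a X (Y \<otimes> X') Z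
      \<cdot> ((X \<otimes> c X' Y) \<otimes> Z) \<cdot> (a X X' Y \<otimes> Z) \<cdot> Inv (a (X \<otimes> X') Y Z)"
    by (subst pentagon_inv) simp_all
  also have "\<dots> = a Y X (X' \<otimes> Z) \<cdot> (c X Y \<otimes> (X' \<otimes> Z)) \<cdot> Inv (a X Y (X' \<otimes> Z)) \<cdot> (X \<otimes> a Y X' Z) \<cdot> (X \<otimes> (c X' Y \<otimes> Z))
      \<cdot> (a X (X' \<otimes> Y) Z \<cdot> (a X X' Y \<otimes> Z) \<cdot> Inv (a (X \<otimes> X') Y Z))"
    using comp_reduce[OF assoc_nat[of X "c X' Y" Z]] by simp
  also have "\<dots> = ch X Y (X' \<otimes> Z) \<cdot> (X \<otimes> ch X' Y Z) \<cdot> a X X' (Y \<otimes> Z)"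
    by (subst pentagon_inv') (simp_all add: ch_def hat_def tensor_comp_reduce)
  finally show ?thesis .
qed

text \<open>A strand that crosses the source of \<open>g\<close> may instead cross its two legs one
  after the other: naturality of the braiding together with the hexagon.\<close>

lemma hat_ch:
  assumes [simp]: "g \<in> Arr C" "Cod C g = Y \<otimes> Y'" "ob X" "ob Y" "ob Y'" "ob Z"
  shows "hat Y Y' g (X \<otimes> Z) \<cdot> ch X (Dom C g) Z = (Y \<otimes> ch X Y' Z) \<cdot> ch X Y (Y' \<otimes> Z) \<cdot> (X \<otimes> hat Y Y' g Z)"
proof -
  have "hat Y Y' g (X \<otimes> Z) \<cdot> ch X (Dom C g) Z = (a Y Y' (X \<otimes> Z) \<cdot> ch X (Y \<otimes> Y') Z) \<cdot> (X \<otimes> (g \<otimes> Z))"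
    using ch_nat[of X g Z] by (simp add: hat_def)
  also have "\<dots> = (Y \<otimes> ch X Y' Z) \<cdot> ch X Y (Y' \<otimes> Z) \<cdot> (X \<otimes> hat Y Y' g Z)"
    by (subst ch_tensor_right) (simp_all add: hat_def whisker_left)
  finally show ?thesis .
qed

lemma ch_hat:
  assumes [simp]: "g \<in> Arr C" "Cod C g = X \<otimes> X'" "ob X" "ob X'" "ob Y" "ob Z"
  shows "(Y \<otimes> hat X X' g Z) \<cdot> ch (Dom C g) Y Z = ch X Y (X' \<otimes> Z) \<cdot> (X \<otimes> ch X' Y Z) \<cdot> hat X X' g (Y \<otimes> Z)"
proof -
  have "(Y \<otimes> hat X X' g Z) \<cdot> ch (Dom C g) Y Z = (Y \<otimes> a X X' Z) \<cdot> (Y \<otimes> (g \<otimes> Z)) \<cdot> ch (Dom C g) Y Z"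
    by (simp add: hat_def whisker_left)
  also have "\<dots> = ((Y \<otimes> a X X' Z) \<cdot> ch (X \<otimes> X') Y Z) \<cdot> (g \<otimes> (Y \<otimes> Z))"
    using ch_nat[of g Y Z] by simp
  also have "\<dots> = ch X Y (X' \<otimes> Z) \<cdot> (X \<otimes> ch X' Y Z) \<cdot> hat X X' g (Y \<otimes> Z)"
    by (subst ch_tensor_left) (simp_all add: hat_def)
  finally show ?thesis .
qed

lemma ch_kill_left:
  assumes [simp]: "e \<in> Arr C" "Cod C e = I" "ob Y" "ob Z"
  shows "(Y \<otimes> kill e Z) \<cdot> ch (Dom C e) Y Z = kill e (Y \<otimes> Z)"
proof -
  have "(Y \<otimes> kill e Z) \<cdot> ch (Dom C e) Y Z = (Y \<otimes> l Z) \<cdot> (Y \<otimes> (e \<otimes> Z)) \<cdot> ch (Dom C e) Y Z"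
    by (simp add: kill_def whisker_left)
  also have "\<dots> = (Y \<otimes> l Z) \<cdot> ch I Y Z \<cdot> (e \<otimes> (Y \<otimes> Z))"
    using ch_nat[of e Y Z] by simp
  also have "\<dots> = ((r Y \<cdot> c I Y) \<otimes> Z) \<cdot> Inv (a I Y Z) \<cdot> (e \<otimes> (Y \<otimes> Z))"
    using comp_reduce[OF triangle[of Y Z]] by (simp add: ch_def hat_def tensor_comp_reduce)
  also have "\<dots> = kill e (Y \<otimes> Z)"
    by (simp add: braiding_unit_left lunit_tensor[symmetric] kill_def)
  finally show ?thesis .
qed

lemma ch_kill_right:
  assumes [simp]: "e \<in> Arr C" "Cod C e = I" "ob X" "ob Z"
  shows "kill e (X \<otimes> Z) \<cdot> ch X (Dom C e) Z = X \<otimes> kill e Z"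
proof -
  have "kill e (X \<otimes> Z) \<cdot> ch X (Dom C e) Z = l (X \<otimes> Z) \<cdot> ch X I Z \<cdot> (X \<otimes> (e \<otimes> Z))"
    using ch_nat[of X e Z] by (simp add: kill_def)
  also have "\<dots> = ((l X \<cdot> c X I) \<otimes> Z) \<cdot> Inv (a X I Z) \<cdot> (X \<otimes> (e \<otimes> Z))"
    using comp_reduce[OF lunit_tensor[of X Z]] by (simp add: ch_def hat_def tensor_comp_reduce)
  also have "\<dots> = X \<otimes> kill e Z"
    by (simp add: braiding_unit_right triangle[symmetric] kill_def whisker_left)
  finally show ?thesis .
qed

lemma ch_tail:
  assumes [simp]: "ob X" "ob Y" "ob Z" "ob W"
  shows "(Y \<otimes> a X Z W) \<cdot> a Y (X \<otimes> Z) W \<cdot> (ch X Y Z \<otimes> W) = ch X Y (Z \<otimes> W) \<cdot> (X \<otimes> a Y Z W) \<cdot> a X (Y \<otimes> Z) W"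
proof -
  have "(Y \<otimes> a X Z W) \<cdot> a Y (X \<otimes> Z) W \<cdot> (ch X Y Z \<otimes> W)
    = ((Y \<otimes> a X Z W) \<cdot> a Y (X \<otimes> Z) W \<cdot> (hat Y X (c X Y) Z \<otimes> W)) \<cdot> (Inv (a X Y Z) \<otimes> W)"
    by (simp add: ch_def whisker_right)
  also have "\<dots> = hat Y X (c X Y) (Z \<otimes> W) \<cdot> a (X \<otimes> Y) Z W \<cdot> (Inv (a X Y Z) \<otimes> W)"
    by (subst hat_tail) simp_all
  also have "\<dots> = ch X Y (Z \<otimes> W) \<cdot> (X \<otimes> a Y Z W) \<cdot> a X (Y \<otimes> Z) W"
    by (subst pentagon_inv) (simp_all add: ch_def)
  finally show ?thesis .
qed

lemma comonoid_arr:
  assumes "comonoid_object C M X d e"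
  shows "ob X" "d \<in> Arr C" "Dom C d = X" "Cod C d = X \<otimes> X" "e \<in> Arr C" "Dom C e = X" "Cod C e = I"
  using assms unfolding comonoid_object_def by (auto dest: homD)

lemma comonoid_hat:
  assumes X: "comonoid_object C M X d e" and [simp]: "ob Z"
  shows "hat X X d (X \<otimes> Z) \<cdot> hat X X d Z = (X \<otimes> hat X X d Z) \<cdot> hat X X d Z"
    and "kill e (X \<otimes> Z) \<cdot> hat X X d Z = X \<otimes> Z"
    and "(X \<otimes> kill e Z) \<cdot> hat X X d Z = X \<otimes> Z"
proof -
  note [simp] = comonoid_arr[OF X]
  have "hat X X d (X \<otimes> Z) \<cdot> hat X X d Z = hat X X d (X \<otimes> Z) \<cdot> a X X Z \<cdot> (d \<otimes> Z)"
    by (simp add: hat_def)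
  also have "\<dots> = (X \<otimes> a X X Z) \<cdot> a X (X \<otimes> X) Z \<cdot> ((a X X X \<cdot> (d \<otimes> X) \<cdot> d) \<otimes> Z)"
    using comp_reduce[OF hat_tail[of d X X X Z, symmetric], of "d \<otimes> Z"] by (simp add: whisker_right) (simp add: hat_def whisker_right)
  also have "\<dots> = (X \<otimes> a X X Z) \<cdot> (X \<otimes> (d \<otimes> Z)) \<cdot> a X X Z \<cdot> (d \<otimes> Z)"
    using comp_reduce[OF assoc_nat[of X d Z]]
    by (simp add: comonoid_object.comult_assoc[OF X] whisker_right)
  also have "\<dots> = (X \<otimes> hat X X d Z) \<cdot> hat X X d Z"
    by (simp add: hat_def whisker_left)
  finally show "hat X X d (X \<otimes> Z) \<cdot> hat X X d Z = (X \<otimes> hat X X d Z) \<cdot> hat X X d Z" .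
  have "kill e (X \<otimes> Z) \<cdot> hat X X d Z = l (X \<otimes> Z) \<cdot> a I X Z \<cdot> ((e \<otimes> X) \<otimes> Z) \<cdot> (d \<otimes> Z)"
    using comp_reduce[OF assoc_nat[of e X Z]] by (simp add: kill_def hat_def)
  also have "\<dots> = (l X \<cdot> (e \<otimes> X) \<cdot> d) \<otimes> Z"
    using comp_reduce[OF lunit_tensor[of X Z]] by (simp add: tensor_comp)
  finally show "kill e (X \<otimes> Z) \<cdot> hat X X d Z = X \<otimes> Z"
    by (simp add: comonoid_object.comult_counit_left[OF X])
  have "(X \<otimes> kill e Z) \<cdot> hat X X d Z = (X \<otimes> l Z) \<cdot> a X I Z \<cdot> ((X \<otimes> e) \<otimes> Z) \<cdot> (d \<otimes> Z)"
    using comp_reduce[OF assoc_nat[of X e Z]] by (simp add: kill_def hat_def whisker_left)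
  also have "\<dots> = (r X \<cdot> (X \<otimes> e) \<cdot> d) \<otimes> Z"
    using comp_reduce[OF triangle[of X Z]] by (simp add: tensor_comp)
  finally show "(X \<otimes> kill e Z) \<cdot> hat X X d Z = X \<otimes> Z"
    by (simp add: comonoid_object.comult_counit_right[OF X])
qed

lemma ch_cocommutative:
  assumes X: "comonoid_object C M X d e" and "c X X \<cdot> d = d" and [simp]: "ob Z"
  shows "ch X X Z \<cdot> hat X X d Z = hat X X d Z"
proof -
  note [simp] = comonoid_arr[OF X]
  have "ch X X Z \<cdot> hat X X d Z = a X X Z \<cdot> ((c X X \<cdot> d) \<otimes> Z)"
    by (simp add: ch_def hat_def tensor_comp)
  then show ?thesis using assms(2) by (simp add: hat_def)
qed

end

section \<open>The relative product of cocommutative comonoids\<close>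

locale comonoid_cospan = braided_monoidal_category C M c
  for C :: "'m cat" and M :: "'m monoidal" and c :: "'m \<Rightarrow> 'm \<Rightarrow> 'm" +
  fixes A dA eA B dB eB H \<pi> f :: 'm
  assumes comonoid_A: "comonoid_object C M A dA eA" and comonoid_B: "comonoid_object C M B dB eB"
    and cocomm_A: "c A A \<cdot> dA = dA" and cocomm_B: "c B B \<cdot> dB = dB"
    and H: "ob H" and \<pi>: "\<pi> \<in> Arr C" "Dom C \<pi> = A" "Cod C \<pi> = H"
    and f: "f \<in> Arr C" "Dom C f = B" "Cod C f = H"
begin

lemmas [simp] = comonoid_arr[OF comonoid_A] comonoid_arr[OF comonoid_B] H \<pi> f

lemmas dA_hat = comonoid_hat[OF comonoid_A] and dB_hat = comonoid_hat[OF comonoid_B]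

abbreviation (input) dAh where "dAh W \<equiv> hat A A dA W"
abbreviation (input) dBh where "dBh W \<equiv> hat B B dB W"

text \<open>The comultiplication \<open>(a, b) \<mapsto> (a_1, b_1, a_2, b_2)\<close> of a product
  of comonoids, with the inner legs crossed by the braiding, rebracketed to the right. The variant
  \<open>prod_comult_hat\<close> carries a tail \<open>W\<close>, which is needed to iterate
  it.\<close>

definition prod_comult where
  "prod_comult = (A \<otimes> ch A B B) \<cdot> dAh (B \<otimes> B) \<cdot> (A \<otimes> dB)"

definition prod_comult_hat where
  "prod_comult_hat W = (A \<otimes> ch A B (B \<otimes> W)) \<cdot> dAh (B \<otimes> (B \<otimes> W)) \<cdot> (A \<otimes> dBh W)"

lemma prod_comult_arr [simp]:
  "prod_comult \<in> Arr C" "Dom C prod_comult = A \<otimes> B" "Cod C prod_comult = A \<otimes> (B \<otimes> (A \<otimes> B))"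
  by (simp_all add: prod_comult_def)

lemma prod_comult_hat_arr [simp]:
  assumes "ob W"
  shows "prod_comult_hat W \<in> Arr C" "Dom C (prod_comult_hat W) = A \<otimes> (B \<otimes> W)"
    "Cod C (prod_comult_hat W) = A \<otimes> (B \<otimes> (A \<otimes> (B \<otimes> W)))"
  using assms by (simp_all add: prod_comult_hat_def)

lemma dAh_nat:
  assumes "g \<in> Arr C"
  shows "dAh (Cod C g) \<cdot> (A \<otimes> g) = (A \<otimes> (A \<otimes> g)) \<cdot> dAh (Dom C g)"
  using hat_nat[of dA A A g] assms by simp

lemma dBh_dB: "dBh B \<cdot> dB = (B \<otimes> dB) \<cdot> dB"
  using comonoid_object.comult_assoc[OF comonoid_B] by (simp add: hat_def)

lemma prod_comult_tail:
  assumes [simp]: "ob W"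
  shows "(A \<otimes> (B \<otimes> a A B W)) \<cdot> (A \<otimes> a B (A \<otimes> B) W) \<cdot> a A (B \<otimes> (A \<otimes> B)) W \<cdot> (prod_comult \<otimes> W)
    = prod_comult_hat W \<cdot> a A B W"
proof -
  have "(A \<otimes> (B \<otimes> a A B W)) \<cdot> (A \<otimes> a B (A \<otimes> B) W) \<cdot> a A (B \<otimes> (A \<otimes> B)) W \<cdot> (prod_comult \<otimes> W)
    = (A \<otimes> (B \<otimes> a A B W)) \<cdot> (A \<otimes> a B (A \<otimes> B) W) \<cdot> (A \<otimes> (ch A B B \<otimes> W)) \<cdot> a A (A \<otimes> (B \<otimes> B)) W
      \<cdot> (dAh (B \<otimes> B) \<otimes> W) \<cdot> ((A \<otimes> dB) \<otimes> W)"
    using comp_reduce[OF assoc_nat[of A "ch A B B" W]] by (simp add: prod_comult_def whisker_right)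
  also have "\<dots> = (A \<otimes> ((B \<otimes> a A B W) \<cdot> a B (A \<otimes> B) W \<cdot> (ch A B B \<otimes> W))) \<cdot> a A (A \<otimes> (B \<otimes> B)) W
      \<cdot> (dAh (B \<otimes> B) \<otimes> W) \<cdot> ((A \<otimes> dB) \<otimes> W)"
    by (simp add: whisker_left)
  also have "\<dots> = (A \<otimes> ch A B (B \<otimes> W)) \<cdot> (A \<otimes> (A \<otimes> a B B W)) \<cdot> ((A \<otimes> a A (B \<otimes> B) W) \<cdot> a A (A \<otimes> (B \<otimes> B)) W
      \<cdot> (dAh (B \<otimes> B) \<otimes> W)) \<cdot> ((A \<otimes> dB) \<otimes> W)"
    by (subst ch_tail) (simp_all add: whisker_left)
  also have "\<dots> = (A \<otimes> ch A B (B \<otimes> W)) \<cdot> (A \<otimes> (A \<otimes> a B B W)) \<cdot> dAh ((B \<otimes> B) \<otimes> W) \<cdot> a A (B \<otimes> B) W \<cdot> ((A \<otimes> dB) \<otimes> W)"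
    by (subst hat_tail) simp_all
  also have "\<dots> = (A \<otimes> ch A B (B \<otimes> W)) \<cdot> dAh (B \<otimes> (B \<otimes> W)) \<cdot> (A \<otimes> a B B W) \<cdot> (A \<otimes> (dB \<otimes> W)) \<cdot> a A B W"
    using comp_reduce[OF dAh_nat[of "a B B W"]] assoc_nat[of A dB W] by simp
  also have "\<dots> = prod_comult_hat W \<cdot> a A B W"
    by (simp add: prod_comult_hat_def hat_def[of B] whisker_left)
  finally show ?thesis .
qed

text \<open>Both sides are brought to the form \<open>?w\<close>: first all comultiplications, then
  the crossings \<open>?y\<close>. Crossings slide past comultiplications by \<open>hat_ch\<close>
  on one side and by \<open>ch_hat\<close> on the other.\<close>

lemma prod_comult_coassoc:
  "prod_comult_hat (A \<otimes> B) \<cdot> prod_comult = (A \<otimes> (B \<otimes> prod_comult)) \<cdot> prod_comult"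
proof -
  let ?y = "ch A B (B \<otimes> (A \<otimes> B)) \<cdot> (A \<otimes> (B \<otimes> ch A B B)) \<cdot> (A \<otimes> ch A B (B \<otimes> B))"
  let ?w = "(A \<otimes> ?y) \<cdot> (A \<otimes> dAh (B \<otimes> (B \<otimes> B))) \<cdot> dAh (B \<otimes> (B \<otimes> B)) \<cdot> (A \<otimes> ((B \<otimes> dB) \<cdot> dB))"
  have "prod_comult_hat (A \<otimes> B) \<cdot> prod_comult
    = (A \<otimes> ch A B (B \<otimes> (A \<otimes> B))) \<cdot> dAh (B \<otimes> (B \<otimes> (A \<otimes> B))) \<cdot> (A \<otimes> (dBh (A \<otimes> B) \<cdot> ch A B B))
      \<cdot> dAh (B \<otimes> B) \<cdot> (A \<otimes> dB)"
    by (simp add: prod_comult_def prod_comult_hat_def whisker_left)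
  also have "dBh (A \<otimes> B) \<cdot> ch A B B = (B \<otimes> ch A B B) \<cdot> ch A B (B \<otimes> B) \<cdot> (A \<otimes> dBh B)"
    using hat_ch[of dB B B A B] by simp
  also have "(A \<otimes> ch A B (B \<otimes> (A \<otimes> B))) \<cdot> dAh (B \<otimes> (B \<otimes> (A \<otimes> B))) \<cdot> (A \<otimes> \<dots>) \<cdot> dAh (B \<otimes> B) \<cdot> (A \<otimes> dB)
    = (A \<otimes> ch A B (B \<otimes> (A \<otimes> B))) \<cdot> (A \<otimes> (A \<otimes> ((B \<otimes> ch A B B) \<cdot> ch A B (B \<otimes> B) \<cdot> (A \<otimes> dBh B))))
      \<cdot> (dAh (A \<otimes> (B \<otimes> B)) \<cdot> dAh (B \<otimes> B)) \<cdot> (A \<otimes> dB)"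
    using comp_reduce[OF dAh_nat[of "(B \<otimes> ch A B B) \<cdot> ch A B (B \<otimes> B) \<cdot> (A \<otimes> dBh B)"]] by simp
  also have "\<dots> = (A \<otimes> ?y) \<cdot> (A \<otimes> ((A \<otimes> (A \<otimes> dBh B)) \<cdot> dAh (B \<otimes> B))) \<cdot> dAh (B \<otimes> B) \<cdot> (A \<otimes> dB)"
    unfolding dA_hat(1)[of "B \<otimes> B", simplified] by (simp add: whisker_left)
  also have "(A \<otimes> (A \<otimes> dBh B)) \<cdot> dAh (B \<otimes> B) = dAh (B \<otimes> (B \<otimes> B)) \<cdot> (A \<otimes> dBh B)"
    using dAh_nat[of "dBh B"] by simp
  also have "(A \<otimes> ?y) \<cdot> (A \<otimes> \<dots>) \<cdot> dAh (B \<otimes> B) \<cdot> (A \<otimes> dB)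
    = (A \<otimes> ?y) \<cdot> (A \<otimes> dAh (B \<otimes> (B \<otimes> B))) \<cdot> ((A \<otimes> (A \<otimes> dBh B)) \<cdot> dAh (B \<otimes> B)) \<cdot> (A \<otimes> dB)"
    by (simp add: whisker_left)
  also have "(A \<otimes> (A \<otimes> dBh B)) \<cdot> dAh (B \<otimes> B) = dAh (B \<otimes> (B \<otimes> B)) \<cdot> (A \<otimes> dBh B)"
    using dAh_nat[of "dBh B"] by simp
  also have "(A \<otimes> ?y) \<cdot> (A \<otimes> dAh (B \<otimes> (B \<otimes> B))) \<cdot> (dAh (B \<otimes> (B \<otimes> B)) \<cdot> (A \<otimes> dBh B)) \<cdot> (A \<otimes> dB) = ?w"
    by (simp add: tensor_comp dBh_dB)
  finally have L: "prod_comult_hat (A \<otimes> B) \<cdot> prod_comult = ?w" .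
  have "(B \<otimes> prod_comult) \<cdot> ch A B B
    = (B \<otimes> (A \<otimes> ch A B B)) \<cdot> (B \<otimes> dAh (B \<otimes> B)) \<cdot> ((B \<otimes> (A \<otimes> dB)) \<cdot> ch A B B)"
    by (simp add: prod_comult_def whisker_left)
  also have "(B \<otimes> (A \<otimes> dB)) \<cdot> ch A B B = ch A B (B \<otimes> B) \<cdot> (A \<otimes> (B \<otimes> dB))"
    using ch_nat[of A B dB] by simp
  also have "(B \<otimes> dAh (B \<otimes> B)) \<cdot> \<dots> = ch A B (A \<otimes> (B \<otimes> B)) \<cdot> (A \<otimes> ch A B (B \<otimes> B)) \<cdot> dAh (B \<otimes> (B \<otimes> B)) \<cdot> (A \<otimes> (B \<otimes> dB))"
    using comp_reduce[OF ch_hat[of dA A A B "B \<otimes> B"]] by simp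
  also have "(B \<otimes> (A \<otimes> ch A B B)) \<cdot> \<dots> = ?y \<cdot> dAh (B \<otimes> (B \<otimes> B)) \<cdot> (A \<otimes> (B \<otimes> dB))"
    using comp_reduce[OF ch_nat[of A B "ch A B B"]] by simp
  finally have R: "(B \<otimes> prod_comult) \<cdot> ch A B B = ?y \<cdot> dAh (B \<otimes> (B \<otimes> B)) \<cdot> (A \<otimes> (B \<otimes> dB))" .
  have "(A \<otimes> (B \<otimes> prod_comult)) \<cdot> prod_comult = (A \<otimes> ((B \<otimes> prod_comult) \<cdot> ch A B B)) \<cdot> dAh (B \<otimes> B) \<cdot> (A \<otimes> dB)"
    by (simp add: prod_comult_def[of] whisker_left)
  also have "\<dots> = (A \<otimes> ?y) \<cdot> (A \<otimes> dAh (B \<otimes> (B \<otimes> B))) \<cdot> ((A \<otimes> (A \<otimes> (B \<otimes> dB))) \<cdot> dAh (B \<otimes> B)) \<cdot> (A \<otimes> dB)"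
    unfolding R by (simp add: whisker_left)
  also have "(A \<otimes> (A \<otimes> (B \<otimes> dB))) \<cdot> dAh (B \<otimes> B) = dAh (B \<otimes> (B \<otimes> B)) \<cdot> (A \<otimes> (B \<otimes> dB))"
    using dAh_nat[of "B \<otimes> dB"] by simp
  also have "(A \<otimes> ?y) \<cdot> (A \<otimes> dAh (B \<otimes> (B \<otimes> B))) \<cdot> (dAh (B \<otimes> (B \<otimes> B)) \<cdot> (A \<otimes> (B \<otimes> dB))) \<cdot> (A \<otimes> dB) = ?w"
    by (simp add: tensor_comp)
  finally show ?thesis using L by simp
qed

lemma prod_comult_counits:
  shows "(A \<otimes> kill eB (A \<otimes> B)) \<cdot> prod_comult = dAh B"
    and "kill eA (B \<otimes> (A \<otimes> B)) \<cdot> prod_comult = ch A B B \<cdot> (A \<otimes> dB)"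
    and "(A \<otimes> (B \<otimes> kill eA B)) \<cdot> prod_comult = A \<otimes> dB"
proof -
  have "(A \<otimes> kill eB (A \<otimes> B)) \<cdot> prod_comult
    = (A \<otimes> (kill eB (A \<otimes> B) \<cdot> ch A B B)) \<cdot> dAh (B \<otimes> B) \<cdot> (A \<otimes> dB)"
    by (simp add: prod_comult_def whisker_left)
  also have "kill eB (A \<otimes> B) \<cdot> ch A B B = A \<otimes> kill eB B"
    using ch_kill_right[of eB A B] by simp
  also have "(A \<otimes> (A \<otimes> kill eB B)) \<cdot> dAh (B \<otimes> B) \<cdot> (A \<otimes> dB) = dAh B \<cdot> (A \<otimes> (kill eB B \<cdot> dB))"
    using comp_reduce[OF dAh_nat[of "kill eB B", symmetric]] by (simp add: whisker_left)
  also have "kill eB B \<cdot> dB = B"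
    using comonoid_object.comult_counit_left[OF comonoid_B] by (simp add: kill_def)
  finally show "(A \<otimes> kill eB (A \<otimes> B)) \<cdot> prod_comult = dAh B" by simp
  have "kill eA (B \<otimes> (A \<otimes> B)) \<cdot> prod_comult
    = ch A B B \<cdot> (kill eA (A \<otimes> (B \<otimes> B)) \<cdot> dAh (B \<otimes> B)) \<cdot> (A \<otimes> dB)"
    using comp_reduce[OF kill_nat[of eA "ch A B B"]] by (simp add: prod_comult_def)
  then show "kill eA (B \<otimes> (A \<otimes> B)) \<cdot> prod_comult = ch A B B \<cdot> (A \<otimes> dB)"
    using dA_hat(2)[of "B \<otimes> B"] by simp
  have "(A \<otimes> (B \<otimes> kill eA B)) \<cdot> prod_comult = (A \<otimes> ((B \<otimes> kill eA B) \<cdot> ch A B B)) \<cdot> dAh (B \<otimes> B) \<cdot> (A \<otimes> dB)"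
    by (simp add: prod_comult_def whisker_left)
  also have "(B \<otimes> kill eA B) \<cdot> ch A B B = kill eA (B \<otimes> B)"
    using ch_kill_left[of eA B B] by simp
  finally show "(A \<otimes> (B \<otimes> kill eA B)) \<cdot> prod_comult = A \<otimes> dB"
    using comp_reduce[OF dA_hat(3)[of "B \<otimes> B"]] by simp
qed

definition coactA where "coactA = (A \<otimes> \<pi>) \<cdot> dA"
definition coactB where "coactB = (f \<otimes> B) \<cdot> dB"
definition projA where "projA = r A \<cdot> (A \<otimes> eB)"
definition projB where "projB = kill eA B"

lemma coact_arr [simp]:
  "coactA \<in> Arr C" "Dom C coactA = A" "Cod C coactA = A \<otimes> H"
  "coactB \<in> Arr C" "Dom C coactB = B" "Cod C coactB = H \<otimes> B"
  "projA \<in> Arr C" "Dom C projA = A \<otimes> B" "Cod C projA = A"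
  "projB \<in> Arr C" "Dom C projB = A \<otimes> B" "Cod C projB = B"
  by (simp_all add: coactA_def coactB_def projA_def projB_def)

abbreviation (input) nuh where "nuh W \<equiv> hat A H coactA W"
abbreviation (input) rhoh where "rhoh W \<equiv> hat H B coactB W"

lemma nuh_eq:
  assumes [simp]: "ob W"
  shows "nuh W = (A \<otimes> (\<pi> \<otimes> W)) \<cdot> dAh W"
  using hat_post[of dA A \<pi> W] by (simp add: coactA_def)

lemma nuh_nat:
  assumes "g \<in> Arr C"
  shows "nuh (Cod C g) \<cdot> (A \<otimes> g) = (A \<otimes> (H \<otimes> g)) \<cdot> nuh (Dom C g)"
  using hat_nat[of coactA A H g] assms by simp

text \<open>The first law is coassociativity of \<open>A\<close>. In the second the coaction sits on
  the middle one of three legs; cocommutativity exchanges it with the last leg, at the price of the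
  crossing \<open>ch A H W\<close>.\<close>

lemma nuh_dAh:
  assumes [simp]: "ob W"
  shows "(A \<otimes> nuh W) \<cdot> dAh W = dAh (H \<otimes> W) \<cdot> nuh W"
    and "nuh (A \<otimes> W) \<cdot> dAh W = (A \<otimes> ch A H W) \<cdot> dAh (H \<otimes> W) \<cdot> nuh W"
proof -
  have 1: "(A \<otimes> (A \<otimes> (\<pi> \<otimes> W))) \<cdot> (A \<otimes> dAh W) \<cdot> dAh W = dAh (H \<otimes> W) \<cdot> nuh W"
  proof -
    have "(A \<otimes> (A \<otimes> (\<pi> \<otimes> W))) \<cdot> (A \<otimes> dAh W) \<cdot> dAh W = ((A \<otimes> (A \<otimes> (\<pi> \<otimes> W))) \<cdot> dAh (A \<otimes> W)) \<cdot> dAh W"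
      using dA_hat(1)[of W] by simp
    also have "\<dots> = dAh (H \<otimes> W) \<cdot> nuh W"
      using comp_reduce[OF dAh_nat[of "\<pi> \<otimes> W"]] by (simp add: nuh_eq)
    finally show ?thesis .
  qed
  then show "(A \<otimes> nuh W) \<cdot> dAh W = dAh (H \<otimes> W) \<cdot> nuh W"
    by (simp add: nuh_eq[of W] whisker_left)
  have "nuh (A \<otimes> W) \<cdot> dAh W = (A \<otimes> (\<pi> \<otimes> (A \<otimes> W))) \<cdot> dAh (A \<otimes> W) \<cdot> dAh W"
    by (simp add: nuh_eq)
  also have "\<dots> = (A \<otimes> (\<pi> \<otimes> (A \<otimes> W))) \<cdot> (A \<otimes> dAh W) \<cdot> dAh W"
    using dA_hat(1)[of W] by simp
  also have "\<dots> = (A \<otimes> (\<pi> \<otimes> (A \<otimes> W))) \<cdot> (A \<otimes> (ch A A W \<cdot> dAh W)) \<cdot> dAh W"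
    by (simp add: ch_cocommutative[OF comonoid_A cocomm_A])
  also have "\<dots> = (A \<otimes> ((\<pi> \<otimes> (A \<otimes> W)) \<cdot> ch A A W)) \<cdot> (A \<otimes> dAh W) \<cdot> dAh W"
    by (simp add: whisker_left)
  also have "(\<pi> \<otimes> (A \<otimes> W)) \<cdot> ch A A W = ch A H W \<cdot> (A \<otimes> (\<pi> \<otimes> W))"
    using ch_nat[of A \<pi> W] by simp
  finally show "nuh (A \<otimes> W) \<cdot> dAh W = (A \<otimes> ch A H W) \<cdot> dAh (H \<otimes> W) \<cdot> nuh W"
    using 1 by (simp add: whisker_left)
qed

text \<open>The counterpart for \<open>B\<close>: the first law is coassociativity, and in the
  second cocommutativity of \<open>B\<close> absorbs the crossing.\<close>

lemma rhoh_dB: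
  "rhoh B \<cdot> dB = (H \<otimes> dB) \<cdot> coactB"
  "ch H B B \<cdot> (H \<otimes> dB) \<cdot> coactB = (B \<otimes> coactB) \<cdot> dB"
proof -
  have "rhoh B \<cdot> dB = (f \<otimes> (B \<otimes> B)) \<cdot> dBh B \<cdot> dB"
    using comp_reduce[OF hat_post[of dB f B B], of dB] by (simp add: coactB_def)
  also have "\<dots> = (H \<otimes> dB) \<cdot> coactB"
    by (simp add: dBh_dB coactB_def tensor_comp_reduce)
  finally show "rhoh B \<cdot> dB = (H \<otimes> dB) \<cdot> coactB" .
  have "ch H B B \<cdot> (H \<otimes> dB) \<cdot> coactB = (ch H B B \<cdot> (f \<otimes> (B \<otimes> B))) \<cdot> (B \<otimes> dB) \<cdot> dB"
    by (simp add: coactB_def tensor_comp_reduce)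
  also have "\<dots> = (B \<otimes> (f \<otimes> B)) \<cdot> (ch B B B \<cdot> dBh B) \<cdot> dB"
    using ch_nat[of f B B] dBh_dB by simp
  also have "\<dots> = (B \<otimes> coactB) \<cdot> dB"
    unfolding ch_cocommutative[OF comonoid_B cocomm_B, of B, simplified] by (simp add: dBh_dB coactB_def tensor_comp_reduce)
  finally show "ch H B B \<cdot> (H \<otimes> dB) \<cdot> coactB = (B \<otimes> coactB) \<cdot> dB" .
qed

definition eqA where "eqA = coactA \<otimes> B"
definition eqB where "eqB = Inv (a A H B) \<cdot> (A \<otimes> coactB)"

lemma eq_arr [simp]:
  "eqA \<in> Arr C" "Dom C eqA = A \<otimes> B" "Cod C eqA = (A \<otimes> H) \<otimes> B"
  "eqB \<in> Arr C" "Dom C eqB = A \<otimes> B" "Cod C eqB = (A \<otimes> H) \<otimes> B"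
  by (simp_all add: eqA_def eqB_def)

lemma eqA_hat:
  assumes [simp]: "ob W"
  shows "a A H (B \<otimes> W) \<cdot> a (A \<otimes> H) B W \<cdot> (eqA \<otimes> W) = nuh (B \<otimes> W) \<cdot> a A B W"
  using assoc_nat[of coactA B W] by (simp add: eqA_def hat_def)

lemma eqB_hat:
  assumes [simp]: "ob W"
  shows "a A H (B \<otimes> W) \<cdot> a (A \<otimes> H) B W \<cdot> (eqB \<otimes> W) = (A \<otimes> rhoh W) \<cdot> a A B W"
proof -
  have "a A H (B \<otimes> W) \<cdot> a (A \<otimes> H) B W \<cdot> (eqB \<otimes> W)
    = a A H (B \<otimes> W) \<cdot> (a (A \<otimes> H) B W \<cdot> (Inv (a A H B) \<otimes> W)) \<cdot> ((A \<otimes> coactB) \<otimes> W)"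
    by (simp add: eqB_def whisker_right)
  also have "\<dots> = (A \<otimes> a H B W) \<cdot> a A (H \<otimes> B) W \<cdot> ((A \<otimes> coactB) \<otimes> W)"
    by (subst pentagon_inv) simp_all
  also have "\<dots> = (A \<otimes> rhoh W) \<cdot> a A B W"
    using assoc_nat[of A coactB W] by (simp add: hat_def whisker_left)
  finally show ?thesis .
qed

lemma projA_tensor:
  assumes [simp]: "ob Y"
  shows "(projA \<otimes> Y) \<cdot> Inv (a A B Y) = A \<otimes> kill eB Y"
proof -
  have "(projA \<otimes> Y) = (r A \<otimes> Y) \<cdot> ((A \<otimes> eB) \<otimes> Y)"
    by (simp add: projA_def tensor_comp)
  also have "\<dots> = (A \<otimes> l Y) \<cdot> a A I Y \<cdot> ((A \<otimes> eB) \<otimes> Y)"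
    using comp_reduce[OF triangle[of A Y]] by simp
  also have "\<dots> = (A \<otimes> kill eB Y) \<cdot> a A B Y"
    using assoc_nat[of A eB Y] by (simp add: kill_def whisker_left)
  finally show ?thesis by simp
qed

lemma projB_tensor:
  assumes [simp]: "ob Y"
  shows "(projB \<otimes> Y) \<cdot> Inv (a A B Y) = kill eA (B \<otimes> Y)"
proof -
  have "kill eA (B \<otimes> Y) \<cdot> a A B Y = l (B \<otimes> Y) \<cdot> a I B Y \<cdot> ((eA \<otimes> B) \<otimes> Y)"
    using assoc_nat[of eA B Y] by (simp add: kill_def)
  also have "\<dots> = projB \<otimes> Y"
    using comp_reduce[OF lunit_tensor[of B Y]] by (simp add: kill_def projB_def tensor_comp)
  finally have "projB \<otimes> Y = kill eA (B \<otimes> Y) \<cdot> a A B Y" ..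
  then show ?thesis by simp
qed

text \<open>\<open>?k\<close> applies the counits of \<open>A\<close> and \<open>B\<close> to the
  outer factors and keeps the middle factor \<open>H\<close>. It turns the two arrows into
  \<open>\<pi> \<cdot> projA\<close> and \<open>f \<cdot> projB\<close>.\<close>

lemma eq_proj:
  assumes [simp]: "z \<in> Arr C" "Cod C z = A \<otimes> B" and eq: "eqA \<cdot> z = eqB \<cdot> z"
  shows "\<pi> \<cdot> projA \<cdot> z = f \<cdot> projB \<cdot> z"
proof -
  let ?k = "r H \<cdot> (H \<otimes> eB) \<cdot> (kill eA H \<otimes> B)"
  have "kill eA H \<cdot> coactA = \<pi>"
  proof -
    have "kill eA H \<cdot> coactA = \<pi> \<cdot> l A \<cdot> (eA \<otimes> A) \<cdot> dA"
      using comp_reduce[OF kill_nat[of eA \<pi>], of dA] by (simp add: coactA_def kill_def)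
    then show ?thesis
      by (simp add: comonoid_object.comult_counit_left[OF comonoid_A])
  qed
  then have "?k \<cdot> eqA = r H \<cdot> (\<pi> \<otimes> I) \<cdot> (A \<otimes> eB)"
    by (simp add: eqA_def tensor_comp)
  also have "\<dots> = \<pi> \<cdot> projA"
    using comp_reduce[OF runit_nat[of \<pi>]] by (simp add: projA_def)
  finally have kA: "?k \<cdot> eqA = \<pi> \<cdot> projA" .
  have "(kill eA H \<otimes> B) \<cdot> Inv (a A H B) = kill eA (H \<otimes> B)"
  proof -
    have "kill eA (H \<otimes> B) \<cdot> a A H B = l (H \<otimes> B) \<cdot> a I H B \<cdot> ((eA \<otimes> H) \<otimes> B)"
      using assoc_nat[of eA H B] by (simp add: kill_def)
    also have "\<dots> = kill eA H \<otimes> B"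
      using comp_reduce[OF lunit_tensor[of H B]] by (simp add: kill_def tensor_comp)
    finally have "kill eA H \<otimes> B = kill eA (H \<otimes> B) \<cdot> a A H B" ..
    then show ?thesis by simp
  qed
  from comp_reduce[OF this, of "A \<otimes> coactB"]
  have "?k \<cdot> eqB = r H \<cdot> (H \<otimes> eB) \<cdot> kill eA (H \<otimes> B) \<cdot> (A \<otimes> coactB)"
    by (simp add: eqB_def)
  also have "\<dots> = r H \<cdot> (H \<otimes> eB) \<cdot> coactB \<cdot> projB"
    using kill_nat[of eA coactB] by (simp add: projB_def)
  also have "\<dots> = r H \<cdot> (f \<otimes> I) \<cdot> (B \<otimes> eB) \<cdot> dB \<cdot> projB"
    by (simp add: coactB_def tensor_comp_reduce)
  also have "\<dots> = f \<cdot> (r B \<cdot> (B \<otimes> eB) \<cdot> dB) \<cdot> projB"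
    using comp_reduce[OF runit_nat[of f], of "(B \<otimes> eB) \<cdot> dB \<cdot> projB"] by simp
  also have "\<dots> = f \<cdot> projB"
    unfolding comonoid_object.comult_counit_right[OF comonoid_B] by simp
  finally have kB: "?k \<cdot> eqB = f \<cdot> projB" .
  have "\<pi> \<cdot> projA \<cdot> z = ?k \<cdot> eqA \<cdot> z"
    using comp_reduce[OF kA, of z] by simp
  also have "\<dots> = f \<cdot> projB \<cdot> z"
    unfolding eq using comp_reduce[OF kB, of z] by simp
  finally show ?thesis .
qed

section \<open>Pairings of comonoid morphisms into the two factors\<close>

context
  fixes X dX eX x y :: 'm
  assumes comonoid_X: "comonoid_object C M X dX eX" and cocomm_X: "c X X \<cdot> dX = dX"
    and x: "x \<in> Arr C" "Dom C x = X" "Cod C x = A" "dA \<cdot> x = (x \<otimes> x) \<cdot> dX" "eA \<cdot> x = eX"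
    and y: "y \<in> Arr C" "Dom C y = X" "Cod C y = B" "dB \<cdot> y = (y \<otimes> y) \<cdot> dX" "eB \<cdot> y = eX"
begin

lemmas [simp] = comonoid_arr[OF comonoid_X] x(1-3) y(1-3)

lemma projA_pair: "projA \<cdot> (x \<otimes> y) \<cdot> dX = x"
proof -
  have "projA \<cdot> (x \<otimes> y) \<cdot> dX = r A \<cdot> (x \<otimes> I) \<cdot> (X \<otimes> eX) \<cdot> dX"
    by (simp add: projA_def tensor_comp_reduce y(5))
  also have "\<dots> = x \<cdot> r X \<cdot> (X \<otimes> eX) \<cdot> dX"
    using comp_reduce[OF runit_nat[of x], of "(X \<otimes> eX) \<cdot> dX"] by simp
  finally show ?thesis
    by (simp add: comonoid_object.comult_counit_right[OF comonoid_X])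
qed

lemma projB_pair: "projB \<cdot> (x \<otimes> y) \<cdot> dX = y"
proof -
  have "projB \<cdot> (x \<otimes> y) \<cdot> dX = l B \<cdot> (I \<otimes> y) \<cdot> (eX \<otimes> X) \<cdot> dX"
    by (simp add: projB_def kill_def tensor_comp_reduce x(5))
  also have "\<dots> = y \<cdot> l X \<cdot> (eX \<otimes> X) \<cdot> dX"
    using comp_reduce[OF lunit_nat[of y], of "(eX \<otimes> X) \<cdot> dX"] by simp
  finally show ?thesis
    by (simp add: comonoid_object.comult_counit_left[OF comonoid_X])
qed

text \<open>Both sides put \<open>x\<close>, \<open>f \<cdot> y\<close> and \<open>y\<close> on the
  three legs of the iterated comultiplication of \<open>X\<close>; coassociativity matches the
  bracketings.\<close>

lemma eq_pair:
  assumes "\<pi> \<cdot> x = f \<cdot> y"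
  shows "eqA \<cdot> (x \<otimes> y) \<cdot> dX = eqB \<cdot> (x \<otimes> y) \<cdot> dX"
proof -
  have "eqA \<cdot> (x \<otimes> y) \<cdot> dX = (((A \<otimes> \<pi>) \<cdot> dA \<cdot> x) \<otimes> y) \<cdot> dX"
    by (simp add: eqA_def coactA_def tensor_comp_reduce)
  also have "\<dots> = ((x \<otimes> (f \<cdot> y)) \<otimes> y) \<cdot> (dX \<otimes> X) \<cdot> dX"
    by (simp add: x(4) tensor_comp_reduce assms)
  also have "(dX \<otimes> X) \<cdot> dX = Inv (a X X X) \<cdot> (X \<otimes> dX) \<cdot> dX"
    by (simp add: comonoid_object.comult_assoc[OF comonoid_X, symmetric])
  also have "((x \<otimes> (f \<cdot> y)) \<otimes> y) \<cdot> \<dots> = Inv (a A H B) \<cdot> (x \<otimes> ((f \<cdot> y) \<otimes> y)) \<cdot> (X \<otimes> dX) \<cdot> dX"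
    using comp_reduce[OF assoc_inv_nat[of x "f \<cdot> y" y, symmetric]] by simp
  also have "\<dots> = Inv (a A H B) \<cdot> (x \<otimes> ((f \<otimes> B) \<cdot> dB \<cdot> y)) \<cdot> dX"
    by (simp add: y(4) tensor_comp_reduce)
  also have "\<dots> = eqB \<cdot> (x \<otimes> y) \<cdot> dX"
    by (simp add: eqB_def coactB_def tensor_comp_reduce)
  finally show ?thesis .
qed

text \<open>Cocommutativity of \<open>X\<close> absorbs the crossing inside
  \<open>prod_comult\<close>. This is why the pairing of two comonoid morphisms is again compatible
  with comultiplication.\<close>

lemma prod_comult_pair:
  "prod_comult \<cdot> (x \<otimes> y) \<cdot> dX = a A B (A \<otimes> B) \<cdot> (((x \<otimes> y) \<cdot> dX) \<otimes> ((x \<otimes> y) \<cdot> dX)) \<cdot> dX"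
proof -
  let ?h = "\<lambda>W. hat X X dX W"
  let ?xy = "x \<otimes> (y \<otimes> (x \<otimes> y))"
  have hX: "?h X \<cdot> dX = (X \<otimes> dX) \<cdot> dX"
    using comonoid_object.comult_assoc[OF comonoid_X] by (simp add: hat_def)
  have h2: "?h (X \<otimes> X) \<cdot> (X \<otimes> dX) \<cdot> dX = (X \<otimes> ((X \<otimes> dX) \<cdot> dX)) \<cdot> dX"
  proof -
    have "?h (X \<otimes> X) \<cdot> (X \<otimes> dX) \<cdot> dX = (X \<otimes> (X \<otimes> dX)) \<cdot> ?h X \<cdot> dX"
      using comp_reduce[OF hat_nat[of dX X X dX], of dX] by simp
    then show ?thesis
      by (simp add: hX tensor_comp_reduce)
  qed
  have "prod_comult \<cdot> (x \<otimes> y) \<cdot> dX = (A \<otimes> ch A B B) \<cdot> dAh (B \<otimes> B) \<cdot> (x \<otimes> (y \<otimes> y)) \<cdot> (X \<otimes> dX) \<cdot> dX"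
    by (simp add: prod_comult_def tensor_comp_reduce y(4))
  also have "dAh (B \<otimes> B) \<cdot> (x \<otimes> (y \<otimes> y)) = (x \<otimes> (x \<otimes> (y \<otimes> y))) \<cdot> ?h (X \<otimes> X)"
    using comp_reduce[OF assoc_nat[of x x "y \<otimes> y", symmetric]] by (simp add: hat_def tensor_comp x(4))
  from comp_reduce[OF this, of "(X \<otimes> dX) \<cdot> dX"]
  have "dAh (B \<otimes> B) \<cdot> (x \<otimes> (y \<otimes> y)) \<cdot> (X \<otimes> dX) \<cdot> dX = (x \<otimes> (x \<otimes> (y \<otimes> y))) \<cdot> (X \<otimes> ((X \<otimes> dX) \<cdot> dX)) \<cdot> dX"
    by (simp add: h2)
  also have "(A \<otimes> ch A B B) \<cdot> \<dots> = (x \<otimes> ((ch A B B \<cdot> (x \<otimes> (y \<otimes> y))) \<cdot> (X \<otimes> dX) \<cdot> dX)) \<cdot> dX"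
    by (simp add: tensor_comp_reduce)
  also have "ch A B B \<cdot> (x \<otimes> (y \<otimes> y)) = (y \<otimes> (x \<otimes> y)) \<cdot> ch X X X"
    using ch_nat[of x y y] by simp
  also have "\<dots> \<cdot> (X \<otimes> dX) \<cdot> dX = (y \<otimes> (x \<otimes> y)) \<cdot> (ch X X X \<cdot> ?h X) \<cdot> dX"
    by (simp add: hX)
  also have "\<dots> = (y \<otimes> (x \<otimes> y)) \<cdot> (X \<otimes> dX) \<cdot> dX"
    unfolding ch_cocommutative[OF comonoid_X cocomm_X, of X, simplified] by (simp add: hX)
  finally have L: "prod_comult \<cdot> (x \<otimes> y) \<cdot> dX = (x \<otimes> ((y \<otimes> (x \<otimes> y)) \<cdot> (X \<otimes> dX) \<cdot> dX)) \<cdot> dX" .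
  have "a A B (A \<otimes> B) \<cdot> (((x \<otimes> y) \<cdot> dX) \<otimes> ((x \<otimes> y) \<cdot> dX)) \<cdot> dX
    = (a A B (A \<otimes> B) \<cdot> ((x \<otimes> y) \<otimes> (x \<otimes> y))) \<cdot> (dX \<otimes> (X \<otimes> X)) \<cdot> (X \<otimes> dX) \<cdot> dX"
    by (simp add: tensor_comp_reduce)
  also have "\<dots> = ?xy \<cdot> ?h (X \<otimes> X) \<cdot> (X \<otimes> dX) \<cdot> dX"
    using assoc_nat[of x y "x \<otimes> y"] by (simp add: hat_def)
  also have "\<dots> = (x \<otimes> ((y \<otimes> (x \<otimes> y)) \<cdot> (X \<otimes> dX) \<cdot> dX)) \<cdot> dX"
    unfolding h2 by (simp add: tensor_comp_reduce)
  finally show ?thesis using L by simp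
qed

end

end

section \<open>The cocommutative comonoid carried by the equalizer\<close>

locale relative_product = comonoid_cospan C M c A dA eA B dB eB H \<pi> f
  for C :: "'m cat" and M :: "'m monoidal" and c :: "'m \<Rightarrow> 'm \<Rightarrow> 'm"
    and A dA eA B dB eB H \<pi> f :: 'm +
  fixes e :: 'm
  assumes e: "is_pullback C eqA eqB e e"
    and e_right: "\<And>W. ob W \<Longrightarrow> is_pullback C (eqA \<otimes> W) (eqB \<otimes> W) (e \<otimes> W) (e \<otimes> W)"
    and e_left: "\<And>W. ob W \<Longrightarrow> is_pullback C (W \<otimes> eqA) (W \<otimes> eqB) (W \<otimes> e) (W \<otimes> e)"
    and mono_left: "\<And>W g. \<lbrakk>ob W; mono_arr C g\<rbrakk> \<Longrightarrow> mono_arr C (W \<otimes> g)"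
begin

abbreviation (input) E where "E \<equiv> Dom C e"

lemma e_arr [simp]: "e \<in> Arr C" "Cod C e = A \<otimes> B" "ob E"
  using pullbackD[OF e] by simp_all

lemma nuh_e: "nuh B \<cdot> e = (A \<otimes> coactB) \<cdot> e"
proof -
  have "nuh B \<cdot> e = a A H B \<cdot> eqA \<cdot> e"
    by (simp add: eqA_def hat_def)
  also have "eqA \<cdot> e = eqB \<cdot> e"
    by (rule pullbackD(9)[OF e])
  finally show ?thesis by (simp add: eqB_def)
qed

text \<open>The first two legs of \<open>prod_comult \<cdot> e\<close> again satisfy the equation
  that defines \<open>e\<close>. The coaction of \<open>A\<close> slides past its comultiplication
  by \<open>nuh_dAh\<close>, which uses cocommutativity, becomes the coaction of \<open>B\<close> by
  \<open>nuh_e\<close>, and meets the same crossings as on the right side.\<close>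

lemma prod_comult_e_right:
  "nuh (B \<otimes> (A \<otimes> B)) \<cdot> prod_comult \<cdot> e = (A \<otimes> rhoh (A \<otimes> B)) \<cdot> prod_comult \<cdot> e"
proof -
  let ?k = "(A \<otimes> (H \<otimes> ch A B B)) \<cdot> (A \<otimes> ch A H (B \<otimes> B)) \<cdot> dAh (H \<otimes> (B \<otimes> B)) \<cdot> (A \<otimes> (H \<otimes> dB)) \<cdot> (A \<otimes> coactB) \<cdot> e"
  have "nuh (B \<otimes> (A \<otimes> B)) \<cdot> prod_comult \<cdot> e
    = (A \<otimes> (H \<otimes> ch A B B)) \<cdot> (nuh (A \<otimes> (B \<otimes> B)) \<cdot> dAh (B \<otimes> B)) \<cdot> (A \<otimes> dB) \<cdot> e"
    using comp_reduce[OF nuh_nat[of "ch A B B"]] by (simp add: prod_comult_def)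
  also have "\<dots> = (A \<otimes> (H \<otimes> ch A B B)) \<cdot> (A \<otimes> ch A H (B \<otimes> B)) \<cdot> dAh (H \<otimes> (B \<otimes> B)) \<cdot> nuh (B \<otimes> B) \<cdot> (A \<otimes> dB) \<cdot> e"
    unfolding nuh_dAh(2)[of "B \<otimes> B", simplified] by simp
  also have "nuh (B \<otimes> B) \<cdot> (A \<otimes> dB) \<cdot> e = (A \<otimes> (H \<otimes> dB)) \<cdot> nuh B \<cdot> e"
    using comp_reduce[OF nuh_nat[of dB]] by simp
  finally have 1: "nuh (B \<otimes> (A \<otimes> B)) \<cdot> prod_comult \<cdot> e = ?k"
    unfolding nuh_e .
  have "(A \<otimes> rhoh (A \<otimes> B)) \<cdot> prod_comult \<cdot> e = (A \<otimes> (rhoh (A \<otimes> B) \<cdot> ch A B B)) \<cdot> dAh (B \<otimes> B) \<cdot> (A \<otimes> dB) \<cdot> e"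
    by (simp add: prod_comult_def whisker_left)
  also have "rhoh (A \<otimes> B) \<cdot> ch A B B = (H \<otimes> ch A B B) \<cdot> ch A H (B \<otimes> B) \<cdot> (A \<otimes> rhoh B)"
    using hat_ch[of coactB H B A B] by simp
  also have "(A \<otimes> \<dots>) \<cdot> dAh (B \<otimes> B) \<cdot> (A \<otimes> dB) \<cdot> e
    = (A \<otimes> (H \<otimes> ch A B B)) \<cdot> (A \<otimes> ch A H (B \<otimes> B)) \<cdot> dAh (H \<otimes> (B \<otimes> B)) \<cdot> (A \<otimes> (rhoh B \<cdot> dB)) \<cdot> e"
    using comp_reduce[OF dAh_nat[of "rhoh B", symmetric]] by (simp add: whisker_left)
  also have "\<dots> = ?k"
    unfolding rhoh_dB(1) by (simp add: whisker_left)
  finally show ?thesis using 1 by simp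
qed

text \<open>The same for the last two legs. Here the coaction of \<open>B\<close> ends up on a
  crossed leg, and cocommutativity of \<open>B\<close> absorbs the crossing
  (\<open>rhoh_dB\<close>).\<close>

lemma prod_comult_e_left: "(A \<otimes> (B \<otimes> nuh B)) \<cdot> prod_comult \<cdot> e = (A \<otimes> (B \<otimes> (A \<otimes> coactB))) \<cdot> prod_comult \<cdot> e"
proof -
  have "(A \<otimes> (B \<otimes> nuh B)) \<cdot> prod_comult \<cdot> e = (A \<otimes> ((B \<otimes> nuh B) \<cdot> ch A B B)) \<cdot> dAh (B \<otimes> B) \<cdot> (A \<otimes> dB) \<cdot> e"
    by (simp add: prod_comult_def whisker_left)
  also have "(B \<otimes> nuh B) \<cdot> ch A B B = ch A B (H \<otimes> B) \<cdot> (A \<otimes> ch H B B) \<cdot> nuh (B \<otimes> B)"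
    using ch_hat[of coactA A H B B] by simp
  also have "(A \<otimes> \<dots>) \<cdot> dAh (B \<otimes> B) \<cdot> (A \<otimes> dB) \<cdot> e
    = (A \<otimes> ch A B (H \<otimes> B)) \<cdot> (A \<otimes> (A \<otimes> ch H B B)) \<cdot> ((A \<otimes> nuh (B \<otimes> B)) \<cdot> dAh (B \<otimes> B)) \<cdot> (A \<otimes> dB) \<cdot> e"
    by (simp add: whisker_left)
  also have "\<dots> = (A \<otimes> ch A B (H \<otimes> B)) \<cdot> (A \<otimes> (A \<otimes> ch H B B)) \<cdot> dAh (H \<otimes> (B \<otimes> B)) \<cdot> nuh (B \<otimes> B) \<cdot> (A \<otimes> dB) \<cdot> e"
    unfolding nuh_dAh(1)[of "B \<otimes> B", simplified] by simp
  also have "nuh (B \<otimes> B) \<cdot> (A \<otimes> dB) \<cdot> e = (A \<otimes> (H \<otimes> dB)) \<cdot> nuh B \<cdot> e"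
    using comp_reduce[OF nuh_nat[of dB]] by simp
  also have "(A \<otimes> (A \<otimes> ch H B B)) \<cdot> dAh (H \<otimes> (B \<otimes> B)) \<cdot> \<dots>
    = dAh (B \<otimes> (H \<otimes> B)) \<cdot> (A \<otimes> (ch H B B \<cdot> (H \<otimes> dB) \<cdot> coactB)) \<cdot> e"
    unfolding nuh_e using comp_reduce[OF dAh_nat[of "ch H B B", symmetric]] by (simp add: whisker_left)
  also have "\<dots> = dAh (B \<otimes> (H \<otimes> B)) \<cdot> (A \<otimes> (B \<otimes> coactB)) \<cdot> (A \<otimes> dB) \<cdot> e"
    unfolding rhoh_dB(2) by (simp add: whisker_left)
  also have "\<dots> = (A \<otimes> (A \<otimes> (B \<otimes> coactB))) \<cdot> dAh (B \<otimes> B) \<cdot> (A \<otimes> dB) \<cdot> e"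
    using comp_reduce[OF dAh_nat[of "B \<otimes> coactB"]] by simp
  also have "(A \<otimes> ch A B (H \<otimes> B)) \<cdot> \<dots> = (A \<otimes> (ch A B (H \<otimes> B) \<cdot> (A \<otimes> (B \<otimes> coactB)))) \<cdot> dAh (B \<otimes> B) \<cdot> (A \<otimes> dB) \<cdot> e"
    by (simp add: whisker_left)
  also have "\<dots> = (A \<otimes> (B \<otimes> (A \<otimes> coactB))) \<cdot> prod_comult \<cdot> e"
    using ch_nat[of A B coactB] by (simp add: prod_comult_def whisker_left)
  finally show ?thesis .
qed

text \<open>The two factors are restricted to \<open>E\<close> one at a time, first through
  \<open>e \<otimes> ?P\<close> and then through \<open>E \<otimes> e\<close>. The condition for the
  second factorization is checked behind the monomorphism \<open>e \<otimes> ?Q\<close>.\<close>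

lemma comult_exists:
  "\<exists>d. d \<in> Arr C \<and> Dom C d = E \<and> Cod C d = E \<otimes> E \<and> (e \<otimes> e) \<cdot> d = Inv (a A B (A \<otimes> B)) \<cdot> prod_comult \<cdot> e"
proof -
  let ?P = "A \<otimes> B" and ?Q = "(A \<otimes> H) \<otimes> B"
  let ?y = "Inv (a A B ?P) \<cdot> prod_comult \<cdot> e"
  have "a A H (B \<otimes> ?P) \<cdot> a (A \<otimes> H) B ?P \<cdot> (eqA \<otimes> ?P) \<cdot> ?y = a A H (B \<otimes> ?P) \<cdot> a (A \<otimes> H) B ?P \<cdot> (eqB \<otimes> ?P) \<cdot> ?y"
    using comp_reduce[OF eqA_hat[of ?P], of ?y] comp_reduce[OF eqB_hat[of ?P], of ?y]
    by (simp add: prod_comult_e_right)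
  then have "a (A \<otimes> H) B ?P \<cdot> (eqA \<otimes> ?P) \<cdot> ?y = a (A \<otimes> H) B ?P \<cdot> (eqB \<otimes> ?P) \<cdot> ?y"
    by (rule iso_cancel_left[of "a A H (B \<otimes> ?P)", rotated -1]) simp_all
  then have "(eqA \<otimes> ?P) \<cdot> ?y = (eqB \<otimes> ?P) \<cdot> ?y"
    by (rule iso_cancel_left[of "a (A \<otimes> H) B ?P", rotated -1]) simp_all
  then have "\<exists>!x. x \<in> Arr C \<and> Dom C x = Dom C ?y \<and> Cod C x = Dom C (e \<otimes> ?P) \<and> (e \<otimes> ?P) \<cdot> x = ?y"
    by (intro pullback_factor[OF e_right]) simp_all
  then obtain x where x: "x \<in> Arr C" "Dom C x = E" "Cod C x = E \<otimes> ?P" "(e \<otimes> ?P) \<cdot> x = ?y"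
    by auto
  note [simp] = x(1-3)
  have *: "(e \<otimes> ?Q) \<cdot> (E \<otimes> g) \<cdot> x = Inv (a A B ?Q) \<cdot> (A \<otimes> (B \<otimes> g)) \<cdot> prod_comult \<cdot> e"
    if [simp]: "g \<in> Arr C" "Dom C g = ?P" "Cod C g = ?Q" for g
  proof -
    have "(e \<otimes> ?Q) \<cdot> (E \<otimes> g) \<cdot> x = (?P \<otimes> g) \<cdot> (e \<otimes> ?P) \<cdot> x"
      by (simp add: tensor_comp_reduce)
    also have "\<dots> = Inv (a A B ?Q) \<cdot> (A \<otimes> (B \<otimes> g)) \<cdot> prod_comult \<cdot> e"
      unfolding x(4) using comp_reduce[OF assoc_inv_nat[of A B g, symmetric]] by simp
    finally show ?thesis .
  qed
  have "(A \<otimes> (B \<otimes> a A H B)) \<cdot> (A \<otimes> (B \<otimes> eqA)) \<cdot> prod_comult \<cdot> e = (A \<otimes> (B \<otimes> nuh B)) \<cdot> prod_comult \<cdot> e"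
    by (simp add: tensor_comp tensor_comp_reduce eqA_def hat_def)
  also have "\<dots> = (A \<otimes> (B \<otimes> a A H B)) \<cdot> (A \<otimes> (B \<otimes> eqB)) \<cdot> prod_comult \<cdot> e"
    unfolding prod_comult_e_left by (simp add: tensor_comp tensor_comp_reduce eqB_def)
  finally have "(A \<otimes> (B \<otimes> eqA)) \<cdot> prod_comult \<cdot> e = (A \<otimes> (B \<otimes> eqB)) \<cdot> prod_comult \<cdot> e"
    by (rule iso_cancel_left[of "A \<otimes> (B \<otimes> a A H B)", rotated -1]) simp_all
  then have "(e \<otimes> ?Q) \<cdot> (E \<otimes> eqA) \<cdot> x = (e \<otimes> ?Q) \<cdot> (E \<otimes> eqB) \<cdot> x"
    by (simp add: *)
  then have "(E \<otimes> eqA) \<cdot> x = (E \<otimes> eqB) \<cdot> x"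
    by (rule mono_cancel[OF pullback_mono[OF e_right[of ?Q]], rotated -1]) simp_all
  then have "\<exists>!d. d \<in> Arr C \<and> Dom C d = Dom C x \<and> Cod C d = Dom C (E \<otimes> e) \<and> (E \<otimes> e) \<cdot> d = x"
    by (intro pullback_factor[OF e_left]) simp_all
  then obtain d where d: "d \<in> Arr C" "Dom C d = E" "Cod C d = E \<otimes> E" "(E \<otimes> e) \<cdot> d = x"
    by auto
  have "(e \<otimes> e) \<cdot> d = (e \<otimes> ?P) \<cdot> (E \<otimes> e) \<cdot> d"
    using d(1-3) by (simp add: tensor_comp_reduce)
  also have "\<dots> = ?y"
    unfolding d(4) x(4) ..
  finally show ?thesis using d by blast
qed

text \<open>The choice is harmless: \<open>e \<otimes> e\<close> is a composite of monomorphisms, so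
  the equation determines the arrow.\<close>

definition comultE where
  "comultE = (SOME d. d \<in> Arr C \<and> Dom C d = E \<and> Cod C d = E \<otimes> E
    \<and> (e \<otimes> e) \<cdot> d = Inv (a A B (A \<otimes> B)) \<cdot> prod_comult \<cdot> e)"

definition counitE where "counitE = eA \<cdot> projA \<cdot> e"

lemma comultE:
  shows "comultE \<in> Arr C" "Dom C comultE = E" "Cod C comultE = E \<otimes> E"
    and e_comultE: "(e \<otimes> e) \<cdot> comultE = Inv (a A B (A \<otimes> B)) \<cdot> prod_comult \<cdot> e"
  using someI_ex[OF comult_exists, folded comultE_def] by auto

lemmas [simp] = comultE(1-3)

lemma counitE_arr [simp]: "counitE \<in> Arr C" "Dom C counitE = E" "Cod C counitE = I"
  by (simp_all add: counitE_def)

lemma projA_e: "((projA \<cdot> e) \<otimes> e) \<cdot> comultE = dAh B \<cdot> e"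
proof -
  have "((projA \<cdot> e) \<otimes> e) \<cdot> comultE = (projA \<otimes> (A \<otimes> B)) \<cdot> (e \<otimes> e) \<cdot> comultE"
    by (simp add: tensor_comp_reduce)
  also have "\<dots> = (A \<otimes> kill eB (A \<otimes> B)) \<cdot> prod_comult \<cdot> e"
    unfolding e_comultE using comp_reduce[OF projA_tensor[of "A \<otimes> B"]] by simp
  also have "\<dots> = dAh B \<cdot> e"
    using comp_reduce[OF prod_comult_counits(1), of e] by simp
  finally show ?thesis .
qed

lemma projB_e: "((projB \<cdot> e) \<otimes> e) \<cdot> comultE = ch A B B \<cdot> (A \<otimes> dB) \<cdot> e"
proof -
  have "((projB \<cdot> e) \<otimes> e) \<cdot> comultE = (projB \<otimes> (A \<otimes> B)) \<cdot> (e \<otimes> e) \<cdot> comultE"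
    by (simp add: tensor_comp_reduce)
  also have "\<dots> = kill eA (B \<otimes> (A \<otimes> B)) \<cdot> prod_comult \<cdot> e"
    unfolding e_comultE using comp_reduce[OF projB_tensor[of "A \<otimes> B"]] by simp
  also have "\<dots> = ch A B B \<cdot> (A \<otimes> dB) \<cdot> e"
    using comp_reduce[OF prod_comult_counits(2), of e] by simp
  finally show ?thesis .
qed

lemma e_projB: "(e \<otimes> (projB \<cdot> e)) \<cdot> comultE = Inv (a A B B) \<cdot> (A \<otimes> dB) \<cdot> e"
proof -
  have "(e \<otimes> (projB \<cdot> e)) \<cdot> comultE = ((A \<otimes> B) \<otimes> projB) \<cdot> (e \<otimes> e) \<cdot> comultE"
    by (simp add: tensor_comp_reduce)
  also have "\<dots> = Inv (a A B B) \<cdot> (A \<otimes> (B \<otimes> kill eA B)) \<cdot> prod_comult \<cdot> e"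
    unfolding e_comultE using comp_reduce[OF assoc_inv_nat[of A B projB, symmetric]] by (simp add: projB_def)
  also have "\<dots> = Inv (a A B B) \<cdot> (A \<otimes> dB) \<cdot> e"
    using comp_reduce[OF prod_comult_counits(3), of e] by simp
  finally show ?thesis .
qed

lemma proj_pair: "((projA \<cdot> e) \<otimes> (projB \<cdot> e)) \<cdot> comultE = e"
proof -
  have "((projA \<cdot> e) \<otimes> (projB \<cdot> e)) \<cdot> comultE = (A \<otimes> projB) \<cdot> ((projA \<cdot> e) \<otimes> e) \<cdot> comultE"
    by (simp add: tensor_comp_reduce)
  also have "\<dots> = e"
    unfolding projA_e using comp_reduce[OF dA_hat(3)[of B]] by (simp add: projB_def)
  finally show ?thesis .
qed

lemma projA_comult: "((projA \<cdot> e) \<otimes> (projA \<cdot> e)) \<cdot> comultE = dA \<cdot> projA \<cdot> e"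
proof -
  have "(A \<otimes> r A) \<cdot> dAh I = dA \<cdot> r A"
    using comp_reduce[OF runit_tensor[of A A]] runit_nat[of dA] by (simp add: hat_def)
  from comp_reduce[OF this, of "A \<otimes> eB"]
  have "(A \<otimes> r A) \<cdot> dAh I \<cdot> (A \<otimes> eB) = dA \<cdot> projA"
    by (simp add: projA_def)
  then have p: "(A \<otimes> projA) \<cdot> dAh B = dA \<cdot> projA"
    using dAh_nat[of eB] by (simp add: projA_def whisker_left)
  have "((projA \<cdot> e) \<otimes> (projA \<cdot> e)) \<cdot> comultE = (A \<otimes> projA) \<cdot> ((projA \<cdot> e) \<otimes> e) \<cdot> comultE"
    by (simp add: tensor_comp_reduce)
  also have "\<dots> = dA \<cdot> projA \<cdot> e"
    unfolding projA_e using comp_reduce[OF p] by simp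
  finally show ?thesis .
qed

lemma projB_comult: "((projB \<cdot> e) \<otimes> (projB \<cdot> e)) \<cdot> comultE = dB \<cdot> projB \<cdot> e"
proof -
  have "((projB \<cdot> e) \<otimes> (projB \<cdot> e)) \<cdot> comultE = (B \<otimes> projB) \<cdot> ((projB \<cdot> e) \<otimes> e) \<cdot> comultE"
    by (simp add: tensor_comp_reduce)
  also have "\<dots> = kill eA (B \<otimes> B) \<cdot> (A \<otimes> dB) \<cdot> e"
    unfolding projB_e unfolding projB_def using comp_reduce[OF ch_kill_left[of eA B B], of "(A \<otimes> dB) \<cdot> e"] by simp
  also have "\<dots> = dB \<cdot> projB \<cdot> e"
    unfolding projB_def using comp_reduce[OF kill_nat[of eA dB]] by simp
  finally show ?thesis .
qed

text \<open>The counits remove the outer legs of \<open>prod_comult\<close> and leave the crossing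
  of the inner ones. With \<open>proj_pair\<close> this says that the components of \<open>e\<close>
  commute in one order outright, and in the other order up to the double braiding.\<close>

lemma projB_projA: "((projB \<cdot> e) \<otimes> (projA \<cdot> e)) \<cdot> comultE = c A B \<cdot> e"
proof -
  have cr: "(B \<otimes> r A) \<cdot> ch A B I = c A B \<cdot> (A \<otimes> r B)"
  proof -
    have "(B \<otimes> r A) \<cdot> ch A B I = r (B \<otimes> A) \<cdot> (c A B \<otimes> I) \<cdot> Inv (a A B I)"
      using comp_reduce[OF runit_tensor[of B A]] by (simp add: ch_def hat_def)
    also have "\<dots> = c A B \<cdot> r (A \<otimes> B) \<cdot> Inv (a A B I)"
      using comp_reduce[OF runit_nat[of "c A B"]] by simp
    also have "\<dots> = c A B \<cdot> (A \<otimes> r B)"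
      by (simp add: runit_tensor[symmetric])
    finally show ?thesis .
  qed
  have "((projB \<cdot> e) \<otimes> (projA \<cdot> e)) \<cdot> comultE = (B \<otimes> projA) \<cdot> ((projB \<cdot> e) \<otimes> e) \<cdot> comultE"
    by (simp add: tensor_comp_reduce)
  also have "\<dots> = (B \<otimes> r A) \<cdot> ((B \<otimes> (A \<otimes> eB)) \<cdot> ch A B B) \<cdot> (A \<otimes> dB) \<cdot> e"
    unfolding projB_e by (simp add: projA_def whisker_left)
  also have "(B \<otimes> (A \<otimes> eB)) \<cdot> ch A B B = ch A B I \<cdot> (A \<otimes> (B \<otimes> eB))"
    using ch_nat[of A B eB] by simp
  also have "(B \<otimes> r A) \<cdot> (ch A B I \<cdot> (A \<otimes> (B \<otimes> eB))) \<cdot> (A \<otimes> dB) \<cdot> e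
    = c A B \<cdot> (A \<otimes> (r B \<cdot> (B \<otimes> eB) \<cdot> dB)) \<cdot> e"
    using comp_reduce[OF cr] by (simp add: whisker_left)
  also have "\<dots> = c A B \<cdot> e"
    by (simp add: comonoid_object.comult_counit_right[OF comonoid_B])
  finally show ?thesis .
qed

lemma counitE_eq: "counitE = eB \<cdot> projB \<cdot> e"
proof -
  have "eA \<cdot> projA = r I \<cdot> (eA \<otimes> eB)"
    using comp_reduce[OF runit_nat[of eA, symmetric]] by (simp add: projA_def tensor_comp)
  also have "\<dots> = eB \<cdot> projB"
    using comp_reduce[OF lunit_nat[of eB, symmetric]] by (simp add: projB_def kill_def tensor_comp lunit_eq_runit)
  finally have *: "eA \<cdot> projA = eB \<cdot> projB" .
  show ?thesis
    unfolding counitE_def using comp_reduce[OF *] by simp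
qed

lemma e_mono: "mono_arr C e" and e_tensor_mono: "ob W \<Longrightarrow> mono_arr C (e \<otimes> W)"
  using pullback_mono e e_right by blast+

lemma counitE_left: "l E \<cdot> (counitE \<otimes> E) \<cdot> comultE = E"
proof -
  have "e \<cdot> l E \<cdot> (counitE \<otimes> E) \<cdot> comultE = l (A \<otimes> B) \<cdot> (counitE \<otimes> e) \<cdot> comultE"
    using comp_reduce[OF lunit_nat[of e, symmetric]] by (simp add: tensor_comp_reduce)
  also have "\<dots> = kill eA (A \<otimes> B) \<cdot> ((projA \<cdot> e) \<otimes> e) \<cdot> comultE"
    by (simp add: counitE_def kill_def tensor_comp_reduce)
  also have "\<dots> = e \<cdot> E"
    unfolding projA_e using comp_reduce[OF dA_hat(2)[of B], of e] by simp
  finally show ?thesis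
    by (rule mono_cancel[OF e_mono, rotated -1]) simp_all
qed

lemma counitE_right: "r E \<cdot> (E \<otimes> counitE) \<cdot> comultE = E"
proof -
  have "e \<cdot> r E \<cdot> (E \<otimes> counitE) \<cdot> comultE = r (A \<otimes> B) \<cdot> (e \<otimes> counitE) \<cdot> comultE"
    using comp_reduce[OF runit_nat[of e, symmetric]] by (simp add: tensor_comp_reduce)
  also have "\<dots> = r (A \<otimes> B) \<cdot> ((A \<otimes> B) \<otimes> eB) \<cdot> (e \<otimes> (projB \<cdot> e)) \<cdot> comultE"
    by (simp add: counitE_eq tensor_comp_reduce)
  also have "\<dots> = r (A \<otimes> B) \<cdot> Inv (a A B I) \<cdot> (A \<otimes> (B \<otimes> eB)) \<cdot> (A \<otimes> dB) \<cdot> e"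
    unfolding e_projB using comp_reduce[OF assoc_inv_nat[of A B eB, symmetric]] by simp
  also have "\<dots> = (A \<otimes> (r B \<cdot> (B \<otimes> eB) \<cdot> dB)) \<cdot> e"
    by (simp add: runit_tensor[symmetric] whisker_left)
  also have "\<dots> = e \<cdot> E"
    by (simp add: comonoid_object.comult_counit_right[OF comonoid_B])
  finally show ?thesis
    by (rule mono_cancel[OF e_mono, rotated -1]) simp_all
qed

lemma hat_e_comultE:
  assumes [simp]: "ob W"
  shows "hat A B e (A \<otimes> (B \<otimes> W)) \<cdot> (E \<otimes> hat A B e W) \<cdot> hat E E comultE W = prod_comult_hat W \<cdot> hat A B e W"
proof -
  let ?P = "A \<otimes> B"
  have "hat A B e (A \<otimes> (B \<otimes> W)) \<cdot> (E \<otimes> hat A B e W) \<cdot> hat E E comultE W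
    = a A B (A \<otimes> (B \<otimes> W)) \<cdot> (?P \<otimes> a A B W) \<cdot> (e \<otimes> (e \<otimes> W)) \<cdot> a E E W \<cdot> (comultE \<otimes> W)"
    by (simp add: hat_def tensor_comp_reduce)
  also have "\<dots> = a A B (A \<otimes> (B \<otimes> W)) \<cdot> (?P \<otimes> a A B W) \<cdot> a ?P ?P W \<cdot> (((e \<otimes> e) \<cdot> comultE) \<otimes> W)"
    using comp_reduce[OF assoc_nat[of e e W]] by (simp add: whisker_right)
  also have "\<dots> = (A \<otimes> (B \<otimes> a A B W)) \<cdot> (a A B (?P \<otimes> W) \<cdot> a ?P ?P W) \<cdot> ((Inv (a A B ?P) \<cdot> prod_comult \<cdot> e) \<otimes> W)"
    unfolding e_comultE using comp_reduce[OF assoc_nat[of A B "a A B W"]] by simp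
  also have "\<dots> = (A \<otimes> (B \<otimes> a A B W)) \<cdot> (A \<otimes> a B ?P W) \<cdot> a A (B \<otimes> ?P) W \<cdot> (prod_comult \<otimes> W) \<cdot> (e \<otimes> W)"
    by (subst pentagon[symmetric]) (simp_all add: tensor_comp)
  also have "\<dots> = prod_comult_hat W \<cdot> hat A B e W"
    using comp_reduce[OF prod_comult_tail[of W], of "e \<otimes> W"] by (simp add: hat_def)
  finally show ?thesis .
qed

text \<open>\<open>?M\<close> embeds \<open>E \<otimes> (E \<otimes> E)\<close> into a right-nested
  product of copies of \<open>A\<close> and \<open>B\<close>, where the claim becomes
  \<open>prod_comult_coassoc\<close>.\<close>

lemma comultE_coassoc: "a E E E \<cdot> (comultE \<otimes> E) \<cdot> comultE = (E \<otimes> comultE) \<cdot> comultE"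
proof -
  let ?P = "A \<otimes> B"
  let ?M = "hat A B e (A \<otimes> (B \<otimes> ?P)) \<cdot> (E \<otimes> (hat A B e ?P \<cdot> (E \<otimes> e)))"
  have m: "mono_arr C (hat A B e W)" if [simp]: "ob W" for W
    unfolding hat_def by (rule mono_comp[OF e_tensor_mono iso_mono]) simp_all
  have base: "hat A B e ?P \<cdot> (E \<otimes> e) \<cdot> comultE = prod_comult \<cdot> e"
    using e_comultE by (simp add: hat_def tensor_comp_reduce)
  have "?M \<cdot> a E E E \<cdot> (comultE \<otimes> E) \<cdot> comultE
    = hat A B e (A \<otimes> (B \<otimes> ?P)) \<cdot> (E \<otimes> hat A B e ?P) \<cdot> (E \<otimes> (E \<otimes> e)) \<cdot> hat E E comultE E \<cdot> comultE"
    by (simp add: whisker_left hat_def[of E])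
  also have "\<dots> = (hat A B e (A \<otimes> (B \<otimes> ?P)) \<cdot> (E \<otimes> hat A B e ?P) \<cdot> hat E E comultE ?P) \<cdot> (E \<otimes> e) \<cdot> comultE"
    using comp_reduce[OF hat_nat[of comultE E E e, symmetric]] by simp
  also have "\<dots> = prod_comult_hat ?P \<cdot> prod_comult \<cdot> e"
    unfolding hat_e_comultE[of ?P, simplified] using base by simp
  also have "\<dots> = (A \<otimes> (B \<otimes> prod_comult)) \<cdot> prod_comult \<cdot> e"
    using comp_reduce[OF prod_comult_coassoc, of e] by simp
  also have "\<dots> = hat A B e (A \<otimes> (B \<otimes> ?P)) \<cdot> (E \<otimes> prod_comult) \<cdot> (E \<otimes> e) \<cdot> comultE"
    using comp_reduce[OF hat_nat[of e A B prod_comult]] base by simp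
  also have "\<dots> = ?M \<cdot> (E \<otimes> comultE) \<cdot> comultE"
    using base by (simp add: tensor_comp_reduce)
  finally show ?thesis
  proof (rule mono_cancel[of ?M, rotated -1])
    show "mono_arr C ?M"
      by (intro mono_comp m mono_left) (simp_all add: e_mono)
  qed simp_all
qed

lemma comonoid_E: "comonoid_object C M E comultE counitE"
  by unfold_locales (simp_all add: homI comultE_coassoc counitE_left counitE_right)

text \<open>
  An arrow commuting with two others commutes with their pairing, and \<open>e\<close> is the pairing of its two
  components; so cocommutativity of \<open>E\<close> reduces to these components commuting with one another.
\<close>

definition commute where
  "commute u v \<longleftrightarrow> c (Cod C u) (Cod C v) \<cdot> (u \<otimes> v) \<cdot> comultE = (v \<otimes> u) \<cdot> comultE"

text \<open>Coassociativity regroups the three legs so that \<open>hexagon1\<close> splits the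
  braiding past a pair into the braidings past \<open>v\<close> and past \<open>w\<close>.\<close>

lemma commute_right:
  assumes [simp]: "u \<in> Arr C" "v \<in> Arr C" "w \<in> Arr C" "Dom C u = E" "Dom C v = E" "Dom C w = E"
    and "commute u v" "commute u w"
  shows "commute u ((v \<otimes> w) \<cdot> comultE)"
proof -
  let ?U = "Cod C u" and ?V = "Cod C v" and ?W = "Cod C w"
  have uv: "c ?U ?V \<cdot> (u \<otimes> v) \<cdot> comultE = (v \<otimes> u) \<cdot> comultE"
    and uw: "c ?U ?W \<cdot> (u \<otimes> w) \<cdot> comultE = (w \<otimes> u) \<cdot> comultE"
    using assms(7,8) unfolding commute_def .
  have co: "(x \<otimes> ((y \<otimes> z) \<cdot> comultE)) \<cdot> comultE = a (Cod C x) (Cod C y) (Cod C z) \<cdot> (((x \<otimes> y) \<cdot> comultE) \<otimes> z) \<cdot> comultE"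
    if [simp]: "x \<in> Arr C" "y \<in> Arr C" "z \<in> Arr C" "Dom C x = E" "Dom C y = E" "Dom C z = E" for x y z
  proof -
    have "(x \<otimes> ((y \<otimes> z) \<cdot> comultE)) \<cdot> comultE = (x \<otimes> (y \<otimes> z)) \<cdot> a E E E \<cdot> (comultE \<otimes> E) \<cdot> comultE"
      unfolding comultE_coassoc by (simp add: tensor_comp_reduce)
    also have "\<dots> = a (Cod C x) (Cod C y) (Cod C z) \<cdot> (((x \<otimes> y) \<cdot> comultE) \<otimes> z) \<cdot> comultE"
      using comp_reduce[OF assoc_nat[of x y z, symmetric]] by (simp add: tensor_comp_reduce)
    finally show ?thesis .
  qed
  have "a ?V ?W ?U \<cdot> c ?U (?V \<otimes> ?W) \<cdot> (u \<otimes> ((v \<otimes> w) \<cdot> comultE)) \<cdot> comultE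
    = (a ?V ?W ?U \<cdot> c ?U (?V \<otimes> ?W) \<cdot> a ?U ?V ?W) \<cdot> (((u \<otimes> v) \<cdot> comultE) \<otimes> w) \<cdot> comultE"
    by (simp add: co)
  also have "\<dots> = (?V \<otimes> c ?U ?W) \<cdot> a ?V ?U ?W \<cdot> ((c ?U ?V \<cdot> (u \<otimes> v) \<cdot> comultE) \<otimes> w) \<cdot> comultE"
    by (subst hexagon1) (simp_all add: tensor_comp_reduce)
  also have "\<dots> = (?V \<otimes> c ?U ?W) \<cdot> (v \<otimes> ((u \<otimes> w) \<cdot> comultE)) \<cdot> comultE"
    unfolding uv by (simp add: co)
  also have "\<dots> = (v \<otimes> (c ?U ?W \<cdot> (u \<otimes> w) \<cdot> comultE)) \<cdot> comultE"
    by (simp add: tensor_comp_reduce)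
  also have "\<dots> = a ?V ?W ?U \<cdot> (((v \<otimes> w) \<cdot> comultE) \<otimes> u) \<cdot> comultE"
    unfolding uw by (simp add: co)
  finally have "c ?U (?V \<otimes> ?W) \<cdot> (u \<otimes> ((v \<otimes> w) \<cdot> comultE)) \<cdot> comultE = (((v \<otimes> w) \<cdot> comultE) \<otimes> u) \<cdot> comultE"
    by (rule iso_cancel_left[of "a ?V ?W ?U", rotated -1]) simp_all
  then show ?thesis
    by (simp add: commute_def)
qed

lemma commute_left:
  assumes [simp]: "u \<in> Arr C" "v \<in> Arr C" "w \<in> Arr C" "Dom C u = E" "Dom C v = E" "Dom C w = E"
    and "commute u w" "commute v w"
  shows "commute ((u \<otimes> v) \<cdot> comultE) w"
proof -
  let ?U = "Cod C u" and ?V = "Cod C v" and ?W = "Cod C w"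
  have uw: "c ?U ?W \<cdot> (u \<otimes> w) \<cdot> comultE = (w \<otimes> u) \<cdot> comultE"
    and vw: "c ?V ?W \<cdot> (v \<otimes> w) \<cdot> comultE = (w \<otimes> v) \<cdot> comultE"
    using assms(7,8) unfolding commute_def .
  have co: "(((x \<otimes> y) \<cdot> comultE) \<otimes> z) \<cdot> comultE = Inv (a (Cod C x) (Cod C y) (Cod C z)) \<cdot> (x \<otimes> ((y \<otimes> z) \<cdot> comultE)) \<cdot> comultE"
    if [simp]: "x \<in> Arr C" "y \<in> Arr C" "z \<in> Arr C" "Dom C x = E" "Dom C y = E" "Dom C z = E" for x y z
  proof -
    have "(x \<otimes> ((y \<otimes> z) \<cdot> comultE)) \<cdot> comultE = (x \<otimes> (y \<otimes> z)) \<cdot> a E E E \<cdot> (comultE \<otimes> E) \<cdot> comultE"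
      unfolding comultE_coassoc by (simp add: tensor_comp_reduce)
    also have "\<dots> = a (Cod C x) (Cod C y) (Cod C z) \<cdot> (((x \<otimes> y) \<cdot> comultE) \<otimes> z) \<cdot> comultE"
      using comp_reduce[OF assoc_nat[of x y z, symmetric]] by (simp add: tensor_comp_reduce)
    finally show ?thesis by simp
  qed
  have "Inv (a ?W ?U ?V) \<cdot> c (?U \<otimes> ?V) ?W \<cdot> (((u \<otimes> v) \<cdot> comultE) \<otimes> w) \<cdot> comultE
    = (Inv (a ?W ?U ?V) \<cdot> c (?U \<otimes> ?V) ?W \<cdot> Inv (a ?U ?V ?W)) \<cdot> (u \<otimes> ((v \<otimes> w) \<cdot> comultE)) \<cdot> comultE"
    by (simp add: co)
  also have "\<dots> = (c ?U ?W \<otimes> ?V) \<cdot> Inv (a ?U ?W ?V) \<cdot> (u \<otimes> (c ?V ?W \<cdot> (v \<otimes> w) \<cdot> comultE)) \<cdot> comultE"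
    by (subst hexagon2) (simp_all add: tensor_comp_reduce)
  also have "\<dots> = (c ?U ?W \<otimes> ?V) \<cdot> (((u \<otimes> w) \<cdot> comultE) \<otimes> v) \<cdot> comultE"
    unfolding vw by (simp add: co)
  also have "\<dots> = ((c ?U ?W \<cdot> (u \<otimes> w) \<cdot> comultE) \<otimes> v) \<cdot> comultE"
    by (simp add: tensor_comp_reduce)
  also have "\<dots> = Inv (a ?W ?U ?V) \<cdot> (w \<otimes> ((u \<otimes> v) \<cdot> comultE)) \<cdot> comultE"
    unfolding uw by (simp add: co)
  finally have "c (?U \<otimes> ?V) ?W \<cdot> (((u \<otimes> v) \<cdot> comultE) \<otimes> w) \<cdot> comultE = (w \<otimes> ((u \<otimes> v) \<cdot> comultE)) \<cdot> comultE"
    by (rule iso_cancel_left[of "Inv (a ?W ?U ?V)", rotated -1]) simp_all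
  then show ?thesis
    by (simp add: commute_def)
qed

lemma comultE_cocommutative:
  assumes dbl: "c B A \<cdot> c A B \<cdot> e = e"
  shows "c E E \<cdot> comultE = comultE"
proof -
  let ?p = "projA \<cdot> e" and ?q = "projB \<cdot> e"
  have pp: "commute ?p ?p"
    using comp_reduce[OF cocomm_A, of ?p] by (simp add: commute_def projA_comult)
  have qq: "commute ?q ?q"
    using comp_reduce[OF cocomm_B, of ?q] by (simp add: commute_def projB_comult)
  have pq: "commute ?p ?q"
    by (simp add: commute_def proj_pair projB_projA)
  \<comment> \<open>The relation for which the double braiding has to fix \<open>e\<close>.\<close>
  have qp: "commute ?q ?p"
    by (simp add: commute_def proj_pair projB_projA dbl)
  \<comment> \<open>Passes from \<open>e\<close> to the identity of \<open>E\<close> by cancelling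
    the monomorphism \<open>e \<otimes> ?U\<close>; so commuting with \<open>e\<close> is as good as
    commuting with everything on \<open>E\<close>.\<close>
  have "commute u E" if u: "commute u e" and [simp]: "u \<in> Arr C" "Dom C u = E" for u
  proof -
    let ?U = "Cod C u"
    have "(e \<otimes> ?U) \<cdot> c ?U E \<cdot> (u \<otimes> E) \<cdot> comultE = c ?U (A \<otimes> B) \<cdot> (u \<otimes> e) \<cdot> comultE"
      using comp_reduce[OF braiding_nat[of ?U e, symmetric], of "(u \<otimes> E) \<cdot> comultE"] by (simp add: tensor_comp_reduce)
    also have "\<dots> = (e \<otimes> ?U) \<cdot> (E \<otimes> u) \<cdot> comultE"
      using u by (simp add: commute_def tensor_comp_reduce)
    finally have "c ?U E \<cdot> (u \<otimes> E) \<cdot> comultE = (E \<otimes> u) \<cdot> comultE"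
      by (rule mono_cancel[OF e_tensor_mono[of ?U], rotated -1]) simp_all
    then show ?thesis by (simp add: commute_def)
  qed
  moreover have "commute ?p e" "commute ?q e"
    using commute_right[OF _ _ _ _ _ _ pp pq] commute_right[OF _ _ _ _ _ _ qp qq] by (simp_all add: proj_pair)
  ultimately have "commute ?p E" "commute ?q E"
    by simp_all
  from commute_left[OF _ _ _ _ _ _ this] have eE: "commute e E"
    by (simp add: proj_pair)
  have "(E \<otimes> e) \<cdot> c E E \<cdot> comultE = c (A \<otimes> B) E \<cdot> (e \<otimes> E) \<cdot> comultE"
    using comp_reduce[OF braiding_nat[of e E, symmetric], of comultE] by simp
  also have "\<dots> = (E \<otimes> e) \<cdot> comultE"
    using eE by (simp add: commute_def)
  finally show ?thesis
    by (rule mono_cancel[OF pullback_mono[OF e_left[of E]], rotated -1]) simp_all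
qed

end

section \<open>The pullback of cocommutative bimonoids\<close>

context duoidal_category
begin

text \<open>Multiplication and unit of \<open>M\<close> factor through \<open>e\<close> because
  \<open>f\<close> and \<open>g\<close> are multiplicative, and the monoid laws follow because
  \<open>e\<close> is monic. The products \<odot> of \<open>dom e\<close> occur only as sources, so
  no equalizer has to pass through \<odot>.\<close>

lemma mhom_equalizer:
  assumes f: "mhom M f N" and g: "mhom M g N" and e: "is_pullback (base D) f g e e"
  shows "\<exists>m u. mhom \<lparr>car = dom e, mul = m, un = u\<rparr> e M"
proof -
  note [simp] = mhomD(1-5)[OF f] mhomD(1-5)[OF g]
  have e': "Ar e" "cod e = car M" "f \<cdot> e = g \<cdot> e"
    using circ.pullbackD[OF e] by simp_all
  note [simp] = e'(1,2)
  have mono_e: "mono e"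
    by (rule circ.pullback_mono[OF e])
  let ?E = "dom e"
  have "f \<cdot> mul M \<cdot> (e \<odot> e) = mul N \<cdot> ((f \<cdot> e) \<odot> (f \<cdot> e))"
    using red[OF mhomD(6)[OF f], of "e \<odot> e"] by (simp add: circ.tensor_comp)
  also have "\<dots> = g \<cdot> mul M \<cdot> (e \<odot> e)"
    unfolding e'(3) using red[OF mhomD(6)[OF g], of "e \<odot> e"] by (simp add: circ.tensor_comp)
  finally have "\<exists>!m. Ar m \<and> dom m = dom (mul M \<cdot> (e \<odot> e)) \<and> cod m = ?E \<and> e \<cdot> m = mul M \<cdot> (e \<odot> e)"
    by (intro circ.pullback_factor[OF e]) simp_all
  then obtain m where m: "Ar m" "dom m = ?E \<odot> ?E" "cod m = ?E" "e \<cdot> m = mul M \<cdot> (e \<odot> e)"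
    by auto
  have "f \<cdot> un M = g \<cdot> un M"
    using mhomD(7)[OF f] mhomD(7)[OF g] by simp
  then have "\<exists>!u. Ar u \<and> dom u = dom (un M) \<and> cod u = ?E \<and> e \<cdot> u = un M"
    by (intro circ.pullback_factor[OF e]) simp_all
  then obtain u where u: "Ar u" "dom u = I" "cod u = ?E" "e \<cdot> u = un M"
    by auto
  note [simp] = m(1-3) u(1-3)
  let ?M = "\<lparr>car = ?E, mul = m, un = u\<rparr>"
  have "ismon ?M"
    unfolding ismon_def
  proof unfold_locales
    show "ob (car ?M)" "\<guillemotleft>mul ?M : car ?M \<odot> car ?M \<rightarrow> car ?M\<guillemotright>" "\<guillemotleft>un ?M : I \<rightarrow> car ?M\<guillemotright>"
      by (auto intro!: homI)
    have "e \<cdot> m \<cdot> (m \<odot> ?E) = mul M \<cdot> ((e \<cdot> m) \<odot> e)"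
      using red[OF m(4), of "m \<odot> ?E"] by (simp add: circ.tensor_comp)
    also have "\<dots> = (mul M \<cdot> (mul M \<odot> car M)) \<cdot> ((e \<odot> e) \<odot> e)"
      unfolding m(4) by (simp add: circ.tensor_comp)
    also have "\<dots> = mul M \<cdot> (e \<odot> (mul M \<cdot> (e \<odot> e))) \<cdot> a\<^sub>o ?E ?E ?E"
      unfolding ismon_assoc[OF mhomD(1)[OF f]] using circ.assoc_nat[of e e e]
      by (simp add: circ.tensor_comp_reduce)
    also have "\<dots> = e \<cdot> m \<cdot> (?E \<odot> m) \<cdot> a\<^sub>o ?E ?E ?E"
      unfolding m(4)[symmetric] using red[OF m(4), of "(?E \<odot> m) \<cdot> a\<^sub>o ?E ?E ?E"] by (simp add: circ.tensor_comp_reduce)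
    finally have "m \<cdot> (m \<odot> ?E) = m \<cdot> (?E \<odot> m) \<cdot> a\<^sub>o ?E ?E ?E"
      by (rule circ.mono_cancel[OF mono_e, rotated -1]) simp_all
    then show "mul ?M \<cdot> (mul ?M \<odot> car ?M) = mul ?M \<cdot> (car ?M \<odot> mul ?M) \<cdot> a\<^sub>o (car ?M) (car ?M) (car ?M)"
      by simp
    have "e \<cdot> m \<cdot> (u \<odot> ?E) = mul M \<cdot> ((e \<cdot> u) \<odot> e)"
      using red[OF m(4), of "u \<odot> ?E"] by (simp add: circ.tensor_comp)
    also have "\<dots> = (mul M \<cdot> (un M \<odot> car M)) \<cdot> (I \<odot> e)"
      unfolding u(4) by (simp add: circ.tensor_comp)
    also have "\<dots> = e \<cdot> l\<^sub>o ?E"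
      unfolding ismon_unit_left[OF mhomD(1)[OF f]] using circ.lunit_nat[of e] by simp
    finally have "m \<cdot> (u \<odot> ?E) = l\<^sub>o ?E"
      by (rule circ.mono_cancel[OF mono_e, rotated -1]) simp_all
    then show "mul ?M \<cdot> (un ?M \<odot> car ?M) = l\<^sub>o (car ?M)"
      by simp
    have "e \<cdot> m \<cdot> (?E \<odot> u) = mul M \<cdot> (e \<odot> (e \<cdot> u))"
      using red[OF m(4), of "?E \<odot> u"] by (simp add: circ.tensor_comp)
    also have "\<dots> = (mul M \<cdot> (car M \<odot> un M)) \<cdot> (e \<odot> I)"
      unfolding u(4) by (simp add: circ.tensor_comp)
    also have "\<dots> = e \<cdot> r\<^sub>o ?E"
      unfolding ismon_unit_right[OF mhomD(1)[OF f]] using circ.runit_nat[of e] by simp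
    finally have "m \<cdot> (?E \<odot> u) = r\<^sub>o ?E"
      by (rule circ.mono_cancel[OF mono_e, rotated -1]) simp_all
    then show "mul ?M \<cdot> (car ?M \<odot> un ?M) = r\<^sub>o (car ?M)"
      by simp
  qed
  then have "mhom ?M e M"
    using m(4) u(4) by (intro mhomI) simp_all
  then show ?thesis by blast
qed

lemma mhom_kill:
  assumes "mhom M f Jmon" "ismon N"
  shows "mhom (prodmon M N) (bull.kill f (car N)) N"
  unfolding bull.kill_def
  by (rule mhom_comp[OF mhom_tensor[OF assms(1) mhom_id[OF assms(2)]] mhom_lunit[OF assms(2)]])

lemma mhom_hat:
  assumes "mhom L d (prodmon M N)" "ismon M" "ismon N" "ismon K"
  shows "mhom (prodmon L K) (bull.hat (car M) (car N) d (car K)) (prodmon M (prodmon N K))"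
  unfolding bull.hat_def
  by (rule mhom_comp[OF mhom_tensor[OF assms(1) mhom_id[OF assms(4)]] mhom_assoc[OF assms(2-4)]])

lemma bimonoidI:
  assumes "ismon (monof L)" "comonoid_object (base D) (bull D) (obj L) (comult L) (counit L)"
    "mhom (monof L) (comult L) (prodmon (monof L) (monof L))" "mhom (monof L) (counit L) Jmon"
  shows "bimonoid D L"
  unfolding bimonoid_def
  using assms(1,2) mhomD(6,7)[OF assms(3)] mhomD(6,7)[OF assms(4)] mhomD(3-5)[OF assms(3)] ismon_arr[OF assms(1)]
  by (simp add: ismon_def)

lemma morphismI:
  assumes "bimonoid D A" "bimonoid D B" "mhom (monof A) f (monof B)"
    "comult B \<cdot> f = (f \<bullet> f) \<cdot> comult A" "counit B \<cdot> f = counit A"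
  shows "bimonoid_morphism D A f B"
proof -
  have "\<guillemotleft>f : obj A \<rightarrow> obj B\<guillemotright>"
    using mhomD(3-5)[OF assms(3)] by (simp add: circ.homI)
  then show ?thesis
    using mhomD(6,7)[OF assms(3)] assms
    by (simp add: bimonoid_morphism_def bimonoid_morphism_axioms_def)
qed

end

section \<open>The bimonoid on the equalizer and its universal property\<close>

context bullet_braided_duoidal_category
begin

lemma mhom_ch:
  assumes [simp]: "ismon L" "ismon M" "ismon N"
  shows "mhom (prodmon L (prodmon M N)) (bull.ch (car L) (car M) (car N)) (prodmon M (prodmon L N))"
  unfolding bull.ch_def
  by (rule mhom_comp[OF mhom_inv[OF mhom_assoc] mhom_hat[OF mhom_braid]]) simp_all

lemma comonoid_cospan_morphisms:
  assumes "bimonoid_morphism D A \<pi> H" "bimonoid_morphism D B f H"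
    "cocommutative D c A" "cocommutative D c B"
  shows "comonoid_cospan (base D) (bull D) c (obj A) (comult A) (counit A) (obj B) (comult B) (counit B) (obj H) \<pi> f"
  by (rule comonoid_cospan.intro[OF bull_braided comonoid_cospan_axioms.intro])
    (use assms in \<open>simp_all add: morphism_arr[OF assms(1)] morphism_arr[OF assms(2)] cocommutative_def
      bimonoid.comonoid[OF morphism_arr(1)[OF assms(1)]] bimonoid.comonoid[OF morphism_arr(1)[OF assms(2)]]\<close>)

lemma Bimon_coc_simps:
  "(A, f, B) \<in> Arr (Bimon_coc D c) \<longleftrightarrow> bimonoid_morphism D A f B \<and> cocommutative D c A \<and> cocommutative D c B"
  "Dom (Bimon_coc D c) (A, f, B) = bimon_id A" "Cod (Bimon_coc D c) (A, f, B) = bimon_id B"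
  "Comp (Bimon_coc D c) (B, g, E) (A, f, B') = (A, g \<cdot> f, E)"
  by (auto simp: Bimon_coc_def Bimon_def)

lemma Bimon_coc_hom:
  "g \<in> hom (Bimon_coc D c) Q (bimon_id Y) \<longleftrightarrow>
    (\<exists>X g'. Q = bimon_id X \<and> g = (X, g', Y) \<and> bimonoid_morphism D X g' Y \<and> cocommutative D c X \<and> cocommutative D c Y)"
  by (cases g) (auto simp: hom_def Bimon_coc_simps bimon_id_def)

context
  fixes A B H :: "'m bimon" and \<pi> f :: 'm
  assumes \<pi>: "bimonoid_morphism D A \<pi> H" and f: "bimonoid_morphism D B f H"
    and coc: "cocommutative D c A" "cocommutative D c B" "cocommutative D c H"
    and intersections: "has_binary_intersections (base D)"
    and preserves: "bullet_preserves_binary_intersections D"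
begin

lemmas [simp] = morphism_arr[OF \<pi>] morphism_arr[OF f]

interpretation cs: comonoid_cospan "base D" "bull D" c "obj A" "comult A" "counit A" "obj B" "comult B" "counit B"
  "obj H" \<pi> f
  by (rule comonoid_cospan_morphisms[OF \<pi> f coc(1,2)])

text \<open>
  Since the two arrows have a common retraction, \<open>is_pullback C eqA eqB e e\<close> says that \<open>e\<close> is their
  equalizer, and this is an intersection of split monomorphisms.
\<close>

lemma eq_retraction:
  "((r\<^sub>b (obj A) \<cdot> (obj A \<bullet> counit H)) \<bullet> obj B) \<cdot> cs.eqA = obj A \<bullet> obj B"
  "((r\<^sub>b (obj A) \<cdot> (obj A \<bullet> counit H)) \<bullet> obj B) \<cdot> cs.eqB = obj A \<bullet> obj B"
proof -
  let ?k = "r\<^sub>b (obj A) \<cdot> (obj A \<bullet> counit H)"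
  have "?k \<cdot> cs.coactA = r\<^sub>b (obj A) \<cdot> (obj A \<bullet> counit A) \<cdot> comult A"
    by (simp add: cs.coactA_def bull.tensor_comp_reduce bimonoid_morphism.counit[OF \<pi>])
  then show "(?k \<bullet> obj B) \<cdot> cs.eqA = obj A \<bullet> obj B"
    by (simp add: cs.eqA_def bull.tensor_comp counit_right)
  have "(?k \<bullet> obj B) \<cdot> cs.eqB = (r\<^sub>b (obj A) \<bullet> obj B) \<cdot> ((obj A \<bullet> counit H) \<bullet> obj B)
      \<cdot> Inv (a\<^sub>b (obj A) (obj H) (obj B)) \<cdot> (obj A \<bullet> cs.coactB)"
    by (simp add: cs.eqB_def bull.tensor_comp_reduce)
  also have "\<dots> = (r\<^sub>b (obj A) \<bullet> obj B) \<cdot> Inv (a\<^sub>b (obj A) J (obj B)) \<cdot> (obj A \<bullet> ((counit H \<bullet> obj B) \<cdot> cs.coactB))"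
    using red[OF bull.assoc_inv_nat[of "obj A" "counit H" "obj B", symmetric]] by (simp add: bull.whisker_left)
  also have "\<dots> = obj A \<bullet> (l\<^sub>b (obj B) \<cdot> (counit H \<bullet> obj B) \<cdot> cs.coactB)"
    by (simp add: bull.triangle[symmetric] bull.whisker_left)
  also have "\<dots> = obj A \<bullet> obj B"
    by (simp add: cs.coactB_def bull.tensor_comp_reduce bimonoid_morphism.counit[OF f] counit_left)
  finally show "(?k \<bullet> obj B) \<cdot> cs.eqB = obj A \<bullet> obj B" .
qed

lemma equalizer_exists: "\<exists>e. is_pullback (base D) cs.eqA cs.eqB e e"
  by (rule circ.coreflexive_equalizer[OF intersections, of _ _ "(r\<^sub>b (obj A) \<cdot> (obj A \<bullet> counit H)) \<bullet> obj B"])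
    (simp_all add: eq_retraction)

lemma mono_eq: "mono cs.eqA" "mono cs.eqB"
  by (rule circ.split_mono[where k="(r\<^sub>b (obj A) \<cdot> (obj A \<bullet> counit H)) \<bullet> obj B"]; simp add: eq_retraction)+

lemma mhom_coact:
  "mhom (monof A) cs.coactA (prodmon (monof A) (monof H))"
  "mhom (monof B) cs.coactB (prodmon (monof H) (monof B))"
  unfolding cs.coactA_def cs.coactB_def
   by (rule mhom_comp[OF mhom_comult mhom_tensor[OF mhom_id[of "monof A", simplified] mhom_morphism[OF \<pi>]]]; simp)
     (rule mhom_comp[OF mhom_comult mhom_tensor[OF mhom_morphism[OF f] mhom_id[of "monof B", simplified]]]; simp)

lemma mhom_eq:
  "mhom (prodmon (monof A) (monof B)) cs.eqA (prodmon (prodmon (monof A) (monof H)) (monof B))"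
  "mhom (prodmon (monof A) (monof B)) cs.eqB (prodmon (prodmon (monof A) (monof H)) (monof B))"
proof -
  show "mhom (prodmon (monof A) (monof B)) cs.eqA (prodmon (prodmon (monof A) (monof H)) (monof B))"
    unfolding cs.eqA_def
    using mhom_tensor[OF mhom_coact(1) mhom_id[of "monof B"]] by simp
  have i: "mhom (prodmon (monof A) (prodmon (monof H) (monof B))) (Inv (a\<^sub>b (obj A) (obj H) (obj B)))
      (prodmon (prodmon (monof A) (monof H)) (monof B))"
    using mhom_inv[OF mhom_assoc[of "monof A" "monof H" "monof B"]] by simp
  show "mhom (prodmon (monof A) (monof B)) cs.eqB (prodmon (prodmon (monof A) (monof H)) (monof B))"
    unfolding cs.eqB_def
    using mhom_comp[OF mhom_tensor[OF mhom_id[of "monof A"] mhom_coact(2)] i] by simp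
qed

text \<open>Each of the three factors of \<open>prod_comult\<close> is a morphism of monoids; this
  is what later makes \<open>comultE\<close> multiplicative.\<close>

lemma mhom_prod_comult:
  "mhom (prodmon (monof A) (monof B)) cs.prod_comult
    (prodmon (monof A) (prodmon (monof B) (prodmon (monof A) (monof B))))"
proof -
  let ?A = "monof A" and ?B = "monof B"
  have 1: "mhom (prodmon ?A ?B) (obj A \<bullet> comult B) (prodmon ?A (prodmon ?B ?B))"
    using mhom_tensor[OF mhom_id[of ?A] mhom_comult[of B]] by simp
  have 2: "mhom (prodmon ?A (prodmon ?B ?B)) (bull.hat (obj A) (obj A) (comult A) (obj B \<bullet> obj B))
      (prodmon ?A (prodmon ?A (prodmon ?B ?B)))"
    using mhom_hat[OF mhom_comult[of A], of "prodmon ?B ?B"] by simp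
  have 3: "mhom (prodmon ?A (prodmon ?A (prodmon ?B ?B))) (obj A \<bullet> bull.ch (obj A) (obj B) (obj B))
      (prodmon ?A (prodmon ?B (prodmon ?A ?B)))"
    using mhom_tensor[OF mhom_id[of ?A] mhom_ch[of ?A ?B ?B]] by simp
  show ?thesis
    unfolding cs.prod_comult_def using mhom_comp[OF mhom_comp[OF 1 2] 3] by simp
qed

lemma mhom_proj:
  "mhom (prodmon (monof A) (monof B)) cs.projA (monof A)"
  "mhom (prodmon (monof A) (monof B)) cs.projB (monof B)"
proof -
  show "mhom (prodmon (monof A) (monof B)) cs.projA (monof A)"
    unfolding cs.projA_def
    using mhom_comp[OF mhom_tensor[OF mhom_id[of "monof A"] mhom_counit[of B]] mhom_runit[of "monof A"]] by simp
  show "mhom (prodmon (monof A) (monof B)) cs.projB (monof B)"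
    unfolding cs.projB_def using mhom_kill[OF mhom_counit[of A], of "monof B"] by simp
qed

text \<open>Isolates the braiding question from the construction: the premise \<open>dbl\<close>
  serves to make the equalizer cocommutative, while structure and universal property come from
  pairing with \<open>e\<close> and cancelling it.\<close>

lemma pullback_if_double_braiding:
  assumes dbl: "\<And>e. \<lbrakk>Ar e; cod e = obj A \<bullet> obj B; cs.eqA \<cdot> e = cs.eqB \<cdot> e\<rbrakk>
    \<Longrightarrow> dbl (obj A) (obj B) \<cdot> e = e"
  shows "has_pullback (Bimon_coc D c) (A, \<pi>, H) (B, f, H)"
proof -
  obtain e where e: "is_pullback (base D) cs.eqA cs.eqB e e"
    using equalizer_exists by blast
  have pr: "preserves_binary_intersections (base D) (\<lambda>g. X \<bullet> g)"
    "preserves_binary_intersections (base D) (\<lambda>g. g \<bullet> X)" if "ob X" for X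
    using preserves that unfolding bullet_preserves_binary_intersections_def by auto
  interpret rp: relative_product "base D" "bull D" c "obj A" "comult A" "counit A" "obj B" "comult B" "counit B"
    "obj H" \<pi> f e
  proof
    show "is_pullback (base D) cs.eqA cs.eqB e e" by (rule e)
    fix W assume W: "ob W"
    show "is_pullback (base D) (cs.eqA \<bullet> W) (cs.eqB \<bullet> W) (e \<bullet> W) (e \<bullet> W)"
      "is_pullback (base D) (W \<bullet> cs.eqA) (W \<bullet> cs.eqB) (W \<bullet> e) (W \<bullet> e)"
      using pr[OF W] mono_eq e unfolding preserves_binary_intersections_def by blast+
    show "mono (W \<bullet> g)" if "mono g" for g
      using circ.preserves_mono[OF pr(1)[OF W] that] W circ.mono_is_arr[OF that] by simp
  qed
  obtain m u where mu: "mhom \<lparr>car = dom e, mul = m, un = u\<rparr> e (prodmon (monof A) (monof B))"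
    using mhom_equalizer[OF mhom_eq e] by blast
  define L where "L = \<lparr>obj = dom e, mult = m, unt = u, comult = rp.comultE, counit = rp.counitE\<rparr>"
  have L: "obj L = dom e" "comult L = rp.comultE" "counit L = rp.counitE"
    by (simp_all add: L_def)
  have mL: "mhom (monof L) e (prodmon (monof A) (monof B))"
    using mu by (simp add: L_def monof_def)
  let ?P = "prodmon (monof A) (monof B)"
  have d: "mhom (monof L) rp.comultE (prodmon (monof L) (monof L))"
  proof (rule mhom_mono)
    have "mhom (prodmon (monof A) (prodmon (monof B) ?P)) (Inv (a\<^sub>b (obj A) (obj B) (obj A \<bullet> obj B))) (prodmon ?P ?P)"
      using mhom_inv[OF mhom_assoc[of "monof A" "monof B" ?P]] by simp
    from mhom_comp[OF mhom_comp[OF mL mhom_prod_comult] this]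
    show "mhom (monof L) (Inv (a\<^sub>b (obj A) (obj B) (obj A \<bullet> obj B)) \<cdot> cs.prod_comult \<cdot> e) (prodmon ?P ?P)" .
    show "mhom (prodmon (monof L) (monof L)) (e \<bullet> e) (prodmon ?P ?P)"
      by (rule mhom_tensor[OF mL mL])
    show "(e \<bullet> e) \<cdot> rp.comultE = Inv (a\<^sub>b (obj A) (obj B) (obj A \<bullet> obj B)) \<cdot> cs.prod_comult \<cdot> e"
      by (rule rp.e_comultE)
    \<comment> \<open>\<open>e \<bullet> e\<close> is decomposed into two one-sided products, each
      monic because \<bullet> preserves intersections.\<close>
    have "mono ((e \<bullet> (obj A \<bullet> obj B)) \<cdot> (dom e \<bullet> e))"
      by (intro circ.mono_comp rp.e_tensor_mono rp.mono_left rp.e_mono) simp_all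
    then show "mono (e \<bullet> e)"
      by (simp add: bull.tensor_comp)
  qed (simp_all add: L)
  have c: "mhom (monof L) rp.counitE Jmon"
    unfolding rp.counitE_def using mhom_comp[OF mhom_comp[OF mL mhom_proj(1)] mhom_counit[of A]] by simp
  have bL: "bimonoid D L"
  proof (rule bimonoidI)
    show "ismon (monof L)" by (rule mhomD(1)[OF mL])
    show "comonoid_object (base D) (bull D) (obj L) (comult L) (counit L)"
      unfolding L by (rule rp.comonoid_E)
    show "mhom (monof L) (comult L) (prodmon (monof L) (monof L))"
      unfolding L by (rule d)
    show "mhom (monof L) (counit L) Jmon"
      unfolding L by (rule c)
  qed
  have "dbl (obj A) (obj B) \<cdot> e = e"
    by (rule dbl[OF _ _ circ.pullbackD(9)[OF e]]) simp_all
  then have "c (obj B) (obj A) \<cdot> c (obj A) (obj B) \<cdot> e = e"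
    by (simp add: dbl_def)
  then have cocL: "cocommutative D c L"
    unfolding cocommutative_def L using rp.comultE_cocommutative by simp
  let ?p = "cs.projA \<cdot> e" and ?q = "cs.projB \<cdot> e"
  have p: "bimonoid_morphism D L ?p A"
    by (rule morphismI[OF bL _ mhom_comp[OF mL mhom_proj(1)]])
      (simp_all add: L rp.projA_comult rp.counitE_def)
  have q: "bimonoid_morphism D L ?q B"
    by (rule morphismI[OF bL _ mhom_comp[OF mL mhom_proj(2)]])
      (simp_all add: L rp.projB_comult rp.counitE_eq)
  have "is_pullback (Bimon_coc D c) (A, \<pi>, H) (B, f, H) (L, ?p, A) (L, ?q, B)"
    unfolding is_pullback_def
  proof (intro conjI exI[of _ "bimon_id L"] allI impI)
    show "(A, \<pi>, H) \<in> Arr (Bimon_coc D c)" "(B, f, H) \<in> Arr (Bimon_coc D c)"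
      "Cod (Bimon_coc D c) (A, \<pi>, H) = Cod (Bimon_coc D c) (B, f, H)"
      using \<pi> f coc by (simp_all add: Bimon_coc_simps)
    show "(L, ?p, A) \<in> hom (Bimon_coc D c) (bimon_id L) (Dom (Bimon_coc D c) (A, \<pi>, H))"
      "(L, ?q, B) \<in> hom (Bimon_coc D c) (bimon_id L) (Dom (Bimon_coc D c) (B, f, H))"
      using p q coc cocL by (auto simp: Bimon_coc_simps Bimon_coc_hom)
    show "Comp (Bimon_coc D c) (A, \<pi>, H) (L, ?p, A) = Comp (Bimon_coc D c) (B, f, H) (L, ?q, B)"
      using cs.eq_proj[of e] circ.pullbackD(9)[OF e] by (simp add: Bimon_coc_simps)
    fix Q x y
    assume xy: "x \<in> hom (Bimon_coc D c) Q (Dom (Bimon_coc D c) (A, \<pi>, H)) \<and>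
      y \<in> hom (Bimon_coc D c) Q (Dom (Bimon_coc D c) (B, f, H)) \<and>
      Comp (Bimon_coc D c) (A, \<pi>, H) x = Comp (Bimon_coc D c) (B, f, H) y"
    then obtain X x' X' y' where X: "Q = bimon_id X" "x = (X, x', A)" "bimonoid_morphism D X x' A"
      "cocommutative D c X" "Q = bimon_id X'" "y = (X', y', B)" "bimonoid_morphism D X' y' B"
      by (auto simp: Bimon_coc_simps Bimon_coc_hom)
    have [simp]: "X' = X"
      using X by (simp add: bimon_id_def)
    have x': "bimonoid_morphism D X x' A" and y': "bimonoid_morphism D X y' B"
      using X by simp_all
    have eq: "\<pi> \<cdot> x' = f \<cdot> y'"
      using xy X by (simp add: Bimon_coc_simps)
    note [simp] = morphism_arr[OF x'] morphism_arr[OF y']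
    let ?w = "(x' \<bullet> y') \<cdot> comult X"
    note pair = bimonoid.comonoid[OF morphism_arr(1)[OF x']] X(4)[unfolded cocommutative_def]
      morphism_arr(3-5)[OF x'] morphism_comult[OF x'] bimonoid_morphism.counit[OF x']
      morphism_arr(3-5)[OF y'] morphism_comult[OF y'] bimonoid_morphism.counit[OF y']
    \<comment> \<open>A cone is turned into its pairing \<open>?w\<close>, which satisfies the
      equation of the equalizer by \<open>eq_pair\<close>.\<close>
    have "\<exists>!h. Ar h \<and> dom h = dom ?w \<and> cod h = dom e \<and> e \<cdot> h = ?w"
      using cs.eq_pair[OF pair eq] by (intro circ.pullback_factor[OF e]) simp_all
    then obtain h where h: "Ar h" "dom h = obj X" "cod h = dom e" "e \<cdot> h = ?w"
      by auto
    note [simp] = h(1-3)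
    have ph: "?p \<cdot> h = x'" and qh: "?q \<cdot> h = y'"
      using cs.projA_pair[OF pair] cs.projB_pair[OF pair] by (simp_all add: h(4))
    have hm: "bimonoid_morphism D X h L"
    proof (rule morphismI)
      show "mhom (monof X) h (monof L)"
        by (rule mhom_mono[OF mhom_comp[OF mhom_comult mhom_tensor[OF mhom_morphism[OF x'] mhom_morphism[OF y']]]
              mL rp.e_mono]) (simp_all add: L h(4))
      \<comment> \<open>That \<open>h\<close> respects comultiplications is tested behind
        \<open>e \<bullet> e\<close>, where it is \<open>prod_comult_pair\<close>; the two factors
        of \<open>e \<bullet> e\<close> are then cancelled in turn.\<close>
      have "(e \<bullet> e) \<cdot> rp.comultE \<cdot> h = Inv (a\<^sub>b (obj A) (obj B) (obj A \<bullet> obj B)) \<cdot> cs.prod_comult \<cdot> ?w"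
        using red[OF rp.e_comultE, of h] by (simp add: h(4))
      also have "\<dots> = ((e \<cdot> h) \<bullet> (e \<cdot> h)) \<cdot> comult X"
        unfolding cs.prod_comult_pair[OF pair] h(4) by simp
      also have "\<dots> = (e \<bullet> (obj A \<bullet> obj B)) \<cdot> (dom e \<bullet> e) \<cdot> (h \<bullet> h) \<cdot> comult X"
        by (simp add: bull.tensor_comp_reduce)
      finally have "(e \<bullet> (obj A \<bullet> obj B)) \<cdot> (dom e \<bullet> e) \<cdot> rp.comultE \<cdot> h
        = (e \<bullet> (obj A \<bullet> obj B)) \<cdot> (dom e \<bullet> e) \<cdot> (h \<bullet> h) \<cdot> comult X"
        by (simp add: bull.tensor_comp_reduce)
      then have "(dom e \<bullet> e) \<cdot> rp.comultE \<cdot> h = (dom e \<bullet> e) \<cdot> (h \<bullet> h) \<cdot> comult X"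
        by (rule circ.mono_cancel[OF rp.e_tensor_mono[of "obj A \<bullet> obj B"], rotated -1]) simp_all
      then have "rp.comultE \<cdot> h = (h \<bullet> h) \<cdot> comult X"
        by (rule circ.mono_cancel[OF rp.mono_left[OF _ rp.e_mono, of "dom e"], rotated -1]) simp_all
      then show "comult L \<cdot> h = (h \<bullet> h) \<cdot> comult X"
        by (simp add: L)
      have "rp.counitE \<cdot> h = counit A \<cdot> ?p \<cdot> h"
        by (simp add: rp.counitE_def)
      then show "counit L \<cdot> h = counit X"
        unfolding L ph bimonoid_morphism.counit[OF x'] .
    qed (simp_all add: bL)
    show "\<exists>!k. k \<in> hom (Bimon_coc D c) Q (bimon_id L) \<and> Comp (Bimon_coc D c) (L, ?p, A) k = x \<and>
      Comp (Bimon_coc D c) (L, ?q, B) k = y"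
    proof (intro ex1I[of _ "(X, h, L)"] conjI)
      show "(X, h, L) \<in> hom (Bimon_coc D c) Q (bimon_id L)"
        using hm X(1,4) cocL by (auto simp: Bimon_coc_hom)
      show "Comp (Bimon_coc D c) (L, ?p, A) (X, h, L) = x" "Comp (Bimon_coc D c) (L, ?q, B) (X, h, L) = y"
        using ph qh X by (simp_all only: Bimon_coc_simps \<open>X' = X\<close>)
      fix k
      assume k: "k \<in> hom (Bimon_coc D c) Q (bimon_id L) \<and> Comp (Bimon_coc D c) (L, ?p, A) k = x \<and>
        Comp (Bimon_coc D c) (L, ?q, B) k = y"
      then obtain Y k' where Y: "Q = bimon_id Y" "k = (Y, k', L)" "bimonoid_morphism D Y k' L"
        unfolding Bimon_coc_hom by blast
      have [simp]: "Y = X"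
        using Y(1) X(1) by (simp add: bimon_id_def)
      have k': "bimonoid_morphism D X k' L" "?p \<cdot> k' = x'" "?q \<cdot> k' = y'"
        using k X Y by (simp_all only: Bimon_coc_simps \<open>X' = X\<close> \<open>Y = X\<close>) auto
      note [simp] = morphism_arr(3,4)[OF k'(1)] morphism_arr(5)[OF k'(1), unfolded L]
      \<comment> \<open>Since \<open>e\<close> is the pairing of its components, a comultiplicative
        \<open>k'\<close> is determined by \<open>?p \<cdot> k'\<close> and
        \<open>?q \<cdot> k'\<close>.\<close>
      have "e \<cdot> k' = (?p \<bullet> ?q) \<cdot> rp.comultE \<cdot> k'"
        using red[OF rp.proj_pair, of k'] by simp
      also have "rp.comultE \<cdot> k' = (k' \<bullet> k') \<cdot> comult X"
        using morphism_comult[OF k'(1)] by (simp add: L)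
      also have "(?p \<bullet> ?q) \<cdot> \<dots> = ((?p \<cdot> k') \<bullet> (?q \<cdot> k')) \<cdot> comult X"
        by (simp add: bull.tensor_comp_reduce)
      also have "\<dots> = e \<cdot> h"
        unfolding k'(2,3) h(4) ..
      finally have "k' = h"
        by (rule circ.mono_cancel[OF rp.e_mono, rotated -1]) simp_all
      then show "k = (X, h, L)"
        using Y by simp
    qed
  qed
  then show ?thesis
    unfolding has_pullback_def by blast
qed

end

end

theorem theorem3p10:
  fixes D :: "'m duoidal"
    and c :: "'m \<Rightarrow> 'm \<Rightarrow> 'm"
    and R :: "'m reversion_data"
    and H H' A :: "'m bimon"
    and \<pi> \<sigma> f :: 'm
  assumes "bullet_braided_duoidal_category D c"
    and "reversion D R"
    and "has_binary_intersections (base D)"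
    and "bullet_preserves_binary_intersections D"
    and "hopf_monoid D R H"
    and "hopf_monoid D R H'"
    and "(A, \<pi>, H) \<in> Arr (Bimon D)"
    and "(H, \<sigma>, A) \<in> Arr (Bimon D)"
    and "Comp (Bimon D) (A, \<pi>, H) (H, \<sigma>, A) = bimon_id H"
    and "mono_arr (base D) (unt H)"
    and "cocommutative D c A"
    and "(H', f, H) \<in> Arr (Bimon_coc D c)"
  shows "has_pullback (Bimon_coc D c) (A, \<pi>, H) (H', f, H)"
proof -
  interpret bullet_braided_duoidal_category D c
    by (rule assms(1))
  have \<pi>: "bimonoid_morphism D A \<pi> H" and \<sigma>: "bimonoid_morphism D H \<sigma> A"
    and \<pi>\<sigma>: "Comp (base D) \<pi> \<sigma> = obj H"
    using assms(7-9) by (simp_all add: Bimon_def bimon_id_def)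
  have f: "bimonoid_morphism D H' f H" and coc: "cocommutative D c H'" "cocommutative D c H"
    using assms(12) by (simp_all add: Bimon_coc_simps)
  note [simp] = morphism_arr[OF \<pi>] morphism_arr[OF f]
  obtain \<Sigma> where \<Sigma>: "antipode D R H \<Sigma>"
    using assms(5) by (auto simp: hopf_monoid_def)
  \<comment> \<open>The antipode of \<open>H\<close> is used here, to make all Hopf maps invertible
    at once: both for the comodule \<open>H'\<close> and for the cofree comodule behind
    \<open>theta\<close>.\<close>
  have hopf: "iso (hopf_map H V \<mu> T \<rho>)" if "rmodule H V \<mu>" "lcomodule H T \<rho>" for V \<mu> T \<rho>
    by (rule reversion.hopf_map_iso[OF assms(2) _ \<Sigma> that]) simp
  have mono_u: "mono (obj A \<bullet> unt H)"
    using assms(4) unfolding bullet_preserves_binary_intersections_def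
    by (intro circ.preserves_mono[OF _ assms(10)]) simp_all
  have \<rho>: "lcomodule H (obj H') ((f \<bullet> obj H') \<cdot> comult H')"
    by (rule lcomodule_morphism[OF f])
  \<comment> \<open>Cocommutativity of \<open>H'\<close> makes the double braiding fix its
    comultiplication; naturality carries this along \<open>f\<close> to the coaction.\<close>
  have d\<rho>: "dbl (obj H) (obj H') \<cdot> (f \<bullet> obj H') \<cdot> comult H' = (f \<bullet> obj H') \<cdot> comult H'"
    using red[OF dbl_nat[of f "obj H'"], of "comult H'"] dbl_comult[OF _ coc(1)] by simp
  show ?thesis
  proof (rule pullback_if_double_braiding[OF \<pi> f assms(11) coc assms(3,4)])
    interpret cs: comonoid_cospan "base D" "bull D" c "obj A" "comult A" "counit A" "obj H'" "comult H'" "counit H'"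
      "obj H" \<pi> f
      by (rule comonoid_cospan_morphisms[OF \<pi> f assms(11) coc(1)])
    fix e
    assume e: "e \<in> Arr (base D)" "Cod (base D) e = obj A \<bullet> obj H'"
      and eq: "cs.eqA \<cdot> e = cs.eqB \<cdot> e"
    show "dbl (obj A) (obj H') \<cdot> e = e"
      using eq e
      by (intro dbl_relative_product[OF \<pi> \<sigma> \<pi>\<sigma> assms(11) hopf mono_u \<rho> d\<rho>])
        (simp_all add: cs.eqA_def cs.eqB_def cs.coactA_def cs.coactB_def)
  qed
qed

end
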